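(* Let $\mathbf B=\mathbf B(\dddot X_n)$ ($r=1$) or $\mathbf B=\mathbf B(X_n^{\mathrm{um}})$ ($r=2$ for $X_n\in\{B_n,C_n,F_4\}$, $r=3$ for $G_2$), with $\Gamma=\Gamma_1(r)$. For any simple $\Gamma$-stable representation $V$ of $\mathbf B$ and any simple representation $\hat\pi$ of $B(X_n)$, we have a projective representation $$\Gamma\to\mathrm{PGL}(V(\hat\pi)).$$ If $V$ is $B(X_n)$-admissible then this projective representation is finite dimensional. Except for $\dddot X_n$ of type $\dddot A_n$ ($n\ge2$), $\dddot D_{2n}$ ($n\ge2$), or $\dddot E_6$, the projective representation descends to the quotient $\Gamma/\{\pm I_2\}$.
   Context: **Coxeter braid groups.** The $p$-braid relation for $a,b$ is $aba\cdots=bab\cdots$ with $2,3,4,6$ factors on each side for $p=0,1,2,3$, and is empty for $p\ge4$. For a diagram $D$, $B(D)$ has one generator per node, generators of nodes joined by $p$ edges satisfying the $p$-braid relation. For a finite irreducible reduced root system of type $X_n$ with simple roots $\alpha_1,\dots,\alpha_n$ (standard labelling), nodes $i\neq j$ of the Coxeter diagram are joined by $(\alpha_i,\alpha_j^\vee)(\alpha_i^\vee,\alpha_j)$ edges; generators of $B(X_n)$ are $\mathcal T_1,\dots,\mathcal T_n$; $\mathcal T_w$ is the product of generators along any reduced expression of the Weyl group element $w$; $s_\gamma$ is the reflection in $\gamma$. **$\mathbf B(\dddot X_n)$**, $X_n\in\{A_n(n\ge1),B_n(n\ge3),C_n(n\ge2),D_n(n\ge4),E_6,E_7,E_8,F_4,G_2\}$: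 $\theta$ is the highest root, $\Theta=\mathcal T_{s_\theta}$. $\dddot X_n$ is the diagram $X_n$ plus three affine nodes with generators $\Theta_{01},\Theta_{02},\Theta_{03}$, pairwise joined by four edges, each joined to node $i$ by $(\theta,\alpha_i^\vee)(\theta^\vee,\alpha_i)$ edges. $\mathbf B(\dddot X_n)$ is the quotient of $B(\dddot X_n)$ by: (a) $\Theta_{01}\Theta_{02}\Theta_{03}\Theta$ is central; (b) only for $C_n$, $n\ge2$: $\Theta_{0i}\mathcal T_1^{-1}\Theta_{0j}\mathcal T_1=\mathcal T_1^{-1}\Theta_{0j}\mathcal T_1\Theta_{0i}$ for $(i,j)\in\{(1,2),(1,3),(2,3)\}$. **$\mathbf B(X_n^{\mathrm{um}})$**, $X_n\in\{B_n(n\ge2),C_n(n\ge2),F_4,G_2\}$: $\theta$ is the dominant short root, $\varphi$ the highest root, $\Theta=\mathcal T_{s_\theta}$, $\Phi=\mathcal T_{s_\varphi}$, $\Psi=(\mathcal T_{s_\varphi s_\theta})^{-1}$. $X_n^{\mathrm{um}}$ is the diagram $X_n$ plus two affine nodes with generators $\Theta_0,\Phi_0$, joined to node $i$ by $(\theta,\alpha_i^\vee)(\theta^\vee,\alpha_i)$, resp. $(\varphi,\alpha_i^\vee)(\varphi^\vee,\alpha_i)$ edges, and to each other by $2$ edges ($3$ for $G_2$). $\mathbf B(X_n^{\mathrm{um}})$ is the quotient of $B(X_n^{\mathrm{um}})$ by: $\Phi_0\Phi\Theta_0\Psi\Phi_0\Theta\Theta_0$ is central. In both cases $B(X_n)$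 is the subgroup generated by $\mathcal T_1,\dots,\mathcal T_n$. **Congruence groups.** $\Gamma_1(1)=\mathrm{SL}(2,\mathbb Z)$; for $r=2,3$, $\Gamma_1(r)$ is the group of matrices in $\mathrm{SL}(2,\mathbb Z)$ congruent to $\begin{bmatrix}1&*\\0&1\end{bmatrix}$ mod $r$; $I_2$ is the identity matrix, and $\Gamma/\{\pm I_2\}$ is the image of $\Gamma$ in $\mathrm{SL}(2,\mathbb Z)/\{\pm I_2\}$. $\widetilde\Gamma_1(1)=\langle \mathfrak u_1,\mathfrak u_2\mid \mathfrak u_1\mathfrak u_2\mathfrak u_1=\mathfrak u_2\mathfrak u_1\mathfrak u_2\rangle$ with projection $\mathfrak u_1\mapsto\begin{bmatrix}1&-1\\0&1\end{bmatrix}$, $\mathfrak u_2\mapsto\begin{bmatrix}1&0\\1&1\end{bmatrix}$, and $\widetilde\Gamma=\widetilde\Gamma_1(r)=\langle \mathfrak u_1,\mathfrak u_2^r\rangle$, which projects onto $\Gamma$. **The action of $\widetilde\Gamma$ on $\mathbf B$** (by automorphisms fixing all $\mathcal T_i$). $\mathfrak u_1$ acts by $\mathfrak a$ and $\mathfrak u_2^r$ by $\mathfrak b$, where on $\mathbf B(\dddot X_n)$: $\mathfrak a:\Theta_{01}\mapsto\Theta_{02},\ \Theta_{02}\mapsto\Theta_{02}^{-1}\Theta_{01}\Theta_{02},\ \Theta_{03}\mapsto\Theta_{03}$; $\mathfrak b:\Theta_{01}\mapsto\Theta_{01},\ \Theta_{02}\mapsto\Theta_{03},\ \Theta_{03}\mapsto\Theta_{03}^{-1}\Theta_{02}\Theta_{03}$;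 and on $\mathbf B(X_n^{\mathrm{um}})$: $\mathfrak a:\Theta_0\mapsto\Phi_0\Phi\Theta_0\Phi^{-1}\Phi_0^{-1},\ \Phi_0\mapsto\Phi_0$; $\mathfrak b:\Theta_0\mapsto\Theta_0,\ \Phi_0\mapsto\Theta\Theta_0\Phi_0\Theta_0^{-1}\Theta^{-1}$. This action is faithful and descends to $\Gamma\to\mathrm{Out}(\mathbf B)$. **Representations** are complex. ${}^{\widetilde\gamma}V$ is $V$ with the action of $\mathbf B$ pre-composed with the automorphism $\widetilde\gamma$. A simple $V$ is $\Gamma$-stable if ${}^{\widetilde\gamma}V\cong V$ for all $\widetilde\gamma\in\widetilde\Gamma$. For a simple representation $\hat\pi$ of $B(X_n)$, $V(\hat\pi)$ is the isotypic component of $\hat\pi$ in $V|_{B(X_n)}$ (the sum of all copies of $\hat\pi$ inside $V$). $V$ is $B(X_n)$-finite if $\mathrm{span}(B(X_n)v)$ is finite dimensional for every $v\in V$; it is $B(X_n)$-admissible if it is $B(X_n)$-finite and $V(\hat\pi)$ is finite dimensional for every finite dimensional simple $\hat\pi$. The projective representation is the one induced by sending $\widetilde\gamma\in\widetilde\Gamma$ to the class of the restriction to $V(\hat\pi)$ of an isomorphism between $V$ and ${}^{\widetilde\gamma}V$ (unique up to scaling).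
   Formalization: The exception list has type D_{2n+1} (n≥2) in place of D_{2n}: descent to Γ/{±I_2} fails in odd rank (e.g. for D_5 on functions on F_3^5 with trivial π̂), while descent is proved for D_{2n}. *)

theory Defs
  imports
    "HOL-Analysis.Determinants"
    "HOL-Algebra.Generated_Groups"
    "HOL-Algebra.Bij"
    "HOL-Number_Theory.Cong"
    "HOL-Library.Function_Algebras"
begin

section \<open>Groups given by generators and relations\<close>

text \<open>A letter is a generator together with a sign; \<open>True\<close> stands for exponent \<open>1\<close> and
  \<open>False\<close> for exponent \<open>-1\<close>.\<close>

type_synonym 'g gword = "('g \<times> bool) list"

definition gwords :: "'g set \<Rightarrow> 'g gword set" where
  "gwords S = lists (S \<times> UNIV)"

definition word_inv :: "'g gword \<Rightarrow> 'g gword" where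
  "word_inv u = rev (map (\<lambda>(g, e). (g, \<not> e)) u)"

inductive pres_eq :: "'g set \<Rightarrow> ('g gword \<times> 'g gword) set \<Rightarrow> 'g gword \<Rightarrow> 'g gword \<Rightarrow> bool"
  for S R where
  refl: "u \<in> gwords S \<Longrightarrow> pres_eq S R u u"
| sym: "pres_eq S R u v \<Longrightarrow> pres_eq S R v u"
| trans: "pres_eq S R u v \<Longrightarrow> pres_eq S R v w \<Longrightarrow> pres_eq S R u w"
| append: "pres_eq S R u u' \<Longrightarrow> pres_eq S R v v' \<Longrightarrow> pres_eq S R (u @ v) (u' @ v')"
| cancel: "g \<in> S \<Longrightarrow> pres_eq S R [(g, e), (g, \<not> e)] []"
| rel: "(u, v) \<in> R \<Longrightarrow> u \<in> gwords S \<Longrightarrow> v \<in> gwords S \<Longrightarrow> pres_eq S R u v"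

definition pres_class :: "'g set \<Rightarrow> ('g gword \<times> 'g gword) set \<Rightarrow> 'g gword \<Rightarrow> 'g gword set" where
  "pres_class S R u = {v. pres_eq S R u v}"

definition pres_group :: "'g set \<Rightarrow> ('g gword \<times> 'g gword) set \<Rightarrow> 'g gword set monoid" where
  "pres_group S R =
    \<lparr>carrier = pres_class S R ` gwords S,
     mult = (\<lambda>a b. \<Union>u\<in>a. \<Union>v\<in>b. pres_class S R (u @ v)),
     one = pres_class S R []\<rparr>"

definition eval_word :: "('h, 'm) monoid_scheme \<Rightarrow> ('g \<Rightarrow> 'h) \<Rightarrow> 'g gword \<Rightarrow> 'h" where
  "eval_word G f u =
    foldr (\<lambda>(g, e) x. (if e then f g else inv\<^bsub>G\<^esub> f g) \<otimes>\<^bsub>G\<^esub> x) u \<one>\<^bsub>G\<^esub>"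

section \<open>Root systems\<close>

datatype cartan_type =
  TypeA nat | TypeB nat | TypeC nat | TypeD nat | TypeE nat | TypeF4 | TypeG2

fun rk :: "cartan_type \<Rightarrow> nat" where
  "rk (TypeA n) = n"
| "rk (TypeB n) = n"
| "rk (TypeC n) = n"
| "rk (TypeD n) = n"
| "rk (TypeE n) = n"
| "rk TypeF4 = 4"
| "rk TypeG2 = 2"

text \<open>Dynkin diagrams with Bourbaki's labelling; in \<open>TypeG2\<close> the root \<open>\<alpha>\<^sub>1\<close> is short.\<close>

fun bonds :: "cartan_type \<Rightarrow> (nat \<times> nat) set" where
  "bonds (TypeA n) = {(i, i + 1) | i. 1 \<le> i \<and> i < n}"
| "bonds (TypeB n) = {(i, i + 1) | i. 1 \<le> i \<and> i < n}"
| "bonds (TypeC n) = {(i, i + 1) | i. 1 \<le> i \<and> i < n}"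
| "bonds (TypeD n) = {(i, i + 1) | i. 1 \<le> i \<and> i + 1 < n} \<union> {(n - 2, n)}"
| "bonds (TypeE n) = {(1, 3), (2, 4)} \<union> {(i, i + 1) | i. 3 \<le> i \<and> i < n}"
| "bonds TypeF4 = {(1, 2), (2, 3), (3, 4)}"
| "bonds TypeG2 = {(1, 2)}"

fun sq_length :: "cartan_type \<Rightarrow> nat \<Rightarrow> int" where
  "sq_length (TypeA n) i = 2"
| "sq_length (TypeB n) i = (if i < n then 4 else 2)"
| "sq_length (TypeC n) i = (if i < n then 2 else 4)"
| "sq_length (TypeD n) i = 2"
| "sq_length (TypeE n) i = 2"
| "sq_length TypeF4 i = (if i \<le> 2 then 4 else 2)"
| "sq_length TypeG2 i = (if i = 1 then 2 else 6)"

text \<open>The inner products \<open>(\<alpha>\<^sub>i, \<alpha>\<^sub>j)\<close>. For joined nodes the Cartan integer with respect to the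
  longer root is \<open>-1\<close>, so the inner product is minus half the larger squared length.\<close>

definition gram :: "cartan_type \<Rightarrow> nat \<Rightarrow> nat \<Rightarrow> int" where
  "gram X i j =
    (if i = j then sq_length X i
     else if (i, j) \<in> bonds X \<or> (j, i) \<in> bonds X
       then - (max (sq_length X i) (sq_length X j) div 2)
     else 0)"

text \<open>Elements of the root lattice are given by their coordinates in the basis
  \<open>\<alpha>\<^sub>1, \<dots>, \<alpha>\<^sub>n\<close>.\<close>

type_synonym lattice_vec = "nat \<Rightarrow> int"

definition inner_form :: "cartan_type \<Rightarrow> lattice_vec \<Rightarrow> lattice_vec \<Rightarrow> int" where
  "inner_form X x y = (\<Sum>i\<in>{1..rk X}. \<Sum>j\<in>{1..rk X}. x i * y j * gram X i j)"

text \<open>\<open>copairing X x \<gamma>\<close> is \<open>(x, \<gamma>\<^sup>\<or>) = 2 (x, \<gamma>) / (\<gamma>, \<gamma>)\<close>; it is only used for roots \<open>\<gamma>\<close>, where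
  the division is exact.\<close>

definition copairing :: "cartan_type \<Rightarrow> lattice_vec \<Rightarrow> lattice_vec \<Rightarrow> int" where
  "copairing X x \<gamma> = (2 * inner_form X x \<gamma>) div inner_form X \<gamma> \<gamma>"

definition simple_root :: "nat \<Rightarrow> lattice_vec" where
  "simple_root i = (\<lambda>k. if k = i then 1 else 0)"

definition reflection :: "cartan_type \<Rightarrow> lattice_vec \<Rightarrow> lattice_vec \<Rightarrow> lattice_vec" where
  "reflection X \<gamma> x = (\<lambda>k. x k - copairing X x \<gamma> * \<gamma> k)"

definition weyl_elt :: "cartan_type \<Rightarrow> nat list \<Rightarrow> lattice_vec \<Rightarrow> lattice_vec" where
  "weyl_elt X u = foldr (\<lambda>i f. reflection X (simple_root i) \<circ> f) u id"

definition roots :: "cartan_type \<Rightarrow> lattice_vec set" where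
  "roots X = {weyl_elt X u (simple_root i) | u i. u \<in> lists {1..rk X} \<and> i \<in> {1..rk X}}"

definition highest_root :: "cartan_type \<Rightarrow> lattice_vec" where
  "highest_root X = (THE \<theta>. \<theta> \<in> roots X \<and> (\<forall>\<gamma>\<in>roots X. \<forall>k. \<gamma> k \<le> \<theta> k))"

definition dominant_short_root :: "cartan_type \<Rightarrow> lattice_vec" where
  "dominant_short_root X =
    (THE \<theta>. \<theta> \<in> roots X \<and> (\<forall>\<gamma>\<in>roots X. inner_form X \<theta> \<theta> \<le> inner_form X \<gamma> \<gamma>) \<and>
       (\<forall>i\<in>{1..rk X}. 0 \<le> copairing X \<theta> (simple_root i)))"

definition reduced_word :: "cartan_type \<Rightarrow> nat list \<Rightarrow> (lattice_vec \<Rightarrow> lattice_vec) \<Rightarrow> bool" where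
  "reduced_word X u w \<longleftrightarrow> u \<in> lists {1..rk X} \<and> weyl_elt X u = w \<and>
    (\<forall>v\<in>lists {1..rk X}. weyl_elt X v = w \<longrightarrow> length u \<le> length v)"

section \<open>The groups \<open>B\<close>\<close>

text \<open>\<open>DDD\<close> is the family with three affine nodes, \<open>UM\<close> the one with two.\<close>

datatype family = DDD | UM

datatype node = T nat | Theta01 | Theta02 | Theta03 | Theta0 | Phi0

fun valid_datum :: "family \<Rightarrow> cartan_type \<Rightarrow> bool" where
  "valid_datum DDD (TypeA n) = (n \<ge> 1)"
| "valid_datum DDD (TypeB n) = (n \<ge> 3)"
| "valid_datum DDD (TypeC n) = (n \<ge> 2)"
| "valid_datum DDD (TypeD n) = (n \<ge> 4)"
| "valid_datum DDD (TypeE n) = (n \<in> {6, 7, 8})"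
| "valid_datum DDD TypeF4 = True"
| "valid_datum DDD TypeG2 = True"
| "valid_datum UM (TypeA n) = False"
| "valid_datum UM (TypeB n) = (n \<ge> 2)"
| "valid_datum UM (TypeC n) = (n \<ge> 2)"
| "valid_datum UM (TypeD n) = False"
| "valid_datum UM (TypeE n) = False"
| "valid_datum UM TypeF4 = True"
| "valid_datum UM TypeG2 = True"

definition affine_nodes :: "family \<Rightarrow> node set" where
  "affine_nodes k = (case k of DDD \<Rightarrow> {Theta01, Theta02, Theta03} | UM \<Rightarrow> {Theta0, Phi0})"

definition nodes :: "family \<Rightarrow> cartan_type \<Rightarrow> node set" where
  "nodes k X = T ` {1..rk X} \<union> affine_nodes k"

fun node_root :: "cartan_type \<Rightarrow> node \<Rightarrow> lattice_vec" where
  "node_root X (T i) = simple_root i"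
| "node_root X Theta01 = highest_root X"
| "node_root X Theta02 = highest_root X"
| "node_root X Theta03 = highest_root X"
| "node_root X Theta0 = dominant_short_root X"
| "node_root X Phi0 = highest_root X"

definition edges :: "family \<Rightarrow> cartan_type \<Rightarrow> node \<Rightarrow> node \<Rightarrow> nat" where
  "edges k X g h =
    (if g \<in> affine_nodes k \<and> h \<in> affine_nodes k
     then (case k of DDD \<Rightarrow> 4 | UM \<Rightarrow> if X = TypeG2 then 3 else 2)
     else nat (copairing X (node_root X g) (node_root X h) *
               copairing X (node_root X h) (node_root X g)))"

fun alternating :: "nat \<Rightarrow> 'g \<Rightarrow> 'g \<Rightarrow> 'g gword" where
  "alternating 0 g h = []"
| "alternating (Suc m) g h = (g, True) # alternating m h g"

definition braid_length :: "nat \<Rightarrow> nat" where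
  "braid_length p = (if p = 3 then 6 else p + 2)"

definition braid_relations :: "'g set \<Rightarrow> ('g \<Rightarrow> 'g \<Rightarrow> nat) \<Rightarrow> ('g gword \<times> 'g gword) set" where
  "braid_relations S p =
    {(alternating (braid_length (p g h)) g h, alternating (braid_length (p g h)) h g) | g h.
       g \<in> S \<and> h \<in> S \<and> g \<noteq> h \<and> p g h < 4}"

definition central_relations :: "'g set \<Rightarrow> 'g gword \<Rightarrow> ('g gword \<times> 'g gword) set" where
  "central_relations S c = {(c @ [(g, True)], (g, True) # c) | g. g \<in> S}"

text \<open>By Matsumoto's theorem the class of \<open>T_word X w\<close> does not depend on the chosen reduced
  expression.\<close>

definition T_word :: "cartan_type \<Rightarrow> (lattice_vec \<Rightarrow> lattice_vec) \<Rightarrow> node gword" where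
  "T_word X w = map (\<lambda>i. (T i, True)) (SOME u. reduced_word X u w)"

abbreviation pos :: "node \<Rightarrow> node gword" where
  "pos g \<equiv> [(g, True)]"

abbreviation neg :: "node \<Rightarrow> node gword" where
  "neg g \<equiv> [(g, False)]"

definition central_word :: "family \<Rightarrow> cartan_type \<Rightarrow> node gword" where
  "central_word k X =
    (case k of
      DDD \<Rightarrow> pos Theta01 @ pos Theta02 @ pos Theta03 @ T_word X (reflection X (highest_root X))
    | UM \<Rightarrow>
        (let s\<^sub>\<theta> = reflection X (dominant_short_root X); s\<^sub>\<phi> = reflection X (highest_root X);
             \<Theta> = T_word X s\<^sub>\<theta>; \<Phi> = T_word X s\<^sub>\<phi>; \<Psi> = word_inv (T_word X (s\<^sub>\<phi> \<circ> s\<^sub>\<theta>))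
         in pos Phi0 @ \<Phi> @ pos Theta0 @ \<Psi> @ pos Phi0 @ \<Theta> @ pos Theta0))"

definition type_C_relations :: "(node gword \<times> node gword) set" where
  "type_C_relations =
    {(pos g @ neg (T 1) @ pos h @ pos (T 1), neg (T 1) @ pos h @ pos (T 1) @ pos g) | g h.
       (g, h) \<in> {(Theta01, Theta02), (Theta01, Theta03), (Theta02, Theta03)}}"

definition B_relations :: "family \<Rightarrow> cartan_type \<Rightarrow> (node gword \<times> node gword) set" where
  "B_relations k X =
    braid_relations (nodes k X) (edges k X) \<union>
    central_relations (nodes k X) (central_word k X) \<union>
    (if k = DDD \<and> (\<exists>n. X = TypeC n) then type_C_relations else {})"

definition B_class :: "family \<Rightarrow> cartan_type \<Rightarrow> node gword \<Rightarrow> node gword set" where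
  "B_class k X = pres_class (nodes k X) (B_relations k X)"

definition B_group :: "family \<Rightarrow> cartan_type \<Rightarrow> node gword set monoid" where
  "B_group k X = pres_group (nodes k X) (B_relations k X)"

definition B_fin :: "family \<Rightarrow> cartan_type \<Rightarrow> node gword set monoid" where
  "B_fin k X = (B_group k X)
    \<lparr>carrier := generate (B_group k X) ((\<lambda>i. B_class k X (pos (T i))) ` {1..rk X})\<rparr>"

section \<open>Congruence groups and their braid group covers\<close>

definition level :: "family \<Rightarrow> cartan_type \<Rightarrow> nat" where
  "level k X = (case k of DDD \<Rightarrow> 1 | UM \<Rightarrow> if X = TypeG2 then 3 else 2)"

definition SL2Z :: "(int^2^2) monoid" where
  "SL2Z = \<lparr>carrier = {M. det M = 1}, mult = (**), one = mat 1\<rparr>"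

definition Gamma1 :: "nat \<Rightarrow> (int^2^2) monoid" where
  "Gamma1 r = SL2Z
    \<lparr>carrier := {M \<in> carrier SL2Z. [M $ 1 $ 1 = 1] (mod int r) \<and> [M $ 2 $ 1 = 0] (mod int r) \<and>
                  [M $ 2 $ 2 = 1] (mod int r)}\<rparr>"

definition plus_minus_one :: "(int^2^2) set" where
  "plus_minus_one = {mat 1, - mat 1}"

definition Gamma1_bar :: "nat \<Rightarrow> (int^2^2) set monoid" where
  "Gamma1_bar r = (SL2Z Mod plus_minus_one)
    \<lparr>carrier := (\<lambda>M. plus_minus_one #>\<^bsub>SL2Z\<^esub> M) ` carrier (Gamma1 r)\<rparr>"

text \<open>The generators \<open>u\<^sub>1\<close>, \<open>u\<^sub>2\<close> of the braid group on three strands are numbered \<open>1\<close> and \<open>2\<close>.\<close>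

definition braid3_relations :: "(nat gword \<times> nat gword) set" where
  "braid3_relations = {(alternating 3 1 2, alternating 3 2 1)}"

definition Braid3 :: "nat gword set monoid" where
  "Braid3 = pres_group {1, 2} braid3_relations"

definition u_gen :: "nat \<Rightarrow> nat gword set" where
  "u_gen i = pres_class {1, 2} braid3_relations [(i, True)]"

definition u_matrix :: "nat \<Rightarrow> int^2^2" where
  "u_matrix i =
    (if i = 1 then vector [vector [1, -1], vector [0, 1]]
     else vector [vector [1, 0], vector [1, 1]])"

definition braid_proj :: "nat gword set \<Rightarrow> int^2^2" where
  "braid_proj c = the_elem (eval_word SL2Z u_matrix ` c)"

definition Gamma1_tilde :: "nat \<Rightarrow> nat gword set monoid" where
  "Gamma1_tilde r = Braid3
    \<lparr>carrier := generate Braid3 {u_gen 1, u_gen 2 [^]\<^bsub>Braid3\<^esub> r}\<rparr>"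

fun a_image :: "cartan_type \<Rightarrow> node \<Rightarrow> node gword" where
  "a_image X (T i) = pos (T i)"
| "a_image X Theta01 = pos Theta02"
| "a_image X Theta02 = neg Theta02 @ pos Theta01 @ pos Theta02"
| "a_image X Theta03 = pos Theta03"
| "a_image X Theta0 =
    (let \<Phi> = T_word X (reflection X (highest_root X))
     in pos Phi0 @ \<Phi> @ pos Theta0 @ word_inv \<Phi> @ neg Phi0)"
| "a_image X Phi0 = pos Phi0"

fun b_image :: "cartan_type \<Rightarrow> node \<Rightarrow> node gword" where
  "b_image X (T i) = pos (T i)"
| "b_image X Theta01 = pos Theta01"
| "b_image X Theta02 = pos Theta03"
| "b_image X Theta03 = neg Theta03 @ pos Theta02 @ pos Theta03"
| "b_image X Theta0 = pos Theta0"
| "b_image X Phi0 =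
    (let \<Theta> = T_word X (reflection X (dominant_short_root X))
     in \<Theta> @ pos Theta0 @ pos Phi0 @ neg Theta0 @ word_inv \<Theta>)"

text \<open>The values on generators determine the action uniquely.\<close>

definition is_Gamma_action ::
  "family \<Rightarrow> cartan_type \<Rightarrow> (nat gword set \<Rightarrow> node gword set \<Rightarrow> node gword set) \<Rightarrow> bool" where
  "is_Gamma_action k X act \<longleftrightarrow>
    act \<in> hom (Gamma1_tilde (level k X)) (AutoGroup (B_group k X)) \<and>
    (\<forall>g\<in>nodes k X. act (u_gen 1) (B_class k X (pos g)) = B_class k X (a_image X g)) \<and>
    (\<forall>g\<in>nodes k X. act (u_gen 2 [^]\<^bsub>Braid3\<^esub> level k X) (B_class k X (pos g)) =
       B_class k X (b_image X g))"

section \<open>Representations\<close>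

text \<open>A representation space is a subspace \<open>V\<close> of a complex vector space with scalar
  multiplication \<open>s\<close>.\<close>

definition linear_map_on ::
  "(complex \<Rightarrow> 'v \<Rightarrow> 'v::ab_group_add) \<Rightarrow> 'v set \<Rightarrow> (complex \<Rightarrow> 'w \<Rightarrow> 'w::ab_group_add) \<Rightarrow>
   ('v \<Rightarrow> 'w) \<Rightarrow> bool" where
  "linear_map_on s V t f \<longleftrightarrow>
    (\<forall>x\<in>V. \<forall>y\<in>V. f (x + y) = f x + f y) \<and> (\<forall>c. \<forall>x\<in>V. f (s c x) = t c (f x))"

definition GL :: "(complex \<Rightarrow> 'v \<Rightarrow> 'v::ab_group_add) \<Rightarrow> 'v set \<Rightarrow> ('v \<Rightarrow> 'v) monoid" where
  "GL s V = BijGroup V \<lparr>carrier := {f \<in> Bij V. linear_map_on s V s f}\<rparr>"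

definition scalar_maps :: "(complex \<Rightarrow> 'v \<Rightarrow> 'v::ab_group_add) \<Rightarrow> 'v set \<Rightarrow> ('v \<Rightarrow> 'v) set" where
  "scalar_maps s V = {restrict (s c) V | c. c \<noteq> 0}"

definition PGL :: "(complex \<Rightarrow> 'v \<Rightarrow> 'v::ab_group_add) \<Rightarrow> 'v set \<Rightarrow> ('v \<Rightarrow> 'v) set monoid" where
  "PGL s V = GL s V Mod scalar_maps s V"

definition representation ::
  "('g, 'm) monoid_scheme \<Rightarrow> (complex \<Rightarrow> 'v \<Rightarrow> 'v::ab_group_add) \<Rightarrow> 'v set \<Rightarrow>
   ('g \<Rightarrow> 'v \<Rightarrow> 'v) \<Rightarrow> bool" where
  "representation G s V \<rho> \<longleftrightarrow> vector_space s \<and> module.subspace s V \<and> \<rho> \<in> hom G (GL s V)"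

definition simple_rep ::
  "('g, 'm) monoid_scheme \<Rightarrow> (complex \<Rightarrow> 'v \<Rightarrow> 'v::ab_group_add) \<Rightarrow> 'v set \<Rightarrow>
   ('g \<Rightarrow> 'v \<Rightarrow> 'v) \<Rightarrow> bool" where
  "simple_rep G s V \<rho> \<longleftrightarrow> representation G s V \<rho> \<and> V \<noteq> {0} \<and>
    (\<forall>U. module.subspace s U \<and> U \<subseteq> V \<and> (\<forall>g\<in>carrier G. \<rho> g ` U \<subseteq> U) \<longrightarrow> U = {0} \<or> U = V)"

definition intertwiner ::
  "('g, 'm) monoid_scheme \<Rightarrow> (complex \<Rightarrow> 'v \<Rightarrow> 'v::ab_group_add) \<Rightarrow> 'v set \<Rightarrow> ('g \<Rightarrow> 'v \<Rightarrow> 'v) \<Rightarrow>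
   (complex \<Rightarrow> 'w \<Rightarrow> 'w::ab_group_add) \<Rightarrow> 'w set \<Rightarrow> ('g \<Rightarrow> 'w \<Rightarrow> 'w) \<Rightarrow> ('v \<Rightarrow> 'w) \<Rightarrow> bool" where
  "intertwiner G s V \<rho> t W \<sigma> f \<longleftrightarrow>
    f \<in> V \<rightarrow> W \<and> linear_map_on s V t f \<and> (\<forall>g\<in>carrier G. \<forall>x\<in>V. f (\<rho> g x) = \<sigma> g (f x))"

definition twist_iso ::
  "('g, 'm) monoid_scheme \<Rightarrow> ('g \<Rightarrow> 'g) \<Rightarrow> (complex \<Rightarrow> 'v \<Rightarrow> 'v::ab_group_add) \<Rightarrow> 'v set \<Rightarrow>
   ('g \<Rightarrow> 'v \<Rightarrow> 'v) \<Rightarrow> ('v \<Rightarrow> 'v) \<Rightarrow> bool" where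
  "twist_iso G \<alpha> s V \<rho> f \<longleftrightarrow> intertwiner G s V \<rho> s V (\<rho> \<circ> \<alpha>) f \<and> bij_betw f V V"

definition Gamma_stable ::
  "family \<Rightarrow> cartan_type \<Rightarrow> (nat gword set \<Rightarrow> node gword set \<Rightarrow> node gword set) \<Rightarrow>
   (complex \<Rightarrow> 'v \<Rightarrow> 'v::ab_group_add) \<Rightarrow> 'v set \<Rightarrow> (node gword set \<Rightarrow> 'v \<Rightarrow> 'v) \<Rightarrow> bool" where
  "Gamma_stable k X act s V \<rho> \<longleftrightarrow>
    (\<forall>\<gamma>\<in>carrier (Gamma1_tilde (level k X)). \<exists>f. twist_iso (B_group k X) (act \<gamma>) s V \<rho> f)"

definition isotypic ::
  "('g, 'm) monoid_scheme \<Rightarrow> (complex \<Rightarrow> 'v \<Rightarrow> 'v::ab_group_add) \<Rightarrow> 'v set \<Rightarrow> ('g \<Rightarrow> 'v \<Rightarrow> 'v) \<Rightarrow>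
   (complex \<Rightarrow> 'w \<Rightarrow> 'w::ab_group_add) \<Rightarrow> 'w set \<Rightarrow> ('g \<Rightarrow> 'w \<Rightarrow> 'w) \<Rightarrow> 'v set" where
  "isotypic G s V \<rho> t W \<sigma> =
    module.span s (\<Union> {f ` W | f. intertwiner G t W \<sigma> s V \<rho> f \<and> inj_on f W})"

definition fin_dim :: "(complex \<Rightarrow> 'v \<Rightarrow> 'v::ab_group_add) \<Rightarrow> 'v set \<Rightarrow> bool" where
  "fin_dim s V \<longleftrightarrow> (\<exists>S. finite S \<and> module.span s S = V)"

definition locally_finite ::
  "('g, 'm) monoid_scheme \<Rightarrow> (complex \<Rightarrow> 'v \<Rightarrow> 'v::ab_group_add) \<Rightarrow> 'v set \<Rightarrow>
   ('g \<Rightarrow> 'v \<Rightarrow> 'v) \<Rightarrow> bool" where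
  "locally_finite G s V \<rho> \<longleftrightarrow>
    (\<forall>v\<in>V. fin_dim s (module.span s ((\<lambda>g. \<rho> g v) ` carrier G)))"

text \<open>Every finite dimensional representation is isomorphic to one on a subspace of the space of
  complex sequences, so it suffices to let \<open>W\<close> range over such subspaces.\<close>

definition seq_scale :: "complex \<Rightarrow> (nat \<Rightarrow> complex) \<Rightarrow> nat \<Rightarrow> complex" where
  "seq_scale c x = (\<lambda>i. c * x i)"

definition admissible ::
  "('g, 'm) monoid_scheme \<Rightarrow> (complex \<Rightarrow> 'v \<Rightarrow> 'v::ab_group_add) \<Rightarrow> 'v set \<Rightarrow>
   ('g \<Rightarrow> 'v \<Rightarrow> 'v) \<Rightarrow> bool" where
  "admissible G s V \<rho> \<longleftrightarrow> locally_finite G s V \<rho> \<and>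
    (\<forall>W \<sigma>. simple_rep G seq_scale W \<sigma> \<and> fin_dim seq_scale W \<longrightarrow>
       fin_dim s (isotypic G s V \<rho> seq_scale W \<sigma>))"

text \<open>\<open>P\<close> sends the image of \<open>\<gamma>\<close> to the class of the restriction to \<open>U\<close> of any isomorphism
  between \<open>V\<close> and its twist by \<open>\<gamma>\<close>.\<close>

definition induced_projective_rep ::
  "family \<Rightarrow> cartan_type \<Rightarrow> (nat gword set \<Rightarrow> node gword set \<Rightarrow> node gword set) \<Rightarrow>
   (complex \<Rightarrow> 'v \<Rightarrow> 'v::ab_group_add) \<Rightarrow> 'v set \<Rightarrow> (node gword set \<Rightarrow> 'v \<Rightarrow> 'v) \<Rightarrow> 'v set \<Rightarrow>
   (int^2^2 \<Rightarrow> ('v \<Rightarrow> 'v) set) \<Rightarrow> bool" where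
  "induced_projective_rep k X act s V \<rho> U P \<longleftrightarrow>
    P \<in> hom (Gamma1 (level k X)) (PGL s U) \<and>
    (\<forall>\<gamma>\<in>carrier (Gamma1_tilde (level k X)). \<forall>f. twist_iso (B_group k X) (act \<gamma>) s V \<rho> f \<longrightarrow>
       restrict f U \<in> carrier (GL s U) \<and>
       P (braid_proj \<gamma>) = scalar_maps s U #>\<^bsub>GL s U\<^esub> restrict f U)"

definition descends :: "nat \<Rightarrow> ('p, 'm) monoid_scheme \<Rightarrow> (int^2^2 \<Rightarrow> 'p) \<Rightarrow> bool" where
  "descends r H P \<longleftrightarrow>
    (\<exists>Q\<in>hom (Gamma1_bar r) H.
       \<forall>M\<in>carrier (Gamma1 r). P M = Q (plus_minus_one #>\<^bsub>SL2Z\<^esub> M))"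

text \<open>These are the simply laced types whose Weyl group does not contain \<open>-1\<close>. In type \<open>D\<close> this
  happens for odd rank: \<open>-1\<close> lies in the Weyl group of \<open>D\<^sub>n\<close> exactly when \<open>n\<close> is even.\<close>

definition exceptional :: "family \<Rightarrow> cartan_type \<Rightarrow> bool" where
  "exceptional k X \<longleftrightarrow> k = DDD \<and>
    ((\<exists>n\<ge>2. X = TypeA n) \<or> (\<exists>n\<ge>2. X = TypeD (2 * n + 1)) \<or> X = TypeE 6)"

end

theory Submission
  imports
    Defs
    "HOL-Computational_Algebra.Fundamental_Theorem_Algebra"
    "HOL-Analysis.Continuum_Not_Denumerable"
begin

text \<open>Write \<open>c\<close> for the element \<open>(u\<^sub>1 u\<^sub>2)\<^sup>3\<close> of the braid group on three strands. It maps to \<open>-1\<close>, and the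
  kernel of the projection to \<open>SL(2, \<int>)\<close> is generated by \<open>c\<^sup>2\<close>. Let \<open>\<zeta>\<close> be the positive lift of the longest
  element \<open>w\<^sub>0\<close> to the finite Artin group \<open>B(X)\<close>. Then \<open>\<zeta>\<^sup>2\<close> is central in \<open>B(X)\<close>, and so is \<open>\<zeta>\<close> if
  \<open>w\<^sub>0 = -1\<close>, that is, outside the exceptional types. The action of \<open>c\<^sup>2\<close> is conjugation by \<open>\<zeta>\<^sup>2\<close>, and if
  \<open>w\<^sub>0 = -1\<close> and the level is at most 2, then \<open>c\<close> acts as conjugation by \<open>\<zeta>\<close>. For three affine nodes this
  follows from \<open>\<zeta> = \<Theta> T\<^sub>v\<close>, where \<open>v\<close> fixes \<open>\<theta>\<close>. For two affine nodes one has \<open>\<zeta> = (M N)\<^sup>r T\<^sub>v\<close>, where \<open>v\<close>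
  fixes \<open>\<theta>\<close> and \<open>\<phi>\<close> and \<open>M\<close>, \<open>N\<close> lift two reflections that generate a dihedral group on the plane of \<open>\<theta>\<close>
  and \<open>\<phi>\<close>.

  If \<open>\<gamma>\<close> acts as conjugation by a central element of \<open>B(X)\<close>, then by Schur's lemma, which holds because
  the group is countable and \<open>\<complex>\<close> is not, any isomorphism between \<open>V\<close> and its twist by \<open>\<gamma>\<close> is a scalar
  on the isotypic component. Hence the class in \<open>PGL\<close> depends only on the image of \<open>\<gamma>\<close> in \<open>\<Gamma>\<close>, or in
  \<open>\<Gamma>/{\<plusminus>1}\<close> outside the exceptional types. In level 3 the latter is no condition, since \<open>\<Gamma>\<close> never
  contains both \<open>M\<close> and \<open>-M\<close>.\<close>

section \<open>Presented groups\<close>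

text \<open>The action is given only by its values on generators, so conjugation by
  \<open>\<zeta>\<close> has to be found by computing with words: \<open>c = (u1 u2)^3\<close> in
  level 1, \<open>c = (u1 u2^2)^2\<close> in level 2 and \<open>c^2 = (u1 u2^3)^3\<close> in level
  3, where \<open>c\<close> itself is missing because -1 is not congruent to 1 mod 3. The obstacle
  in level 2 is that \<open>M\<close> and \<open>N\<close> lift reflections in roots that are in
  general not simple, so the presentation does not list their relations with the affine generators.
  The relation \<open>x N x N = N x N x\<close> for \<open>x = \<Theta>\<^sub>0\<close> is forced by
  the centrality of the last relator and by the fact that the action preserves relations. Lengths of
  Weyl group elements are handled as inversion counts. This gives Matsumoto's theorem, hence
  well-defined lifts, and reduces multiplicativity of lifts to the question whether an inversion is
  undone. The theory is developed from positive definiteness and connectedness of the diagram; the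
  separate types enter when these two properties are verified and when \<open>- w0\<close> is
  determined.\<close>

lemma gwords_Nil [simp]: "[] \<in> gwords S"
  and gwords_Cons [simp]: "((g, e) # u \<in> gwords S) = (g \<in> S \<and> u \<in> gwords S)"
  and gwords_append [simp]: "(u @ v \<in> gwords S) = (u \<in> gwords S \<and> v \<in> gwords S)"
  and gwords_word_inv [simp]: "(word_inv u \<in> gwords S) = (u \<in> gwords S)"
  by (auto simp: gwords_def word_inv_def lists_eq_set)

lemma pres_eq_gwords: "pres_eq S R u v \<Longrightarrow> u \<in> gwords S \<and> v \<in> gwords S"
  by (induction rule: pres_eq.induct) auto

lemma pres_class_eq_iff:
  assumes "u \<in> gwords S"
  shows "pres_class S R u = pres_class S R v \<longleftrightarrow> pres_eq S R u v"
proof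
  assume "pres_class S R u = pres_class S R v"
  moreover have "u \<in> pres_class S R u"
    using assms by (auto simp: pres_class_def intro: pres_eq.refl)
  ultimately show "pres_eq S R u v"
    by (auto simp: pres_class_def intro: pres_eq.sym)
next
  assume "pres_eq S R u v"
  then show "pres_class S R u = pres_class S R v"
    by (auto simp: pres_class_def intro: pres_eq.sym pres_eq.trans)
qed

text \<open>The union that defines \<open>mult\<close> runs over all representatives. It collapses
  because \<open>pres_eq\<close> is a congruence for concatenation and neither class is
  empty.\<close>

lemma pres_mult:
  assumes "u \<in> gwords S" "v \<in> gwords S"
  shows "pres_class S R u \<otimes>\<^bsub>pres_group S R\<^esub> pres_class S R v = pres_class S R (u @ v)"
proof -
  have *: "pres_class S R (u' @ v') = pres_class S R (u @ v)"
    if "pres_eq S R u u'" "pres_eq S R v v'" for u' v'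
    using assms pres_eq.append[OF that] by (simp add: pres_class_eq_iff[symmetric])
  have "(\<Union>u'\<in>pres_class S R u. \<Union>v'\<in>pres_class S R v. pres_class S R (u' @ v')) =
      (\<Union>u'\<in>pres_class S R u. \<Union>v'\<in>pres_class S R v. pres_class S R (u @ v))"
    by (intro SUP_cong refl *) (simp_all add: pres_class_def)
  also have "\<dots> = pres_class S R (u @ v)"
    using assms by (auto simp: pres_class_def intro: pres_eq.refl)
  finally show ?thesis
    by (simp add: pres_group_def)
qed

lemma pres_carrier: "carrier (pres_group S R) = pres_class S R ` gwords S"
  and pres_one: "\<one>\<^bsub>pres_group S R\<^esub> = pres_class S R []"
  by (simp_all add: pres_group_def)

lemma pres_eq_word_inv:
  assumes "u \<in> gwords S"
  shows "pres_eq S R (word_inv u @ u) []" "pres_eq S R (u @ word_inv u) []"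
proof -
  have left: "pres_eq S R (word_inv u @ u) []" if "u \<in> gwords S" for u
    using that
  proof (induction u)
    case Nil
    then show ?case by (simp add: word_inv_def pres_eq.refl)
  next
    case (Cons x u)
    obtain g e where x: "x = (g, e)" by (cases x)
    with Cons.prems have g: "g \<in> S" "u \<in> gwords S" by auto
    have "pres_eq S R [(g, \<not> e), (g, e)] []"
      using pres_eq.cancel[OF g(1), of R "\<not> e"] by simp
    then have "pres_eq S R ((word_inv u @ [(g, \<not> e), (g, e)]) @ u) ((word_inv u @ []) @ u)"
      using g by (intro pres_eq.append pres_eq.refl) auto
    then show ?case
      using Cons.IH[OF g(2)] by (auto simp: x word_inv_def intro: pres_eq.trans)
  qed
  then show "pres_eq S R (word_inv u @ u) []" using assms by blast
  have "word_inv (word_inv u) = u"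
    by (simp add: word_inv_def rev_map comp_def split_def)
  then show "pres_eq S R (u @ word_inv u) []"
    using left[of "word_inv u"] assms by simp
qed

lemma group_pres_group: "group (pres_group S R)"
proof (rule groupI)
  fix a assume "a \<in> carrier (pres_group S R)"
  then obtain u where u: "u \<in> gwords S" "a = pres_class S R u" by (auto simp: pres_carrier)
  show "\<exists>y\<in>carrier (pres_group S R). y \<otimes>\<^bsub>pres_group S R\<^esub> a = \<one>\<^bsub>pres_group S R\<^esub>"
    using u pres_eq_word_inv(1)[OF u(1)]
    by (intro bexI[of _ "pres_class S R (word_inv u)"])
       (auto simp: pres_mult pres_one pres_carrier pres_class_eq_iff)
qed (auto simp: pres_carrier pres_mult pres_one)

lemma pres_inv:
  assumes "u \<in> gwords S"
  shows "inv\<^bsub>pres_group S R\<^esub> pres_class S R u = pres_class S R (word_inv u)"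
  using assms pres_eq_word_inv[OF assms]
  by (intro group.inv_equality[OF group_pres_group])
     (auto simp: pres_mult pres_one pres_carrier pres_class_eq_iff)

lemma (in group) eval_word_closed [simp]:
  assumes "f \<in> S \<rightarrow> carrier G" "u \<in> gwords S"
  shows "eval_word G f u \<in> carrier G"
  using assms(2) by (induction u) (use assms(1) in \<open>auto simp: eval_word_def Pi_iff\<close>)

lemma eval_word_Nil [simp]: "eval_word G f [] = \<one>\<^bsub>G\<^esub>"
  and eval_word_Cons [simp]:
    "eval_word G f ((g, e) # u) = (if e then f g else inv\<^bsub>G\<^esub> f g) \<otimes>\<^bsub>G\<^esub> eval_word G f u"
  by (simp_all add: eval_word_def)

lemma (in group) eval_word_append:
  assumes "f \<in> S \<rightarrow> carrier G" "u \<in> gwords S" "v \<in> gwords S"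
  shows "eval_word G f (u @ v) = eval_word G f u \<otimes> eval_word G f v"
  using assms(2)
proof (induction u)
  case Nil
  then show ?case using assms by simp
next
  case (Cons x u)
  obtain g e where x: "x = (g, e)" by (cases x)
  with Cons.prems have "g \<in> S" "u \<in> gwords S" by auto
  moreover from this have "f g \<in> carrier G" using assms(1) by auto
  ultimately show ?case
    using Cons.IH eval_word_closed[OF assms(1)] assms(3) by (simp add: x m_assoc)
qed

text \<open>The universal property of a presentation. A pair in \<open>R\<close> acts only if both
  sides are words over \<open>S\<close>, hence the extra premises in the assumption on
  \<open>R\<close>.\<close>

lemma (in group) eval_word_pres_eq:
  assumes f: "f \<in> S \<rightarrow> carrier G"
    and R: "\<And>u v. (u, v) \<in> R \<Longrightarrow> u \<in> gwords S \<Longrightarrow> v \<in> gwords S \<Longrightarrow> eval_word G f u = eval_word G f v"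
    and "pres_eq S R u v"
  shows "eval_word G f u = eval_word G f v"
  using assms(3)
proof (induction rule: pres_eq.induct)
  case (append u u' v v')
  then show ?case
    using pres_eq_gwords[OF append.hyps(1)] pres_eq_gwords[OF append.hyps(2)]
    by (simp add: eval_word_append[OF f])
next
  case (cancel g e)
  then have "f g \<in> carrier G" using f by auto
  then show ?case by simp
qed (use R in auto)

text \<open>With \<open>hom_eval_word\<close> this reduces statements about homomorphisms out of a
  presented group to the values on generators.\<close>

lemma eval_word_pres_group:
  assumes "u \<in> gwords S"
  shows "eval_word (pres_group S R) (\<lambda>g. pres_class S R [(g, True)]) u = pres_class S R u"
  using assms
proof (induction u)
  case Nil
  then show ?case by (simp add: pres_one)
next
  case (Cons x u)
  obtain g e where x: "x = (g, e)" by (cases x)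
  with Cons.prems have g: "g \<in> S" "u \<in> gwords S" by auto
  then have "inv\<^bsub>pres_group S R\<^esub> pres_class S R [(g, True)] = pres_class S R [(g, False)]"
    by (subst pres_inv) (auto simp: word_inv_def)
  then show ?case using Cons.IH g by (auto simp: x pres_mult)
qed

lemma hom_eval_word:
  assumes "group G" "group H" "\<phi> \<in> hom G H" "f \<in> S \<rightarrow> carrier G" "u \<in> gwords S"
  shows "\<phi> (eval_word G f u) = eval_word H (\<phi> \<circ> f) u"
  using assms(5)
proof (induction u)
  case Nil
  show ?case using hom_one[OF assms(3,1,2)] by simp
next
  case (Cons x u)
  interpret group_hom G H \<phi>
    using assms(1-3) by (simp add: group_hom_def group_hom_axioms_def)
  obtain g e where x: "x = (g, e)" by (cases x)
  with Cons.prems have "g \<in> S" "u \<in> gwords S" by auto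
  moreover from this have "f g \<in> carrier G" using assms(4) by auto
  ultimately show ?case
    using Cons.IH G.eval_word_closed[OF assms(4)] by (simp add: x)
qed

lemma pres_hom_eqI:
  assumes "group H" "\<phi> \<in> hom (pres_group S R) H" "\<psi> \<in> hom (pres_group S R) H"
    and "\<And>g. g \<in> S \<Longrightarrow> \<phi> (pres_class S R [(g, True)]) = \<psi> (pres_class S R [(g, True)])"
    and "a \<in> carrier (pres_group S R)"
  shows "\<phi> a = \<psi> a"
proof -
  define gen where "gen = (\<lambda>g. pres_class S R [(g, True)])"
  obtain u where u: "u \<in> gwords S" "a = pres_class S R u" using assms(5) by (auto simp: pres_carrier)
  have gen: "gen \<in> S \<rightarrow> carrier (pres_group S R)" by (auto simp: gen_def pres_carrier)
  have "eval_word H (\<phi> \<circ> gen) u = eval_word H (\<psi> \<circ> gen) u"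
    using u(1) by (induction u) (use assms(4) in \<open>auto simp: gen_def\<close>)
  then have "\<phi> (eval_word (pres_group S R) gen u) = \<psi> (eval_word (pres_group S R) gen u)"
    using assms(1-3) gen u(1) by (simp add: hom_eval_word[OF group_pres_group])
  then show ?thesis
    using u by (simp add: gen_def eval_word_pres_group)
qed

lemma countable_pres_group:
  assumes "countable S"
  shows "countable (carrier (pres_group S R))"
  using assms by (auto simp: pres_carrier gwords_def)

section \<open>Linear algebra of representations\<close>

text \<open>A countable spanning set is the increasing union of finite sets \<open>S n\<close>, and
  the span of each of them meets an independent set in finitely many vectors.\<close>

lemma (in vector_space) countable_independent:
  assumes "countable K" "independent B" "B \<subseteq> span K"
  shows "countable B"
proof (cases "K = {}")
  case True
  then have "B \<subseteq> {0}" using assms by simp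
  then show ?thesis using countable_subset by blast
next
  case False
  define S where "S n = from_nat_into K ` {..<n}" for n :: nat
  have "\<exists>n. b \<in> span (S n)" if b: "b \<in> B" for b
  proof -
    obtain t r where t: "b = (\<Sum>a\<in>t. scale (r a) a)" "finite t" "t \<subseteq> K"
      using assms(3) b unfolding span_explicit by blast
    define n where "n = Suc (Max (insert 0 (to_nat_on K ` t)))"
    have "t \<subseteq> S n"
    proof
      fix a assume a: "a \<in> t"
      then have "to_nat_on K a < n"
        using t(2) by (auto simp: n_def less_Suc_eq_le)
      moreover have "from_nat_into K (to_nat_on K a) = a"
        using a t(3) assms(1) by auto
      ultimately show "a \<in> S n"
        unfolding S_def by (metis image_eqI lessThan_iff)
    qed
    then have "b \<in> span (S n)"
      unfolding t(1) by (intro span_sum span_scale span_base) auto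
    then show ?thesis ..
  qed
  then have "B = (\<Union>n. B \<inter> span (S n))" by auto
  moreover have "finite (B \<inter> span (S n))" for n
    using independent_span_bound[of "S n" "B \<inter> span (S n)"] independent_mono[OF assms(2)]
    by (metis Int_lower1 Int_lower2 S_def finite_imageI finite_lessThan)
  then have "countable (\<Union>n. B \<inter> span (S n))"
    by (intro countable_UN) (auto intro: countable_finite)
  ultimately show ?thesis by simp
qed

lemma linear_map_onD:
  assumes "linear_map_on s V t f"
  shows "x \<in> V \<Longrightarrow> y \<in> V \<Longrightarrow> f (x + y) = f x + f y" "x \<in> V \<Longrightarrow> f (s c x) = t c (f x)"
  using assms by (auto simp: linear_map_on_def)

locale linear_self_map = vector_space s for s :: "complex \<Rightarrow> 'v::ab_group_add \<Rightarrow> 'v" +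
  fixes V :: "'v set" and f :: "'v \<Rightarrow> 'v"
  assumes subspace: "subspace V" and closed: "x \<in> V \<Longrightarrow> f x \<in> V"
    and linear: "linear_map_on s V s f"
begin

lemma zero: "f 0 = 0"
  using linear_map_onD(2)[OF linear, of 0 0] subspace_0[OF subspace] by simp

text \<open>This is \<open>p(f) x\<close> by Horner's scheme. It is applied to vectors, not formed
  in an algebra of endomorphisms, because \<open>f\<close> is linear on \<open>V\<close>
  only.\<close>

definition poly_act :: "complex poly \<Rightarrow> 'v \<Rightarrow> 'v" where
  "poly_act p = fold_coeffs (\<lambda>a g x. s a x + f (g x)) p (\<lambda>x. 0)"

lemma poly_act_0 [simp]: "poly_act 0 x = 0"
  by (simp add: poly_act_def)

lemma poly_act_pCons [simp]: "poly_act (pCons a p) x = s a x + f (poly_act p x)"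
  by (cases "p = 0"; cases "a = 0") (auto simp: poly_act_def zero)

lemma poly_act_closed [simp]: "x \<in> V \<Longrightarrow> poly_act p x \<in> V"
  by (induction p) (auto simp: subspace_0[OF subspace] subspace_add[OF subspace] subspace_scale[OF subspace] closed)

lemma poly_act_add: "x \<in> V \<Longrightarrow> poly_act (p + q) x = poly_act p x + poly_act q x"
  by (induction p q rule: poly_induct2)
     (auto simp: linear_map_onD[OF linear] scale_left_distrib algebra_simps)

lemma poly_act_smult: "x \<in> V \<Longrightarrow> poly_act (smult a p) x = s a (poly_act p x)"
  by (induction p) (auto simp: linear_map_onD[OF linear] scale_right_distrib)

lemma poly_act_sum: "x \<in> V \<Longrightarrow> poly_act (\<Sum>c\<in>C. P c) x = (\<Sum>c\<in>C. poly_act (P c) x)"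
  by (induction C rule: infinite_finite_induct) (auto simp: poly_act_add)

lemma poly_act_vec_add: "x \<in> V \<Longrightarrow> y \<in> V \<Longrightarrow> poly_act p (x + y) = poly_act p x + poly_act p y"
  by (induction p) (auto simp: linear_map_onD[OF linear] scale_right_distrib)

lemma poly_act_vec_scale: "x \<in> V \<Longrightarrow> poly_act p (s c x) = s c (poly_act p x)"
  by (induction p) (auto simp: linear_map_onD[OF linear] scale_right_distrib mult.commute)

lemma poly_act_vec_sum:
  "(\<And>c. c \<in> C \<Longrightarrow> x c \<in> V) \<Longrightarrow> poly_act p (\<Sum>c\<in>C. x c) = (\<Sum>c\<in>C. poly_act p (x c))"
proof (induction C rule: infinite_finite_induct)
  case empty
  show ?case by (induction p) (auto simp: zero)
next
  case (infinite A)
  have "poly_act p 0 = 0" by (induction p) (auto simp: zero)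
  with infinite show ?case by simp
next
  case (insert a C)
  then show ?case using subspace_sum[OF subspace, of C x] by (simp add: poly_act_vec_add)
qed

lemma linear_factor_eq: "[:- c, 1:] * q = smult (- c) q + pCons 0 q" for c :: complex
  by simp

lemma poly_act_linear_factor:
  assumes "x \<in> V"
  shows "poly_act ([:- c, 1:] * q) x = f (poly_act q x) - s c (poly_act q x)"
  unfolding linear_factor_eq using assms by (subst poly_act_add) (auto simp: poly_act_smult simp del: smult_minus_left)

text \<open>Here the linear factor acts first. If \<open>f w - c w = v\<close>, a product applied to
  \<open>w\<close> thus becomes the product of the other factors applied to
  \<open>v\<close>.\<close>

lemma poly_act_linear_factor':
  assumes "x \<in> V"
  shows "poly_act ([:- c, 1:] * q) x = poly_act q (f x - s c x)"
proof -
  have "poly_act q (f x) = f (poly_act q x)"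
    using assms by (induction q) (auto simp: zero linear_map_onD[OF linear] closed subspace_scale[OF subspace])
  moreover have "poly_act q (f x + s (- c) x) = poly_act q (f x) + s (- c) (poly_act q x)"
    using assms closed subspace_scale[OF subspace assms, of "- c"]
    by (subst poly_act_vec_add) (auto simp only: poly_act_vec_scale)
  ultimately show ?thesis
    using assms by (simp add: poly_act_linear_factor del: mult_pCons_left)
qed

text \<open>Over \<complex> the polynomial splits, and each linear factor is injective on
  \<open>V\<close> by assumption.\<close>

lemma poly_act_nonzero:
  assumes inj: "\<And>c x. x \<in> V \<Longrightarrow> f x = s c x \<Longrightarrow> x = 0"
    and "p \<noteq> 0" "x \<in> V" "x \<noteq> 0"
  shows "poly_act p x \<noteq> 0"
  using assms(2)
proof (induction "degree p" arbitrary: p)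
  case 0
  then obtain a where "p = [:a:]" using degree_eq_zeroE by metis
  then show ?case using 0 \<open>x \<noteq> 0\<close> by (auto simp: zero)
next
  case (Suc d)
  then have "\<not> constant (poly p)" by (simp add: constant_degree)
  then obtain c where "poly p c = 0" using fundamental_theorem_of_algebra by blast
  then obtain q where q: "p = [:- c, 1:] * q" using poly_eq_0_iff_dvd by blast
  with Suc have "q \<noteq> 0" "degree q = d"
    by (auto simp: degree_mult_eq simp del: mult_pCons_left)
  then have "poly_act q x \<noteq> 0" using Suc by blast
  moreover have "poly_act q x \<in> V" using assms by simp
  ultimately show ?case
    using inj[of "poly_act q x" c] assms(3) poly_act_linear_factor[of x c q] q by auto
qed

text \<open>Dixmier's resolvent argument. Without eigenvectors every \<open>f - c\<close> is
  bijective on \<open>V\<close>, and the vectors \<open>w c = (f - c)^-1 v\<close> form an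
  uncountable independent family.\<close>

lemma eigenvector_if_countable:
  assumes K: "countable K" "V \<subseteq> span K" and V: "V \<noteq> {0}"
    and surj: "\<And>c. \<lbrakk>\<And>x. x \<in> V \<Longrightarrow> f x = s c x \<Longrightarrow> x = 0\<rbrakk> \<Longrightarrow> V \<subseteq> (\<lambda>x. f x - s c x) ` V"
  shows "\<exists>c. \<exists>x\<in>V. x \<noteq> 0 \<and> f x = s c x"
proof (rule ccontr)
  assume "\<nexists>c. \<exists>x\<in>V. x \<noteq> 0 \<and> f x = s c x"
  then have inj: "\<And>c x. x \<in> V \<Longrightarrow> f x = s c x \<Longrightarrow> x = 0" by auto
  obtain v where v: "v \<in> V" "v \<noteq> 0" using V subspace_0[OF subspace] by auto
  have "\<exists>w\<in>V. f w - s c w = v" for c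
    using surj[of c] inj v(1) unfolding image_iff subset_iff by metis
  then obtain w where w: "\<And>c. w c \<in> V" "\<And>c. f (w c) - s c (w c) = v" by metis
  have w0: "w c \<noteq> 0" for c using w(2)[of c] v(2) zero by auto
  have "inj w"
  proof (rule injI)
    fix c d assume eq: "w c = w d"
    have "s c (w c) = f (w c) - v" "s d (w d) = f (w d) - v"
      using w(2)[of c] w(2)[of d] by (metis diff_diff_eq2 add_diff_cancel_left')+
    then show "c = d" using w0[of d] eq scale_cancel_right by metis
  qed
  have "independent (range w)"
    unfolding independent_explicit_finite_subsets
  proof (intro allI impI ballI)
    fix S u x
    assume S: "S \<subseteq> range w" "finite S" and sum: "(\<Sum>x\<in>S. s (u x) x) = 0" and x: "x \<in> S"
    define C where "C = w -` S"
    have SC: "S = w ` C" using S by (auto simp: C_def)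
    have C: "finite C" using S(2) \<open>inj w\<close> by (simp add: C_def finite_vimageI)
    obtain c0 where c0: "c0 \<in> C" "x = w c0" using x SC by auto
    \<comment> \<open>\<open>P c\<close> clears denominators: the full product applied to
      \<open>w c\<close> is \<open>P c\<close> applied to \<open>v\<close>. A linear relation among
      the \<open>w c\<close> therefore says \<open>Q(f) v = 0\<close>, which forces
      \<open>Q = 0\<close>.\<close>
    define P where "P c = (\<Prod>d\<in>C - {c}. [:- d, 1:])" for c
    define Q where "Q = (\<Sum>c\<in>C. smult (u (w c)) (P c))"
    have "poly_act (\<Prod>d\<in>C. [:- d, 1:]) (w c) = poly_act (P c) v" if "c \<in> C" for c
      using that C w by (subst prod.remove) (auto simp: poly_act_linear_factor' P_def simp del: mult_pCons_left)
    then have "(\<Sum>c\<in>C. poly_act (\<Prod>d\<in>C. [:- d, 1:]) (s (u (w c)) (w c))) = poly_act Q v"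
      using v w by (simp add: Q_def poly_act_sum poly_act_smult poly_act_vec_scale)
    moreover have "(\<Sum>c\<in>C. s (u (w c)) (w c)) = 0"
      using sum sum.reindex[of w C "\<lambda>x. s (u x) x"] inj_on_subset[OF \<open>inj w\<close>, of C]
      by (simp add: SC)
    moreover have "(\<Sum>c\<in>C. poly_act R (s (u (w c)) (w c))) = poly_act R (\<Sum>c\<in>C. s (u (w c)) (w c))" for R
      using w by (subst poly_act_vec_sum) (auto simp: subspace_scale[OF subspace])
    ultimately have "poly_act Q v = poly_act (\<Prod>d\<in>C. [:- d, 1:]) 0"
      by simp
    also have "\<dots> = 0"
      using poly_act_vec_scale[of 0 _ 0] subspace_0[OF subspace] by simp
    finally have "Q = 0" using poly_act_nonzero[OF _ _ v] inj by blast
    \<comment> \<open>At \<open>c0\<close> every summand of \<open>Q\<close> vanishes except the one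
      of \<open>c0\<close>, whose product has no zero factor.\<close>
    then have "0 = poly Q c0" by simp
    also have "\<dots> = (\<Sum>c\<in>C. u (w c) * (\<Prod>d\<in>C - {c}. c0 - d))"
      by (simp add: Q_def P_def poly_sum poly_prod)
    also have "\<dots> = u (w c0) * (\<Prod>d\<in>C - {c0}. c0 - d) + (\<Sum>c\<in>C - {c0}. u (w c) * (\<Prod>d\<in>C - {c}. c0 - d))"
      using C c0 by (subst sum.remove) auto
    also have "(\<Sum>c\<in>C - {c0}. u (w c) * (\<Prod>d\<in>C - {c}. c0 - d)) = 0"
      using C c0 by (intro sum.neutral) (auto intro!: prod_zero)
    finally show "u x = 0" using C c0 by simp
  qed
  then have "countable (range w)"
    by (rule countable_independent[OF K(1)]) (use K(2) w(1) in blast)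
  then show False
    using countable_image_inj_on[OF _ \<open>inj w\<close>] uncountable_UNIV_complex by blast
qed

end

section \<open>Linear groups of a subspace and their projective quotients\<close>

lemma GL_carrier: "f \<in> carrier (GL s V) \<longleftrightarrow> f \<in> extensional V \<and> bij_betw f V V \<and> linear_map_on s V s f"
  by (auto simp: GL_def Bij_def)

lemma GL_mult:
  "f \<in> carrier (GL s V) \<Longrightarrow> g \<in> carrier (GL s V) \<Longrightarrow> f \<otimes>\<^bsub>GL s V\<^esub> g = compose V f g"
  by (simp add: GL_def BijGroup_def)

lemma GL_one: "\<one>\<^bsub>GL s V\<^esub> = (\<lambda>x\<in>V. x)"
  by (simp add: GL_def BijGroup_def)

lemma linear_map_on_inv_into:
  assumes "vector_space s" "module.subspace s V" "linear_map_on s V s f" "bij_betw f V V"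
  shows "linear_map_on s V s (inv_into V f)"
proof -
  interpret vector_space s by fact
  have *: "inv_into V f x \<in> V" "f (inv_into V f x) = x" if "x \<in> V" for x
    using assms(4) that by (auto simp: bij_betw_def inv_into_into f_inv_into_f)
  have inv: "inv_into V f z = y" if "f y = z" "y \<in> V" for y z
    using assms(4) that by (auto simp: bij_betw_def)
  show ?thesis
    unfolding linear_map_on_def
  proof (intro conjI ballI allI)
    fix x y assume "x \<in> V" "y \<in> V"
    then show "inv_into V f (x + y) = inv_into V f x + inv_into V f y"
      using * assms(2) linear_map_onD[OF assms(3)] by (intro inv) (auto simp: subspace_add)
  next
    fix c x assume "x \<in> V"
    then show "inv_into V f (s c x) = s c (inv_into V f x)"
      using * assms(2) linear_map_onD[OF assms(3)] by (intro inv) (auto simp: subspace_scale)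
  qed
qed

lemma subgroup_GL:
  assumes "vector_space s" "module.subspace s V"
  shows "subgroup (carrier (GL s V)) (BijGroup V)"
proof -
  interpret vector_space s by fact
  show ?thesis
  proof (rule subgroup.intro)
    show "carrier (GL s V) \<subseteq> carrier (BijGroup V)" by (auto simp: GL_def BijGroup_def)
  next
    fix f g assume fg: "f \<in> carrier (GL s V)" "g \<in> carrier (GL s V)"
    then have "f \<in> Bij V" "g \<in> Bij V" by (auto simp: GL_def)
    moreover have "g x \<in> V" if "x \<in> V" for x
      using \<open>g \<in> Bij V\<close> that by (auto simp: Bij_def bij_betw_def)
    ultimately show "f \<otimes>\<^bsub>BijGroup V\<^esub> g \<in> carrier (GL s V)"
      using fg assms(2) compose_Bij[of f V g]
      by (auto simp: GL_def BijGroup_def linear_map_on_def compose_def subspace_add subspace_scale)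
  next
    show "\<one>\<^bsub>BijGroup V\<^esub> \<in> carrier (GL s V)"
      using assms(2) by (auto simp: GL_def BijGroup_def id_Bij linear_map_on_def subspace_add subspace_scale)
  next
    fix f assume f: "f \<in> carrier (GL s V)"
    then have *: "f \<in> Bij V" "linear_map_on s V s f" by (auto simp: GL_def)
    then have "linear_map_on s V s (inv_into V f)"
      using assms by (intro linear_map_on_inv_into) (auto simp: Bij_def)
    then show "inv\<^bsub>BijGroup V\<^esub> f \<in> carrier (GL s V)"
      using * restrict_inv_into_Bij[of f V] assms(2)
      by (auto simp: inv_BijGroup GL_def linear_map_on_def subspace_add subspace_scale)
  qed
qed

lemma group_GL:
  assumes "vector_space s" "module.subspace s V"
  shows "group (GL s V)"
proof -
  have "GL s V = BijGroup V \<lparr>carrier := carrier (GL s V)\<rparr>"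
    by (simp add: GL_def)
  then show ?thesis
    using subgroup.subgroup_is_group[OF subgroup_GL[OF assms] group_BijGroup] by metis
qed

lemma scalar_maps_GL:
  assumes "vector_space s" "module.subspace s V" "c \<noteq> 0"
  shows "restrict (s c) V \<in> carrier (GL s V)"
proof -
  interpret vector_space s by fact
  have "bij_betw (s c) V V"
    by (rule bij_betw_byWitness[where f' = "s (inverse c)"])
       (use assms(2,3) subspace_scale[OF assms(2)] in auto)
  then have "bij_betw (restrict (s c) V) V V"
    by (rule bij_betw_cong[THEN iffD2, rotated]) simp
  moreover have "linear_map_on s V s (restrict (s c) V)"
    using assms(2) by (simp add: linear_map_on_def subspace_add subspace_scale scale_right_distrib mult.commute)
  ultimately show ?thesis
    by (simp add: GL_carrier)
qed

text \<open>Scalars commute with every linear bijection, so they are even central.\<close>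

lemma normal_scalar_maps:
  assumes "vector_space s" "module.subspace s V"
  shows "normal (scalar_maps s V) (GL s V)"
proof -
  interpret vector_space s by fact
  interpret group "GL s V" by (rule group_GL[OF assms])
  have "subgroup (scalar_maps s V) (GL s V)"
  proof (rule subgroupI)
    show "scalar_maps s V \<subseteq> carrier (GL s V)"
      using scalar_maps_GL[OF assms] by (auto simp: scalar_maps_def)
    show "scalar_maps s V \<noteq> {}" by (auto simp: scalar_maps_def intro: exI[of _ 1])
  next
    fix a assume "a \<in> scalar_maps s V"
    then obtain c where c: "c \<noteq> 0" "a = restrict (s c) V" by (auto simp: scalar_maps_def)
    then have "inv\<^bsub>GL s V\<^esub> a = restrict (s (inverse c)) V"
      using assms scalar_maps_GL[OF assms]
      by (intro inv_equality) (auto simp: GL_mult GL_one compose_def subspace_scale intro!: restrict_ext)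
    then show "inv\<^bsub>GL s V\<^esub> a \<in> scalar_maps s V"
      using c by (auto simp: scalar_maps_def)
  next
    fix a b assume "a \<in> scalar_maps s V" "b \<in> scalar_maps s V"
    then obtain c d where c: "c \<noteq> 0" "a = restrict (s c) V" "d \<noteq> 0" "b = restrict (s d) V"
      by (auto simp: scalar_maps_def)
    then have "a \<otimes>\<^bsub>GL s V\<^esub> b = restrict (s (c * d)) V"
      using assms scalar_maps_GL[OF assms]
      by (auto simp: GL_mult compose_def subspace_scale intro!: restrict_ext)
    then show "a \<otimes>\<^bsub>GL s V\<^esub> b \<in> scalar_maps s V"
      using c by (auto simp: scalar_maps_def intro!: exI[of _ "c * d"])
  qed
  moreover have "x \<otimes>\<^bsub>GL s V\<^esub> h \<otimes>\<^bsub>GL s V\<^esub> inv\<^bsub>GL s V\<^esub> x \<in> scalar_maps s V"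
    if x: "x \<in> carrier (GL s V)" and "h \<in> scalar_maps s V" for x h
  proof -
    obtain c where c: "c \<noteq> 0" "h = restrict (s c) V" using \<open>h \<in> scalar_maps s V\<close> by (auto simp: scalar_maps_def)
    then have h: "h \<in> carrier (GL s V)" using scalar_maps_GL[OF assms] by simp
    have "y \<in> V \<Longrightarrow> x y \<in> V" for y using x by (auto simp: GL_carrier bij_betw_def)
    then have "x \<otimes>\<^bsub>GL s V\<^esub> h = h \<otimes>\<^bsub>GL s V\<^esub> x"
      using x h assms(2) by (auto simp: GL_mult compose_def c subspace_scale GL_carrier linear_map_onD intro!: restrict_ext)
    then have "x \<otimes>\<^bsub>GL s V\<^esub> h \<otimes>\<^bsub>GL s V\<^esub> inv\<^bsub>GL s V\<^esub> x = h"
      using x h by (simp add: m_assoc)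
    then show ?thesis using that by simp
  qed
  ultimately show ?thesis by (simp add: normal_inv_iff)
qed

lemma group_PGL:
  assumes "vector_space s" "module.subspace s V"
  shows "group (PGL s V)"
  using normal.factorgroup_is_group[OF normal_scalar_maps[OF assms]] by (simp add: PGL_def)

section \<open>Representations on subspaces and Schur's lemma\<close>

locale rep = G: group G + vector_space s
  for G :: "('g, 'm) monoid_scheme" (structure) and s :: "complex \<Rightarrow> 'v::ab_group_add \<Rightarrow> 'v" +
  fixes V :: "'v set" and \<rho> :: "'g \<Rightarrow> 'v \<Rightarrow> 'v"
  assumes subspace: "subspace V" and hom: "\<rho> \<in> hom G (GL s V)"
begin

lemma rep_GL: "g \<in> carrier G \<Longrightarrow> \<rho> g \<in> carrier (GL s V)"
  using hom by (auto simp: hom_def)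

lemma rep_bij: "g \<in> carrier G \<Longrightarrow> bij_betw (\<rho> g) V V"
  and rep_linear: "g \<in> carrier G \<Longrightarrow> linear_map_on s V s (\<rho> g)"
  using rep_GL by (auto simp: GL_carrier)

lemma rep_closed [simp]: "g \<in> carrier G \<Longrightarrow> x \<in> V \<Longrightarrow> \<rho> g x \<in> V"
  using rep_bij by (auto simp: bij_betw_def)

lemmas rep_add = linear_map_onD(1)[OF rep_linear] and rep_scale = linear_map_onD(2)[OF rep_linear]

lemma rep_diff: "g \<in> carrier G \<Longrightarrow> x \<in> V \<Longrightarrow> y \<in> V \<Longrightarrow> \<rho> g (x - y) = \<rho> g x - \<rho> g y"
  using rep_add[of g "x - y" y] subspace_diff[OF subspace, of x y] by (simp add: algebra_simps)

lemma rep_mult: "g \<in> carrier G \<Longrightarrow> h \<in> carrier G \<Longrightarrow> x \<in> V \<Longrightarrow> \<rho> (g \<otimes> h) x = \<rho> g (\<rho> h x)"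
  using hom rep_GL by (auto simp: hom_def GL_mult compose_def)

lemma rep_one: "x \<in> V \<Longrightarrow> \<rho> \<one> x = x"
  using hom_one[OF hom G.group_axioms group_GL[OF vector_space_axioms subspace]] by (simp add: GL_one)

lemma rep_inv: "g \<in> carrier G \<Longrightarrow> x \<in> V \<Longrightarrow> \<rho> (inv g) (\<rho> g x) = x"
  by (metis G.inv_closed G.l_inv rep_mult rep_one)

lemma rep_subgroup:
  assumes "subgroup K G"
  shows "rep (G\<lparr>carrier := K\<rparr>) s V \<rho>"
proof -
  have "\<rho> \<in> hom (G\<lparr>carrier := K\<rparr>) (GL s V)"
    using hom subgroup.subset[OF assms] by (auto simp: hom_def Pi_iff subset_iff)
  then show ?thesis
    using subgroup.subgroup_is_group[OF assms G.group_axioms] subspace vector_space_axioms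
    by (simp add: rep_def rep_axioms_def)
qed

end

lemma rep_iff: "group G \<Longrightarrow> representation G s V \<rho> \<longleftrightarrow> rep G s V \<rho>"
  by (auto simp: representation_def rep_def rep_axioms_def)

locale simple = rep G s V \<rho>
  for G :: "('g, 'm) monoid_scheme" (structure) and s :: "complex \<Rightarrow> 'v::ab_group_add \<Rightarrow> 'v"
    and V \<rho> +
  assumes nonzero: "V \<noteq> {0}"
    and minimal: "\<And>U. subspace U \<Longrightarrow> U \<subseteq> V \<Longrightarrow> (\<And>g. g \<in> carrier G \<Longrightarrow> \<rho> g ` U \<subseteq> U) \<Longrightarrow> U = {0} \<or> U = V"

lemma simple_iff: "group G \<Longrightarrow> simple_rep G s V \<rho> \<longleftrightarrow> simple G s V \<rho>"
  using rep_iff[of G s V \<rho>]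
  by (simp add: simple_rep_def simple_def simple_axioms_def Ball_def imp_conjL)

lemma (in rep) intertwiner_kernel:
  assumes "vector_space t" "intertwiner G s V \<rho> t W \<sigma> f" "rep G t W \<sigma>"
  shows "subspace {x \<in> V. f x = 0}" "g \<in> carrier G \<Longrightarrow> \<rho> g ` {x \<in> V. f x = 0} \<subseteq> {x \<in> V. f x = 0}"
proof -
  interpret W: rep G t W \<sigma> by fact
  have lin: "linear_map_on s V t f" and f: "f \<in> V \<rightarrow> W" using assms(2) by (auto simp: intertwiner_def)
  have "f 0 = 0" using linear_map_onD(2)[OF lin, of 0 0] subspace_0[OF subspace] by simp
  then show "subspace {x \<in> V. f x = 0}"
    using linear_map_onD[OF lin] subspace by (auto simp: subspace_def)
  have "\<sigma> g 0 = 0" if "g \<in> carrier G"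
    using W.rep_scale[OF that, of 0 0] W.subspace_0[OF W.subspace] by simp
  then show "\<rho> g ` {x \<in> V. f x = 0} \<subseteq> {x \<in> V. f x = 0}" if "g \<in> carrier G"
    using assms(2) that by (auto simp: intertwiner_def)
qed

lemma (in rep) intertwiner_image:
  assumes "intertwiner G s V \<rho> t W \<sigma> f" "rep G t W \<sigma>"
  shows "module.subspace t (f ` V)" "f ` V \<subseteq> W" "g \<in> carrier G \<Longrightarrow> \<sigma> g ` (f ` V) \<subseteq> f ` V"
proof -
  interpret W: rep G t W \<sigma> by fact
  have lin: "linear_map_on s V t f" using assms by (auto simp: intertwiner_def)
  have "f 0 = 0" using linear_map_onD(2)[OF lin, of 0 0] subspace_0[OF subspace] by simp
  then have "0 \<in> f ` V" using subspace_0[OF subspace] by (metis image_eqI)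
  moreover have "f x + f y \<in> f ` V" if "x \<in> V" "y \<in> V" for x y
    using that linear_map_onD(1)[OF lin, of x y] subspace_add[OF subspace, of x y] by (metis image_eqI)
  moreover have "t c (f x) \<in> f ` V" if "x \<in> V" for x c
    using that linear_map_onD(2)[OF lin, of x c] subspace_scale[OF subspace, of x c] by (metis image_eqI)
  ultimately show "module.subspace t (f ` V)"
    by (auto simp: W.subspace_def)
  show "f ` V \<subseteq> W" using assms by (auto simp: intertwiner_def)
  show "\<sigma> g ` (f ` V) \<subseteq> f ` V" if "g \<in> carrier G"
  proof -
    have "\<sigma> g (f x) = f (\<rho> g x)" "\<rho> g x \<in> V" if "x \<in> V" for x
      using assms \<open>g \<in> carrier G\<close> that by (auto simp: intertwiner_def)
    then show ?thesis by (simp add: image_subset_iff)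
  qed
qed

text \<open>The orbit of a nonzero vector is countable and spans \<open>V\<close> by minimality, so
  an eigenvector exists. Its eigenspace is the kernel of an intertwiner, hence all of
  \<open>V\<close>. Surjectivity of an injective \<open>f - c\<close> comes from minimality applied
  to the image.\<close>

lemma (in simple) schur:
  assumes f: "intertwiner G s V \<rho> s V \<rho> f" and G: "countable (carrier G)"
  shows "\<exists>c. \<forall>x\<in>V. f x = s c x"
proof -
  interpret linear_self_map s V f
    using subspace f by unfold_locales (auto simp: intertwiner_def)
  have shift: "intertwiner G s V \<rho> s V \<rho> (\<lambda>x. f x - s c x)" for c
    using f subspace
    by (auto simp: intertwiner_def linear_map_on_def subspace_diff subspace_scale scale_right_distrib
        scale_right_diff_distrib mult.commute rep_scale rep_diff closed)
  obtain v where v: "v \<in> V" "v \<noteq> 0" using nonzero subspace_0[OF subspace] by auto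
  have surj: "V \<subseteq> (\<lambda>x. f x - s c x) ` V" if "\<And>x. x \<in> V \<Longrightarrow> f x = s c x \<Longrightarrow> x = 0" for c
  proof -
    have "(\<lambda>x. f x - s c x) ` V = {0} \<or> (\<lambda>x. f x - s c x) ` V = V"
      by (rule minimal[OF intertwiner_image[OF shift rep_axioms]])
    moreover have "f v - s c v \<in> (\<lambda>x. f x - s c x) ` V" "f v - s c v \<noteq> 0"
      using that[OF v(1)] v by auto
    ultimately show ?thesis by blast
  qed
  define K where "K = (\<lambda>g. \<rho> g v) ` carrier G"
  have K: "K \<subseteq> V" using v by (auto simp: K_def)
  have "span K = {0} \<or> span K = V"
  proof (rule minimal)
    show "subspace (span K)" by simp
    show KV: "span K \<subseteq> V" using K subspace by (simp add: span_minimal)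
    show "\<rho> g ` span K \<subseteq> span K" if g: "g \<in> carrier G" for g
    proof
      fix y assume "y \<in> \<rho> g ` span K"
      then obtain x where x: "x \<in> span K" "y = \<rho> g x" by auto
      have "subspace {x \<in> V. \<rho> g x \<in> span K}"
        using subspace rep_add[OF g] rep_scale[OF g] rep_scale[OF g, of 0 0] subspace_0[OF subspace]
        by (auto simp: subspace_def span_add span_scale span_zero)
      moreover have "K \<subseteq> {x \<in> V. \<rho> g x \<in> span K}"
        using v g by (auto simp: K_def rep_mult[symmetric] intro!: span_base)
      ultimately show "y \<in> span K" using x span_minimal by blast
    qed
  qed
  moreover have "v \<in> K"
    using rep_one[OF v(1)] unfolding K_def by (metis G.one_closed image_eqI)
  ultimately have "V \<subseteq> span K" using v by (auto dest: span_base)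
  then obtain c x where x: "x \<in> V" "x \<noteq> 0" "f x = s c x"
    using eigenvector_if_countable[of K] G nonzero surj by (auto simp: K_def)
  have "{x \<in> V. f x - s c x = 0} = {0} \<or> {x \<in> V. f x - s c x = 0} = V"
    by (rule minimal[OF intertwiner_kernel(1)[OF vector_space_axioms shift rep_axioms] _
          intertwiner_kernel(2)[OF vector_space_axioms shift rep_axioms]]) auto
  then have "{x \<in> V. f x - s c x = 0} = V" using x by auto
  then show ?thesis by (intro exI[of _ c]) auto
qed

section \<open>Isotypic components and the projective representation\<close>

context rep
begin

lemma isotypic_subspace: "subspace (isotypic G s V \<rho> t W \<sigma>)"
  by (simp add: isotypic_def)

lemma isotypic_subset: "isotypic G s V \<rho> t W \<sigma> \<subseteq> V"
  unfolding isotypic_def by (rule span_minimal[OF _ subspace]) (auto simp: intertwiner_def)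

lemma isotypic_mem: "x \<in> isotypic G s V \<rho> t W \<sigma> \<Longrightarrow> x \<in> V"
  using isotypic_subset by blast

lemma intertwiner_inv_into:
  assumes "intertwiner G s V \<rho> s V \<rho> f" "bij_betw f V V"
  shows "intertwiner G s V \<rho> s V \<rho> (inv_into V f)"
proof -
  have *: "inv_into V f x \<in> V" "f (inv_into V f x) = x" if "x \<in> V" for x
    using assms(2) that by (auto simp: bij_betw_def inv_into_into f_inv_into_f)
  have inv: "inv_into V f z = y" if "f y = z" "y \<in> V" for y z
    using assms(2) that by (auto simp: bij_betw_def)
  have "linear_map_on s V s (inv_into V f)"
    using assms subspace vector_space_axioms by (intro linear_map_on_inv_into) (auto simp: intertwiner_def)
  moreover have "inv_into V f (\<rho> g x) = \<rho> g (inv_into V f x)" if "g \<in> carrier G" "x \<in> V" for g x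
    using assms(1) that * by (intro inv) (auto simp: intertwiner_def)
  ultimately show ?thesis
    using * by (auto simp: intertwiner_def)
qed

text \<open>Composing an embedding of \<open>W\<close> with an injective self-intertwiner of
  \<open>V\<close> gives another embedding.\<close>

lemma isotypic_invariant:
  assumes f: "intertwiner G s V \<rho> s V \<rho> f" "inj_on f V"
  shows "f ` isotypic G s V \<rho> t W \<sigma> \<subseteq> isotypic G s V \<rho> t W \<sigma>" (is "_ \<subseteq> ?U")
proof -
  have lin: "linear_map_on s V s f" and fV: "f \<in> V \<rightarrow> V" using f by (auto simp: intertwiner_def)
  have "f 0 = 0" using linear_map_onD(2)[OF lin, of 0 0] subspace_0[OF subspace] by simp
  then have "subspace {x \<in> V. f x \<in> ?U}"
    using subspace isotypic_subspace[of t W \<sigma>]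
    by (auto simp: subspace_def linear_map_onD[OF lin])
  moreover have "\<Union> {j ` W | j. intertwiner G t W \<sigma> s V \<rho> j \<and> inj_on j W} \<subseteq> {x \<in> V. f x \<in> ?U}"
  proof clarify
    fix j y assume j: "intertwiner G t W \<sigma> s V \<rho> j" "inj_on j W" and y: "y \<in> W"
    have jV: "j w \<in> V" if "w \<in> W" for w using j that by (auto simp: intertwiner_def)
    have "intertwiner G t W \<sigma> s V \<rho> (f \<circ> j)"
      using f(1) j(1) jV by (auto simp: intertwiner_def linear_map_on_def)
    moreover have "inj_on (f \<circ> j) W"
      using f(2) j(2) jV by (intro comp_inj_on) (auto intro: inj_on_subset)
    ultimately have "(f \<circ> j) y \<in> ?U"
      using y unfolding isotypic_def by (intro span_base) blast
    then show "j y \<in> V \<and> f (j y) \<in> ?U" using jV y by auto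
  qed
  ultimately have "?U \<subseteq> {x \<in> V. f x \<in> ?U}"
    unfolding isotypic_def by (rule span_minimal[rotated])
  then show ?thesis by blast
qed

lemma isotypic_bij:
  assumes f: "intertwiner G s V \<rho> s V \<rho> f" "bij_betw f V V"
  shows "bij_betw f (isotypic G s V \<rho> t W \<sigma>) (isotypic G s V \<rho> t W \<sigma>)" (is "bij_betw f ?U ?U")
proof -
  have f': "inj_on f V" and fV: "f ` V = V" using f(2) by (auto simp: bij_betw_def)
  have inv: "inv_into V f ` ?U \<subseteq> ?U"
    by (rule isotypic_invariant[OF intertwiner_inv_into[OF f]])
       (simp add: inj_on_inv_into fV)
  have "?U \<subseteq> f ` ?U"
  proof
    fix x assume x: "x \<in> ?U"
    then have "f (inv_into V f x) = x" using isotypic_mem[OF x] fV by (simp add: f_inv_into_f)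
    then show "x \<in> f ` ?U" using inv x by (intro image_eqI[of _ _ "inv_into V f x"]) auto
  qed
  then show ?thesis
    using isotypic_invariant[OF f(1) f', of t W \<sigma>] inj_on_subset[OF f' isotypic_subset]
    by (simp add: bij_betw_def subset_antisym)
qed

text \<open>Schur's lemma on \<open>W\<close> gives the scalar, and every embedding of
  \<open>W\<close> carries the same scalar into \<open>V\<close>.\<close>

lemma central_scalar_on_isotypic:
  assumes W: "simple G t W \<pi>" and G: "countable (carrier G)"
    and \<zeta>: "\<zeta> \<in> carrier G" "\<And>g. g \<in> carrier G \<Longrightarrow> \<zeta> \<otimes> g = g \<otimes> \<zeta>"
  shows "\<exists>c. c \<noteq> 0 \<and> (\<forall>x\<in>isotypic G s V \<rho> t W \<pi>. \<rho> \<zeta> x = s c x)"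
proof -
  interpret W: simple G t W \<pi> by fact
  have "intertwiner G t W \<pi> t W \<pi> (\<pi> \<zeta>)"
    using \<zeta> W.rep_linear[OF \<zeta>(1)] by (auto simp: intertwiner_def W.rep_mult[symmetric])
  then obtain c where c: "\<And>x. x \<in> W \<Longrightarrow> \<pi> \<zeta> x = t c x"
    using W.schur G by blast
  obtain w where w: "w \<in> W" "w \<noteq> 0" using W.nonzero W.subspace_0[OF W.subspace] by auto
  have "c \<noteq> 0"
  proof
    assume "c = 0"
    then have "\<pi> \<zeta> w = 0" using c w by simp
    moreover have "\<pi> \<zeta> 0 = 0" using c[OF W.subspace_0[OF W.subspace]] by simp
    ultimately show False
      using W.rep_bij[OF \<zeta>(1)] w W.subspace_0[OF W.subspace] by (auto simp: bij_betw_def inj_on_def)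
  qed
  moreover have "subspace {x \<in> V. \<rho> \<zeta> x = s c x}"
    using subspace \<zeta>(1) rep_scale[OF \<zeta>(1), of 0 0] subspace_0[OF subspace]
    by (auto simp: subspace_def rep_add rep_scale scale_right_distrib mult.commute)
  moreover have "\<Union> {j ` W | j. intertwiner G t W \<pi> s V \<rho> j \<and> inj_on j W} \<subseteq> {x \<in> V. \<rho> \<zeta> x = s c x}"
  proof clarify
    fix j y assume j: "intertwiner G t W \<pi> s V \<rho> j" and y: "y \<in> W"
    then have "\<rho> \<zeta> (j y) = j (\<pi> \<zeta> y)" using \<zeta> by (auto simp: intertwiner_def)
    also have "\<dots> = s c (j y)" using j y c by (auto simp: intertwiner_def linear_map_on_def)
    finally show "j y \<in> V \<and> \<rho> \<zeta> (j y) = s c (j y)" using j y by (auto simp: intertwiner_def)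
  qed
  ultimately have "isotypic G s V \<rho> t W \<pi> \<subseteq> {x \<in> V. \<rho> \<zeta> x = s c x}"
    unfolding isotypic_def by (intro span_minimal)
  with \<open>c \<noteq> 0\<close> show ?thesis by blast
qed

end

text \<open>Separates the representation theory from the Artin groups. In the application
  \<open>E\<close> is the braid group cover, \<open>K\<close> the finite Artin group inside
  \<open>G\<close> and \<open>p\<close> the projection to the congruence group. The assumption
  \<open>ker\<close> is what the group theory has to supply.\<close>

locale twisted_rep = V: simple G s V \<rho> + E: group E
  for G :: "('g, 'm) monoid_scheme" (structure) and s :: "complex \<Rightarrow> 'v::ab_group_add \<Rightarrow> 'v"
    and V \<rho> and E :: "('e, 'n) monoid_scheme" +
  fixes K :: "'g set" and act :: "'e \<Rightarrow> 'g \<Rightarrow> 'g"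
    and t :: "complex \<Rightarrow> 'w::ab_group_add \<Rightarrow> 'w" and W :: "'w set" and \<pi> :: "'g \<Rightarrow> 'w \<Rightarrow> 'w"
    and Q :: "('q, 'k) monoid_scheme" and p :: "'e \<Rightarrow> 'q"
  assumes countable: "countable (carrier G)"
    and K: "subgroup K G"
    and act: "act \<in> hom E (AutoGroup G)"
    and fixes_K: "\<lbrakk>\<gamma> \<in> carrier E; g \<in> K\<rbrakk> \<Longrightarrow> act \<gamma> g = g"
    and stable: "\<gamma> \<in> carrier E \<Longrightarrow> \<exists>f. twist_iso G (act \<gamma>) s V \<rho> f"
    and W: "simple_rep (G\<lparr>carrier := K\<rparr>) t W \<pi>"
    and Q: "group Q"
    and p: "p \<in> hom E Q" "p ` carrier E = carrier Q"
    and ker: "\<lbrakk>\<gamma> \<in> carrier E; p \<gamma> = \<one>\<^bsub>Q\<^esub>\<rbrakk> \<Longrightarrow>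
      \<exists>\<zeta>\<in>K. (\<forall>g\<in>K. \<zeta> \<otimes> g = g \<otimes> \<zeta>) \<and> (\<forall>g\<in>carrier G. act \<gamma> g = \<zeta> \<otimes> g \<otimes> inv \<zeta>)"
begin

abbreviation "H \<equiv> G\<lparr>carrier := K\<rparr>"

definition "U = isotypic H s V \<rho> t W \<pi>"

sublocale Vh: rep H s V \<rho>
  using V.rep_subgroup[OF K] .

lemma W_simple: "simple H t W \<pi>"
  using W simple_iff[OF Vh.G.group_axioms] by blast

lemma K_carrier: "g \<in> K \<Longrightarrow> g \<in> carrier G"
  using subgroup.subset[OF K] by blast

lemma U_subspace: "V.subspace U" and U_mem: "x \<in> U \<Longrightarrow> x \<in> V"
  using Vh.isotypic_subspace Vh.isotypic_mem by (auto simp: U_def)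

sublocale PGL_U: group "PGL s U"
  using group_PGL[OF V.vector_space_axioms U_subspace] .

sublocale GL_U: group "GL s U"
  using group_GL[OF V.vector_space_axioms U_subspace] .

sublocale scal: normal "scalar_maps s U" "GL s U"
  using normal_scalar_maps[OF V.vector_space_axioms U_subspace] .

lemma act_closed: "\<gamma> \<in> carrier E \<Longrightarrow> g \<in> carrier G \<Longrightarrow> act \<gamma> g \<in> carrier G"
  and act_comp: "\<lbrakk>\<gamma> \<in> carrier E; \<delta> \<in> carrier E; g \<in> carrier G\<rbrakk> \<Longrightarrow> act (\<gamma> \<otimes>\<^bsub>E\<^esub> \<delta>) g = act \<gamma> (act \<delta> g)"
proof -
  have auto: "act \<gamma> \<in> auto G" if "\<gamma> \<in> carrier E" for \<gamma>
    using act that by (auto simp: hom_def AutoGroup_def)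
  then show "\<gamma> \<in> carrier E \<Longrightarrow> g \<in> carrier G \<Longrightarrow> act \<gamma> g \<in> carrier G"
    by (auto simp: auto_def hom_def)
  show "\<lbrakk>\<gamma> \<in> carrier E; \<delta> \<in> carrier E; g \<in> carrier G\<rbrakk> \<Longrightarrow> act (\<gamma> \<otimes>\<^bsub>E\<^esub> \<delta>) g = act \<gamma> (act \<delta> g)"
    using act auto by (auto simp: hom_def AutoGroup_def BijGroup_def auto_def compose_def)
qed

abbreviation "twist \<gamma> f \<equiv> twist_iso G (act \<gamma>) s V \<rho> f"

lemma twistD:
  assumes "twist \<gamma> f"
  shows "bij_betw f V V" "linear_map_on s V s f" "x \<in> V \<Longrightarrow> f x \<in> V"
    "g \<in> carrier G \<Longrightarrow> x \<in> V \<Longrightarrow> f (\<rho> g x) = \<rho> (act \<gamma> g) (f x)"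
  using assms by (auto simp: twist_iso_def intertwiner_def)

lemma twist_U:
  assumes "twist \<gamma> f" "\<gamma> \<in> carrier E"
  shows "bij_betw f U U" "restrict f U \<in> carrier (GL s U)" "x \<in> U \<Longrightarrow> f x \<in> U"
proof -
  have "intertwiner H s V \<rho> s V \<rho> f"
    using twistD[OF assms(1)] fixes_K[OF assms(2)] K_carrier by (auto simp: intertwiner_def)
  then show bij: "bij_betw f U U"
    using Vh.isotypic_bij twistD(1)[OF assms(1)] by (simp add: U_def)
  then have "bij_betw (restrict f U) U U"
    by (rule bij_betw_cong[THEN iffD2, rotated]) simp
  moreover have "linear_map_on s U s (restrict f U)"
    using linear_map_onD[OF twistD(2)[OF assms(1)]] U_subspace U_mem
    by (simp add: linear_map_on_def V.subspace_add V.subspace_scale)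
  ultimately show "restrict f U \<in> carrier (GL s U)" by (simp add: GL_carrier)
  show "f x \<in> U" if "x \<in> U" using bij that by (auto simp: bij_betw_def)
qed

lemma twist_comp:
  assumes "twist \<gamma> f" "twist \<delta> h" "\<gamma> \<in> carrier E" "\<delta> \<in> carrier E"
  shows "twist (\<gamma> \<otimes>\<^bsub>E\<^esub> \<delta>) (f \<circ> h)"
  using twistD[OF assms(1)] twistD[OF assms(2)] assms(3,4) bij_betw_trans[of h V V f V]
  by (auto simp: twist_iso_def intertwiner_def act_comp act_closed linear_map_on_def)

text \<open>Because \<open>\<rho> (\<zeta> g \<zeta>^-1) (\<rho> \<zeta> x) = \<rho> \<zeta> (\<rho>
  g x)\<close>, an inner twist is realised by the group element itself.\<close>

lemma twist_inner:
  assumes "\<zeta> \<in> K" "\<And>g. g \<in> carrier G \<Longrightarrow> act \<gamma> g = \<zeta> \<otimes> g \<otimes> inv \<zeta>"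
  shows "twist \<gamma> (\<rho> \<zeta>)"
  using assms K_carrier[OF assms(1)] V.rep_bij V.rep_linear
  by (auto simp: twist_iso_def intertwiner_def V.rep_mult V.rep_inv)

text \<open>\<open>h^-1 f\<close> intertwines \<open>V\<close> with itself, so Schur's lemma
  applies.\<close>

lemma twist_unique:
  assumes "twist \<gamma> f" "twist \<gamma> h" "\<gamma> \<in> carrier E"
  shows "\<exists>c. c \<noteq> 0 \<and> (\<forall>x\<in>V. f x = s c (h x))"
proof -
  note f = twistD[OF assms(1)] and h = twistD[OF assms(2)]
  define h' where "h' = inv_into V h"
  have h': "h' x \<in> V" "h (h' x) = x" if "x \<in> V" for x
    using h(1) that by (auto simp: h'_def bij_betw_def inv_into_into f_inv_into_f)
  have inv: "h' z = y" if "h y = z" "y \<in> V" for y z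
    using h(1) that by (auto simp: h'_def bij_betw_def)
  have "linear_map_on s V s h'"
    unfolding h'_def using h V.subspace V.vector_space_axioms by (intro linear_map_on_inv_into)
  then have "intertwiner G s V \<rho> s V \<rho> (\<lambda>x. h' (f x))"
    using f linear_map_onD[OF f(2)]
    by (auto simp: intertwiner_def linear_map_on_def h' h'(2) h(4) intro!: inv)
  then obtain c where c: "\<And>x. x \<in> V \<Longrightarrow> h' (f x) = s c x"
    using V.schur countable by blast
  have fc: "f x = s c (h x)" if "x \<in> V" for x
    using c[OF that] h'(2)[OF f(3)[OF that]] linear_map_onD(2)[OF h(2) that] by metis
  obtain v where v: "v \<in> V" "v \<noteq> 0" using V.nonzero V.subspace_0[OF V.subspace] by auto
  have "c \<noteq> 0"
  proof
    assume "c = 0"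
    then have "f v = f 0" using fc[OF v(1)] fc[OF V.subspace_0[OF V.subspace]] by simp
    then show False using f(1) v V.subspace_0[OF V.subspace] by (auto simp: bij_betw_def inj_on_def)
  qed
  then show ?thesis using fc by blast
qed

lemma inner_scalar:
  assumes "\<gamma> \<in> carrier E" "\<zeta> \<in> K" "\<And>g. g \<in> K \<Longrightarrow> \<zeta> \<otimes> g = g \<otimes> \<zeta>"
    "\<And>g. g \<in> carrier G \<Longrightarrow> act \<gamma> g = \<zeta> \<otimes> g \<otimes> inv \<zeta>" "twist \<gamma> f"
  shows "\<exists>c. c \<noteq> 0 \<and> (\<forall>x\<in>U. f x = s c x)"
proof -
  obtain c where c: "c \<noteq> 0" "\<And>x. x \<in> U \<Longrightarrow> \<rho> \<zeta> x = s c x"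
    using Vh.central_scalar_on_isotypic[OF W_simple, of \<zeta>] assms(2,3) countable_subset[OF subgroup.subset[OF K] countable]
    by (auto simp: U_def)
  obtain d where d: "d \<noteq> 0" "\<And>x. x \<in> V \<Longrightarrow> f x = s d (\<rho> \<zeta> x)"
    using twist_unique[OF assms(5) twist_inner[OF assms(2,4)] assms(1)] by blast
  show ?thesis
    using c d U_mem by (intro exI[of _ "d * c"]) auto
qed

text \<open>The quotient \<open>\<epsilon>\<close> of \<open>\<gamma>\<close> and
  \<open>\<delta>\<close> lies in the kernel of \<open>p\<close>, so its isomorphism
  \<open>e\<close> is a scalar on \<open>U\<close>. The composite of \<open>e\<close> and
  \<open>h\<close> is a second isomorphism for \<open>\<gamma>\<close>, to be compared with
  \<open>f\<close>.\<close>

lemma twist_scalar: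
  assumes "twist \<gamma> f" "twist \<delta> h" "\<gamma> \<in> carrier E" "\<delta> \<in> carrier E" "p \<gamma> = p \<delta>"
  shows "\<exists>c. c \<noteq> 0 \<and> (\<forall>x\<in>U. f x = s c (h x))"
proof -
  interpret p: group_hom E Q p
    using p Q E.group_axioms by (simp add: group_hom_def group_hom_axioms_def)
  define \<epsilon> where "\<epsilon> = \<gamma> \<otimes>\<^bsub>E\<^esub> inv\<^bsub>E\<^esub> \<delta>"
  have \<epsilon>: "\<epsilon> \<in> carrier E" "p \<epsilon> = \<one>\<^bsub>Q\<^esub>" "\<epsilon> \<otimes>\<^bsub>E\<^esub> \<delta> = \<gamma>"
    using assms by (auto simp: \<epsilon>_def E.m_assoc)
  obtain e where e: "twist \<epsilon> e" using stable \<epsilon> by blast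
  obtain \<zeta> where "\<zeta> \<in> K" "\<forall>g\<in>K. \<zeta> \<otimes> g = g \<otimes> \<zeta>" "\<forall>g\<in>carrier G. act \<epsilon> g = \<zeta> \<otimes> g \<otimes> inv \<zeta>"
    using ker[OF \<epsilon>(1,2)] by blast
  then obtain c where c: "c \<noteq> 0" "\<And>x. x \<in> U \<Longrightarrow> e x = s c x"
    using inner_scalar[OF \<epsilon>(1) _ _ _ e] by blast
  obtain d where d: "d \<noteq> 0" "\<And>x. x \<in> V \<Longrightarrow> f x = s d (e (h x))"
    using twist_unique[OF assms(1) _ assms(3), of "e \<circ> h"] twist_comp[OF e assms(2) \<epsilon>(1) assms(4)] \<epsilon>(3) by auto
  show ?thesis
    using c d U_mem twist_U(3)[OF assms(2,4)] by (intro exI[of _ "d * c"]) auto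
qed

definition "cls f = scalar_maps s U #>\<^bsub>GL s U\<^esub> restrict f U"

lemma cls_eqI:
  assumes "restrict f U \<in> carrier (GL s U)" "restrict h U \<in> carrier (GL s U)" "c \<noteq> 0" "\<And>x. x \<in> U \<Longrightarrow> f x = s c (h x)"
  shows "cls f = cls h"
proof -
  have hU: "h x \<in> U" if "x \<in> U" for x
    using assms(2) that bij_betwE[of "restrict h U" U U] by (auto simp: GL_carrier)
  have "restrict f U = restrict (s c) U \<otimes>\<^bsub>GL s U\<^esub> restrict h U"
    using assms scalar_maps_GL[OF V.vector_space_axioms U_subspace, of c] hU
    by (auto simp: GL_mult compose_def intro!: restrict_ext)
  then have "restrict f U \<in> scalar_maps s U #>\<^bsub>GL s U\<^esub> restrict h U"
    using assms(3) by (auto simp: r_coset_def scalar_maps_def)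
  then show ?thesis
    unfolding cls_def using GL_U.repr_independence[OF _ assms(2) scal.subgroup_axioms] by simp
qed

lemma cls_mult:
  assumes "restrict f U \<in> carrier (GL s U)" "restrict h U \<in> carrier (GL s U)"
  shows "cls f \<otimes>\<^bsub>PGL s U\<^esub> cls h = cls (f \<circ> h)"
proof -
  have "h x \<in> U" if "x \<in> U" for x
    using assms(2) that bij_betwE[of "restrict h U" U U] by (auto simp: GL_carrier)
  then have "restrict (f \<circ> h) U = restrict f U \<otimes>\<^bsub>GL s U\<^esub> restrict h U"
    using assms by (auto simp: GL_mult compose_def intro!: restrict_ext)
  then show ?thesis
    using scal.rcos_sum[OF assms] by (simp add: cls_def PGL_def FactGroup_def)
qed

lemma cls_carrier: "restrict f U \<in> carrier (GL s U) \<Longrightarrow> cls f \<in> carrier (PGL s U)"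
  by (auto simp: cls_def PGL_def FactGroup_def RCOSETS_def)

text \<open>Lifts \<open>\<Gamma>\<close> and isomorphisms \<open>F\<close> are chosen arbitrarily.
  By \<open>twist_scalar\<close> the class does not depend on either choice, and this independence
  is also what makes \<open>P\<close> multiplicative.\<close>

theorem projective_representation:
  "\<exists>P\<in>hom Q (PGL s U). \<forall>\<gamma>\<in>carrier E. \<forall>f. twist \<gamma> f \<longrightarrow> P (p \<gamma>) = cls f"
proof -
  define \<Gamma> where "\<Gamma> M = (SOME \<gamma>. \<gamma> \<in> carrier E \<and> p \<gamma> = M)" for M
  define F where "F \<gamma> = (SOME f. twist \<gamma> f)" for \<gamma>
  define P where "P M = cls (F (\<Gamma> M))" for M
  have \<Gamma>: "\<Gamma> M \<in> carrier E" "p (\<Gamma> M) = M" if "M \<in> carrier Q" for M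
    using someI_ex[of "\<lambda>\<gamma>. \<gamma> \<in> carrier E \<and> p \<gamma> = M"] that unfolding p(2)[symmetric] \<Gamma>_def by blast+
  have F: "twist \<gamma> (F \<gamma>)" if "\<gamma> \<in> carrier E" for \<gamma>
    unfolding F_def using someI_ex[OF stable[OF that]] .
  have P: "P (p \<gamma>) = cls f" if \<gamma>: "\<gamma> \<in> carrier E" and f: "twist \<gamma> f" for \<gamma> f
  proof -
    have M: "p \<gamma> \<in> carrier Q" using \<gamma> p by blast
    obtain c where "c \<noteq> 0" "\<forall>x\<in>U. F (\<Gamma> (p \<gamma>)) x = s c (f x)"
      using twist_scalar[OF F[OF \<Gamma>(1)[OF M]] f \<Gamma>(1)[OF M] \<gamma> \<Gamma>(2)[OF M]] by blast
    then show ?thesis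
      unfolding P_def using twist_U(2)[OF F[OF \<Gamma>(1)[OF M]] \<Gamma>(1)[OF M]] twist_U(2)[OF f \<gamma>]
      by (intro cls_eqI) auto
  qed
  have "P \<in> hom Q (PGL s U)"
  proof (rule homI)
    fix M assume "M \<in> carrier Q"
    then show "P M \<in> carrier (PGL s U)"
      using twist_U(2)[OF F \<Gamma>(1)] \<Gamma>(1) by (auto simp: P_def intro!: cls_carrier)
  next
    fix M N assume M: "M \<in> carrier Q" and N: "N \<in> carrier Q"
    have "p (\<Gamma> M \<otimes>\<^bsub>E\<^esub> \<Gamma> N) = M \<otimes>\<^bsub>Q\<^esub> N"
      using p(1) \<Gamma>[OF M] \<Gamma>[OF N] by (simp add: hom_mult)
    moreover have "twist (\<Gamma> M \<otimes>\<^bsub>E\<^esub> \<Gamma> N) (F (\<Gamma> M) \<circ> F (\<Gamma> N))"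
      using F \<Gamma>(1)[OF M] \<Gamma>(1)[OF N] by (intro twist_comp)
    ultimately have "P (M \<otimes>\<^bsub>Q\<^esub> N) = cls (F (\<Gamma> M) \<circ> F (\<Gamma> N))"
      using P \<Gamma>(1)[OF M] \<Gamma>(1)[OF N] by (metis E.m_closed)
    then show "P (M \<otimes>\<^bsub>Q\<^esub> N) = P M \<otimes>\<^bsub>PGL s U\<^esub> P N"
      using twist_U(2)[OF F \<Gamma>(1)] \<Gamma>(1) M N by (simp add: P_def cls_mult)
  qed
  with P show ?thesis by blast
qed

lemma cls_inner:
  assumes "\<gamma> \<in> carrier E" "\<zeta> \<in> K" "\<And>g. g \<in> K \<Longrightarrow> \<zeta> \<otimes> g = g \<otimes> \<zeta>"
    "\<And>g. g \<in> carrier G \<Longrightarrow> act \<gamma> g = \<zeta> \<otimes> g \<otimes> inv \<zeta>" "twist \<gamma> f"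
  shows "cls f = \<one>\<^bsub>PGL s U\<^esub>"
proof -
  obtain c where c: "c \<noteq> 0" "\<forall>x\<in>U. f x = s c x" using inner_scalar[OF assms] by blast
  then have "restrict f U \<in> scalar_maps s U"
    by (auto simp: scalar_maps_def intro!: exI[of _ c] restrict_ext)
  then show ?thesis
    using GL_U.coset_join2[OF twist_U(2)[OF assms(5,1)] scal.subgroup_axioms]
    by (simp add: cls_def PGL_def FactGroup_def)
qed

end

text \<open>Carries the structure along an injection. It serves to realise an abstract simple
  representation on sequences, where \<open>admissible\<close> can be applied.\<close>

lemma (in simple) transport:
  fixes t :: "complex \<Rightarrow> 'w::ab_group_add \<Rightarrow> 'w"
  assumes t: "vector_space t" and lin: "linear_map_on s V t \<psi>" and inj: "inj_on \<psi> V"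
  shows "\<exists>\<sigma>. simple G t (\<psi> ` V) \<sigma> \<and> (\<forall>g\<in>carrier G. \<forall>x\<in>V. \<sigma> g (\<psi> x) = \<psi> (\<rho> g x))"
proof -
  interpret T: vector_space t by fact
  define \<sigma> where "\<sigma> g = (\<lambda>y\<in>\<psi> ` V. \<psi> (\<rho> g (inv_into V \<psi> y)))" for g
  have \<sigma>: "\<sigma> g (\<psi> x) = \<psi> (\<rho> g x)" if "x \<in> V" for g x
    using that inj by (simp add: \<sigma>_def)
  have "\<psi> 0 = 0" using linear_map_onD(2)[OF lin, of 0 0] subspace_0[OF subspace] by simp
  then have "0 \<in> \<psi> ` V" using subspace_0[OF subspace] by (metis image_eqI)
  moreover have "\<psi> x + \<psi> y \<in> \<psi> ` V" if "x \<in> V" "y \<in> V" for x y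
    using that linear_map_onD(1)[OF lin, of x y] subspace_add[OF subspace, of x y] by (metis image_eqI)
  moreover have "t c (\<psi> x) \<in> \<psi> ` V" if "x \<in> V" for x c
    using that linear_map_onD(2)[OF lin, of x c] subspace_scale[OF subspace, of x c] by (metis image_eqI)
  ultimately have sub: "T.subspace (\<psi> ` V)"
    by (auto simp: T.subspace_def)
  have GL: "\<sigma> g \<in> carrier (GL t (\<psi> ` V))" if g: "g \<in> carrier G" for g
  proof -
    have "bij_betw (\<sigma> g) (\<psi> ` V) (\<psi> ` V)"
      using g rep_inv[OF G.inv_closed] rep_inv[OF g] inj
      by (intro bij_betw_byWitness[where f' = "\<sigma> (inv g)"]) (auto simp: \<sigma>)
    moreover have "linear_map_on t (\<psi> ` V) t (\<sigma> g)"
      unfolding linear_map_on_def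
    proof (intro conjI ballI allI)
      fix x y assume "x \<in> \<psi> ` V" "y \<in> \<psi> ` V"
      then obtain x' y' where xy: "x = \<psi> x'" "y = \<psi> y'" "x' \<in> V" "y' \<in> V" by blast
      then have "x + y = \<psi> (x' + y')" using linear_map_onD(1)[OF lin] by simp
      then show "\<sigma> g (x + y) = \<sigma> g x + \<sigma> g y"
        using xy g \<sigma>[of "x' + y'"] subspace_add[OF subspace]
        by (simp add: \<sigma> rep_add linear_map_onD[OF lin])
    next
      fix c x assume "x \<in> \<psi> ` V"
      then obtain x' where x: "x = \<psi> x'" "x' \<in> V" by blast
      then have "t c x = \<psi> (s c x')" using linear_map_onD(2)[OF lin] by simp
      then show "\<sigma> g (t c x) = t c (\<sigma> g x)"
        using x g \<sigma>[of "s c x'"] subspace_scale[OF subspace]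
        by (simp add: \<sigma> rep_scale linear_map_onD[OF lin])
    qed
    ultimately show ?thesis by (simp add: GL_carrier \<sigma>_def)
  qed
  have "\<sigma> \<in> hom G (GL t (\<psi> ` V))"
  proof (rule homI)
    fix g h assume gh: "g \<in> carrier G" "h \<in> carrier G"
    have "\<sigma> (g \<otimes> h) = compose (\<psi> ` V) (\<sigma> g) (\<sigma> h)"
    proof (rule extensionalityI[of _ "\<psi> ` V"])
      fix y assume "y \<in> \<psi> ` V"
      then show "\<sigma> (g \<otimes> h) y = compose (\<psi> ` V) (\<sigma> g) (\<sigma> h) y"
        using gh by (auto simp: \<sigma> rep_mult compose_def)
    qed (auto simp: \<sigma>_def)
    then show "\<sigma> (g \<otimes> h) = \<sigma> g \<otimes>\<^bsub>GL t (\<psi> ` V)\<^esub> \<sigma> h" using GL gh by (simp add: GL_mult)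
  qed (rule GL)
  then interpret T: rep G t "\<psi> ` V" \<sigma>
    using sub by unfold_locales
  have "simple G t (\<psi> ` V) \<sigma>"
  proof
    obtain v where "v \<in> V" "v \<noteq> 0" using nonzero subspace_0[OF subspace] by auto
    then have "\<psi> v \<in> \<psi> ` V" "\<psi> v \<noteq> 0"
      using inj_on_eq_iff[OF inj, of v 0] \<open>\<psi> 0 = 0\<close> subspace_0[OF subspace] by auto
    then show "\<psi> ` V \<noteq> {0}" by blast
  next
    fix U assume U: "T.subspace U" "U \<subseteq> \<psi> ` V" "\<And>g. g \<in> carrier G \<Longrightarrow> \<sigma> g ` U \<subseteq> U"
    define U' where "U' = {x \<in> V. \<psi> x \<in> U}"
    have "U' = {0} \<or> U' = V"
    proof (rule minimal)
      show "subspace U'"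
        using subspace U(1) \<open>\<psi> 0 = 0\<close>
        by (auto simp: U'_def subspace_def T.subspace_def linear_map_onD[OF lin])
      show "U' \<subseteq> V" by (auto simp: U'_def)
      show "\<rho> g ` U' \<subseteq> U'" if "g \<in> carrier G" for g
        using U(3)[OF that] that by (auto simp: U'_def \<sigma>[symmetric])
    qed
    moreover have "U = \<psi> ` U'" using U(2) by (auto simp: U'_def)
    ultimately show "U = {0} \<or> U = \<psi> ` V" using \<open>\<psi> 0 = 0\<close> by auto
  qed
  with \<sigma> show ?thesis by blast
qed

lemma isotypic_transport:
  assumes "linear_map_on t W u \<psi>" "inj_on \<psi> W" "rep G t W \<pi>"
    and \<sigma>: "\<And>g x. g \<in> carrier G \<Longrightarrow> x \<in> W \<Longrightarrow> \<sigma> g (\<psi> x) = \<psi> (\<pi> g x)"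
  shows "isotypic G s V \<rho> u (\<psi> ` W) \<sigma> = isotypic G s V \<rho> t W \<pi>"
proof -
  interpret W: rep G t W \<pi> by fact
  have "{j ` \<psi> ` W | j. intertwiner G u (\<psi> ` W) \<sigma> s V \<rho> j \<and> inj_on j (\<psi> ` W)} =
      {j ` W | j. intertwiner G t W \<pi> s V \<rho> j \<and> inj_on j W}" (is "?A = ?B")
  proof (rule Set.set_eqI)
    fix Y
    have B: "Y \<in> ?B" if "intertwiner G u (\<psi> ` W) \<sigma> s V \<rho> j" "inj_on j (\<psi> ` W)" "Y = j ` \<psi> ` W" for j
    proof -
      have "intertwiner G t W \<pi> s V \<rho> (j \<circ> \<psi>)"
        using that(1) linear_map_onD[OF assms(1)]
        by (auto simp: intertwiner_def linear_map_on_def \<sigma>[symmetric])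
      moreover have "inj_on (j \<circ> \<psi>) W" using that(2) assms(2) by (simp add: comp_inj_on)
      moreover have "Y = (j \<circ> \<psi>) ` W" using that(3) by (simp add: image_comp)
      ultimately show ?thesis by blast
    qed
    have A: "Y \<in> ?A" if j: "intertwiner G t W \<pi> s V \<rho> j" "inj_on j W" "Y = j ` W" for j
    proof -
      define k where "k = j \<circ> inv_into W \<psi>"
      have k: "k (\<psi> x) = j x" if "x \<in> W" for x using assms(2) that by (simp add: k_def)
      have jlin: "linear_map_on t W s j" using j(1) by (simp add: intertwiner_def)
      have k_add: "k (\<psi> x + \<psi> y) = k (\<psi> x) + k (\<psi> y)" if "x \<in> W" "y \<in> W" for x y
        using that k[of "x + y"] W.subspace_add[OF W.subspace] linear_map_onD[OF assms(1)] linear_map_onD[OF jlin]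
        by (simp add: k)
      have k_scale: "k (u c (\<psi> x)) = s c (k (\<psi> x))" if "x \<in> W" for c x
        using that k[of "t c x"] W.subspace_scale[OF W.subspace] linear_map_onD[OF assms(1)] linear_map_onD[OF jlin]
        by (simp add: k)
      have "intertwiner G u (\<psi> ` W) \<sigma> s V \<rho> k"
        using j(1) k_add k_scale by (auto simp: intertwiner_def linear_map_on_def k \<sigma>)
      moreover have "inj_on k (\<psi> ` W)"
        using j(2) assms(2) by (auto simp: inj_on_def k)
      moreover have "Y = k ` \<psi> ` W" using j(3) by (auto simp: k image_image)
      ultimately show ?thesis by blast
    qed
    show "Y \<in> ?A \<longleftrightarrow> Y \<in> ?B"
      unfolding mem_Collect_eq using A[unfolded mem_Collect_eq] B[unfolded mem_Collect_eq] by metis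
  qed
  then show ?thesis by (simp add: isotypic_def)
qed

lemma vector_space_seq_scale: "vector_space seq_scale"
  by unfold_locales (auto simp: seq_scale_def fun_eq_iff algebra_simps)

lemma (in vector_space) ex_finite_basis:
  assumes "finite S" "subspace U" "U \<subseteq> span S"
  shows "\<exists>B. finite B \<and> independent B \<and> span B = U"
proof -
  obtain B where B: "B \<subseteq> U" "independent B" "U \<subseteq> span B" using maximal_independent_subset by blast
  then have "finite B" using independent_span_bound[OF assms(1), of B] assms(3) by blast
  moreover have "span B = U" using B assms(2) by (simp add: span_minimal subset_antisym)
  ultimately show ?thesis using B by blast
qed

text \<open>Coordinates with respect to a finite basis, continued by zeros.\<close>

lemma seq_coordinates:
  assumes "vector_space s" "finite S" "module.subspace s U" "U \<subseteq> module.span s S"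
  shows "\<exists>\<phi>. linear_map_on s U seq_scale \<phi> \<and> inj_on \<phi> U \<and> fin_dim seq_scale (\<phi> ` U)"
proof -
  interpret vector_space s by fact
  interpret seq: vector_space seq_scale by (rule vector_space_seq_scale)
  obtain B where B: "finite B" "independent B" "span B = U"
    using ex_finite_basis[OF assms(2-4)] by blast
  obtain b where b: "bij_betw b {..<card B} B"
    using B(1) ex_bij_betw_nat_finite[of B] by (auto simp: lessThan_atLeast0)
  define n where "n = card B"
  define \<phi> where "\<phi> x = (\<lambda>i. if i < n then representation B x (b i) else 0)" for x
  have lin: "linear_map_on s U seq_scale \<phi>"
    using B by (auto simp: linear_map_on_def \<phi>_def seq_scale_def representation_add representation_scale fun_eq_iff)
  define e where "e i = (\<lambda>k. if k = i then 1 else 0 :: complex)" for i :: nat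
  define E where "E = e ` {..<n}"
  have sub: "\<phi> x \<in> seq.span E" for x
  proof -
    have sum_apply: "(\<Sum>i\<in>I. g i) k = (\<Sum>i\<in>I. g i k)" for I :: "nat set" and g :: "nat \<Rightarrow> nat \<Rightarrow> complex" and k
      by (induction I rule: infinite_finite_induct) auto
    have "\<phi> x = (\<Sum>i<n. seq_scale (\<phi> x i) (e i))"
    proof
      fix k
      have "(\<Sum>i<n. seq_scale (\<phi> x i) (e i)) k = (\<Sum>i<n. if i = k then \<phi> x i else 0)"
        unfolding sum_apply by (intro sum.cong) (auto simp: seq_scale_def e_def)
      then show "\<phi> x k = (\<Sum>i<n. seq_scale (\<phi> x i) (e i)) k" by (simp add: \<phi>_def)
    qed
    also have "\<dots> \<in> seq.span E"
      by (intro seq.span_sum seq.span_scale seq.span_base) (auto simp: E_def)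
    finally show ?thesis .
  qed
  have inj: "inj_on \<phi> U"
  proof (rule inj_onI)
    fix x y assume xy: "x \<in> U" "y \<in> U" "\<phi> x = \<phi> y"
    have "representation B x a = representation B y a" if "a \<in> B" for a
    proof -
      obtain i where "i < n" "a = b i" using b \<open>a \<in> B\<close> by (auto simp: n_def bij_betw_def)
      then show ?thesis using fun_cong[OF xy(3), of i] by (simp add: \<phi>_def)
    qed
    then have "(\<Sum>a\<in>B. s (representation B x a) a) = (\<Sum>a\<in>B. s (representation B y a) a)"
      by simp
    then show "x = y" using xy B by (simp add: sum_representation_eq)
  qed
  have "linear_map_on s U seq_scale \<phi> \<Longrightarrow> seq.subspace (\<phi> ` U)"
  proof -
    have "\<phi> 0 = 0" using linear_map_onD(2)[OF lin, of 0 0] assms(3) by (simp add: subspace_0)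
    then have "0 \<in> \<phi> ` U" using subspace_0[OF assms(3)] by (metis image_eqI)
    moreover have "\<phi> x + \<phi> y \<in> \<phi> ` U" if "x \<in> U" "y \<in> U" for x y
      using that linear_map_onD(1)[OF lin, of x y] subspace_add[OF assms(3), of x y] by (metis image_eqI)
    moreover have "seq_scale c (\<phi> x) \<in> \<phi> ` U" if "x \<in> U" for x c
      using that linear_map_onD(2)[OF lin, of x c] subspace_scale[OF assms(3), of x c] by (metis image_eqI)
    ultimately show ?thesis by (auto simp: seq.subspace_def)
  qed
  then obtain C where "finite C" "seq.span C = \<phi> ` U"
    using seq.ex_finite_basis[of E "\<phi> ` U"] sub lin by (auto simp: E_def)
  then show ?thesis using lin inj by (auto simp: fin_dim_def)
qed

text \<open>Admissibility tests only finite dimensional representations on sequences, while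
  \<open>W\<close> is arbitrary. If \<open>W\<close> does not embed into \<open>V\<close>, its
  component is zero. If it does, the span of the orbit of one image vector is finite dimensional by
  local finiteness and contains the whole image of \<open>W\<close>, so \<open>W\<close> can be
  moved to sequences.\<close>

lemma admissible_fin_dim_isotypic:
  assumes G: "group G" and V: "rep G s V \<rho>" and W: "simple G t W \<pi>" and adm: "admissible G s V \<rho>"
  shows "fin_dim s (isotypic G s V \<rho> t W \<pi>)"
proof (cases "\<exists>j. intertwiner G t W \<pi> s V \<rho> j \<and> inj_on j W")
  case False
  interpret rep G s V \<rho> by fact
  have "{j ` W | j. intertwiner G t W \<pi> s V \<rho> j \<and> inj_on j W} = {}" using False by blast
  then have "isotypic G s V \<rho> t W \<pi> = span {}" unfolding isotypic_def by (metis Union_empty)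
  then show ?thesis unfolding fin_dim_def by blast
next
  case True
  interpret rep G s V \<rho> by fact
  interpret W: simple G t W \<pi> by fact
  obtain j where j: "intertwiner G t W \<pi> s V \<rho> j" "inj_on j W" using True by blast
  have lin: "linear_map_on t W s j" and jV: "x \<in> W \<Longrightarrow> j x \<in> V" for x
    using j by (auto simp: intertwiner_def)
  obtain w where w: "w \<in> W" "w \<noteq> 0" using W.nonzero W.subspace_0[OF W.subspace] by auto
  define K where "K = (\<lambda>g. \<rho> g (j w)) ` carrier G"
  obtain S where S: "finite S" "span S = span K"
    using adm jV[OF w(1)] by (auto simp: admissible_def locally_finite_def fin_dim_def K_def)
  have "W.subspace (W \<inter> j -` span K)"
    using W.subspace linear_map_onD[OF lin] linear_map_onD(2)[OF lin, of 0 0]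
    by (auto simp: W.subspace_def span_add span_scale span_zero)
  moreover have "\<pi> g ` (W \<inter> j -` span K) \<subseteq> W \<inter> j -` span K" if g: "g \<in> carrier G" for g
  proof -
    have "subspace {x \<in> V. \<rho> g x \<in> span K}"
      using subspace rep_add[OF g] rep_scale[OF g] rep_scale[OF g, of 0 0] subspace_0[OF subspace]
      by (auto simp: subspace_def span_add span_scale span_zero)
    moreover have "K \<subseteq> {x \<in> V. \<rho> g x \<in> span K}"
      using jV[OF w(1)] g by (auto simp: K_def rep_mult[symmetric] intro!: span_base)
    ultimately have "\<rho> g x \<in> span K" if "x \<in> span K" for x using that span_minimal by blast
    then show ?thesis using j(1) g by (auto simp: intertwiner_def)
  qed
  moreover have "w \<in> W \<inter> j -` span K"
    using w rep_one[OF jV[OF w(1)]] by (auto simp: K_def intro!: span_base image_eqI[of _ _ "\<one>\<^bsub>G\<^esub>"])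
  ultimately have "W \<inter> j -` span K = W"
    using W.minimal[of "W \<inter> j -` span K"] w by blast
  then have sub: "j ` W \<subseteq> span S" using S by auto
  note im = W.intertwiner_image[OF j(1) rep_axioms]
  obtain \<phi> where \<phi>: "linear_map_on s (j ` W) seq_scale \<phi>" "inj_on \<phi> (j ` W)" "fin_dim seq_scale (\<phi> ` j ` W)"
    using seq_coordinates[OF vector_space_axioms S(1) im(1) sub] by blast
  define \<psi> where "\<psi> = \<phi> \<circ> j"
  have \<psi>: "linear_map_on t W seq_scale \<psi>" "inj_on \<psi> W"
    using \<phi> j(2) linear_map_onD[OF lin] by (auto simp: \<psi>_def linear_map_on_def comp_inj_on)
  obtain \<sigma> where \<sigma>: "simple G seq_scale (\<psi> ` W) \<sigma>" "\<And>g x. g \<in> carrier G \<Longrightarrow> x \<in> W \<Longrightarrow> \<sigma> g (\<psi> x) = \<psi> (\<pi> g x)"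
    using W.transport[OF vector_space_seq_scale \<psi>] by blast
  have "fin_dim s (isotypic G s V \<rho> seq_scale (\<psi> ` W) \<sigma>)"
    using adm \<sigma>(1) \<phi>(3) simple_iff[OF G, of seq_scale "\<psi> ` W" \<sigma>]
    by (simp add: admissible_def \<psi>_def image_comp)
  then show ?thesis
    using isotypic_transport[OF \<psi> W.rep_axioms \<sigma>(2), where s = s and V = V and \<rho> = \<rho>] by simp
qed

section \<open>The modular group and the braid group on three strands\<close>

definition M2 :: "int \<Rightarrow> int \<Rightarrow> int \<Rightarrow> int \<Rightarrow> int^2^2" where
  "M2 a b c d = vector [vector [a, b], vector [c, d]]"

lemma M2_nth [simp]: "M2 a b c d $ 1 $ 1 = a" "M2 a b c d $ 1 $ 2 = b" "M2 a b c d $ 2 $ 1 = c" "M2 a b c d $ 2 $ 2 = d"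
  by (simp_all add: M2_def)

lemma M2_eta: "M = M2 (M $ 1 $ 1) (M $ 1 $ 2) (M $ 2 $ 1) (M $ 2 $ 2)"
  by (simp add: vec_eq_iff forall_2)

lemma M2_eq [simp]: "M2 a b c d = M2 a' b' c' d' \<longleftrightarrow> a = a' \<and> b = b' \<and> c = c' \<and> d = d'"
  by (metis M2_nth)

lemma M2_mult [simp]:
  "M2 a b c d ** M2 a' b' c' d' = M2 (a * a' + b * c') (a * b' + b * d') (c * a' + d * c') (c * b' + d * d')"
  by (simp add: vec_eq_iff forall_2 matrix_matrix_mult_def sum_2)

lemma M2_det [simp]: "det (M2 a b c d) = a * d - b * c"
  by (simp add: det_2)

lemma M2_one: "mat 1 = M2 1 0 0 1" and M2_minus [simp]: "- M2 a b c d = M2 (- a) (- b) (- c) (- d)"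
  by (simp_all add: vec_eq_iff forall_2 mat_def)

lemma SL2Z_simps [simp]:
  "M \<in> carrier SL2Z \<longleftrightarrow> det M = 1" "M \<otimes>\<^bsub>SL2Z\<^esub> N = M ** N" "\<one>\<^bsub>SL2Z\<^esub> = M2 1 0 0 1"
  by (simp_all add: SL2Z_def M2_one)

lemma SL2Z_group: "group SL2Z"
proof (rule groupI)
  fix M assume "M \<in> carrier SL2Z"
  moreover obtain a b c d where "M = M2 a b c d" using M2_eta by blast
  ultimately show "\<exists>N\<in>carrier SL2Z. N \<otimes>\<^bsub>SL2Z\<^esub> M = \<one>\<^bsub>SL2Z\<^esub>"
    by (intro bexI[of _ "M2 d (- b) (- c) a"]) (auto simp: algebra_simps)
qed (auto simp: det_mul matrix_mul_assoc M2_one[symmetric])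

interpretation SL2Z: group SL2Z by (rule SL2Z_group)

lemma SL2Z_inv [simp]: "a * d - b * c = 1 \<Longrightarrow> inv\<^bsub>SL2Z\<^esub> M2 a b c d = M2 d (- b) (- c) a"
  by (rule SL2Z.inv_equality) (auto simp: algebra_simps)

lemma u_matrix_simps [simp]: "u_matrix (Suc 0) = M2 1 (- 1) 0 1" "u_matrix 2 = M2 1 0 1 1"
  by (simp_all add: u_matrix_def M2_def)

interpretation B3: group Braid3
  unfolding Braid3_def by (rule group_pres_group)

lemma u_gen_closed [simp]: "u_gen (Suc 0) \<in> carrier Braid3" "u_gen 2 \<in> carrier Braid3"
  by (auto simp: Braid3_def u_gen_def pres_carrier)

lemma braid_relation:
  "u_gen 1 \<otimes>\<^bsub>Braid3\<^esub> u_gen 2 \<otimes>\<^bsub>Braid3\<^esub> u_gen 1 = u_gen 2 \<otimes>\<^bsub>Braid3\<^esub> u_gen 1 \<otimes>\<^bsub>Braid3\<^esub> u_gen 2"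
proof -
  have "pres_eq {1, 2} braid3_relations [(1, True), (2, True), (1, True)] [(2, True), (1, True), (2, True)]"
    by (rule pres_eq.rel) (auto simp: braid3_relations_def numeral_3_eq_3)
  then show ?thesis
    by (simp add: Braid3_def u_gen_def pres_mult pres_class_eq_iff)
qed

text \<open>\<open>braid_proj\<close> picks the unique element of the image of a class; uniqueness
  holds because the two matrices satisfy the braid relation.\<close>

lemma braid_proj_class:
  assumes "u \<in> gwords {1, 2}"
  shows "braid_proj (pres_class {1, 2} braid3_relations u) = eval_word SL2Z u_matrix u"
proof -
  have "eval_word SL2Z u_matrix v = eval_word SL2Z u_matrix u" if "pres_eq {1, 2} braid3_relations u v" for v
    by (rule SL2Z.eval_word_pres_eq[symmetric, OF _ _ that]) (auto simp: braid3_relations_def numeral_3_eq_3)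
  then have "eval_word SL2Z u_matrix ` pres_class {1, 2} braid3_relations u = {eval_word SL2Z u_matrix u}"
    using assms by (auto simp: pres_class_def intro: pres_eq.refl)
  then show ?thesis by (simp add: braid_proj_def)
qed

lemmas braid_proj_class' = braid_proj_class[unfolded One_nat_def]

lemma u_matrix_closed: "u_matrix \<in> {1, 2} \<rightarrow> carrier SL2Z"
  by auto

lemma braid_proj_hom: "braid_proj \<in> hom Braid3 SL2Z"
proof (rule homI)
  fix a assume "a \<in> carrier Braid3"
  then show "braid_proj a \<in> carrier SL2Z"
    using SL2Z.eval_word_closed[OF u_matrix_closed] by (auto simp: Braid3_def pres_carrier braid_proj_class')
next
  fix a b assume "a \<in> carrier Braid3" "b \<in> carrier Braid3"
  then show "braid_proj (a \<otimes>\<^bsub>Braid3\<^esub> b) = braid_proj a \<otimes>\<^bsub>SL2Z\<^esub> braid_proj b"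
    using SL2Z.eval_word_append[OF u_matrix_closed] by (auto simp: Braid3_def pres_carrier braid_proj_class' pres_mult)
qed

interpretation proj: group_hom Braid3 SL2Z braid_proj
  by (simp add: group_hom_def group_hom_axioms_def braid_proj_hom SL2Z_group B3.group_axioms)

lemma braid_proj_gens [simp]: "braid_proj (u_gen (Suc 0)) = M2 1 (- 1) 0 1" "braid_proj (u_gen 2) = M2 1 0 1 1"
  unfolding u_gen_def by (subst braid_proj_class; simp)+

locale braid_pair = group G for G (structure) +
  fixes x y
  assumes xy [simp]: "x \<in> carrier G" "y \<in> carrier G" and braid: "x \<otimes> y \<otimes> x = y \<otimes> x \<otimes> y"
begin

text \<open>Modulo \<plusminus>1, the images of \<open>s\<close> and \<open>t\<close> are the
  generators of orders 2 and 3 of the modular group as a free product. The element \<open>c\<close>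
  is both \<open>t^3\<close> and \<open>s^2\<close>.\<close>

definition "s = x \<otimes> y \<otimes> x"
definition "t = x \<otimes> y"
definition "c = t \<otimes> t \<otimes> t"

lemma closed [simp]: "s \<in> carrier G" "t \<in> carrier G" "c \<in> carrier G"
  by (simp_all add: s_def t_def c_def)

lemma braid': "z \<in> carrier G \<Longrightarrow> y \<otimes> (x \<otimes> (y \<otimes> z)) = x \<otimes> (y \<otimes> (x \<otimes> z))"
  using braid by (simp add: m_assoc[symmetric])

lemma braid'': "y \<otimes> (x \<otimes> y) = x \<otimes> (y \<otimes> x)"
  using braid by (simp add: m_assoc)

lemma sy: "s \<otimes> y = t \<otimes> t" and tx: "t \<otimes> x = s" and sx: "s \<otimes> x = y \<otimes> s" and sy': "s \<otimes> y = x \<otimes> s"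
  by (simp_all add: s_def t_def m_assoc braid' braid'')

lemma c_eq: "s \<otimes> s = c"
proof -
  have "c = (s \<otimes> y) \<otimes> t" unfolding c_def sy ..
  also have "\<dots> = s \<otimes> (y \<otimes> x \<otimes> y)" by (simp add: t_def m_assoc)
  finally show ?thesis by (simp only: braid[symmetric] s_def)
qed

lemma c_comm: "c \<otimes> x = x \<otimes> c" "c \<otimes> y = y \<otimes> c" "c \<otimes> s = s \<otimes> c" "c \<otimes> t = t \<otimes> c"
proof -
  show "c \<otimes> x = x \<otimes> c" "c \<otimes> y = y \<otimes> c"
    by (metis c_eq sx sy' m_assoc closed(1) xy)+
  show "c \<otimes> s = s \<otimes> c" by (simp add: c_eq[symmetric] m_assoc)
  show "c \<otimes> t = t \<otimes> c" by (simp add: c_def m_assoc)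
qed

text \<open>The images of \<open>x\<^sup>-\<^sup>1\<close> and \<open>y\<close> in the modular group generate a monoid of nonnegative matrices.\<close>

definition mon :: "bool list \<Rightarrow> 'a" where
  "mon m = foldr (\<lambda>e z. (if e then inv x else y) \<otimes> z) m \<one>"

lemma mon_simps [simp]: "mon [] = \<one>" "mon (e # m) = (if e then inv x else y) \<otimes> mon m"
  by (simp_all add: mon_def)

lemma mon_closed [simp]: "mon m \<in> carrier G"
  by (induction m) auto

text \<open>Since \<open>inv x = s^-1 t\<close> and \<open>y = s^-1 t^2\<close>, these are the
  normal forms in the free product of cyclic groups of orders 2 and 3, multiplied by a power of the
  central \<open>c\<close>.\<close>

inductive_set normal_forms :: "'a set" where
  "i < 3 \<Longrightarrow> d < 2 \<Longrightarrow> c [^] (k :: int) \<otimes> (t [^] (i :: nat) \<otimes> (mon m \<otimes> s [^] (d :: nat))) \<in> normal_forms"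

lemma c_pow_comm:
  assumes z: "z \<in> carrier G" and comm: "c \<otimes> z = z \<otimes> c"
  shows "z \<otimes> c [^] (k :: int) = c [^] k \<otimes> z"
proof -
  have nat: "c [^] n \<otimes> z = z \<otimes> c [^] n" for n :: nat
    by (rule group_commutes_pow[OF comm closed(3) z])
  have "z \<otimes> inv w = inv w \<otimes> z" if w: "w \<in> carrier G" "w \<otimes> z = z \<otimes> w" for w
  proof -
    have "z = inv w \<otimes> z \<otimes> w" using w z by (simp add: m_assoc w(2)[symmetric]) (simp add: m_assoc[symmetric])
    then show ?thesis using w(1) z by (metis inv_solve_right m_closed inv_closed)
  qed
  then show ?thesis
    using nat by (cases k rule: int_cases2) (auto simp: int_pow_int int_pow_neg_int z)
qed

lemma st: "s \<otimes> t = c \<otimes> inv x" and stt: "s \<otimes> (t \<otimes> t) = c \<otimes> y" and sxi: "s \<otimes> inv x = t"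
proof -
  show "s \<otimes> inv x = t" using tx by (metis closed(2) inv_solve_right xy(1) closed(1))
  have "s \<otimes> t \<otimes> x = c" by (simp add: m_assoc tx c_eq)
  then show "s \<otimes> t = c \<otimes> inv x" by (metis inv_solve_right closed xy(1) m_closed)
  show "s \<otimes> (t \<otimes> t) = c \<otimes> y" by (simp add: sy[symmetric] c_eq m_assoc[symmetric])
qed

lemma normal_forms_c: "g \<in> normal_forms \<Longrightarrow> c [^] (j :: int) \<otimes> g \<in> normal_forms"
proof (erule normal_forms.cases)
  fix i d :: nat and k m assume "i < 3" "d < 2" "g = c [^] (k :: int) \<otimes> (t [^] i \<otimes> (mon m \<otimes> s [^] d))"
  then show ?thesis
    using normal_forms.intros[of i d "j + k" m] by (simp add: int_pow_mult m_assoc)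
qed

lemma normal_forms_t: "g \<in> normal_forms \<Longrightarrow> t \<otimes> g \<in> normal_forms"
proof (erule normal_forms.cases)
  fix i d :: nat and k m assume *: "i < 3" "d < 2" "g = c [^] (k :: int) \<otimes> (t [^] i \<otimes> (mon m \<otimes> s [^] d))"
  have "t \<otimes> g = c [^] k \<otimes> (t \<otimes> (t [^] i \<otimes> (mon m \<otimes> s [^] d)))"
    using c_pow_comm[of t k] c_comm by (simp add: * m_assoc[symmetric])
  also have "\<dots> = c [^] k \<otimes> (t [^] Suc i \<otimes> (mon m \<otimes> s [^] d))"
    by (subst nat_pow_Suc2) (auto simp: m_assoc)
  also have "\<dots> \<in> normal_forms"
  proof (cases "Suc i < 3")
    case True
    then show ?thesis using *(2) by (rule normal_forms.intros)
  next
    case False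
    then have "t [^] Suc i = c [^] (1 :: int)" using *(1) by (cases "i = 2") (auto simp: c_def eval_nat_numeral m_assoc)
    then have "c [^] k \<otimes> (t [^] Suc i \<otimes> (mon m \<otimes> s [^] d)) =
        c [^] k \<otimes> (c [^] (1::int) \<otimes> (c [^] (0::int) \<otimes> (t [^] (0::nat) \<otimes> (mon m \<otimes> s [^] d))))"
      by simp
    then show ?thesis
      by (simp only:) (intro normal_forms_c normal_forms.intros *(2), simp)
  qed
  finally show ?thesis .
qed

text \<open>If a power of \<open>t\<close> stands in front, \<open>s\<close> merges with it into a
  new syllable \<open>inv x\<close> or \<open>y\<close>, up to \<open>c\<close>. Otherwise
  \<open>s\<close> turns the first syllable into \<open>t\<close> or \<open>t^2\<close>, or meets
  the final power of \<open>s\<close>.\<close>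

lemma normal_forms_s: "g \<in> normal_forms \<Longrightarrow> s \<otimes> g \<in> normal_forms"
proof (erule normal_forms.cases)
  fix i d :: nat and k m assume *: "i < 3" "d < 2" "g = c [^] (k :: int) \<otimes> (t [^] i \<otimes> (mon m \<otimes> s [^] d))"
  define r where "r = mon m \<otimes> s [^] d"
  have r [simp]: "r \<in> carrier G" by (simp add: r_def)
  have intro: "t [^] i \<otimes> (mon m \<otimes> s [^] d) \<in> normal_forms" if "i < 3" "d < 2" for i d :: nat and m
    using normal_forms.intros[OF that, of 0 m] by simp
  have intro1: "mon m \<otimes> s [^] d \<in> normal_forms" if "d < 2" for d :: nat and m
    using intro[of 0 d m] that by simp
  have intro_c: "c \<otimes> z \<in> normal_forms" if "z \<in> normal_forms" for z
    using normal_forms_c[OF that, of 1] by simp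
  have "s \<otimes> g = c [^] k \<otimes> (s \<otimes> (t [^] i \<otimes> r))"
    using c_pow_comm[of s k] c_comm by (simp add: * r_def m_assoc[symmetric])
  moreover have "s \<otimes> (t [^] i \<otimes> r) \<in> normal_forms"
  proof -
    consider "i = 1" | "i = 2" | "i = 0" "m = []" | m' where "i = 0" "m = True # m'" | m' where "i = 0" "m = False # m'"
    proof -
      have "i = 0 \<or> i = 1 \<or> i = 2" using *(1) by linarith
      moreover have "m = [] \<or> (\<exists>m'. m = True # m') \<or> (\<exists>m'. m = False # m')"
        by (metis (full_types) list.exhaust)
      ultimately show thesis using that by blast
    qed
    then show ?thesis
    proof cases
      \<comment> \<open>The syllable produced from \<open>t\<close> is \<open>inv x\<close>; in the
        next case \<open>t^2\<close> produces \<open>y\<close>.\<close>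
      case 1
      have "s \<otimes> (t \<otimes> r) = c \<otimes> (inv x \<otimes> r)"
        using st by (simp add: m_assoc[symmetric])
      also have "\<dots> = c \<otimes> (mon (True # m) \<otimes> s [^] d)" by (simp add: r_def m_assoc)
      finally show ?thesis using 1 intro_c[OF intro1[OF *(2)], of "True # m"] by (simp del: mon_simps)
    next
      case 2
      have "s \<otimes> (t [^] i \<otimes> r) = c \<otimes> (y \<otimes> r)"
        using stt by (simp add: 2 m_assoc[symmetric] eval_nat_numeral)
      also have "\<dots> = c \<otimes> (mon (False # m) \<otimes> s [^] d)" by (simp add: r_def m_assoc)
      finally show ?thesis using intro_c[OF intro1[OF *(2)], of "False # m"] by (simp del: mon_simps)
    next
      case 3
      consider "d = 0" | "d = 1" using *(2) by linarith
      then show ?thesis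
      proof cases
        case 1
        then show ?thesis using 3 intro1[of 1 "[]"] by (simp add: r_def)
      next
        case 2
        then show ?thesis using 3 intro_c[OF intro1[of 0 "[]"]] by (simp add: r_def c_eq)
      qed
    next
      case 4
      have "s \<otimes> r = t [^] (1::nat) \<otimes> (mon m' \<otimes> s [^] d)"
        using sxi by (simp add: r_def 4 m_assoc[symmetric])
      then show ?thesis using 4 intro[OF _ *(2), of 1 m'] by simp
    next
      case 5
      have "s \<otimes> r = t [^] (2::nat) \<otimes> (mon m' \<otimes> s [^] d)"
        using sy by (simp add: r_def 5 m_assoc[symmetric] eval_nat_numeral)
      then show ?thesis using 5 intro[OF _ *(2), of 2 m'] by simp
    qed
  qed
  ultimately show ?thesis using normal_forms_c by simp
qed

lemma letters:
  "x = c [^] (- 1 :: int) \<otimes> (t \<otimes> (t \<otimes> s))" "inv x = c [^] (- 1 :: int) \<otimes> (s \<otimes> t)"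
  "y = c [^] (- 1 :: int) \<otimes> (s \<otimes> (t \<otimes> t))" "inv y = c [^] (- 1 :: int) \<otimes> (t \<otimes> s)"
proof -
  have *: "z = c [^] (- 1 :: int) \<otimes> w" if "c \<otimes> z = w" "z \<in> carrier G" for z w
    using that by (auto simp: int_pow_neg m_assoc[symmetric])
  show "x = c [^] (- 1 :: int) \<otimes> (t \<otimes> (t \<otimes> s))"
    by (rule *) (simp_all add: c_def m_assoc tx)
  show "inv x = c [^] (- 1 :: int) \<otimes> (s \<otimes> t)"
    by (rule *) (simp_all add: st)
  show "y = c [^] (- 1 :: int) \<otimes> (s \<otimes> (t \<otimes> t))"
    by (rule *) (simp_all add: stt)
  have "t \<otimes> s \<otimes> y = c" by (simp add: m_assoc sy c_def)
  then have "c \<otimes> inv y = t \<otimes> s" by (metis inv_solve_right closed xy(2) m_closed)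
  then show "inv y = c [^] (- 1 :: int) \<otimes> (t \<otimes> s)" by (rule *) simp
qed

lemma normal_forms_letters:
  assumes "g \<in> normal_forms"
  shows "x \<otimes> g \<in> normal_forms" "inv x \<otimes> g \<in> normal_forms" "y \<otimes> g \<in> normal_forms" "inv y \<otimes> g \<in> normal_forms"
proof -
  have g: "g \<in> carrier G" using assms by (auto elim!: normal_forms.cases)
  note * = normal_forms_c normal_forms_s normal_forms_t assms
  show "x \<otimes> g \<in> normal_forms" by (subst letters(1)) (use g in \<open>simp add: m_assoc *\<close>)
  show "inv x \<otimes> g \<in> normal_forms" by (subst letters(2)) (use g in \<open>simp add: m_assoc *\<close>)
  show "y \<otimes> g \<in> normal_forms" by (subst letters(3)) (use g in \<open>simp add: m_assoc *\<close>)
  show "inv y \<otimes> g \<in> normal_forms" by (subst letters(4)) (use g in \<open>simp add: m_assoc *\<close>)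
qed

text \<open>This identity and the next one write \<open>c\<close> and \<open>c^2\<close> in terms of
  \<open>x\<close> and \<open>y^2\<close> or \<open>y^3\<close>, so that they lie in the covers of
  levels 2 and 3.\<close>

lemma c_eq_2: "(x \<otimes> (y \<otimes> y)) \<otimes> (x \<otimes> (y \<otimes> y)) = c"
proof -
  have "y \<otimes> (x \<otimes> (y \<otimes> y)) = x \<otimes> s" by (simp add: s_def m_assoc braid' braid'')
  then have "(x \<otimes> (y \<otimes> y)) \<otimes> (x \<otimes> (y \<otimes> y)) = x \<otimes> y \<otimes> (x \<otimes> s)" by (simp add: m_assoc)
  then show ?thesis by (simp add: c_eq[symmetric] s_def m_assoc)
qed

lemma cc_eq_3:
  "(x \<otimes> (y \<otimes> (y \<otimes> y))) \<otimes> (x \<otimes> (y \<otimes> (y \<otimes> y))) \<otimes> (x \<otimes> (y \<otimes> (y \<otimes> y))) = c \<otimes> c"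
proof -
  define d where "d = x \<otimes> (y \<otimes> y)"
  have d [simp]: "d \<in> carrier G" by (simp add: d_def)
  have yd: "y \<otimes> d = x \<otimes> s" by (simp add: d_def s_def m_assoc braid' braid'')
  have dd: "d \<otimes> d = c" using c_eq_2 by (simp add: d_def)
  have "(x \<otimes> (y \<otimes> (y \<otimes> y))) = d \<otimes> y" by (simp add: d_def m_assoc)
  then have "(x \<otimes> (y \<otimes> (y \<otimes> y))) \<otimes> (x \<otimes> (y \<otimes> (y \<otimes> y))) \<otimes> (x \<otimes> (y \<otimes> (y \<otimes> y))) =
      d \<otimes> (y \<otimes> d) \<otimes> (y \<otimes> d) \<otimes> y" by (simp add: m_assoc)
  also have "\<dots> = d \<otimes> (x \<otimes> s) \<otimes> (x \<otimes> s) \<otimes> y" by (simp only: yd)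
  also have "\<dots> = c \<otimes> c"
  proof -
    have "d \<otimes> (x \<otimes> s) \<otimes> (x \<otimes> s) \<otimes> y = d \<otimes> x \<otimes> (s \<otimes> x) \<otimes> s \<otimes> y" by (simp add: m_assoc)
    also have "\<dots> = d \<otimes> x \<otimes> y \<otimes> (s \<otimes> s) \<otimes> y" by (simp add: sx m_assoc)
    also have "\<dots> = d \<otimes> x \<otimes> y \<otimes> (c \<otimes> y)" by (simp add: c_eq m_assoc)
    also have "\<dots> = d \<otimes> d \<otimes> c" by (simp add: c_comm(2) d_def m_assoc)
    finally show ?thesis by (simp add: dd)
  qed
  finally show ?thesis .
qed

end

interpretation bp: braid_pair Braid3 "u_gen (Suc 0)" "u_gen 2"
  using braid_relation by unfold_locales auto

lemma braid_proj_cst: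
  "braid_proj bp.t = M2 0 (- 1) 1 1" "braid_proj bp.s = M2 0 (- 1) 1 0"
  "braid_proj bp.c = M2 (- 1) 0 0 (- 1)"
  by (simp_all add: bp.s_def bp.t_def bp.c_def)

text \<open>Each syllable adds one row to the other. As the diagonal entries stay at least 1, this
  makes an off-diagonal entry at least 1.\<close>

lemma braid_proj_mon:
  "\<exists>a b c d. braid_proj (bp.mon m) = M2 a b c d \<and> a \<ge> 1 \<and> b \<ge> 0 \<and> c \<ge> 0 \<and> d \<ge> 1 \<and> (m \<noteq> [] \<longrightarrow> b + c \<ge> 1)"
proof (induction m)
  case (Cons e m)
  then obtain a b c d where "braid_proj (bp.mon m) = M2 a b c d" "a \<ge> 1" "b \<ge> 0" "c \<ge> 0" "d \<ge> 1" by blast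
  then show ?case by (cases e) auto
qed simp

lemma braid_proj_c_pow:
  "braid_proj (bp.c [^]\<^bsub>Braid3\<^esub> (k :: int)) = (if even k then M2 1 0 0 1 else M2 (- 1) 0 0 (- 1))"
proof -
  have nat: "braid_proj (bp.c [^]\<^bsub>Braid3\<^esub> n) = (if even n then M2 1 0 0 1 else M2 (- 1) 0 0 (- 1))" for n :: nat
    by (induction n) (auto simp: braid_proj_cst)
  show ?thesis
    using nat by (cases k rule: int_cases2) (auto simp: int_pow_int B3.int_pow_neg_int)
qed

lemma Braid3_normal_forms:
  assumes "g \<in> carrier Braid3"
  shows "g \<in> bp.normal_forms"
proof -
  have gen: "u_gen = (\<lambda>i. pres_class {1, 2} braid3_relations [(i, True)])"
    by (simp add: u_gen_def fun_eq_iff)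
  obtain u where u: "u \<in> gwords {1, 2}" "g = pres_class {1, 2} braid3_relations u"
    using assms by (auto simp: Braid3_def pres_carrier)
  have "eval_word Braid3 u_gen u \<in> bp.normal_forms"
    using u(1)
  proof (induction u)
    case Nil
    show ?case using bp.normal_forms.intros[of 0 0 0 "[]"] by simp
  next
    case (Cons a u)
    obtain i e where a: "a = (i, e)" by (cases a)
    with Cons have "i = Suc 0 \<or> i = 2" "eval_word Braid3 u_gen u \<in> bp.normal_forms" by auto
    then show ?case using bp.normal_forms_letters by (auto simp: a)
  qed
  then show ?thesis using u eval_word_pres_group[OF u(1)] by (simp add: gen Braid3_def)
qed

text \<open>The sign pattern of \<open>braid_proj_mon\<close> excludes every normal form except a
  pure power of \<open>c\<close>, and the exponent is even because \<open>c\<close> maps to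
  -1.\<close>

theorem braid_proj_kernel:
  assumes "g \<in> carrier Braid3" "braid_proj g = \<one>\<^bsub>SL2Z\<^esub>"
  shows "\<exists>j::int. g = (bp.c \<otimes>\<^bsub>Braid3\<^esub> bp.c) [^]\<^bsub>Braid3\<^esub> j"
proof -
  from Braid3_normal_forms[OF assms(1)] show ?thesis
  proof cases
    case (1 i d k m)
    obtain a b c d' where M: "braid_proj (bp.mon m) = M2 a b c d'" "a \<ge> 1" "b \<ge> 0" "c \<ge> 0" "d' \<ge> 1" "m \<noteq> [] \<longrightarrow> b + c \<ge> 1"
      using braid_proj_mon by blast
    have i: "i = 0 \<or> i = 1 \<or> i = Suc 1" and d: "d = 0 \<or> d = 1" using 1 by linarith+
    have eq: "braid_proj (bp.c [^]\<^bsub>Braid3\<^esub> k) ** (braid_proj (bp.t [^]\<^bsub>Braid3\<^esub> i) ** (M2 a b c d' ** braid_proj (bp.s [^]\<^bsub>Braid3\<^esub> d))) = M2 1 0 0 1"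
      using assms(2) unfolding 1 by (simp add: M)
    have "m = [] \<and> i = 0 \<and> d = 0 \<and> even k"
      using i d eq M(2-6) by (auto simp: braid_proj_c_pow braid_proj_cst split: if_splits)
    moreover from this obtain j where "k = 2 * j" by blast
    ultimately have "g = bp.c [^]\<^bsub>Braid3\<^esub> (2 * j)" unfolding 1 by simp
    then have "g = (bp.c [^]\<^bsub>Braid3\<^esub> (2 :: int)) [^]\<^bsub>Braid3\<^esub> j" by (simp add: B3.int_pow_pow)
    moreover have "bp.c [^]\<^bsub>Braid3\<^esub> (2 :: int) = bp.c \<otimes>\<^bsub>Braid3\<^esub> bp.c"
      using B3.int_pow_mult[of bp.c 1 1] by simp
    ultimately show ?thesis by metis
  qed
qed

section \<open>The congruence groups as images of their covers\<close>

lemma Gamma1_mem: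
  "M2 a b c d \<in> carrier (Gamma1 r) \<longleftrightarrow>
    a * d - b * c = 1 \<and> [a = 1] (mod int r) \<and> [c = 0] (mod int r) \<and> [d = 1] (mod int r)"
  by (auto simp: Gamma1_def)

lemma Gamma1_subgroup: "subgroup (carrier (Gamma1 r)) SL2Z"
proof (rule SL2Z.subgroupI)
  show "carrier (Gamma1 r) \<noteq> {}" using Gamma1_mem[of 1 0 0 1 r] by auto
  fix M assume M: "M \<in> carrier (Gamma1 r)"
  obtain a b c d where abcd: "M = M2 a b c d" using M2_eta by blast
  show "inv\<^bsub>SL2Z\<^esub> M \<in> carrier (Gamma1 r)"
    using M cong_minus_minus_iff[of c 0 "int r"] by (simp add: abcd Gamma1_mem mult.commute)
  fix N assume N: "N \<in> carrier (Gamma1 r)"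
  obtain a' b' c' d' where abcd': "N = M2 a' b' c' d'" using M2_eta by blast
  have "[a * a' + b * c' = 1 * 1 + b * 0] (mod int r)" "[c * a' + d * c' = 0 * 1 + d * 0] (mod int r)"
    "[c * b' + d * d' = 0 * b' + 1 * 1] (mod int r)"
    by (intro cong_add cong_mult cong_refl; use M N in \<open>auto simp: abcd abcd' Gamma1_mem\<close>)+
  moreover have "det (M ** N) = 1"
    using M N by (simp add: abcd abcd' Gamma1_mem det_mul del: M2_mult)
  ultimately show "M \<otimes>\<^bsub>SL2Z\<^esub> N \<in> carrier (Gamma1 r)"
    by (simp add: abcd abcd' Gamma1_mem)
qed (auto simp: Gamma1_def)

lemma braid_proj_pow: "braid_proj (u_gen 2 [^]\<^bsub>Braid3\<^esub> (n :: nat)) = M2 1 0 (int n) 1"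
  by (induction n) auto

lemma Gamma1_tilde_subgroup: "subgroup (carrier (Gamma1_tilde r)) Braid3"
  unfolding Gamma1_tilde_def by (simp add: B3.generate_is_subgroup)

lemma group_Gamma1_tilde: "group (Gamma1_tilde r)"
proof -
  have "Gamma1_tilde r = Braid3\<lparr>carrier := carrier (Gamma1_tilde r)\<rparr>" by (simp add: Gamma1_tilde_def)
  then show ?thesis
    using subgroup.subgroup_is_group[OF Gamma1_tilde_subgroup B3.group_axioms] by metis
qed

lemma Gamma1_tilde_gens: "u_gen (Suc 0) \<in> carrier (Gamma1_tilde r)" "u_gen 2 [^]\<^bsub>Braid3\<^esub> r \<in> carrier (Gamma1_tilde r)"
  by (auto simp: Gamma1_tilde_def intro: generate.incl)

lemma c_in_Gamma1_tilde:
  assumes "r = 1 \<or> r = 2"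
  shows "bp.c \<in> carrier (Gamma1_tilde r)"
proof -
  note closed = subgroup.m_closed[OF Gamma1_tilde_subgroup, of _ r]
  note gens = Gamma1_tilde_gens[of r]
  show ?thesis
  proof (cases "r = 1")
    case True
    then have "u_gen 2 \<in> carrier (Gamma1_tilde r)" using gens by simp
    then show ?thesis unfolding bp.c_def bp.t_def using gens by (intro closed)
  next
    case False
    then have "Suc (Suc 0) = r" using assms by simp
    moreover have "u_gen 2 [^]\<^bsub>Braid3\<^esub> Suc (Suc 0) = u_gen 2 \<otimes>\<^bsub>Braid3\<^esub> u_gen 2" by simp
    ultimately have "u_gen 2 \<otimes>\<^bsub>Braid3\<^esub> u_gen 2 \<in> carrier (Gamma1_tilde r)"
      using gens(2) by metis
    then show ?thesis using gens unfolding bp.c_eq_2[symmetric] by (simp add: closed)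
  qed
qed

lemma cc_in_Gamma1_tilde:
  assumes "r = 1 \<or> r = 2 \<or> r = 3"
  shows "bp.c \<otimes>\<^bsub>Braid3\<^esub> bp.c \<in> carrier (Gamma1_tilde r)"
proof (cases "r = 3")
  case True
  note closed = subgroup.m_closed[OF Gamma1_tilde_subgroup, of _ r]
  note gens = Gamma1_tilde_gens[of r]
  have "u_gen 2 [^]\<^bsub>Braid3\<^esub> Suc (Suc (Suc 0)) = u_gen 2 \<otimes>\<^bsub>Braid3\<^esub> (u_gen 2 \<otimes>\<^bsub>Braid3\<^esub> u_gen 2)"
    by (simp add: B3.m_assoc)
  moreover have "Suc (Suc (Suc 0)) = r" using True by simp
  ultimately have "u_gen 2 \<otimes>\<^bsub>Braid3\<^esub> (u_gen 2 \<otimes>\<^bsub>Braid3\<^esub> u_gen 2) \<in> carrier (Gamma1_tilde r)"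
    using gens(2) by metis
  then show ?thesis using gens unfolding bp.cc_eq_3[symmetric] by (simp add: closed)
next
  case False
  then show ?thesis using assms c_in_Gamma1_tilde subgroup.m_closed[OF Gamma1_tilde_subgroup] by blast
qed

text \<open>Euclid's algorithm on the first column \<open>(a, c)\<close>, with the steps
  \<open>a \<plusminus> c\<close> and \<open>c \<plusminus> r a\<close>. For nonzero entries one of
  them always shrinks the column: the first if \<open>2 |a| > |c|\<close>, and otherwise the second,
  because then \<open>r |a| < 2 |c|\<close> thanks to \<open>r \<le> 3\<close>.\<close>

theorem braid_proj_image:
  assumes r: "r = 1 \<or> r = 2 \<or> r = 3"
  shows "braid_proj ` carrier (Gamma1_tilde r) = carrier (Gamma1 r)"
proof
  let ?H = "braid_proj ` carrier (Gamma1_tilde r)"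
  have H: "subgroup ?H SL2Z"
    using proj.subgroup_img_is_subgroup[OF Gamma1_tilde_subgroup] .
  have "carrier (Gamma1_tilde r) \<subseteq> {g \<in> carrier Braid3. braid_proj g \<in> carrier (Gamma1 r)}"
  proof
    fix g assume "g \<in> carrier (Gamma1_tilde r)"
    then have "g \<in> generate Braid3 {u_gen 1, u_gen 2 [^]\<^bsub>Braid3\<^esub> r}" by (simp add: Gamma1_tilde_def)
    then show "g \<in> {g \<in> carrier Braid3. braid_proj g \<in> carrier (Gamma1 r)}"
    proof (induction rule: generate.induct)
      case one
      then show ?case using subgroup.one_closed[OF Gamma1_subgroup] by simp
    next
      case (incl h)
      then show ?case by (auto simp: Gamma1_mem braid_proj_pow cong_0_iff)
    next
      case (inv h)
      then have "h \<in> carrier Braid3" "braid_proj h \<in> carrier (Gamma1 r)"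
        by (auto simp: Gamma1_mem braid_proj_pow cong_0_iff)
      then show ?case using subgroup.m_inv_closed[OF Gamma1_subgroup] by auto
    next
      case (eng h k)
      then show ?case using subgroup.m_closed[OF Gamma1_subgroup] by auto
    qed
  qed
  then show "?H \<subseteq> carrier (Gamma1 r)" by blast
  have A: "M2 1 (- 1) 0 1 \<in> ?H" using Gamma1_tilde_gens(1)[of r] by (metis braid_proj_gens(1) image_eqI)
  have B: "M2 1 0 (int r) 1 \<in> ?H" using Gamma1_tilde_gens(2)[of r] by (metis braid_proj_pow image_eqI)
  have A': "M2 1 1 0 1 \<in> ?H" using subgroup.m_inv_closed[OF H A] by simp
  have B': "M2 1 0 (- int r) 1 \<in> ?H" using subgroup.m_inv_closed[OF H B] by simp
  have mult: "M ** N \<in> ?H" if "M \<in> ?H" "N \<in> ?H" for M N using subgroup.m_closed[OF H that] by simp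
  have unip: "M2 1 b 0 1 \<in> ?H" for b
  proof (induction b rule: int_induct[of _ 0])
    case base
    show ?case using subgroup.one_closed[OF H] by simp
  next
    case (step1 b)
    then show ?case using mult[OF A' step1(2)] by (simp add: add.commute)
  next
    case (step2 b)
    then show ?case using mult[OF A step2(2)] by simp
  qed
  \<comment> \<open>The diagonal is (1, 1) or (-1, -1). The second is excluded mod 3, and in levels
    1 and 2 the matrix -1 is the image of \<open>c\<close>.\<close>
  have c0: "M2 a b 0 d \<in> ?H" if "M2 a b 0 d \<in> carrier (Gamma1 r)" for a b d
  proof -
    have "a * d = 1" using that by (simp add: Gamma1_mem)
    then have "a = 1 \<and> d = 1 \<or> a = - 1 \<and> d = - 1" by (rule zmult_eq_1_iff[THEN iffD1])
    then show ?thesis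
    proof
      assume "a = 1 \<and> d = 1" then show ?thesis using unip by simp
    next
      assume ad: "a = - 1 \<and> d = - 1"
      then have "r \<noteq> 3" using that by (auto simp: Gamma1_mem cong_def)
      then have "M2 (- 1) 0 0 (- 1) \<in> ?H"
        using c_in_Gamma1_tilde[of r] r braid_proj_cst(3) by (metis image_eqI)
      from mult[OF this unip[of "- b"]] show ?thesis using ad by simp
    qed
  qed
  have "M2 a b c d \<in> ?H" if "M2 a b c d \<in> carrier (Gamma1 r)" for a b c d
    using that
  proof (induction "nat (\<bar>a\<bar> + \<bar>c\<bar>)" arbitrary: a b c d rule: less_induct)
    case less
    have step: "M2 a b c d \<in> ?H" if "g \<in> ?H" "g ** M2 a b c d \<in> ?H" for g
    proof -
      have "g \<in> carrier SL2Z" "M2 a b c d \<in> carrier SL2Z"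
        using that(1) subgroup.subset[OF H] less.prems by (auto simp: Gamma1_mem)
      then have "inv\<^bsub>SL2Z\<^esub> g \<otimes>\<^bsub>SL2Z\<^esub> (g \<otimes>\<^bsub>SL2Z\<^esub> M2 a b c d) = M2 a b c d"
        by (metis SL2Z.inv_closed SL2Z.l_inv SL2Z.l_one SL2Z.m_assoc)
      then show ?thesis
        using subgroup.m_closed[OF H subgroup.m_inv_closed[OF H that(1)] that(2)] by simp
    qed
    have \<Gamma>: "g ** M2 a b c d \<in> carrier (Gamma1 r)" if "g \<in> ?H" for g
      using subgroup.m_closed[OF Gamma1_subgroup, of g r "M2 a b c d"] less.prems that
        \<open>?H \<subseteq> carrier (Gamma1 r)\<close> by auto
    have smaller: "M2 a b c d \<in> ?H" if "g \<in> ?H" "g ** M2 a b c d = M2 a' b' c' d'" "\<bar>a'\<bar> + \<bar>c'\<bar> < \<bar>a\<bar> + \<bar>c\<bar>" for g a' b' c' d'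
      using step[OF that(1)] less.hyps[of a' c' b' d'] \<Gamma>[OF that(1)] that(2,3) by auto
    consider "c = 0" | "c \<noteq> 0" "a = 0" | "a \<noteq> 0" "2 * \<bar>a\<bar> > \<bar>c\<bar>" "c \<noteq> 0" | "a \<noteq> 0" "2 * \<bar>a\<bar> \<le> \<bar>c\<bar>"
      by linarith
    then show ?case
    proof cases
      case 1
      then show ?thesis using c0 less.prems by simp
    next
      case 2
      have bc: "b * (- c) = 1" using less.prems 2 by (simp add: Gamma1_mem)
      then have c: "c = 1 \<or> c = - 1" using zmult_eq_1_iff[of b "- c"] by auto
      \<comment> \<open>The entry \<open>a = 0\<close> is congruent to 1 only in level 1, where the
        product of the two generators clears \<open>c\<close>.\<close>
      then have r1: "r = 1" using less.prems r by (auto simp: Gamma1_mem cong_def)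
      then have "M2 1 0 (int r) 1 ** (M2 1 (- 1) 0 1 ** M2 a b c d) \<in> ?H"
        using c0 \<Gamma>[OF mult[OF B A]] 2 by (simp add: algebra_simps)
      then show ?thesis using step[OF mult[OF B A]] by (simp add: matrix_mul_assoc del: M2_mult)
    next
      case 3
      show ?thesis
      proof (cases "a * c > 0")
        case True
        then have "\<bar>a - c\<bar> < \<bar>a\<bar>" using 3 by (auto simp: zero_less_mult_iff)
        then show ?thesis by (intro smaller[OF A]) auto
      next
        case False
        then have "a > 0 \<and> c < 0 \<or> a < 0 \<and> c > 0" using 3 by (auto simp: zero_less_mult_iff not_less)
        then have "\<bar>a + c\<bar> < \<bar>a\<bar>" using 3 by auto
        then show ?thesis by (intro smaller[OF A']) auto
      qed
    next
      case 4
      show ?thesis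
      proof (cases "a * c > 0")
        case True
        then have "\<bar>c - int r * a\<bar> < \<bar>c\<bar>" using 4 r by (auto simp: zero_less_mult_iff)
        then show ?thesis by (intro smaller[OF B']) auto
      next
        case False
        then have "a > 0 \<and> c < 0 \<or> a < 0 \<and> c > 0" using 4 by (auto simp: zero_less_mult_iff not_less)
        then have "\<bar>c + int r * a\<bar> < \<bar>c\<bar>" using 4 r by auto
        then show ?thesis by (intro smaller[OF B]) (auto simp: add.commute)
      qed
    qed
  qed
  then show "carrier (Gamma1 r) \<subseteq> ?H" using M2_eta by (metis subsetI)
qed

section \<open>Root systems and Weyl groups\<close>

text \<open>The integrality of Cartan integers in \<open>sq_length_dvd\<close> and their list in
  \<open>cartan_cases\<close> rest on this.\<close>

lemma sq_length_cases:
  "(\<forall>i. sq_length X i = 2 \<or> sq_length X i = 4) \<or> (\<forall>i. sq_length X i = 2 \<or> sq_length X i = 6)"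
  by (cases X) auto

lemma sq_length_bounds: "sq_length X i \<ge> 2" "sq_length X i \<le> 6"
  using sq_length_cases[of X] by (auto dest: spec[of _ i])

lemma gram_sym: "gram X i j = gram X j i"
  by (auto simp: gram_def max.commute)

lemma gram_self [simp]: "gram X i i = sq_length X i"
  by (simp add: gram_def)

lemma gram_nonpos: "i \<noteq> j \<Longrightarrow> gram X i j \<le> 0"
  using sq_length_bounds(1)[of X i] by (auto simp: gram_def)

lemma sq_length_dvd: "sq_length X i dvd 2 * gram X i j" "sq_length X j dvd 2 * gram X i j"
proof -
  have *: "sq_length X i dvd 2 * gram X i j" for i j
  proof -
    have "2 * (max (sq_length X i) (sq_length X j) div 2) = max (sq_length X i) (sq_length X j)"
      using sq_length_cases[of X] by (elim disjE) (frule spec[of _ i], drule spec[of _ j], auto)+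
    moreover have "sq_length X i dvd max (sq_length X i) (sq_length X j)"
      using sq_length_cases[of X] by (elim disjE) (frule spec[of _ i], drule spec[of _ j], auto)+
    ultimately show ?thesis by (simp add: gram_def)
  qed
  show "sq_length X i dvd 2 * gram X i j" "sq_length X j dvd 2 * gram X i j"
    using * *[of j i] by (simp_all add: gram_sym)
qed

definition scl :: "int \<Rightarrow> lattice_vec \<Rightarrow> lattice_vec" where
  "scl c x = (\<lambda>k. c * x k)"

lemma scl_apply [simp]: "scl c x k = c * x k"
  by (simp add: scl_def)

lemma reflection_eq: "reflection X \<gamma> x = x - scl (copairing X x \<gamma>) \<gamma>"
  by (simp add: reflection_def fun_eq_iff)

lemma inner_form_sym: "inner_form X x y = inner_form X y x"
proof -
  have *: "x i * y j * gram X i j = y j * x i * gram X j i" for i j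
    by (simp add: gram_sym[of X j i])
  show ?thesis
    unfolding inner_form_def
    by (subst sum.swap) (rule sum.cong[OF HOL.refl], rule sum.cong[OF HOL.refl], rule *)
qed

lemma inner_form_add: "inner_form X (x + y) z = inner_form X x z + inner_form X y z"
    "inner_form X z (x + y) = inner_form X z x + inner_form X z y"
  and inner_form_diff: "inner_form X (x - y) z = inner_form X x z - inner_form X y z"
    "inner_form X z (x - y) = inner_form X z x - inner_form X z y"
  and inner_form_uminus: "inner_form X (- y) z = - inner_form X y z" "inner_form X z (- y) = - inner_form X z y"
  and inner_form_scl: "inner_form X (scl c y) z = c * inner_form X y z" "inner_form X z (scl c y) = c * inner_form X z y"
  by (simp_all add: inner_form_def algebra_simps sum.distrib sum_subtractf sum_negf sum_distrib_left)

lemmas inner_form_simps = inner_form_add inner_form_diff inner_form_uminus inner_form_scl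

lemma simple_root_apply [simp]: "simple_root i i = 1" "k \<noteq> i \<Longrightarrow> simple_root i k = 0"
  by (simp_all add: simple_root_def)

lemma inner_form_expand: "inner_form X x y = (\<Sum>i\<in>{1..rk X}. y i * inner_form X x (simple_root i))"
proof -
  have "inner_form X x (simple_root i) = (\<Sum>j\<in>{1..rk X}. x j * gram X j i)" if "i \<in> {1..rk X}" for i
  proof -
    have "inner_form X x (simple_root i) = (\<Sum>j\<in>{1..rk X}. \<Sum>k\<in>{1..rk X}. if k = i then x j * gram X j k else 0)"
      unfolding inner_form_def by (intro sum.cong HOL.refl) (auto simp: simple_root_def)
    then show ?thesis using that by simp
  qed
  moreover have "inner_form X x y = (\<Sum>i\<in>{1..rk X}. \<Sum>j\<in>{1..rk X}. x j * y i * gram X j i)"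
    unfolding inner_form_def by (rule sum.swap)
  ultimately show ?thesis
    by (simp add: sum_distrib_left mult.commute mult.left_commute)
qed

lemma inner_form_simple_roots:
  assumes "i \<in> {1..rk X}" "j \<in> {1..rk X}"
  shows "inner_form X (simple_root i) (simple_root j) = gram X i j"
proof -
  have "inner_form X (simple_root i) (simple_root j) =
      (\<Sum>a\<in>{1..rk X}. \<Sum>b\<in>{1..rk X}. if b = j then (if a = i then gram X a b else 0) else 0)"
    unfolding inner_form_def by (intro sum.cong HOL.refl) (auto simp: simple_root_def)
  then show ?thesis using assms by simp
qed

text \<open>The division in \<open>copairing\<close> is exact for simple roots on the whole lattice,
  which makes simple reflections linear.\<close>

lemma copairing_simple:
  assumes "i \<in> {1..rk X}"
  shows "copairing X x (simple_root i) * sq_length X i = 2 * inner_form X x (simple_root i)"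
proof -
  have "sq_length X i dvd 2 * inner_form X x (simple_root i)"
    unfolding inner_form_sym[of X x] inner_form_expand[of X _ x] sum_distrib_left
  proof (intro dvd_sum)
    fix j assume j: "j \<in> {1..rk X}"
    have "sq_length X i dvd x j * (2 * gram X i j)" using sq_length_dvd(1)[of X i j] by (rule dvd_mult)
    then show "sq_length X i dvd 2 * (x j * inner_form X (simple_root i) (simple_root j))"
      using assms j by (simp add: inner_form_simple_roots mult.commute mult.left_commute)
  qed
  then show ?thesis
    using assms by (simp add: copairing_def inner_form_simple_roots)
qed

lemma copairing_simple_linear:
  assumes "i \<in> {1..rk X}"
  shows "copairing X (x + y) (simple_root i) = copairing X x (simple_root i) + copairing X y (simple_root i)"
    "copairing X (scl c x) (simple_root i) = c * copairing X x (simple_root i)"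
  using copairing_simple[OF assms, of "x + y"] copairing_simple[OF assms, of x] copairing_simple[OF assms, of y]
    copairing_simple[OF assms, of "scl c x"] sq_length_bounds(1)[of X i]
    mult_right_cancel[of "sq_length X i" "copairing X (x + y) (simple_root i)" "copairing X x (simple_root i) + copairing X y (simple_root i)"]
    mult_right_cancel[of "sq_length X i" "copairing X (scl c x) (simple_root i)" "c * copairing X x (simple_root i)"]
  by (auto simp: inner_form_simps algebra_simps)

section \<open>Words in simple reflections and their action on roots\<close>

abbreviation weyl_words :: "cartan_type \<Rightarrow> nat list set" where
  "weyl_words X \<equiv> lists {1..rk X}"

lemma weyl_elt_simps [simp]:
  "weyl_elt X [] = id" "weyl_elt X (i # u) = reflection X (simple_root i) \<circ> weyl_elt X u"
  by (simp_all add: weyl_elt_def)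

lemma weyl_elt_append: "weyl_elt X (u @ v) = weyl_elt X u \<circ> weyl_elt X v"
  by (induction u) (auto simp: comp_assoc)

lemma simple_reflection_linear:
  assumes "i \<in> {1..rk X}"
  shows "reflection X (simple_root i) (x + y) = reflection X (simple_root i) x + reflection X (simple_root i) y"
    "reflection X (simple_root i) (scl c x) = scl c (reflection X (simple_root i) x)"
  using copairing_simple_linear[OF assms] by (auto simp: reflection_def fun_eq_iff algebra_simps)

lemma simple_reflection_inner:
  assumes "i \<in> {1..rk X}"
  shows "inner_form X (reflection X (simple_root i) x) (reflection X (simple_root i) y) = inner_form X x y"
proof -
  define a b where "a = copairing X x (simple_root i)" and "b = copairing X y (simple_root i)"
  have "a * sq_length X i = 2 * inner_form X x (simple_root i)" "b * sq_length X i = 2 * inner_form X y (simple_root i)"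
    using copairing_simple[OF assms] by (auto simp: a_def b_def)
  moreover have "inner_form X (reflection X (simple_root i) x) (reflection X (simple_root i) y) =
      inner_form X x y - b * inner_form X x (simple_root i) - a * inner_form X y (simple_root i) + a * b * sq_length X i"
    using assms
    by (simp add: reflection_eq inner_form_simps inner_form_simple_roots a_def b_def
        inner_form_sym[of X "simple_root i" y] algebra_simps)
  moreover from calculation(1,2) have "2 * (b * inner_form X x (simple_root i)) = a * b * sq_length X i"
    "2 * (a * inner_form X y (simple_root i)) = a * b * sq_length X i" by simp_all
  ultimately show ?thesis by linarith
qed

lemma copairing_self: "i \<in> {1..rk X} \<Longrightarrow> copairing X (simple_root i) (simple_root i) = 2"
  using sq_length_bounds(1)[of X i] by (simp add: copairing_def inner_form_simple_roots)

lemma simple_reflection_simple: "i \<in> {1..rk X} \<Longrightarrow> reflection X (simple_root i) (simple_root i) = - simple_root i"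
  by (simp add: reflection_eq copairing_self fun_eq_iff)

lemma simple_reflection_invol:
  assumes "i \<in> {1..rk X}"
  shows "reflection X (simple_root i) (reflection X (simple_root i) x) = x"
proof -
  define r where "r = reflection X (simple_root i) x"
  define c where "c = copairing X x (simple_root i)"
  have x: "x = r + scl c (simple_root i)"
    by (simp add: reflection_eq r_def c_def)
  have "reflection X (simple_root i) x = reflection X (simple_root i) r + scl c (- simple_root i)"
    by (subst x) (simp only: simple_reflection_linear[OF assms] simple_reflection_simple[OF assms])
  then have "reflection X (simple_root i) r = r - scl c (- simple_root i)"
    unfolding r_def[symmetric] by (metis add_diff_cancel_right')
  moreover have "scl c (- simple_root i) = - scl c (simple_root i)" by (simp add: fun_eq_iff)
  ultimately have "reflection X (simple_root i) r = x" using x by (metis diff_minus_eq_add)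
  then show ?thesis unfolding r_def .
qed

lemma weyl_elt_linear:
  assumes "u \<in> weyl_words X"
  shows "weyl_elt X u (x + y) = weyl_elt X u x + weyl_elt X u y" "weyl_elt X u (scl c x) = scl c (weyl_elt X u x)"
  using assms by (induction u) (auto simp: simple_reflection_linear)

lemma weyl_elt_uminus: "u \<in> weyl_words X \<Longrightarrow> weyl_elt X u (- x) = - weyl_elt X u x"
  using weyl_elt_linear(2)[of u X "-1" x] by (simp add: scl_def fun_Compl_def)

lemma weyl_elt_diff: "u \<in> weyl_words X \<Longrightarrow> weyl_elt X u (x - y) = weyl_elt X u x - weyl_elt X u y"
  using weyl_elt_linear(1)[of u X x "- y"] by (simp add: weyl_elt_uminus)

lemma weyl_elt_inner: "u \<in> weyl_words X \<Longrightarrow> inner_form X (weyl_elt X u x) (weyl_elt X u y) = inner_form X x y"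
  by (induction u) (auto simp: simple_reflection_inner)

lemma weyl_elt_rev:
  assumes "u \<in> weyl_words X"
  shows "weyl_elt X (rev u) (weyl_elt X u x) = x" "weyl_elt X u (weyl_elt X (rev u) x) = x"
  using assms by (induction u arbitrary: x) (auto simp: weyl_elt_append simple_reflection_invol)

lemma roots_weyl: "u \<in> weyl_words X \<Longrightarrow> \<gamma> \<in> roots X \<Longrightarrow> weyl_elt X u \<gamma> \<in> roots X"
proof -
  assume u: "u \<in> weyl_words X" and "\<gamma> \<in> roots X"
  then obtain v i where "v \<in> weyl_words X" "i \<in> {1..rk X}" "\<gamma> = weyl_elt X v (simple_root i)"
    by (auto simp: roots_def)
  then show ?thesis
    using u unfolding roots_def by (intro CollectI exI[of _ "u @ v"] exI[of _ i]) (auto simp: weyl_elt_append)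
qed

lemma simple_root_roots: "i \<in> {1..rk X} \<Longrightarrow> simple_root i \<in> roots X"
  unfolding roots_def by (intro CollectI exI[of _ "[]"] exI[of _ i]) auto

lemma simple_reflection_roots: "i \<in> {1..rk X} \<Longrightarrow> \<gamma> \<in> roots X \<Longrightarrow> reflection X (simple_root i) \<gamma> \<in> roots X"
  using roots_weyl[of "[i]" X \<gamma>] by simp

lemma roots_induct [consumes 1, case_names simple reflect]:
  assumes "\<gamma> \<in> roots X" and "\<And>i. i \<in> {1..rk X} \<Longrightarrow> P (simple_root i)"
    and "\<And>i \<gamma>. i \<in> {1..rk X} \<Longrightarrow> \<gamma> \<in> roots X \<Longrightarrow> P \<gamma> \<Longrightarrow> P (reflection X (simple_root i) \<gamma>)"
  shows "P \<gamma>"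
proof -
  obtain u i where u: "u \<in> weyl_words X" and i: "i \<in> {1..rk X}" "\<gamma> = weyl_elt X u (simple_root i)"
    using assms(1) by (auto simp: roots_def)
  from u have "P (weyl_elt X u (simple_root i))"
    by (induction u) (use assms(2,3) i(1) roots_weyl simple_root_roots in auto)
  then show ?thesis using i by simp
qed

lemma roots_uminus: "\<gamma> \<in> roots X \<Longrightarrow> - \<gamma> \<in> roots X"
proof (induction rule: roots_induct)
  case (simple i)
  then show ?case using simple_reflection_roots[OF simple simple_root_roots[OF simple]] by (metis simple_reflection_simple[OF simple])
next
  case (reflect i \<gamma>)
  then show ?case
    using simple_reflection_roots[OF reflect(1,3)] weyl_elt_uminus[of "[i]" X \<gamma>] by (simp del: uminus_apply)
qed

lemma roots_support: "\<gamma> \<in> roots X \<Longrightarrow> k \<notin> {1..rk X} \<Longrightarrow> \<gamma> k = 0"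
  by (induction rule: roots_induct) (auto simp: reflection_def simple_root_def)

lemma roots_norm: "\<gamma> \<in> roots X \<Longrightarrow> \<exists>i\<in>{1..rk X}. inner_form X \<gamma> \<gamma> = sq_length X i"
  by (induction rule: roots_induct) (auto simp: inner_form_simple_roots simple_reflection_inner)

lemma roots_norm_bounds:
  assumes "\<gamma> \<in> roots X"
  shows "inner_form X \<gamma> \<gamma> \<ge> 2" "inner_form X \<gamma> \<gamma> \<le> 6"
  using roots_norm[OF assms] sq_length_bounds by metis+

text \<open>The coroot of \<gamma> has coordinate
  \<open>\<gamma>_j |\<alpha>_j|^2 / |\<gamma>|^2\<close> at the simple coroot number
  \<open>j\<close>. That these numbers are integers is preserved by simple reflections.\<close>

lemma roots_coroot_integral:
  "\<gamma> \<in> roots X \<Longrightarrow> j \<in> {1..rk X} \<Longrightarrow> inner_form X \<gamma> \<gamma> dvd \<gamma> j * sq_length X j"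
proof (induction arbitrary: j rule: roots_induct)
  case (simple i)
  then show ?case by (cases "i = j") (auto simp: inner_form_simple_roots)
next
  case (reflect i \<gamma>)
  have "inner_form X \<gamma> \<gamma> dvd 2 * inner_form X \<gamma> (simple_root i)"
    unfolding inner_form_sym[of X \<gamma> "simple_root i"] inner_form_expand[of X "simple_root i" \<gamma>] sum_distrib_left
  proof (intro dvd_sum)
    fix k assume k: "k \<in> {1..rk X}"
    obtain c where c: "2 * gram X i k = sq_length X k * c" using sq_length_dvd(2)[of X k i] by (auto elim: dvdE)
    have "2 * (\<gamma> k * inner_form X (simple_root i) (simple_root k)) = \<gamma> k * sq_length X k * c"
      using c k reflect(1) by (simp add: inner_form_simple_roots algebra_simps)
    then show "inner_form X \<gamma> \<gamma> dvd 2 * (\<gamma> k * inner_form X (simple_root i) (simple_root k))"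
      using reflect(3)[OF k] by (metis dvd_mult2)
  qed
  then have "inner_form X \<gamma> \<gamma> dvd copairing X \<gamma> (simple_root i) * sq_length X i"
    using copairing_simple[OF reflect(1), of \<gamma>] by simp
  moreover have "reflection X (simple_root i) \<gamma> j = \<gamma> j - copairing X \<gamma> (simple_root i) * simple_root i j"
    by (simp add: reflection_def)
  ultimately show ?case
    using reflect(3)[OF reflect(4)] unfolding simple_reflection_inner[OF reflect(1)]
    by (cases "j = i") (auto simp: left_diff_distrib)
qed

lemma roots_copairing:
  assumes "\<gamma> \<in> roots X"
  shows "copairing X x \<gamma> * inner_form X \<gamma> \<gamma> = 2 * inner_form X x \<gamma>"
proof -
  have "inner_form X \<gamma> \<gamma> dvd 2 * inner_form X x \<gamma>"
    unfolding inner_form_expand[of X x \<gamma>] sum_distrib_left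
  proof (intro dvd_sum)
    fix k assume k: "k \<in> {1..rk X}"
    have "2 * (\<gamma> k * inner_form X x (simple_root k)) = \<gamma> k * sq_length X k * copairing X x (simple_root k)"
      using copairing_simple[OF k, of x] by (simp add: algebra_simps)
    then show "inner_form X \<gamma> \<gamma> dvd 2 * (\<gamma> k * inner_form X x (simple_root k))"
      using roots_coroot_integral[OF assms k] by (metis dvd_mult2)
  qed
  then show ?thesis by (simp add: copairing_def)
qed

lemma weyl_reflection:
  assumes "u \<in> weyl_words X"
  shows "weyl_elt X u (reflection X \<gamma> x) = reflection X (weyl_elt X u \<gamma>) (weyl_elt X u x)"
  using assms by (simp add: reflection_eq weyl_elt_diff weyl_elt_linear copairing_def weyl_elt_inner)

lemma reflection_weyl:
  assumes "\<gamma> \<in> roots X"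
  shows "\<exists>u\<in>weyl_words X. reflection X \<gamma> = weyl_elt X u"
proof -
  obtain u i where u: "u \<in> weyl_words X" "i \<in> {1..rk X}" "\<gamma> = weyl_elt X u (simple_root i)"
    using assms by (auto simp: roots_def)
  have "reflection X \<gamma> x = weyl_elt X (u @ i # rev u) x" for x
    using weyl_reflection[OF u(1), of "simple_root i" "weyl_elt X (rev u) x"] u
    by (simp add: weyl_elt_append weyl_elt_rev)
  then show ?thesis using u by (intro bexI[of _ "u @ i # rev u"]) auto
qed

text \<open>A diagonal term is \<open>x_i\<close> times \<open>x_i |\<alpha>_i|^2\<close>. The
  off-diagonal terms pair up to \<open>x_i x_j\<close> times twice the Gram entry, which is a
  multiple of \<open>|\<alpha>_i|^2\<close>.\<close>

lemma norm_dvd: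
  assumes "\<And>i. i \<in> {1..rk X} \<Longrightarrow> l dvd x i * sq_length X i"
  shows "l dvd inner_form X x x"
proof -
  have "l dvd (\<Sum>i\<in>S. \<Sum>j\<in>S. x i * x j * gram X i j)" if "finite S" "S \<subseteq> {1..rk X}" for S
    using that
  proof (induction S rule: finite_induct)
    case (insert a S)
    have "(\<Sum>i\<in>insert a S. \<Sum>j\<in>insert a S. x i * x j * gram X i j) =
        x a * (x a * sq_length X a) + (\<Sum>j\<in>S. x a * x j * gram X a j) + (\<Sum>i\<in>S. x i * x a * gram X i a) +
        (\<Sum>i\<in>S. \<Sum>j\<in>S. x i * x j * gram X i j)"
      using insert.hyps by (simp add: sum.distrib)
    also have "(\<Sum>i\<in>S. x i * x a * gram X i a) = (\<Sum>j\<in>S. x a * x j * gram X a j)"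
      by (intro sum.cong HOL.refl) (simp add: gram_sym[of X a])
    also have "x a * (x a * sq_length X a) + (\<Sum>j\<in>S. x a * x j * gram X a j) + (\<Sum>j\<in>S. x a * x j * gram X a j) =
        x a * (x a * sq_length X a) + (\<Sum>j\<in>S. x j * x a * (2 * gram X a j))"
      by (simp add: sum.distrib[symmetric] algebra_simps)
    finally have sum: "(\<Sum>i\<in>insert a S. \<Sum>j\<in>insert a S. x i * x j * gram X i j) =
      x a * (x a * sq_length X a) + (\<Sum>j\<in>S. x j * x a * (2 * gram X a j)) + (\<Sum>i\<in>S. \<Sum>j\<in>S. x i * x j * gram X i j)" .
    have "l dvd x a * (x a * sq_length X a)" using assms[of a] insert.prems dvd_mult by blast
    moreover have "l dvd (\<Sum>i\<in>S. \<Sum>j\<in>S. x i * x j * gram X i j)" using insert by simp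
    moreover have "l dvd (\<Sum>j\<in>S. x j * x a * (2 * gram X a j))"
    proof (rule dvd_sum)
      fix j
      obtain c where "2 * gram X a j = sq_length X a * c" using sq_length_dvd(1)[of X a j] by (auto elim: dvdE)
      then have "x j * x a * (2 * gram X a j) = x a * sq_length X a * (c * x j)" by simp
      then show "l dvd x j * x a * (2 * gram X a j)" using assms[of a] insert.prems by (metis dvd_mult2 insert_subset)
    qed
    ultimately show ?case unfolding sum by (intro dvd_add)
  qed simp
  then show ?thesis by (simp add: inner_form_def)
qed

section \<open>Positive roots, inversions and reduced words\<close>

definition pos_roots :: "cartan_type \<Rightarrow> lattice_vec set" where
  "pos_roots X = {\<gamma> \<in> roots X. \<forall>k. 0 \<le> \<gamma> k}"

definition weyl_group :: "cartan_type \<Rightarrow> (lattice_vec \<Rightarrow> lattice_vec) set" where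
  "weyl_group X = weyl_elt X ` weyl_words X"

text \<open>By \<open>reduced_word_iff\<close> this is the Coxeter length, so minimality over all
  words becomes a count of roots.\<close>

definition ninv :: "cartan_type \<Rightarrow> (lattice_vec \<Rightarrow> lattice_vec) \<Rightarrow> nat" where
  "ninv X w = card {\<gamma> \<in> pos_roots X. w \<gamma> \<notin> pos_roots X}"

abbreviation "refl_s X i \<equiv> reflection X (simple_root i)"

lemma weyl_group_intros:
  "id \<in> weyl_group X" "i \<in> {1..rk X} \<Longrightarrow> refl_s X i \<in> weyl_group X" "u \<in> weyl_words X \<Longrightarrow> weyl_elt X u \<in> weyl_group X"
proof -
  show "u \<in> weyl_words X \<Longrightarrow> weyl_elt X u \<in> weyl_group X" for u by (simp add: weyl_group_def)
  from this[of "[]"] this[of "[i]"] show "id \<in> weyl_group X" "i \<in> {1..rk X} \<Longrightarrow> refl_s X i \<in> weyl_group X"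
    by simp_all
qed

lemma weyl_group_comp: "v \<in> weyl_group X \<Longrightarrow> w \<in> weyl_group X \<Longrightarrow> v \<circ> w \<in> weyl_group X"
proof -
  assume "v \<in> weyl_group X" "w \<in> weyl_group X"
  then obtain u u' where "u \<in> weyl_words X" "u' \<in> weyl_words X" "v = weyl_elt X u" "w = weyl_elt X u'"
    by (auto simp: weyl_group_def)
  then show ?thesis using weyl_group_intros(3)[of "u @ u'" X] by (simp add: weyl_elt_append)
qed

abbreviation "winv \<equiv> inv_into UNIV"

lemma rev_lists_iff [simp]: "rev u \<in> lists A \<longleftrightarrow> u \<in> lists A"
  by (auto simp: lists_eq_set)

lemma inv_weyl_elt: "u \<in> weyl_words X \<Longrightarrow> winv (weyl_elt X u) = weyl_elt X (rev u)"
  by (rule inv_equality) (simp_all add: weyl_elt_rev)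

lemma weyl_group_inv: "w \<in> weyl_group X \<Longrightarrow> winv w \<in> weyl_group X"
proof -
  assume "w \<in> weyl_group X"
  then obtain u where "u \<in> weyl_words X" "w = weyl_elt X u" by (auto simp: weyl_group_def)
  then show ?thesis using weyl_group_intros(3)[of "rev u" X] by (simp add: inv_weyl_elt)
qed

lemma weyl_groupD:
  assumes "w \<in> weyl_group X"
  shows "w (x + y) = w x + w y" "w (scl c x) = scl c (w x)" "w (- x) = - w x" "w (x - y) = w x - w y"
    "inner_form X (w x) (w y) = inner_form X x y" "w (winv w x) = x" "winv w (w x) = x" "bij w"
    "\<gamma> \<in> roots X \<Longrightarrow> w \<gamma> \<in> roots X" "w (reflection X \<gamma> x) = reflection X (w \<gamma>) (w x)"
    "\<gamma> \<in> roots X \<Longrightarrow> winv w \<gamma> \<in> roots X"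
proof -
  obtain u where u: "u \<in> weyl_words X" "w = weyl_elt X u" using assms by (auto simp: weyl_group_def)
  show "w (x + y) = w x + w y" "w (scl c x) = scl c (w x)" "w (- x) = - w x" "w (x - y) = w x - w y"
    "inner_form X (w x) (w y) = inner_form X x y" "w (winv w x) = x" "winv w (w x) = x"
    "\<gamma> \<in> roots X \<Longrightarrow> w \<gamma> \<in> roots X" "w (reflection X \<gamma> x) = reflection X (w \<gamma>) (w x)"
    "\<gamma> \<in> roots X \<Longrightarrow> winv w \<gamma> \<in> roots X"
    using u by (simp_all add: weyl_elt_linear weyl_elt_uminus weyl_elt_diff weyl_elt_inner inv_weyl_elt
        weyl_elt_rev roots_weyl weyl_reflection)
  show "bij w"
    unfolding u(2) by (rule o_bij[of "weyl_elt X (rev u)"]; rule ext) (use u(1) in \<open>simp_all add: weyl_elt_rev\<close>)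
qed

text \<open>The two facts about finite types from which the general theory is developed are
  definiteness and connectedness of the diagram. The latter is stated as an induction principle
  along edges.\<close>

locale root_system =
  fixes X :: cartan_type
  assumes rank: "{1..rk X} \<noteq> {}"
    and posdef: "\<And>i x. i \<in> {1..rk X} \<Longrightarrow> x i \<noteq> 0 \<Longrightarrow> inner_form X x x > 0"
    and connected: "\<And>Q i j. i \<in> {1..rk X} \<Longrightarrow> Q i \<Longrightarrow>
      (\<And>i j. i \<in> {1..rk X} \<Longrightarrow> j \<in> {1..rk X} \<Longrightarrow> Q i \<Longrightarrow> gram X i j \<noteq> 0 \<Longrightarrow> Q j) \<Longrightarrow>
      j \<in> {1..rk X} \<Longrightarrow> Q j"
begin

text \<open>Roots are determined by their coordinates mod 5: if
  \<open>\<alpha> - \<beta> = 5 \<gamma>\<close>, the parallelogram identity gives \<open>25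
  |\<gamma>|^2 \<le> 2 |\<alpha>|^2 + 2 |\<beta>|^2 \<le> 24\<close>, so \<gamma> is zero.\<close>

lemma finite_roots: "finite (roots X)"
proof -
  define I where "I = {1..rk X}"
  define f where "f \<gamma> = (\<lambda>i\<in>I. \<gamma> i mod 5)" for \<gamma> :: lattice_vec
  have "inj_on f (roots X)"
  proof (rule inj_onI)
    fix \<alpha> \<beta> assume \<alpha>: "\<alpha> \<in> roots X" and \<beta>: "\<beta> \<in> roots X" and eq: "f \<alpha> = f \<beta>"
    define \<gamma> where "\<gamma> i = (\<alpha> i - \<beta> i) div 5" for i
    have "5 dvd \<alpha> i - \<beta> i" for i
    proof (cases "i \<in> I")
      case True
      then have "\<alpha> i mod 5 = \<beta> i mod 5" using fun_cong[OF eq, of i] by (simp add: f_def)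
      then show ?thesis by (simp add: mod_eq_dvd_iff)
    qed (use roots_support[OF \<alpha>] roots_support[OF \<beta>] in \<open>simp add: I_def\<close>)
    then have diff: "\<alpha> - \<beta> = scl 5 \<gamma>" by (auto simp: \<gamma>_def fun_eq_iff)
    then have "inner_form X (\<alpha> - \<beta>) (\<alpha> - \<beta>) = 25 * inner_form X \<gamma> \<gamma>" by (simp add: inner_form_scl)
    moreover have "inner_form X (\<alpha> - \<beta>) (\<alpha> - \<beta>) + inner_form X (\<alpha> + \<beta>) (\<alpha> + \<beta>) =
        2 * inner_form X \<alpha> \<alpha> + 2 * inner_form X \<beta> \<beta>"
      by (simp add: inner_form_simps)
    moreover have "inner_form X (\<alpha> + \<beta>) (\<alpha> + \<beta>) \<ge> 0"
    proof (cases "\<exists>i\<in>{1..rk X}. (\<alpha> + \<beta>) i \<noteq> 0")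
      case True
      then obtain i where "i \<in> {1..rk X}" "(\<alpha> + \<beta>) i \<noteq> 0" by blast
      then show ?thesis using posdef[of i "\<alpha> + \<beta>"] by linarith
    qed (simp add: inner_form_def)
    ultimately have "inner_form X \<gamma> \<gamma> \<le> 0"
      using roots_norm_bounds(2)[OF \<alpha>] roots_norm_bounds(2)[OF \<beta>] by simp
    then have "\<gamma> i = 0" if "i \<in> I" for i using posdef[of i \<gamma>] that by (auto simp: I_def)
    then have "\<alpha> i = \<beta> i" for i
      using fun_cong[OF diff, of i] roots_support[OF \<alpha>, of i] roots_support[OF \<beta>, of i]
      by (cases "i \<in> I") (auto simp: I_def)
    then show "\<alpha> = \<beta>" by (simp add: fun_eq_iff)
  qed
  moreover have "f ` roots X \<subseteq> (\<Pi>\<^sub>E i\<in>I. {0..4})" by (auto simp: f_def)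
  moreover have "finite (\<Pi>\<^sub>E i\<in>I. {0..4::int})" by (intro finite_PiE) (auto simp: I_def)
  ultimately show ?thesis by (meson finite_imageD finite_subset)
qed

lemma root_nonzero: "\<gamma> \<in> roots X \<Longrightarrow> \<exists>i\<in>{1..rk X}. \<gamma> i \<noteq> 0"
proof (rule ccontr)
  assume "\<gamma> \<in> roots X" "\<not> (\<exists>i\<in>{1..rk X}. \<gamma> i \<noteq> 0)"
  moreover from this have "inner_form X \<gamma> \<gamma> = 0" by (simp add: inner_form_def)
  ultimately show False using roots_norm_bounds(1)[of \<gamma> X] by simp
qed

lemma norm_zero: "inner_form X x x \<le> 0 \<Longrightarrow> (\<And>k. k \<notin> {1..rk X} \<Longrightarrow> x k = 0) \<Longrightarrow> x k = 0"
  using posdef[of k x] by fastforce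

text \<open>If \<open>\<gamma> = \<beta> - \<delta>\<close> with \<open>\<beta>, \<delta> \<ge> 0\<close> nonzero of disjoint support, then integrality of the coroot
  makes the norms of \<open>\<beta>\<close> and \<open>\<delta>\<close> multiples of that of \<open>\<gamma>\<close>, while \<open>(\<beta>, \<delta>) \<le> 0\<close>.\<close>

lemma root_sign:
  assumes \<gamma>: "\<gamma> \<in> roots X"
  shows "(\<forall>k. 0 \<le> \<gamma> k) \<or> (\<forall>k. \<gamma> k \<le> 0)"
proof (rule ccontr)
  assume neg: "\<not> ?thesis"
  define l where "l = inner_form X \<gamma> \<gamma>"
  define \<beta> \<delta> where "\<beta> k = max (\<gamma> k) 0" and "\<delta> k = max (- \<gamma> k) 0" for k
  have l: "l > 0" using roots_norm_bounds(1)[OF \<gamma>] by (simp add: l_def)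
  have \<gamma>_eq: "\<gamma> = \<beta> - \<delta>" by (auto simp: \<beta>_def \<delta>_def fun_eq_iff)
  have "l dvd inner_form X \<beta> \<beta>" "l dvd inner_form X \<delta> \<delta>"
    using roots_coroot_integral[OF \<gamma>]
    by (auto simp: \<beta>_def \<delta>_def l_def max_def intro!: norm_dvd)
  moreover have "inner_form X \<beta> \<beta> > 0" "inner_form X \<delta> \<delta> > 0"
  proof -
    obtain i j where ij: "\<gamma> i < 0" "\<gamma> j > 0" using neg by (auto simp: not_le)
    then have "i \<in> {1..rk X}" "j \<in> {1..rk X}" using roots_support[OF \<gamma>] by force+
    then show "inner_form X \<beta> \<beta> > 0" "inner_form X \<delta> \<delta> > 0"
      using ij posdef[of j \<beta>] posdef[of i \<delta>] by (auto simp: \<beta>_def \<delta>_def)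
  qed
  ultimately have "inner_form X \<beta> \<beta> \<ge> l" "inner_form X \<delta> \<delta> \<ge> l" by (auto simp: zdvd_imp_le)
  moreover have "inner_form X \<beta> \<delta> \<le> 0"
    unfolding inner_form_def
  proof (intro sum_nonpos)
    fix i j
    show "\<beta> i * \<delta> j * gram X i j \<le> 0"
    proof (cases "i = j")
      case True
      then show ?thesis by (simp add: \<beta>_def \<delta>_def max_def)
    next
      case False
      then show ?thesis using gram_nonpos[OF False, of X] by (simp add: \<beta>_def \<delta>_def mult_nonneg_nonpos)
    qed
  qed
  moreover have "l = inner_form X \<beta> \<beta> + inner_form X \<delta> \<delta> - 2 * inner_form X \<beta> \<delta>"
    by (simp add: l_def \<gamma>_eq inner_form_simps inner_form_sym[of X \<delta> \<beta>])
  ultimately show False using l by linarith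
qed

lemma not_pos_roots: "\<gamma> \<in> roots X \<Longrightarrow> \<gamma> \<notin> pos_roots X \<longleftrightarrow> (\<forall>k. \<gamma> k \<le> 0)"
proof -
  assume \<gamma>: "\<gamma> \<in> roots X"
  obtain i where "\<gamma> i \<noteq> 0" using root_nonzero[OF \<gamma>] by blast
  then have "\<not> ((\<forall>k. 0 \<le> \<gamma> k) \<and> (\<forall>k. \<gamma> k \<le> 0))" by (meson order_antisym)
  then show ?thesis using root_sign[OF \<gamma>] \<gamma> by (auto simp: pos_roots_def)
qed

lemma pos_roots_uminus: "\<gamma> \<in> roots X \<Longrightarrow> - \<gamma> \<in> pos_roots X \<longleftrightarrow> \<gamma> \<notin> pos_roots X"
  using not_pos_roots[of \<gamma>] roots_uminus[of \<gamma>] by (simp add: pos_roots_def)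

lemma pos_rootsD: "\<gamma> \<in> pos_roots X \<Longrightarrow> \<gamma> \<in> roots X" "\<gamma> \<in> pos_roots X \<Longrightarrow> 0 \<le> \<gamma> k"
  by (auto simp: pos_roots_def)

lemma pos_roots_coord: "\<gamma> \<in> roots X \<Longrightarrow> \<gamma> k > 0 \<Longrightarrow> \<gamma> \<in> pos_roots X"
  by (metis not_pos_roots not_le)

lemma simple_root_pos: "i \<in> {1..rk X} \<Longrightarrow> simple_root i \<in> pos_roots X"
  using simple_root_roots[of i X] by (auto simp: pos_roots_def simple_root_def)

lemma finite_pos_roots: "finite (pos_roots X)"
  using finite_roots by (auto simp: pos_roots_def)

text \<open>The root system is reduced: for \<open>\<gamma> = m \<alpha>_i\<close>, integrality of
  the coroot says that \<open>m^2\<close> divides \<open>m\<close>.\<close>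

lemma multiple_simple_root:
  assumes \<gamma>: "\<gamma> \<in> pos_roots X" and i: "i \<in> {1..rk X}" and "\<And>k. k \<noteq> i \<Longrightarrow> \<gamma> k = 0"
  shows "\<gamma> = simple_root i"
proof -
  have \<gamma>_eq: "\<gamma> = scl (\<gamma> i) (simple_root i)"
    using assms(3) by (auto simp: fun_eq_iff simple_root_def)
  then have norm: "inner_form X \<gamma> \<gamma> = \<gamma> i * \<gamma> i * sq_length X i"
    using inner_form_simple_roots[OF i i] by (metis inner_form_scl gram_self mult.assoc)
  have "\<gamma> i * \<gamma> i * sq_length X i dvd \<gamma> i * sq_length X i"
    using roots_coroot_integral[OF pos_rootsD(1)[OF \<gamma>] i] by (simp add: norm)
  moreover have pos: "\<gamma> i > 0"
    using root_nonzero[OF pos_rootsD(1)[OF \<gamma>]] assms(3) pos_rootsD(2)[OF \<gamma>, of i] by (metis order_le_less)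
  moreover have "sq_length X i > 0" using sq_length_bounds(1)[of X i] by simp
  ultimately have "\<gamma> i dvd 1" by (auto simp: mult.assoc)
  then have "\<gamma> i = 1" using pos by simp
  then show ?thesis using \<gamma>_eq by (simp add: scl_def fun_eq_iff)
qed

lemma simple_reflection_pos:
  assumes "\<gamma> \<in> pos_roots X" "i \<in> {1..rk X}" "\<gamma> \<noteq> simple_root i"
  shows "refl_s X i \<gamma> \<in> pos_roots X"
proof -
  obtain k where k: "k \<noteq> i" "\<gamma> k \<noteq> 0" using multiple_simple_root assms by blast
  then have "refl_s X i \<gamma> k > 0"
    using pos_rootsD(2)[OF assms(1), of k] by (simp add: reflection_def)
  then show ?thesis
    using pos_roots_coord simple_reflection_roots[OF assms(2) pos_rootsD(1)[OF assms(1)]] by blast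
qed

lemma simple_reflection_pos_iff:
  assumes "\<gamma> \<in> roots X" "i \<in> {1..rk X}"
  shows "refl_s X i \<gamma> \<in> pos_roots X \<longleftrightarrow> (\<gamma> \<in> pos_roots X \<and> \<gamma> \<noteq> simple_root i) \<or> \<gamma> = - simple_root i"
proof (cases "\<gamma> \<in> pos_roots X")
  case True
  then have "\<gamma> \<noteq> - simple_root i"
    using pos_roots_uminus[OF simple_root_roots[OF assms(2)]] simple_root_pos[OF assms(2)] by auto
  moreover have "refl_s X i (simple_root i) \<notin> pos_roots X"
    using pos_roots_uminus[OF simple_root_roots[OF assms(2)]] simple_root_pos[OF assms(2)]
    by (simp add: simple_reflection_simple[OF assms(2)] del: uminus_apply)
  ultimately show ?thesis using True simple_reflection_pos[OF True assms(2)] by auto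
next
  case False
  then have m: "- \<gamma> \<in> pos_roots X" using pos_roots_uminus[OF assms(1)] by blast
  have refl_m: "refl_s X i (- \<gamma>) = - refl_s X i \<gamma>" by (rule weyl_groupD(3)[OF weyl_group_intros(2)[OF assms(2)]])
  show ?thesis
  proof (cases "- \<gamma> = simple_root i")
    case True
    then have "refl_s X i \<gamma> = simple_root i"
      using refl_m simple_reflection_simple[OF assms(2)] by (metis minus_minus)
    then show ?thesis using simple_root_pos[OF assms(2)] True by (metis minus_minus)
  next
    case F: False
    then have "- refl_s X i \<gamma> \<in> pos_roots X" using simple_reflection_pos[OF m assms(2)] refl_m by simp
    then have "refl_s X i \<gamma> \<notin> pos_roots X"
      using pos_roots_uminus[OF simple_reflection_roots[OF assms(2,1)]] by blast
    then show ?thesis using False F by (metis minus_minus)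
  qed
qed

text \<open>The reflection changes the sign of \<open>w \<gamma>\<close> only if
  \<open>w \<gamma>\<close> is \<alpha>_i or its negative, so exactly one inversion is gained or
  lost. The loss for \<open>w\<close> is the gain for \<open>s_i w\<close>.\<close>

lemma ninv_refl:
  assumes i: "i \<in> {1..rk X}" and w: "w \<in> weyl_group X"
  shows "winv w (simple_root i) \<in> pos_roots X \<Longrightarrow> ninv X (refl_s X i \<circ> w) = Suc (ninv X w)"
    "winv w (simple_root i) \<notin> pos_roots X \<Longrightarrow> ninv X w = Suc (ninv X (refl_s X i \<circ> w))"
proof -
  have up: "ninv X (refl_s X i \<circ> w) = Suc (ninv X w)"
    if w: "w \<in> weyl_group X" and pos: "winv w (simple_root i) \<in> pos_roots X" for w
  proof -
    define \<alpha> where "\<alpha> = winv w (simple_root i)"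
    have w\<alpha>: "w \<alpha> = simple_root i" using weyl_groupD(6)[OF w] by (simp add: \<alpha>_def)
    have \<alpha>: "\<gamma> = \<alpha>" if "w \<gamma> = simple_root i" for \<gamma>
      using weyl_groupD(7)[OF w, of \<gamma>] that by (simp add: \<alpha>_def)
    have neg: "\<gamma> \<notin> pos_roots X" if "w \<gamma> = - simple_root i" for \<gamma>
    proof -
      have "w (- \<gamma>) = simple_root i" using weyl_groupD(3)[OF w, of \<gamma>] that by (metis minus_minus)
      then have "- \<gamma> = \<alpha>" using weyl_groupD(7)[OF w, of "- \<gamma>"] by (simp add: \<alpha>_def)
      then show ?thesis using pos pos_roots_uminus pos_rootsD(1) by (metis \<alpha>_def)
    qed
    have "(refl_s X i (w \<gamma>) \<notin> pos_roots X) = (\<gamma> = \<alpha> \<or> w \<gamma> \<notin> pos_roots X)" if "\<gamma> \<in> pos_roots X" for \<gamma>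
      using simple_reflection_pos_iff[OF weyl_groupD(9)[OF w pos_rootsD(1)[OF that]] i] w\<alpha> \<alpha> neg that by metis
    moreover have "\<alpha> \<in> pos_roots X" using pos by (simp add: \<alpha>_def)
    ultimately have "{\<gamma> \<in> pos_roots X. (refl_s X i \<circ> w) \<gamma> \<notin> pos_roots X} =
        insert \<alpha> {\<gamma> \<in> pos_roots X. w \<gamma> \<notin> pos_roots X}"
      by auto
    moreover have "\<alpha> \<notin> {\<gamma> \<in> pos_roots X. w \<gamma> \<notin> pos_roots X}"
      using w\<alpha> simple_root_pos[OF i] by simp
    ultimately show ?thesis
      unfolding ninv_def using finite_pos_roots by simp
  qed
  then show "winv w (simple_root i) \<in> pos_roots X \<Longrightarrow> ninv X (refl_s X i \<circ> w) = Suc (ninv X w)"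
    using w by blast
  assume neg: "winv w (simple_root i) \<notin> pos_roots X"
  define v where "v = refl_s X i \<circ> w"
  have v: "v \<in> weyl_group X" using weyl_group_comp[OF weyl_group_intros(2)[OF i] w] by (simp add: v_def)
  have w_eq: "refl_s X i \<circ> v = w" by (auto simp: v_def fun_eq_iff simple_reflection_invol[OF i])
  have "v (- winv w (simple_root i)) = simple_root i"
    unfolding v_def comp_apply weyl_groupD(3)[OF w] weyl_groupD(6)[OF w]
      weyl_groupD(3)[OF weyl_group_intros(2)[OF i]] simple_reflection_simple[OF i] by simp
  then have "winv v (simple_root i) = - winv w (simple_root i)"
    using weyl_groupD(7)[OF v] by metis
  then have "winv v (simple_root i) \<in> pos_roots X"
    using neg pos_roots_uminus weyl_groupD(11)[OF w simple_root_roots[OF i]] by simp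
  then show "ninv X w = Suc (ninv X (refl_s X i \<circ> w))"
    using up[OF v] w_eq by (simp add: v_def)
qed

lemma ninv_id: "ninv X id = 0"
  by (simp add: ninv_def)

lemma ninv_le_length: "u \<in> weyl_words X \<Longrightarrow> ninv X (weyl_elt X u) \<le> length u"
proof (induction u rule: list.induct)
  case (Cons i u)
  then show ?case
    using ninv_refl[of i "weyl_elt X u"] weyl_group_intros(3)[of u X]
    by (cases "winv (weyl_elt X u) (simple_root i) \<in> pos_roots X") (simp_all del: comp_apply)
qed (simp add: ninv_id)

text \<open>Induction on the word. Either the first letter is the reflection in \<beta> and cancels,
  or it moves \<beta> to another positive root, to which the rest of the word applies.\<close>

lemma exchange:
  assumes "u \<in> weyl_words X" "\<beta> \<in> pos_roots X" "winv (weyl_elt X u) \<beta> \<notin> pos_roots X"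
  shows "\<exists>v\<in>weyl_words X. Suc (length v) = length u \<and> reflection X \<beta> \<circ> weyl_elt X u = weyl_elt X v"
  using assms
proof (induction u arbitrary: \<beta> rule: list.induct)
  case (Cons j u)
  have j: "j \<in> {1..rk X}" and u: "u \<in> weyl_words X" using Cons.prems(1) by auto
  have inv: "winv (weyl_elt X (j # u)) \<beta> = winv (weyl_elt X u) (refl_s X j \<beta>)"
    using j u by (simp only: inv_weyl_elt Cons_in_lists_iff simp_thms rev.simps weyl_elt_append) simp
  show ?case
  proof (cases "\<beta> = simple_root j")
    case True
    then have "reflection X \<beta> \<circ> weyl_elt X (j # u) = weyl_elt X u"
      unfolding True by (intro ext) (simp add: simple_reflection_invol[OF j])
    then show ?thesis using u by (intro bexI[of _ u]) (simp_all del: weyl_elt_simps)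
  next
    case False
    then have "refl_s X j \<beta> \<in> pos_roots X" using simple_reflection_pos Cons.prems j by blast
    from Cons.IH[OF u this Cons.prems(3)[unfolded inv]] obtain v where v: "v \<in> weyl_words X" "Suc (length v) = length u"
      "reflection X (refl_s X j \<beta>) \<circ> weyl_elt X u = weyl_elt X v"
      by blast
    have "reflection X \<beta> \<circ> weyl_elt X (j # u) = weyl_elt X (j # v)"
    proof
      fix x
      have "reflection X \<beta> (refl_s X j y) = refl_s X j (reflection X (refl_s X j \<beta>) y)" for y
        using weyl_groupD(10)[OF weyl_group_intros(2)[OF j], of "refl_s X j \<beta>" y] simple_reflection_invol[OF j] by simp
      then show "(reflection X \<beta> \<circ> weyl_elt X (j # u)) x = weyl_elt X (j # v) x"
        using fun_cong[OF v(3), of x] by simp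
    qed
    then show ?thesis using v j by (intro bexI[of _ "j # v"]) (auto simp del: comp_apply weyl_elt_simps)
  qed
qed simp

text \<open>If the tail already has length equal to its inversion count but the whole word has not,
  then \<alpha>_i is an inversion root of the inverse of the tail, and the exchange condition
  removes two letters.\<close>

lemma shorten:
  assumes "u \<in> weyl_words X" "ninv X (weyl_elt X u) \<noteq> length u"
  shows "\<exists>v\<in>weyl_words X. length v < length u \<and> weyl_elt X v = weyl_elt X u"
  using assms
proof (induction u rule: list.induct)
  case (Cons i u)
  then have i: "i \<in> {1..rk X}" and u: "u \<in> weyl_words X" by auto
  show ?case
  proof (cases "ninv X (weyl_elt X u) = length u")
    case True
    then have "winv (weyl_elt X u) (simple_root i) \<notin> pos_roots X"
      using ninv_refl(1)[OF i weyl_group_intros(3)[OF u]] Cons.prems by (auto simp del: comp_apply)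
    then obtain v where "v \<in> weyl_words X" "Suc (length v) = length u" "refl_s X i \<circ> weyl_elt X u = weyl_elt X v"
      using exchange[OF u simple_root_pos[OF i]] by blast
    then show ?thesis by (intro bexI[of _ v]) (auto simp del: comp_apply)
  next
    case False
    then obtain v where "v \<in> weyl_words X" "length v < length u" "weyl_elt X v = weyl_elt X u" using Cons.IH[OF u] by blast
    then show ?thesis using i by (intro bexI[of _ "i # v"]) (auto simp del: comp_apply)
  qed
qed (simp add: ninv_id)

lemma ex_word_ninv:
  assumes "w \<in> weyl_group X"
  shows "\<exists>u\<in>weyl_words X. weyl_elt X u = w \<and> length u = ninv X w"
proof -
  obtain u where u: "u \<in> weyl_words X" "weyl_elt X u = w" using assms by (auto simp: weyl_group_def)
  then show ?thesis
  proof (induction "length u" arbitrary: u rule: less_induct)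
    case less
    then show ?case using shorten[of u] by (metis (no_types, lifting))
  qed
qed

lemma reduced_word_iff:
  "reduced_word X u w \<longleftrightarrow> u \<in> weyl_words X \<and> weyl_elt X u = w \<and> length u = ninv X w"
proof
  assume r: "reduced_word X u w"
  then have u: "u \<in> weyl_words X" "weyl_elt X u = w" by (auto simp: reduced_word_def)
  then obtain v where "v \<in> weyl_words X" "weyl_elt X v = w" "length v = ninv X w"
    using ex_word_ninv[of w] weyl_group_intros(3) by metis
  then show "u \<in> weyl_words X \<and> weyl_elt X u = w \<and> length u = ninv X w"
    using r u ninv_le_length[of u] by (auto simp: reduced_word_def order_antisym)
next
  assume "u \<in> weyl_words X \<and> weyl_elt X u = w \<and> length u = ninv X w"
  then show "reduced_word X u w" using ninv_le_length unfolding reduced_word_def by metis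
qed

lemma ex_reduced_word: "w \<in> weyl_group X \<Longrightarrow> \<exists>u. reduced_word X u w"
  using ex_word_ninv by (auto simp: reduced_word_iff)

lemma reduced_word_Cons:
  assumes "reduced_word X (i # u) w"
  shows "i \<in> {1..rk X}" "reduced_word X u (refl_s X i \<circ> w)" "winv w (simple_root i) \<notin> pos_roots X"
proof -
  have i: "i \<in> {1..rk X}" and u: "u \<in> weyl_words X" and w: "w = refl_s X i \<circ> weyl_elt X u"
    and l: "Suc (length u) = ninv X w"
    using assms by (auto simp: reduced_word_iff)
  show "i \<in> {1..rk X}" by fact
  have wW: "w \<in> weyl_group X"
    unfolding w by (intro weyl_group_comp weyl_group_intros i u)
  have eq: "refl_s X i \<circ> w = weyl_elt X u"
    by (auto simp: w fun_eq_iff simple_reflection_invol[OF i])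
  show neg: "winv w (simple_root i) \<notin> pos_roots X"
    using ninv_refl(1)[OF i wW] eq ninv_le_length[OF u] l by auto
  then have "length u = ninv X (refl_s X i \<circ> w)" using ninv_refl(2)[OF i wW] l by simp
  then show "reduced_word X u (refl_s X i \<circ> w)" using u eq by (simp add: reduced_word_iff)
qed

lemma reduced_word_ConsI:
  assumes "w \<in> weyl_group X" "i \<in> {1..rk X}" "winv w (simple_root i) \<notin> pos_roots X" "reduced_word X u (refl_s X i \<circ> w)"
  shows "reduced_word X (i # u) w"
proof -
  have "refl_s X i \<circ> (refl_s X i \<circ> w) = w" by (auto simp: fun_eq_iff simple_reflection_invol[OF assms(2)])
  then show ?thesis
    using assms ninv_refl(2)[OF assms(2,1,3)] by (auto simp: reduced_word_iff)
qed

lemma reduced_word_append: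
  assumes "reduced_word X u v" "reduced_word X u' w" "ninv X (v \<circ> w) = ninv X v + ninv X w"
  shows "reduced_word X (u @ u') (v \<circ> w)"
  using assms by (auto simp: reduced_word_iff weyl_elt_append)

text \<open>The inversions of \<open>v w\<close> are those of \<open>w\<close> together with the
  preimages under \<open>w\<close> of those of \<open>v\<close>. The assumption \<open>add\<close>
  says that \<open>v\<close> undoes no inversion of \<open>w\<close>.\<close>

lemma ninv_comp:
  assumes v: "v \<in> weyl_group X" and w: "w \<in> weyl_group X"
    and add: "\<And>\<gamma>. \<gamma> \<in> pos_roots X \<Longrightarrow> w \<gamma> \<notin> pos_roots X \<Longrightarrow> v (w \<gamma>) \<notin> pos_roots X"
  shows "ninv X (v \<circ> w) = ninv X v + ninv X w"
proof -
  have w_pos: "winv w \<gamma> \<in> pos_roots X" if "\<gamma> \<in> pos_roots X" "v \<gamma> \<notin> pos_roots X" for \<gamma>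
  proof (rule ccontr)
    assume "winv w \<gamma> \<notin> pos_roots X"
    then have *: "- winv w \<gamma> \<in> pos_roots X"
      using pos_roots_uminus weyl_groupD(11)[OF w] pos_rootsD(1) that by blast
    have "w (- winv w \<gamma>) = - \<gamma>" by (simp add: weyl_groupD[OF w] del: uminus_apply)
    then have "v (- \<gamma>) \<notin> pos_roots X"
      using add[OF *] that(1) pos_roots_uminus pos_rootsD(1)[OF that(1)] by auto
    then show False
      using that pos_roots_uminus[of "v \<gamma>"] weyl_groupD(9)[OF v pos_rootsD(1)[OF that(1)]] weyl_groupD(3)[OF v, of \<gamma>] by auto
  qed
  have "{\<gamma> \<in> pos_roots X. (v \<circ> w) \<gamma> \<notin> pos_roots X} =
      {\<gamma> \<in> pos_roots X. w \<gamma> \<notin> pos_roots X} \<union> winv w ` {\<gamma> \<in> pos_roots X. v \<gamma> \<notin> pos_roots X}" (is "?L = ?A \<union> ?B")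
  proof (intro equalityI subsetI)
    fix \<gamma> assume "\<gamma> \<in> ?L"
    then show "\<gamma> \<in> ?A \<union> ?B"
      using weyl_groupD(7)[OF w, of \<gamma>, symmetric] by (cases "w \<gamma> \<in> pos_roots X") auto
  next
    fix \<gamma> assume "\<gamma> \<in> ?A \<union> ?B"
    then show "\<gamma> \<in> ?L" using add w_pos weyl_groupD(6)[OF w] by auto
  qed
  moreover have "?A \<inter> ?B = {}" using weyl_groupD(6)[OF w] by auto
  moreover have "card ?B = card {\<gamma> \<in> pos_roots X. v \<gamma> \<notin> pos_roots X}"
    by (rule card_image) (metis (mono_tags, lifting) inj_onI weyl_groupD(6)[OF w])
  ultimately show ?thesis
    unfolding ninv_def using finite_pos_roots by (simp add: card_Un_disjoint)
qed

end

section \<open>Dominant roots\<close>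

definition dominant :: "cartan_type \<Rightarrow> lattice_vec \<Rightarrow> bool" where
  "dominant X x \<longleftrightarrow> (\<forall>i\<in>{1..rk X}. 0 \<le> inner_form X x (simple_root i))"

lemma dominantD: "dominant X x \<Longrightarrow> i \<in> {1..rk X} \<Longrightarrow> 0 \<le> inner_form X x (simple_root i)"
  by (simp add: dominant_def)

lemma dominant_inner_nonneg: "dominant X x \<Longrightarrow> (\<And>k. 0 \<le> y k) \<Longrightarrow> 0 \<le> inner_form X x y"
  unfolding inner_form_expand[of X x y] by (intro sum_nonneg) (simp add: dominant_def)

lemma copairing_sign:
  assumes "i \<in> {1..rk X}"
  shows "0 \<le> copairing X x (simple_root i) \<longleftrightarrow> 0 \<le> inner_form X x (simple_root i)"
    "copairing X x (simple_root i) < 0 \<longleftrightarrow> inner_form X x (simple_root i) < 0"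
proof -
  have "copairing X x (simple_root i) * sq_length X i = 2 * inner_form X x (simple_root i)" "sq_length X i > 0"
    using copairing_simple[OF assms, of x] sq_length_bounds(1)[of X i] by auto
  then show "0 \<le> copairing X x (simple_root i) \<longleftrightarrow> 0 \<le> inner_form X x (simple_root i)"
    "copairing X x (simple_root i) < 0 \<longleftrightarrow> inner_form X x (simple_root i) < 0"
    by (smt (verit) mult_nonneg_nonneg mult_neg_pos)+
qed

lemma roots_reflection: "\<gamma> \<in> roots X \<Longrightarrow> \<delta> \<in> roots X \<Longrightarrow> reflection X \<gamma> \<delta> \<in> roots X"
  using reflection_weyl[of \<gamma> X] roots_weyl by metis

lemma reflection_group: "\<gamma> \<in> roots X \<Longrightarrow> reflection X \<gamma> \<in> weyl_group X"
  using reflection_weyl[of \<gamma> X] weyl_group_intros(3) by metis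

lemma reflection_invol:
  assumes "\<gamma> \<in> roots X"
  shows "reflection X \<gamma> (reflection X \<gamma> x) = x"
proof -
  have "copairing X \<gamma> \<gamma> * inner_form X \<gamma> \<gamma> = 2 * inner_form X \<gamma> \<gamma>" using roots_copairing[OF assms] by blast
  then have "copairing X \<gamma> \<gamma> = 2" using roots_norm_bounds(1)[OF assms] by simp
  then have "reflection X \<gamma> \<gamma> = - \<gamma>" by (simp add: reflection_eq fun_eq_iff)
  moreover have "reflection X \<gamma> (reflection X \<gamma> x) =
      reflection X \<gamma> x - scl (copairing X x \<gamma>) (reflection X \<gamma> \<gamma>)"
    by (subst (2) reflection_eq) (simp add: weyl_groupD[OF reflection_group[OF assms]])
  ultimately have "reflection X \<gamma> (reflection X \<gamma> x) = reflection X \<gamma> x - scl (copairing X x \<gamma>) (- \<gamma>)"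
    by simp
  also have "\<dots> = x" by (simp add: reflection_def fun_eq_iff)
  finally show ?thesis .
qed

context root_system
begin

lemma reduced_word_group: "reduced_word X u w \<Longrightarrow> w \<in> weyl_group X"
  unfolding reduced_word_iff using weyl_group_intros(3) by blast

text \<open>A negative pairing with \<alpha>_i would make the reflected root larger. The set
  \<open>A\<close> will be all roots, or all roots of one length.\<close>

lemma maximal_root_dominant:
  assumes A: "A \<subseteq> roots X" and \<gamma>: "\<gamma> \<in> A" and max: "\<And>\<delta>. \<delta> \<in> A \<Longrightarrow> \<gamma> \<le> \<delta> \<Longrightarrow> \<gamma> = \<delta>"
    and closed: "\<And>i. i \<in> {1..rk X} \<Longrightarrow> refl_s X i \<gamma> \<in> A"
  shows "dominant X \<gamma>"
  unfolding dominant_def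
proof (intro ballI, rule ccontr)
  fix i assume i: "i \<in> {1..rk X}" and "\<not> 0 \<le> inner_form X \<gamma> (simple_root i)"
  then have neg: "copairing X \<gamma> (simple_root i) < 0" using copairing_sign(2)[OF i] by simp
  then have "\<gamma> \<le> refl_s X i \<gamma>"
    by (auto simp: le_fun_def reflection_def simple_root_def)
  then have "\<gamma> = refl_s X i \<gamma>" using max[OF closed[OF i]] by blast
  then have "\<gamma> i = refl_s X i \<gamma> i" by metis
  then show False using neg by (simp add: reflection_def)
qed

lemma dominant_root_pos:
  assumes \<gamma>: "\<gamma> \<in> roots X" and dom: "dominant X \<gamma>"
  shows "\<gamma> \<in> pos_roots X"
proof (rule ccontr)
  assume "\<gamma> \<notin> pos_roots X"
  then have "\<forall>k. 0 \<le> (- \<gamma>) k" using not_pos_roots[OF \<gamma>] by simp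
  then have "0 \<le> inner_form X \<gamma> (- \<gamma>)" using dominant_inner_nonneg[OF dom] by blast
  then show False using roots_norm_bounds(1)[OF \<gamma>] by (simp add: inner_form_uminus del: uminus_apply)
qed

lemma inner_form_simple_right:
  assumes "j \<in> {1..rk X}"
  shows "inner_form X x (simple_root j) = (\<Sum>k\<in>{1..rk X}. x k * gram X k j)"
  unfolding inner_form_sym[of X x] inner_form_expand[of X "simple_root j" x]
  by (intro sum.cong HOL.refl) (simp add: inner_form_simple_roots[OF assms] gram_sym[of X j])

text \<open>Otherwise connectedness provides an edge that leaves the support, and the pairing with
  the simple root at its outer end is negative.\<close>

lemma dominant_root_support:
  assumes \<gamma>: "\<gamma> \<in> roots X" and dom: "dominant X \<gamma>" and j: "j \<in> {1..rk X}"
  shows "\<gamma> j > 0"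
proof -
  have pos: "0 \<le> \<gamma> k" for k using dominant_root_pos[OF \<gamma> dom] pos_rootsD(2) by blast
  obtain i where i: "i \<in> {1..rk X}" "\<gamma> i \<noteq> 0" using root_nonzero[OF \<gamma>] by blast
  show ?thesis
  proof (rule connected[of i "\<lambda>i. \<gamma> i > 0", OF i(1) _ _ j])
    show "0 < \<gamma> i" using i(2) pos[of i] by simp
    fix a b assume a: "a \<in> {1..rk X}" and b: "b \<in> {1..rk X}" and "0 < \<gamma> a" and g: "gram X a b \<noteq> 0"
    show "0 < \<gamma> b"
    proof (rule ccontr)
      assume "\<not> 0 < \<gamma> b"
      then have b0: "\<gamma> b = 0" using pos[of b] by simp
      then have "a \<noteq> b" using \<open>0 < \<gamma> a\<close> by auto
      then have neg: "\<gamma> a * gram X a b < 0" using gram_nonpos[of a b X] g \<open>0 < \<gamma> a\<close> by (simp add: mult_pos_neg)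
      have "\<gamma> k * gram X k b \<le> 0" for k
        using pos[of k] b0 gram_nonpos[of k b X] by (cases "k = b") (auto simp: mult_nonneg_nonpos)
      then have "(\<Sum>k\<in>{1..rk X} - {a}. \<gamma> k * gram X k b) \<le> 0" by (intro sum_nonpos) simp
      moreover have "(\<Sum>k\<in>{1..rk X}. \<gamma> k * gram X k b) = \<gamma> a * gram X a b + (\<Sum>k\<in>{1..rk X} - {a}. \<gamma> k * gram X k b)"
        using a by (intro sum.remove) auto
      ultimately have "inner_form X \<gamma> (simple_root b) < 0"
        unfolding inner_form_simple_right[OF b] using neg by linarith
      then show False using dominantD[OF dom b] by simp
    qed
  qed
qed

text \<open>All terms of the expansion in simple roots are nonnegative. As \<delta> has full
  support, their vanishing would give \<gamma> norm 0.\<close>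

lemma dominant_roots_inner_pos:
  assumes \<gamma>: "\<gamma> \<in> roots X" "dominant X \<gamma>" and \<delta>: "\<delta> \<in> roots X" "dominant X \<delta>"
  shows "inner_form X \<gamma> \<delta> > 0"
proof (rule ccontr)
  assume "\<not> inner_form X \<gamma> \<delta> > 0"
  then have "(\<Sum>i\<in>{1..rk X}. \<delta> i * inner_form X \<gamma> (simple_root i)) \<le> 0"
    by (simp add: inner_form_expand[of X \<gamma> \<delta>])
  moreover have nonneg: "0 \<le> \<delta> i * inner_form X \<gamma> (simple_root i)" if "i \<in> {1..rk X}" for i
    using dominant_root_support[OF \<delta> that] dominantD[OF \<gamma>(2) that] by simp
  ultimately have "\<forall>i\<in>{1..rk X}. \<delta> i * inner_form X \<gamma> (simple_root i) = 0"
    using sum_nonneg_eq_0_iff[of "{1..rk X}" "\<lambda>i. \<delta> i * inner_form X \<gamma> (simple_root i)"]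
      sum_nonneg[of "{1..rk X}" "\<lambda>i. \<delta> i * inner_form X \<gamma> (simple_root i)"] by fastforce
  then have "inner_form X \<gamma> (simple_root i) = 0" if "i \<in> {1..rk X}" for i
    using dominant_root_support[OF \<delta> that] that by fastforce
  then have "inner_form X \<gamma> \<gamma> = 0" by (simp add: inner_form_expand[of X \<gamma> \<gamma>])
  then show False using roots_norm_bounds(1)[OF \<gamma>(1)] by simp
qed

lemma norm_nonneg: "0 \<le> inner_form X x x"
proof (cases "\<exists>i\<in>{1..rk X}. x i \<noteq> 0")
  case True
  then obtain i where "i \<in> {1..rk X}" "x i \<noteq> 0" by blast
  then show ?thesis using posdef[of i x] by simp
qed (simp add: inner_form_def)

text \<open>Both Cartan integers are positive. If neither is 1, the difference has norm at most 0;
  if one is 1, the difference is a reflected root up to sign.\<close>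

lemma roots_diff:
  assumes \<gamma>: "\<gamma> \<in> roots X" and \<delta>: "\<delta> \<in> roots X" and "inner_form X \<gamma> \<delta> > 0" "\<gamma> \<noteq> \<delta>"
  shows "\<gamma> - \<delta> \<in> roots X"
proof -
  define a b where "a = copairing X \<gamma> \<delta>" and "b = copairing X \<delta> \<gamma>"
  have a: "a * inner_form X \<delta> \<delta> = 2 * inner_form X \<gamma> \<delta>" and b: "b * inner_form X \<gamma> \<gamma> = 2 * inner_form X \<gamma> \<delta>"
    using roots_copairing[OF \<delta>, of \<gamma>] roots_copairing[OF \<gamma>, of \<delta>] by (simp_all add: a_def b_def inner_form_sym[of X \<delta> \<gamma>])
  have pos: "inner_form X \<delta> \<delta> > 0" "inner_form X \<gamma> \<gamma> > 0" using roots_norm_bounds(1)[OF \<gamma>] roots_norm_bounds(1)[OF \<delta>] by auto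
  have "0 < a * inner_form X \<delta> \<delta>" "0 < b * inner_form X \<gamma> \<gamma>" using a b assms(3) by simp_all
  then have "a > 0" "b > 0" using pos by (simp_all add: zero_less_mult_iff)
  have "a = 1 \<or> b = 1"
  proof (rule ccontr)
    assume "\<not> ?thesis"
    then have "a \<ge> 2" "b \<ge> 2" using \<open>a > 0\<close> \<open>b > 0\<close> by auto
    then have "a * inner_form X \<delta> \<delta> \<ge> 2 * inner_form X \<delta> \<delta>" "b * inner_form X \<gamma> \<gamma> \<ge> 2 * inner_form X \<gamma> \<gamma>"
      using pos by (auto intro: mult_right_mono)
    then have "inner_form X (\<gamma> - \<delta>) (\<gamma> - \<delta>) \<le> 0"
      using a b by (simp add: inner_form_simps inner_form_sym[of X \<delta> \<gamma>])
    then have "(\<gamma> - \<delta>) k = 0" for k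
      using norm_zero[of "\<gamma> - \<delta>" k] roots_support[OF \<gamma>] roots_support[OF \<delta>] by simp
    then show False using assms(4) by (auto simp: fun_eq_iff)
  qed
  then show ?thesis
  proof
    assume "a = 1"
    then have "reflection X \<delta> \<gamma> = \<gamma> - \<delta>" by (simp add: reflection_eq a_def[symmetric] fun_eq_iff)
    then show ?thesis using roots_reflection[OF \<delta> \<gamma>] by simp
  next
    assume "b = 1"
    then have "- reflection X \<gamma> \<delta> = \<gamma> - \<delta>" by (simp add: reflection_eq b_def[symmetric] fun_eq_iff)
    then show ?thesis using roots_uminus[OF roots_reflection[OF \<gamma> \<delta>]] by metis
  qed
qed

lemma dominant_roots_comparable:
  assumes \<gamma>: "\<gamma> \<in> roots X" "dominant X \<gamma>" and \<delta>: "\<delta> \<in> roots X" "dominant X \<delta>"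
  shows "\<gamma> \<le> \<delta> \<or> \<delta> \<le> \<gamma>"
proof (cases "\<gamma> = \<delta>")
  case False
  then have "\<gamma> - \<delta> \<in> roots X" using roots_diff dominant_roots_inner_pos assms by blast
  then show ?thesis using root_sign[of "\<gamma> - \<delta>"] by (auto simp: le_fun_def)
qed simp

lemma norm_mono_dominant:
  assumes "dominant X \<gamma>" "dominant X \<delta>" "\<delta> \<le> \<gamma>"
  shows "inner_form X \<delta> \<delta> \<le> inner_form X \<gamma> \<gamma>"
    "inner_form X \<delta> \<delta> = inner_form X \<gamma> \<gamma> \<Longrightarrow> inner_form X (\<gamma> - \<delta>) (\<gamma> - \<delta>) = 0"
proof -
  have "0 \<le> inner_form X \<gamma> (\<gamma> - \<delta>)" "0 \<le> inner_form X \<delta> (\<gamma> - \<delta>)"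
    using assms by (auto intro!: dominant_inner_nonneg simp: le_fun_def)
  moreover have "inner_form X \<gamma> \<gamma> - inner_form X \<delta> \<delta> = inner_form X \<gamma> (\<gamma> - \<delta>) + inner_form X \<delta> (\<gamma> - \<delta>)"
    "inner_form X (\<gamma> - \<delta>) (\<gamma> - \<delta>) = inner_form X \<gamma> (\<gamma> - \<delta>) - inner_form X \<delta> (\<gamma> - \<delta>)"
    by (simp_all add: inner_form_diff inner_form_sym[of X \<gamma> \<delta>])
  ultimately show "inner_form X \<delta> \<delta> \<le> inner_form X \<gamma> \<gamma>"
    "inner_form X \<delta> \<delta> = inner_form X \<gamma> \<gamma> \<Longrightarrow> inner_form X (\<gamma> - \<delta>) (\<gamma> - \<delta>) = 0"
    by linarith+
qed

text \<open>Dominant roots are comparable, and comparable ones of equal norm coincide. This is how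
  the highest root and the dominant short root are recognised later.\<close>

lemma dominant_root_unique:
  assumes \<gamma>: "\<gamma> \<in> roots X" "dominant X \<gamma>" and \<delta>: "\<delta> \<in> roots X" "dominant X \<delta>"
    and "inner_form X \<gamma> \<gamma> = inner_form X \<delta> \<delta>"
  shows "\<gamma> = \<delta>"
proof -
  have *: "\<gamma> = \<delta>" if "\<gamma> \<in> roots X" "\<delta> \<in> roots X" "inner_form X (\<gamma> - \<delta>) (\<gamma> - \<delta>) \<le> 0" for \<gamma> \<delta>
  proof
    fix k show "\<gamma> k = \<delta> k"
      using norm_zero[OF that(3), of k] roots_support[OF that(1)] roots_support[OF that(2)] by simp
  qed
  show ?thesis
    using dominant_roots_comparable[OF assms(1-4)]
  proof
    assume "\<gamma> \<le> \<delta>"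
    then show ?thesis using norm_mono_dominant(2)[OF \<delta>(2) \<gamma>(2)] *[of \<delta> \<gamma>] assms by simp
  next
    assume "\<delta> \<le> \<gamma>"
    then show ?thesis using norm_mono_dominant(2)[OF \<gamma>(2) \<delta>(2)] *[of \<gamma> \<delta>] assms by simp
  qed
qed

text \<open>Every root lies below a maximal one; maximal roots are dominant, hence comparable, hence
  all equal.\<close>

lemma ex_highest_root: "\<exists>!\<theta>. \<theta> \<in> roots X \<and> (\<forall>\<gamma>\<in>roots X. \<forall>k. \<gamma> k \<le> \<theta> k)"
proof -
  obtain i where "i \<in> {1..rk X}" using rank by blast
  then obtain \<theta> where \<theta>: "\<theta> \<in> roots X" and max: "\<And>\<delta>. \<delta> \<in> roots X \<Longrightarrow> \<theta> \<le> \<delta> \<Longrightarrow> \<theta> = \<delta>"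
    using finite_has_maximal2[OF finite_roots simple_root_roots[of i X]] by metis
  have \<theta>_dom: "dominant X \<theta>" by (rule maximal_root_dominant[of "roots X", OF _ \<theta> max]) (use \<theta> simple_reflection_roots in auto)
  have "\<gamma> \<le> \<theta>" if \<gamma>: "\<gamma> \<in> roots X" for \<gamma>
  proof -
    obtain \<delta> where \<delta>: "\<delta> \<in> roots X" "\<gamma> \<le> \<delta>" and max': "\<And>\<epsilon>. \<epsilon> \<in> roots X \<Longrightarrow> \<delta> \<le> \<epsilon> \<Longrightarrow> \<delta> = \<epsilon>"
      using finite_has_maximal2[OF finite_roots \<gamma>] by metis
    have "dominant X \<delta>" by (rule maximal_root_dominant[of "roots X", OF _ \<delta>(1) max']) (use \<delta> simple_reflection_roots in auto)
    then have "\<theta> = \<delta>" using dominant_roots_comparable[OF \<theta> \<theta>_dom \<delta>(1)] max[OF \<delta>(1)] max'[OF \<theta>] by blast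
    then show ?thesis using \<delta> by simp
  qed
  then show ?thesis
    using \<theta> by (intro ex1I[of _ \<theta>]) (auto simp: le_fun_def fun_eq_iff intro: order_antisym)
qed

lemma highest_root: "highest_root X \<in> roots X" "\<gamma> \<in> roots X \<Longrightarrow> \<gamma> k \<le> highest_root X k"
  using theI'[OF ex_highest_root] by (auto simp: highest_root_def)

lemma highest_root_unique:
  "\<theta> \<in> roots X \<Longrightarrow> (\<And>\<gamma> k. \<gamma> \<in> roots X \<Longrightarrow> \<gamma> k \<le> \<theta> k) \<Longrightarrow> \<theta> = highest_root X"
  using ex_highest_root highest_root by blast

lemma highest_root_dominant: "dominant X (highest_root X)"
  by (rule maximal_root_dominant[of "roots X"])
    (use highest_root simple_reflection_roots in \<open>auto simp: le_fun_def fun_eq_iff intro: order_antisym\<close>)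

lemma ex_dominant_same_norm:
  assumes \<gamma>: "\<gamma> \<in> roots X"
  shows "\<exists>\<delta>\<in>roots X. dominant X \<delta> \<and> inner_form X \<delta> \<delta> = inner_form X \<gamma> \<gamma>"
proof -
  define A where "A = {\<delta> \<in> roots X. inner_form X \<delta> \<delta> = inner_form X \<gamma> \<gamma>}"
  have "finite A" "\<gamma> \<in> A" using finite_roots \<gamma> by (auto simp: A_def)
  then obtain \<delta> where \<delta>: "\<delta> \<in> A" and max: "\<And>\<epsilon>. \<epsilon> \<in> A \<Longrightarrow> \<delta> \<le> \<epsilon> \<Longrightarrow> \<delta> = \<epsilon>"
    using finite_has_maximal2[of A \<gamma>] by metis
  have "dominant X \<delta>"
    by (rule maximal_root_dominant[of A, OF _ \<delta> max])
       (use \<delta> in \<open>auto simp: A_def simple_reflection_roots simple_reflection_inner\<close>)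
  then show ?thesis using \<delta> by (auto simp: A_def)
qed

lemma highest_root_long:
  assumes "\<gamma> \<in> roots X"
  shows "inner_form X \<gamma> \<gamma> \<le> inner_form X (highest_root X) (highest_root X)"
proof -
  obtain \<delta> where \<delta>: "\<delta> \<in> roots X" "dominant X \<delta>" "inner_form X \<delta> \<delta> = inner_form X \<gamma> \<gamma>"
    using ex_dominant_same_norm[OF assms] by blast
  then show ?thesis
    using norm_mono_dominant(1)[OF highest_root_dominant \<delta>(2)] highest_root(2) by (simp add: le_fun_def)
qed

lemma highest_root_eqI:
  assumes "\<gamma> \<in> roots X" "dominant X \<gamma>" "\<And>\<delta>. \<delta> \<in> roots X \<Longrightarrow> inner_form X \<delta> \<delta> \<le> inner_form X \<gamma> \<gamma>"
  shows "highest_root X = \<gamma>"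
  using dominant_root_unique[OF highest_root(1) highest_root_dominant assms(1,2)]
    highest_root_long[OF assms(1)] assms(3)[OF highest_root(1)] by simp

lemma dominant_copairing: "dominant X \<gamma> \<longleftrightarrow> (\<forall>i\<in>{1..rk X}. 0 \<le> copairing X \<gamma> (simple_root i))"
  using copairing_sign(1) by (auto simp: dominant_def)

lemma ex_dominant_short_root:
  "\<exists>!\<theta>. \<theta> \<in> roots X \<and> (\<forall>\<gamma>\<in>roots X. inner_form X \<theta> \<theta> \<le> inner_form X \<gamma> \<gamma>) \<and>
    (\<forall>i\<in>{1..rk X}. 0 \<le> copairing X \<theta> (simple_root i))"
proof -
  define N where "N = (\<lambda>\<gamma>. inner_form X \<gamma> \<gamma>) ` roots X"
  have N: "finite N" "N \<noteq> {}" using finite_roots highest_root(1) by (auto simp: N_def)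
  then have "Min N \<in> N" by simp
  then obtain \<gamma> where \<gamma>: "\<gamma> \<in> roots X" "inner_form X \<gamma> \<gamma> = Min N" by (auto simp: N_def)
  then have min: "inner_form X \<gamma> \<gamma> \<le> inner_form X \<delta> \<delta>" if "\<delta> \<in> roots X" for \<delta>
    using N(1) that by (auto simp: N_def)
  obtain \<theta> where \<theta>: "\<theta> \<in> roots X" "dominant X \<theta>" "inner_form X \<theta> \<theta> = inner_form X \<gamma> \<gamma>"
    using ex_dominant_same_norm[OF \<gamma>(1)] by blast
  show ?thesis
  proof (rule ex1I[of _ \<theta>])
    show "\<theta> \<in> roots X \<and> (\<forall>\<gamma>\<in>roots X. inner_form X \<theta> \<theta> \<le> inner_form X \<gamma> \<gamma>) \<and>
        (\<forall>i\<in>{1..rk X}. 0 \<le> copairing X \<theta> (simple_root i))"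
      using \<theta> min dominant_copairing by simp
    fix \<theta>'
    assume *: "\<theta>' \<in> roots X \<and> (\<forall>\<gamma>\<in>roots X. inner_form X \<theta>' \<theta>' \<le> inner_form X \<gamma> \<gamma>) \<and>
        (\<forall>i\<in>{1..rk X}. 0 \<le> copairing X \<theta>' (simple_root i))"
    then have \<theta>': "\<theta>' \<in> roots X" and "inner_form X \<theta>' \<theta>' \<le> inner_form X \<theta> \<theta>" using \<theta>(1) by blast+
    moreover have "inner_form X \<theta> \<theta> \<le> inner_form X \<theta>' \<theta>'" using min[OF \<theta>'] \<theta>(3) by simp
    ultimately have "inner_form X \<theta>' \<theta>' = inner_form X \<theta> \<theta>" by simp
    then show "\<theta>' = \<theta>" using dominant_root_unique[of \<theta>' \<theta>] * \<theta> dominant_copairing by blast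
  qed
qed

lemma dominant_short_root: "dominant_short_root X \<in> roots X" "dominant X (dominant_short_root X)"
    "\<gamma> \<in> roots X \<Longrightarrow> inner_form X (dominant_short_root X) (dominant_short_root X) \<le> inner_form X \<gamma> \<gamma>"
  using theI'[OF ex_dominant_short_root] dominant_copairing by (auto simp: dominant_short_root_def)

lemma dominant_short_root_eqI:
  assumes "\<gamma> \<in> roots X" "dominant X \<gamma>" "\<And>\<delta>. \<delta> \<in> roots X \<Longrightarrow> inner_form X \<gamma> \<gamma> \<le> inner_form X \<delta> \<delta>"
  shows "dominant_short_root X = \<gamma>"
  using dominant_root_unique[OF dominant_short_root(1,2) assms(1,2)]
    dominant_short_root(3)[OF assms(1)] assms(3)[OF dominant_short_root(1)] by simp

text \<open>For a left descent \<alpha>_j of \<open>w\<close>, the vector \<open>x\<close> pairs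
  nonnegatively with \<alpha>_j and nonpositively with \<open>w^-1 \<alpha>_j\<close>. The two
  pairings agree because \<open>w\<close> fixes \<open>x\<close>, so both vanish and the letter can
  be stripped.\<close>

lemma stabilizer_word:
  assumes "dominant X x" "reduced_word X u w" "w x = x" "i \<in> set u"
  shows "inner_form X x (simple_root i) = 0"
  using assms(2-4)
proof (induction u arbitrary: w rule: list.induct)
  case (Cons j u)
  note j = reduced_word_Cons[OF Cons.prems(1)]
  have w: "w \<in> weyl_group X" by (rule reduced_word_group[OF Cons.prems(1)])
  have neg: "\<forall>k. 0 \<le> (- winv w (simple_root j)) k"
    using j(3) not_pos_roots weyl_groupD(11)[OF w simple_root_roots[OF j(1)]] by simp
  have "inner_form X x (simple_root j) = inner_form X x (winv w (simple_root j))"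
    using weyl_groupD(5)[OF w, of x "winv w (simple_root j)"] Cons.prems(2) by (simp add: weyl_groupD(6)[OF w])
  moreover have "inner_form X x (- winv w (simple_root j)) \<ge> 0"
    using dominant_inner_nonneg[OF assms(1)] neg by blast
  ultimately have j0: "inner_form X x (simple_root j) = 0"
    using dominantD[OF assms(1) j(1)] by (simp add: inner_form_uminus del: uminus_apply)
  then have "refl_s X j x = x"
    using copairing_simple[OF j(1), of x] sq_length_bounds(1)[of X j] by (simp add: reflection_eq fun_eq_iff)
  then have "(refl_s X j \<circ> w) x = x" using Cons.prems(2) by simp
  then show ?case using Cons.IH[OF j(2)] j0 Cons.prems(3) by auto
qed simp

section \<open>The longest element and the opposition involution\<close>

lemma weyl_expand:
  assumes w: "w \<in> weyl_group X" and supp: "\<And>k. k \<notin> {1..rk X} \<Longrightarrow> x k = 0"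
  shows "w x k = (\<Sum>i\<in>{1..rk X}. x i * w (simple_root i) k)"
proof -
  have step: "w (\<lambda>k. if k \<in> S then x k else 0) = (\<lambda>k. \<Sum>i\<in>S. x i * w (simple_root i) k)" if "finite S" for S
    using that
  proof (induction S rule: finite_induct)
    case empty
    have "w (scl 0 0) = scl 0 (w 0)" by (rule weyl_groupD(2)[OF w])
    then show ?case by (simp add: scl_def zero_fun_def)
  next
    case (insert a S)
    have "(\<lambda>k. if k \<in> insert a S then x k else 0) = scl (x a) (simple_root a) + (\<lambda>k. if k \<in> S then x k else 0)"
      using insert.hyps by (auto simp: fun_eq_iff simple_root_def)
    then have "w (\<lambda>k. if k \<in> insert a S then x k else 0) = scl (x a) (w (simple_root a)) + w (\<lambda>k. if k \<in> S then x k else 0)"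
      by (simp only: weyl_groupD(1,2)[OF w])
    then show ?case using insert by (simp add: fun_eq_iff)
  qed
  have "(\<lambda>k. if k \<in> {1..rk X} then x k else 0) = x" using supp by auto
  from step[OF finite_atLeastAtMost, of 1 "rk X", unfolded this] show ?thesis by simp
qed

lemma weyl_expand_root:
  assumes "w \<in> weyl_group X" "\<gamma> \<in> pos_roots X"
  shows "w \<gamma> k = (\<Sum>i\<in>{1..rk X}. \<gamma> i * w (simple_root i) k)"
  by (rule weyl_expand[OF assms(1)]) (rule roots_support[OF pos_rootsD(1)[OF assms(2)]])

lemma ninv_zero: "w \<in> weyl_group X \<Longrightarrow> ninv X w = 0 \<Longrightarrow> w = id"
  using ex_word_ninv[of w] by (metis length_0_conv weyl_elt_simps(1))

text \<open>An element with the largest number of inversions works: if it kept \<alpha>_i positive,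
  then multiplying by \<open>s_i\<close> on the right would add one. Linearity extends negativity
  from simple to positive roots.\<close>

lemma ex_longest: "\<exists>w\<in>weyl_group X. \<forall>\<gamma>\<in>pos_roots X. w \<gamma> \<notin> pos_roots X"
proof -
  have bound: "ninv X w \<le> card (pos_roots X)" for w
    unfolding ninv_def by (rule card_mono[OF finite_pos_roots]) blast
  define n where "n = Max (ninv X ` weyl_group X)"
  have fin: "finite (ninv X ` weyl_group X)"
    by (rule finite_subset[of _ "{..card (pos_roots X)}"]) (use bound in blast, simp)
  have "n \<in> ninv X ` weyl_group X"
    unfolding n_def using fin weyl_group_intros(1) by (intro Max_in) auto
  then obtain w where w: "w \<in> weyl_group X" "ninv X w = n" by auto
  have simple: "w (simple_root i) \<notin> pos_roots X" if i: "i \<in> {1..rk X}" for i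
  proof
    assume pos: "w (simple_root i) \<in> pos_roots X"
    have s: "refl_s X i \<in> weyl_group X" by (rule weyl_group_intros(2)[OF i])
    have "ninv X (w \<circ> refl_s X i) = ninv X w + ninv X (refl_s X i)"
    proof (rule ninv_comp[OF w(1) s])
      fix \<gamma> assume "\<gamma> \<in> pos_roots X" "refl_s X i \<gamma> \<notin> pos_roots X"
      then have "\<gamma> = simple_root i" using simple_reflection_pos[OF _ i] by blast
      then show "w (refl_s X i \<gamma>) \<notin> pos_roots X"
        using pos pos_roots_uminus[OF pos_rootsD(1)[OF pos]]
        by (simp add: simple_reflection_simple[OF i] weyl_groupD(3)[OF w(1)] del: uminus_apply)
    qed
    moreover have "ninv X (refl_s X i) = Suc 0"
      using ninv_refl(1)[OF i weyl_group_intros(1)] simple_root_pos[OF i] by (simp add: ninv_id)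
    moreover have "ninv X (w \<circ> refl_s X i) \<le> n"
      unfolding n_def using weyl_group_comp[OF w(1) s] fin by (intro Max_ge) auto
    ultimately show False using w by simp
  qed
  have "w \<gamma> \<notin> pos_roots X" if \<gamma>: "\<gamma> \<in> pos_roots X" for \<gamma>
  proof -
    have "\<forall>k. w (simple_root i) k \<le> 0" if "i \<in> {1..rk X}" for i
      using simple[OF that] not_pos_roots weyl_groupD(9)[OF w(1) simple_root_roots[OF that]] by blast
    then have "w \<gamma> k \<le> 0" for k
      unfolding weyl_expand_root[OF w(1) \<gamma>]
      using pos_rootsD(2)[OF \<gamma>] by (intro sum_nonpos) (simp add: mult_nonneg_nonpos)
    then show ?thesis using not_pos_roots weyl_groupD(9)[OF w(1) pos_rootsD(1)[OF \<gamma>]] by blast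
  qed
  with w(1) show ?thesis by blast
qed

definition w0 :: "lattice_vec \<Rightarrow> lattice_vec" where
  "w0 = (SOME w. w \<in> weyl_group X \<and> (\<forall>\<gamma>\<in>pos_roots X. w \<gamma> \<notin> pos_roots X))"

lemma w0: "w0 \<in> weyl_group X" "\<gamma> \<in> pos_roots X \<Longrightarrow> w0 \<gamma> \<notin> pos_roots X"
  using someI_ex[of "\<lambda>w. w \<in> weyl_group X \<and> (\<forall>\<gamma>\<in>pos_roots X. w \<gamma> \<notin> pos_roots X)"] ex_longest
  unfolding w0_def by blast+

lemma w0_pos: "\<gamma> \<in> pos_roots X \<Longrightarrow> - w0 \<gamma> \<in> pos_roots X"
  using w0 pos_roots_uminus weyl_groupD(9)[OF w0(1)] pos_rootsD(1) by blast

lemma w0_invol: "w0 (w0 x) = x"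
proof -
  have "w0 (w0 \<gamma>) \<in> pos_roots X" if "\<gamma> \<in> pos_roots X" for \<gamma>
    using w0_pos[OF w0_pos[OF that]] by (simp add: weyl_groupD(3)[OF w0(1)] del: uminus_apply)
  then have "{\<gamma> \<in> pos_roots X. (w0 \<circ> w0) \<gamma> \<notin> pos_roots X} = {}" by simp
  then have "ninv X (w0 \<circ> w0) = 0" unfolding ninv_def by (simp only: card.empty)
  then have "w0 \<circ> w0 = id" by (rule ninv_zero[OF weyl_group_comp[OF w0(1) w0(1)]])
  from fun_cong[OF this, of x] show ?thesis by simp
qed

text \<open>\<open>- w0\<close> is an involution that preserves the positive roots, all of height at
  least 1. With \<beta> the image of \<alpha>_i, applying it to the expansion of \<beta> shows that
  the height 1 of \<alpha>_i is at least the height of \<beta>.\<close>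

lemma w0_simple:
  assumes i: "i \<in> {1..rk X}"
  shows "\<exists>j\<in>{1..rk X}. w0 (simple_root i) = - simple_root j"
proof -
  let ?I = "{1..rk X}"
  define ht where "ht x = (\<Sum>k\<in>?I. x k)" for x :: lattice_vec
  define \<beta> where "\<beta> = - w0 (simple_root i)"
  have \<beta>: "\<beta> \<in> pos_roots X" using w0_pos[OF simple_root_pos[OF i]] by (simp add: \<beta>_def)
  have ht_pos: "ht \<gamma> \<ge> 1" if g: "\<gamma> \<in> pos_roots X" for \<gamma>
  proof -
    obtain k where k: "k \<in> ?I" "\<gamma> k \<noteq> 0" using root_nonzero[OF pos_rootsD(1)[OF g]] by blast
    have "\<gamma> k \<le> ht \<gamma>"
      unfolding ht_def by (rule member_le_sum[OF k(1)]) (use pos_rootsD(2)[OF g] in simp_all)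
    then show ?thesis using pos_rootsD(2)[OF g, of k] k(2) by linarith
  qed
  have expand: "simple_root i k = (\<Sum>j\<in>?I. \<beta> j * (- w0 (simple_root j)) k)" for k
  proof -
    have "simple_root i = - w0 \<beta>"
      by (simp add: \<beta>_def weyl_groupD(3)[OF w0(1)] w0_invol del: uminus_apply)
    then have "simple_root i k = - w0 \<beta> k" by simp
    then show ?thesis
      unfolding weyl_expand_root[OF w0(1) \<beta>] by (simp add: sum_negf)
  qed
  have "ht (simple_root i) = (\<Sum>k\<in>?I. \<Sum>j\<in>?I. \<beta> j * (- w0 (simple_root j)) k)"
    unfolding ht_def by (rule sum.cong[OF HOL.refl], rule expand)
  also have "\<dots> = (\<Sum>j\<in>?I. \<Sum>k\<in>?I. \<beta> j * (- w0 (simple_root j)) k)"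
    by (rule sum.swap)
  also have "\<dots> = (\<Sum>j\<in>?I. \<beta> j * ht (- w0 (simple_root j)))"
    unfolding ht_def sum_distrib_left ..
  finally have "ht (simple_root i) = (\<Sum>j\<in>?I. \<beta> j * ht (- w0 (simple_root j)))" .
  moreover have "(\<Sum>j\<in>?I. \<beta> j * ht (- w0 (simple_root j))) \<ge> (\<Sum>j\<in>?I. \<beta> j * 1)"
    using ht_pos[OF w0_pos[OF simple_root_pos]] pos_rootsD(2)[OF \<beta>]
    by (intro sum_mono mult_left_mono) auto
  moreover have "ht (simple_root i) = 1"
    unfolding ht_def using i by (simp add: simple_root_def)
  ultimately have ht: "ht \<beta> \<le> 1" by (simp add: ht_def)
  obtain j where j: "j \<in> ?I" "\<beta> j \<noteq> 0" using root_nonzero[OF pos_rootsD(1)[OF \<beta>]] by blast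
  have "\<beta> k = 0" if "k \<noteq> j" for k
  proof (cases "k \<in> ?I")
    case True
    have "ht \<beta> = \<beta> j + (\<beta> k + (\<Sum>l\<in>?I - {j} - {k}. \<beta> l))"
      unfolding ht_def using j(1) True that by (subst sum.remove[of _ j], simp, simp, subst sum.remove[of _ k]) auto
    moreover have "0 \<le> (\<Sum>l\<in>?I - {j} - {k}. \<beta> l)" using pos_rootsD(2)[OF \<beta>] by (intro sum_nonneg) auto
    ultimately show ?thesis using ht j(2) pos_rootsD(2)[OF \<beta>, of j] pos_rootsD(2)[OF \<beta>, of k] by linarith
  next
    case False
    then show ?thesis by (rule roots_support[OF pos_rootsD(1)[OF \<beta>]])
  qed
  then have "\<beta> = simple_root j" by (rule multiple_simple_root[OF \<beta> j(1)])
  then have "w0 (simple_root i) = - simple_root j" unfolding \<beta>_def by (metis minus_minus)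
  then show ?thesis using j(1) by blast
qed

text \<open>The diagram automorphism induced by \<open>- w0\<close>; it measures how far
  \<open>w0\<close> is from -1.\<close>

definition opp :: "nat \<Rightarrow> nat" where
  "opp i = (SOME j. j \<in> {1..rk X} \<and> w0 (simple_root i) = - simple_root j)"

lemma opp: "i \<in> {1..rk X} \<Longrightarrow> opp i \<in> {1..rk X}" "i \<in> {1..rk X} \<Longrightarrow> w0 (simple_root i) = - simple_root (opp i)"
  using someI_ex[of "\<lambda>j. j \<in> {1..rk X} \<and> w0 (simple_root i) = - simple_root j"] w0_simple[of i]
  unfolding opp_def by blast+

lemma simple_root_inj: "simple_root i = simple_root j \<Longrightarrow> i = j"
  by (metis simple_root_apply zero_neq_one)

lemma opp_opp: "i \<in> {1..rk X} \<Longrightarrow> opp (opp i) = i"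
proof -
  assume i: "i \<in> {1..rk X}"
  have "simple_root i = w0 (- simple_root (opp i))" using w0_invol[of "simple_root i"] opp(2)[OF i] by simp
  also have "\<dots> = simple_root (opp (opp i))"
    using opp(2)[OF opp(1)[OF i]] by (simp add: weyl_groupD(3)[OF w0(1)] del: uminus_apply)
  finally show ?thesis using simple_root_inj by metis
qed

lemma opp_gram:
  assumes "i \<in> {1..rk X}" "j \<in> {1..rk X}"
  shows "gram X (opp i) (opp j) = gram X i j"
  using weyl_groupD(5)[OF w0(1), of "simple_root i" "simple_root j"] assms
    inner_form_simple_roots[OF opp(1)[OF assms(1)] opp(1)[OF assms(2)]]
  by (simp add: opp inner_form_uminus inner_form_simple_roots del: atLeastAtMost_iff uminus_apply)

lemma w0_minus_one:
  assumes "\<And>i. i \<in> {1..rk X} \<Longrightarrow> opp i = i" "\<And>k. k \<notin> {1..rk X} \<Longrightarrow> x k = 0"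
  shows "w0 x = - x"
proof
  fix k
  have "w0 x k = (\<Sum>i\<in>{1..rk X}. x i * w0 (simple_root i) k)" by (rule weyl_expand[OF w0(1) assms(2)])
  also have "\<dots> = (\<Sum>i\<in>{1..rk X}. if i = k then - x i else 0)"
    using opp(2) assms(1) by (intro sum.cong HOL.refl) (auto simp: simple_root_def)
  finally show "w0 x k = (- x) k" using assms(2)[of k] by simp
qed

text \<open>\<open>- w0\<close> preserves the set of roots and their coordinatewise order, so it
  fixes the maximum. In contrast to \<open>w0 = -1\<close>, this holds in every type.\<close>

lemma w0_highest_root: "w0 (highest_root X) = - highest_root X"
proof -
  let ?\<theta> = "highest_root X"
  have "- w0 ?\<theta> = ?\<theta>"
  proof (rule highest_root_unique)
    show "- w0 ?\<theta> \<in> roots X" using roots_uminus weyl_groupD(9)[OF w0(1) highest_root(1)] by blast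
    fix \<gamma> k assume \<gamma>: "\<gamma> \<in> roots X"
    define \<delta> where "\<delta> = ?\<theta> - (- w0 \<gamma>)"
    have \<gamma>': "- w0 \<gamma> \<in> roots X" using roots_uminus weyl_groupD(9)[OF w0(1) \<gamma>] by blast
    have "0 \<le> \<delta> i" for i using highest_root(2)[OF \<gamma>', of i] by (simp add: \<delta>_def)
    moreover have "\<delta> i = 0" if "i \<notin> {1..rk X}" for i
      using roots_support[OF highest_root(1) that] roots_support[OF \<gamma>' that] by (simp add: \<delta>_def)
    ultimately have "0 \<le> (- w0 \<delta>) k"
      using weyl_expand[OF w0(1), of \<delta> k] pos_rootsD(2)[OF w0_pos[OF simple_root_pos], of _ k]
      by (auto intro!: sum_nonpos mult_nonneg_nonpos)
    also have "- w0 \<delta> = - w0 ?\<theta> - \<gamma>"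
      by (simp add: \<delta>_def weyl_groupD(1,3,4)[OF w0(1)] w0_invol del: uminus_apply)
    finally show "\<gamma> k \<le> (- w0 ?\<theta>) k" by simp
  qed
  then show ?thesis by (metis minus_minus)
qed

end

section \<open>Lifts of Weyl group elements to Artin groups\<close>

primrec alt :: "nat \<Rightarrow> nat \<Rightarrow> nat \<Rightarrow> nat list" where
  "alt 0 i j = []"
| "alt (Suc m) i j = i # alt m j i"

lemma alt_snoc: "alt (Suc m) i j = alt m i j @ [if even m then i else j]"
  by (induction m arbitrary: i j) auto

lemma length_alt [simp]: "length (alt m i j) = m"
  by (induction m arbitrary: i j) auto

lemma set_alt: "set (alt m i j) \<subseteq> {i, j}"
proof (induction m arbitrary: i j)
  case (Suc m)
  then show ?case using Suc[of j i] by auto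
qed simp

lemma alt_numeral [simp]: "alt (numeral n) i j = i # alt (pred_numeral n) j i"
  by (simp add: numeral_eq_Suc)

definition coxeter_m :: "cartan_type \<Rightarrow> nat \<Rightarrow> nat \<Rightarrow> nat" where
  "coxeter_m X i j = braid_length (nat (copairing X (simple_root i) (simple_root j) *
     copairing X (simple_root j) (simple_root i)))"

definition rank2 :: "nat \<Rightarrow> nat \<Rightarrow> int \<Rightarrow> int \<Rightarrow> lattice_vec" where
  "rank2 i j p q = scl p (simple_root i) + scl q (simple_root j)"

text \<open>The summand \<open>x\<close> lets a computation with two coordinates prove identities of
  maps on the whole lattice, not only on the plane of the two simple roots.\<close>

lemma rank2_refl:
  assumes "i \<in> {1..rk X}" "j \<in> {1..rk X}"
  shows "refl_s X i (x + rank2 i j p q) =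
      x + rank2 i j (- p - copairing X (simple_root j) (simple_root i) * q - copairing X x (simple_root i)) q"
    "refl_s X j (x + rank2 i j p q) =
      x + rank2 i j p (- q - copairing X (simple_root i) (simple_root j) * p - copairing X x (simple_root j))"
proof -
  have "copairing X (x + rank2 i j p q) (simple_root i) =
      copairing X x (simple_root i) + 2 * p + q * copairing X (simple_root j) (simple_root i)"
    "copairing X (x + rank2 i j p q) (simple_root j) =
      copairing X x (simple_root j) + p * copairing X (simple_root i) (simple_root j) + 2 * q"
    using assms by (simp_all add: rank2_def copairing_simple_linear copairing_self)
  then show "refl_s X i (x + rank2 i j p q) =
      x + rank2 i j (- p - copairing X (simple_root j) (simple_root i) * q - copairing X x (simple_root i)) q"
    "refl_s X j (x + rank2 i j p q) =
      x + rank2 i j p (- q - copairing X (simple_root i) (simple_root j) * p - copairing X x (simple_root j))"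
    by (simp_all add: reflection_eq fun_eq_iff rank2_def algebra_simps)
qed

lemma rank2_refl0:
  assumes "i \<in> {1..rk X}" "j \<in> {1..rk X}"
  shows "refl_s X i (rank2 i j p q) = rank2 i j (- p - copairing X (simple_root j) (simple_root i) * q) q"
    "refl_s X j (rank2 i j p q) = rank2 i j p (- q - copairing X (simple_root i) (simple_root j) * p)"
  using rank2_refl[OF assms, of 0 p q] copairing_simple_linear(2)[OF assms(1), of 0 0]
    copairing_simple_linear(2)[OF assms(2), of 0 0]
  by (simp_all add: scl_def zero_fun_def[symmetric])

lemma cartan_cases:
  assumes "i \<in> {1..rk X}" "j \<in> {1..rk X}" "i \<noteq> j"
  shows "(copairing X (simple_root i) (simple_root j), copairing X (simple_root j) (simple_root i))
    \<in> {(0, 0), (- 1, - 1), (- 1, - 2), (- 2, - 1), (- 1, - 3), (- 3, - 1)}"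
proof -
  have 1: "copairing X (simple_root i) (simple_root j) * sq_length X j = 2 * gram X i j"
    using copairing_simple[OF assms(2), of "simple_root i"] inner_form_simple_roots[OF assms(1,2)] by simp
  have 2: "copairing X (simple_root j) (simple_root i) * sq_length X i = 2 * gram X i j"
    using copairing_simple[OF assms(1), of "simple_root j"] inner_form_simple_roots[OF assms(2,1)] gram_sym[of X i j] by simp
  have gram: "2 * gram X i j = 0 \<or> gram X i j = - (max (sq_length X i) (sq_length X j) div 2)"
    using assms(3) by (simp add: gram_def)
  have len: "(sq_length X i = 2 \<or> sq_length X i = 4) \<and> (sq_length X j = 2 \<or> sq_length X j = 4) \<or>
      (sq_length X i = 2 \<or> sq_length X i = 6) \<and> (sq_length X j = 2 \<or> sq_length X j = 6)"
    using sq_length_cases[of X] by blast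
  show ?thesis using 1 2 gram len by (elim disjE conjE) auto
qed

definition cone2 :: "nat \<Rightarrow> nat \<Rightarrow> lattice_vec set" where
  "cone2 i j = {rank2 i j p q | p q. p \<ge> 0 \<and> q \<ge> 0}"

lemma cone2I [simp]: "p \<ge> 0 \<Longrightarrow> q \<ge> 0 \<Longrightarrow> rank2 i j p q \<in> cone2 i j"
  by (auto simp: cone2_def)

lemma rank2_simple: "simple_root i = rank2 i j 1 0" "simple_root j = rank2 i j 0 1"
  by (simp_all add: rank2_def fun_eq_iff)

text \<open>Finite computations over the six possible pairs of Cartan integers. The second part runs
  through the positive roots of the rank 2 subsystem, which are the inversions of the alternating
  word.\<close>

lemma dihedral:
  assumes "i \<in> {1..rk X}" "j \<in> {1..rk X}" "i \<noteq> j"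
  shows "weyl_elt X (alt (coxeter_m X i j) i j) = weyl_elt X (alt (coxeter_m X i j) j i)"
    and "k < coxeter_m X i j \<Longrightarrow> weyl_elt X (alt k i j) (simple_root (if even k then i else j)) \<in> cone2 i j"
proof -
  define a b where "a = copairing X (simple_root i) (simple_root j)" and "b = copairing X (simple_root j) (simple_root i)"
  have cases: "a = 0 \<and> b = 0 \<or> a = -1 \<and> b = -1 \<or> a = -1 \<and> b = -2 \<or> a = -2 \<and> b = -1 \<or> a = -1 \<and> b = -3 \<or> a = -3 \<and> b = -1"
    using cartan_cases[OF assms] by (simp add: a_def b_def)
  note r = rank2_refl[OF assms(1,2), folded a_def b_def] and r0 = rank2_refl0[OF assms(1,2), folded a_def b_def]
  have m: "coxeter_m X i j = braid_length (nat (a * b))" by (simp add: coxeter_m_def a_def b_def)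
  have "weyl_elt X (alt (coxeter_m X i j) i j) (x + rank2 i j 0 0) =
      weyl_elt X (alt (coxeter_m X i j) j i) (x + rank2 i j 0 0)" for x
    using cases by (elim disjE) (simp_all add: m braid_length_def r algebra_simps)
  moreover have "x + rank2 i j 0 0 = x" for x by (simp add: rank2_def fun_eq_iff)
  ultimately show "weyl_elt X (alt (coxeter_m X i j) i j) = weyl_elt X (alt (coxeter_m X i j) j i)"
    by (simp add: fun_eq_iff)
  have *: "weyl_elt X (alt k i j) (rank2 i j (if even k then 1 else 0) (if even k then 0 else 1)) \<in> cone2 i j"
    if "k < coxeter_m X i j"
  proof -
    have "k < 6" using that cases by (elim disjE) (auto simp: m braid_length_def)
    then have "k = 0 \<or> k = 1 \<or> k = 2 \<or> k = 3 \<or> k = 4 \<or> k = 5" by linarith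
    then show ?thesis
      using cases that by (elim disjE) (simp_all add: m braid_length_def r0)
  qed
  then show "k < coxeter_m X i j \<Longrightarrow> weyl_elt X (alt k i j) (simple_root (if even k then i else j)) \<in> cone2 i j"
    using rank2_simple(1)[of i j] rank2_simple(2)[of j i] by (cases "even k") metis+
qed

lemma (in root_system) cone2_neg:
  assumes v: "v \<in> weyl_group X" and ij: "i \<in> {1..rk X}" "j \<in> {1..rk X}"
    and neg: "v (simple_root i) \<notin> pos_roots X" "v (simple_root j) \<notin> pos_roots X"
    and x: "x \<in> cone2 i j" "x \<in> roots X"
  shows "v x \<notin> pos_roots X"
proof -
  obtain p q where pq: "x = rank2 i j p q" "p \<ge> 0" "q \<ge> 0" using x(1) by (auto simp: cone2_def)
  have "\<forall>k. v (simple_root i) k \<le> 0" "\<forall>k. v (simple_root j) k \<le> 0"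
    using neg not_pos_roots weyl_groupD(9)[OF v] simple_root_roots ij by blast+
  moreover have "v x = scl p (v (simple_root i)) + scl q (v (simple_root j))"
    by (simp only: pq(1) rank2_def weyl_groupD(1,2)[OF v])
  ultimately have "\<forall>k. v x k \<le> 0"
    using pq(2,3) by (simp add: add_nonpos_nonpos mult_nonneg_nonpos)
  then show ?thesis using not_pos_roots weyl_groupD(9)[OF v x(2)] by blast
qed

text \<open>The alternating word is split off letter by letter. The root of the next letter, carried
  back by the letters so far, lies in the cone of the two simple roots, where \<open>w^-1\<close>
  takes negative values; so that letter is a left descent of the rest.\<close>

lemma (in root_system) reduced_word_dihedral:
  assumes w: "w \<in> weyl_group X" and ij: "i \<in> {1..rk X}" "j \<in> {1..rk X}" "i \<noteq> j"
    and neg: "winv w (simple_root i) \<notin> pos_roots X" "winv w (simple_root j) \<notin> pos_roots X"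
  shows "\<exists>z. reduced_word X (alt (coxeter_m X i j) i j @ z) w"
proof -
  have "\<exists>z. reduced_word X (alt k i j @ z) w" if "k \<le> coxeter_m X i j" for k
    using that
  proof (induction k)
    case 0
    then show ?case using ex_reduced_word[OF w] by simp
  next
    case (Suc k)
    then obtain z where z: "reduced_word X (alt k i j @ z) w" by auto
    define a where "a = (if even k then i else j)"
    have a: "a \<in> {1..rk X}" using ij by (simp add: a_def)
    have words: "alt k i j \<in> weyl_words X" "z \<in> weyl_words X" using z by (auto simp: reduced_word_iff)
    define v where "v = weyl_elt X z"
    have v: "v \<in> weyl_group X" unfolding v_def by (rule weyl_group_intros(3)[OF words(2)])
    have w_eq: "w = weyl_elt X (alt k i j) \<circ> v" using z by (simp add: reduced_word_iff weyl_elt_append v_def)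
    have "winv v (simple_root a) = winv w (weyl_elt X (alt k i j) (simple_root a))"
    proof -
      have "w (winv v (simple_root a)) = weyl_elt X (alt k i j) (simple_root a)"
        by (simp add: w_eq weyl_groupD(6)[OF v])
      then show ?thesis using weyl_groupD(7)[OF w] by metis
    qed
    then have neg': "winv v (simple_root a) \<notin> pos_roots X"
      using cone2_neg[OF weyl_group_inv[OF w] ij(1,2) neg] dihedral(2)[OF ij, of k] Suc.prems
        roots_weyl[OF words(1) simple_root_roots[OF a]] by (simp add: a_def)
    \<comment> \<open>The rest is reduced, since a shorter word for \<open>v\<close> would shorten a
      reduced word of \<open>w\<close>.\<close>
    have "ninv X v = length z"
    proof -
      have "ninv X v \<le> length z" unfolding v_def by (rule ninv_le_length[OF words(2)])
      moreover obtain z' where z': "reduced_word X z' v" using ex_reduced_word[OF v] by blast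
      then have "weyl_elt X (alt k i j @ z') = w" "length z' = ninv X v" "alt k i j @ z' \<in> weyl_words X"
        using words by (auto simp: reduced_word_iff weyl_elt_append w_eq)
      then have "ninv X w \<le> k + ninv X v" using ninv_le_length[of "alt k i j @ z'"] by simp
      moreover have "ninv X w = k + length z" using z by (simp add: reduced_word_iff)
      ultimately show ?thesis by simp
    qed
    moreover obtain z' where z': "reduced_word X z' (refl_s X a \<circ> v)"
      using ex_reduced_word weyl_group_comp[OF weyl_group_intros(2)[OF a] v] by blast
    ultimately have r: "reduced_word X (a # z') v" "length (a # z') = length z"
      using reduced_word_ConsI[OF v a neg' z'] by (auto simp: reduced_word_iff)
    then have "reduced_word X (alt k i j @ a # z') w"
      using z words by (auto simp: reduced_word_iff weyl_elt_append w_eq simp del: weyl_elt_simps)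
    then have "reduced_word X (alt (Suc k) i j @ z') w"
      by (simp add: alt_snoc a_def del: alt.simps)
    then show ?case ..
  qed
  then show ?thesis by blast
qed

text \<open>Formulated for any elements satisfying the braid relations, so that it applies to the
  images of the generators in the larger group.\<close>

locale artin = root_system X + group G for X and G (structure) +
  fixes \<tau> :: "nat \<Rightarrow> 'a"
  assumes \<tau>: "i \<in> {1..rk X} \<Longrightarrow> \<tau> i \<in> carrier G"
    and braid: "\<lbrakk>i \<in> {1..rk X}; j \<in> {1..rk X}; i \<noteq> j\<rbrakk> \<Longrightarrow>
      foldr (\<lambda>i x. \<tau> i \<otimes> x) (alt (coxeter_m X i j) i j) \<one> = foldr (\<lambda>i x. \<tau> i \<otimes> x) (alt (coxeter_m X i j) j i) \<one>"
begin

definition prodw :: "nat list \<Rightarrow> 'a" where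
  "prodw u = foldr (\<lambda>i x. \<tau> i \<otimes> x) u \<one>"

lemma prodw_simps [simp]: "prodw [] = \<one>" "prodw (i # u) = \<tau> i \<otimes> prodw u"
  by (simp_all add: prodw_def)

lemma prodw_closed [simp]: "u \<in> weyl_words X \<Longrightarrow> prodw u \<in> carrier G"
  by (induction u rule: list.induct) (simp_all add: \<tau>)

lemma prodw_append: "u \<in> weyl_words X \<Longrightarrow> v \<in> weyl_words X \<Longrightarrow> prodw (u @ v) = prodw u \<otimes> prodw v"
  by (induction u rule: list.induct) (simp_all add: \<tau> m_assoc)

text \<open>Induction on the length. Two words with different first letters are both compared with
  words that start with the full alternating words in these letters and continue with a common
  rest.\<close>

theorem matsumoto:
  assumes "reduced_word X u w" "reduced_word X v w"
  shows "prodw u = prodw v"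
  using assms
proof (induction "length u" arbitrary: u v w)
  case 0
  then have "length v = 0" unfolding reduced_word_iff by metis
  then show ?case using 0 by simp
next
  case (Suc n)
  have wW: "w \<in> weyl_group X" using Suc.prems(1) weyl_group_intros(3) by (auto simp: reduced_word_iff)
  have len: "length v = length u" using Suc.prems by (auto simp: reduced_word_iff)
  obtain i u' where u: "u = i # u'" using Suc.hyps(2) by (cases u) auto
  obtain j v' where v: "v = j # v'" using Suc.hyps(2) len by (cases v) auto
  note i = reduced_word_Cons[OF Suc.prems(1)[unfolded u]] and j = reduced_word_Cons[OF Suc.prems(2)[unfolded v]]
  show ?case
  proof (cases "i = j")
    case True
    then have "prodw u' = prodw v'" using Suc.hyps(1)[of u' "refl_s X i \<circ> w" v'] Suc.hyps(2) i j u by simp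
    then show ?thesis using True by (simp add: u v)
  next
    case False
    obtain z where z: "reduced_word X (alt (coxeter_m X i j) i j @ z) w"
      using reduced_word_dihedral[OF wW i(1) j(1) False i(3) j(3)] by blast
    have zw: "z \<in> weyl_words X" and ijw: "alt (coxeter_m X i j) i j \<in> weyl_words X" using z by (auto simp: reduced_word_iff)
    have jiw: "alt (coxeter_m X i j) j i \<in> weyl_words X"
      using set_alt[of "coxeter_m X i j" j i] i(1) j(1) by (auto simp: in_lists_conv_set)
    then have z': "reduced_word X (alt (coxeter_m X i j) j i @ z) w"
      using z zw dihedral(1)[OF i(1) j(1) False] by (auto simp: reduced_word_iff weyl_elt_append)
    have "coxeter_m X i j \<noteq> 0" by (simp add: coxeter_m_def braid_length_def)
    then obtain m where m: "coxeter_m X i j = Suc m" using not0_implies_Suc by blast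
    have "prodw u = prodw (alt (coxeter_m X i j) i j @ z)"
    proof -
      have "reduced_word X (alt m j i @ z) (refl_s X i \<circ> w)" using reduced_word_Cons(2) z by (simp add: m)
      then show ?thesis using Suc.hyps(1)[OF _ i(2)] Suc.hyps(2) by (simp add: u m)
    qed
    also have "\<dots> = prodw (alt (coxeter_m X i j) j i @ z)"
      unfolding prodw_append[OF ijw zw] prodw_append[OF jiw zw]
      using braid[OF i(1) j(1) False] by (simp only: prodw_def)
    also have "\<dots> = prodw v"
    proof -
      have "reduced_word X (alt m i j @ z) (refl_s X j \<circ> w)" using reduced_word_Cons(2) z' by (simp add: m)
      then show ?thesis using Suc.hyps(1)[OF _ j(2)] Suc.hyps(2) len by (simp add: u v m)
    qed
    finally show ?thesis .
  qed
qed

definition Tw :: "(lattice_vec \<Rightarrow> lattice_vec) \<Rightarrow> 'a" where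
  "Tw w = prodw (SOME u. reduced_word X u w)"

lemma Tw_reduced: "reduced_word X u w \<Longrightarrow> Tw w = prodw u"
  unfolding Tw_def by (rule matsumoto[of _ w]) (rule someI)

lemma Tw_closed [simp]: "w \<in> weyl_group X \<Longrightarrow> Tw w \<in> carrier G"
proof -
  assume "w \<in> weyl_group X"
  then obtain u where u: "reduced_word X u w" using ex_reduced_word by blast
  then show ?thesis unfolding Tw_reduced[OF u] by (simp add: reduced_word_iff)
qed

lemma Tw_comp:
  assumes "v \<in> weyl_group X" "w \<in> weyl_group X"
    and "\<And>\<gamma>. \<gamma> \<in> pos_roots X \<Longrightarrow> w \<gamma> \<notin> pos_roots X \<Longrightarrow> v (w \<gamma>) \<notin> pos_roots X"
  shows "Tw (v \<circ> w) = Tw v \<otimes> Tw w"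
proof -
  obtain u u' where u: "reduced_word X u v" "reduced_word X u' w" using ex_reduced_word assms(1,2) by metis
  then have r: "reduced_word X (u @ u') (v \<circ> w)" using reduced_word_append ninv_comp[OF assms] by blast
  show ?thesis
    unfolding Tw_reduced[OF u(1)] Tw_reduced[OF u(2)] Tw_reduced[OF r]
    using u by (intro prodw_append) (simp_all add: reduced_word_iff)
qed

lemma Tw_simple:
  assumes i: "i \<in> {1..rk X}"
  shows "Tw (refl_s X i) = \<tau> i"
proof -
  have "ninv X (refl_s X i \<circ> id) = Suc 0"
    using ninv_refl(1)[OF i weyl_group_intros(1)] simple_root_pos[OF i] by (simp add: ninv_id)
  then have "reduced_word X [i] (refl_s X i)" using i by (simp add: reduced_word_iff)
  then show ?thesis using Tw_reduced \<tau>[OF i] by fastforce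
qed

end

section \<open>The Cartan types\<close>

text \<open>Writing \<open>x\<^sub>i = d\<^sub>i y\<^sub>i\<close> and \<open>g\<^sub>i\<^sub>j = d\<^sub>i d\<^sub>j gram\<^sub>i\<^sub>j\<close>, the form is
  \<open>(x, x) = \<Sum>\<^sub>i y\<^sub>i\<^sup>2 (\<Sum>\<^sub>j g\<^sub>i\<^sub>j) - 1/2 \<Sum>\<^sub>i\<^sub>j g\<^sub>i\<^sub>j (y\<^sub>i - y\<^sub>j)\<^sup>2\<close>.\<close>

lemma posdef_criterion:
  fixes d :: "nat \<Rightarrow> int"
  assumes d: "\<And>i. i \<in> {1..rk X} \<Longrightarrow> d i > 0"
    and row: "\<And>i. i \<in> {1..rk X} \<Longrightarrow> 0 \<le> (\<Sum>j\<in>{1..rk X}. d j * gram X j i)"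
    and base: "base \<in> {1..rk X}" "0 < (\<Sum>j\<in>{1..rk X}. d j * gram X j base)"
    and conn: "\<And>Q i j. i \<in> {1..rk X} \<Longrightarrow> Q i \<Longrightarrow>
      (\<And>i j. i \<in> {1..rk X} \<Longrightarrow> j \<in> {1..rk X} \<Longrightarrow> Q i \<Longrightarrow> gram X i j \<noteq> 0 \<Longrightarrow> Q j) \<Longrightarrow>
      j \<in> {1..rk X} \<Longrightarrow> Q j"
    and x: "i \<in> {1..rk X}" "x i \<noteq> 0"
  shows "inner_form X x x > 0"
proof (rule ccontr)
  let ?I = "{1..rk X}"
  define y where "y i = real_of_int (x i) / real_of_int (d i)" for i
  define g where "g i j = real_of_int (gram X i j) * d i * d j" for i j
  have g_sym: "g i j = g j i" for i j by (simp add: g_def gram_sym[of X i j])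
  have xy: "real_of_int (x i) = y i * d i" if "i \<in> ?I" for i using d[OF that] by (simp add: y_def)
  have g_nonpos: "g i j * (y i - y j)\<^sup>2 \<le> 0" if "i \<in> ?I" "j \<in> ?I" for i j
  proof (cases "i = j")
    case False
    then have "g i j \<le> 0"
      using gram_nonpos[OF False, of X] d[OF that(1)] d[OF that(2)]
      by (simp add: g_def mult_nonpos_nonneg)
    then show ?thesis by (simp add: mult_nonpos_nonneg)
  qed simp
  define R where "R i = (\<Sum>j\<in>?I. d j * gram X j i)" for i
  have row': "(\<Sum>j\<in>?I. g j i) = real_of_int (d i) * real_of_int (R i)" for i
    by (simp add: g_def R_def sum_distrib_left mult.commute mult.left_commute)
  have D: "0 \<le> (y i)\<^sup>2 * (\<Sum>j\<in>?I. g j i)" if "i \<in> ?I" for i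
  proof -
    have "0 \<le> R i" "0 < d i" using row[OF that] d[OF that] by (simp_all add: R_def)
    then show ?thesis unfolding row' by simp
  qed
  have t: "2 * (g i j * (y i * y j)) = g i j * (y i)\<^sup>2 + g i j * (y j)\<^sup>2 - g i j * (y i - y j)\<^sup>2" for i j
    by (simp add: power2_eq_square algebra_simps)
  have "real_of_int (inner_form X x x) = (\<Sum>i\<in>?I. \<Sum>j\<in>?I. g i j * (y i * y j))"
    unfolding inner_form_def of_int_sum
    by (intro sum.cong HOL.refl) (simp add: xy g_def)
  then have "2 * real_of_int (inner_form X x x) =
      (\<Sum>i\<in>?I. \<Sum>j\<in>?I. g i j * (y i)\<^sup>2 + g i j * (y j)\<^sup>2 - g i j * (y i - y j)\<^sup>2)"
    by (simp only: sum_distrib_left t)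
  also have "\<dots> = (\<Sum>i\<in>?I. \<Sum>j\<in>?I. g i j * (y i)\<^sup>2) + (\<Sum>i\<in>?I. \<Sum>j\<in>?I. g i j * (y j)\<^sup>2)
      - (\<Sum>i\<in>?I. \<Sum>j\<in>?I. g i j * (y i - y j)\<^sup>2)"
    by (simp only: sum.distrib sum_subtractf)
  also have "(\<Sum>i\<in>?I. \<Sum>j\<in>?I. g i j * (y j)\<^sup>2) = (\<Sum>i\<in>?I. (y i)\<^sup>2 * (\<Sum>j\<in>?I. g j i))"
    by (subst sum.swap) (simp add: sum_distrib_left mult.commute)
  also have "(\<Sum>i\<in>?I. \<Sum>j\<in>?I. g i j * (y i)\<^sup>2) = (\<Sum>i\<in>?I. (y i)\<^sup>2 * (\<Sum>j\<in>?I. g j i))"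
    unfolding sum_distrib_left
    by (intro sum.cong HOL.refl) (use g_sym in \<open>simp add: mult.commute\<close>)
  finally have eq: "2 * real_of_int (inner_form X x x) =
      2 * (\<Sum>i\<in>?I. (y i)\<^sup>2 * (\<Sum>j\<in>?I. g j i)) + (\<Sum>i\<in>?I. \<Sum>j\<in>?I. - (g i j * (y i - y j)\<^sup>2))"
    by (simp add: sum_negf)
  have D_nonneg: "0 \<le> (\<Sum>i\<in>?I. (y i)\<^sup>2 * (\<Sum>j\<in>?I. g j i))" using D by (intro sum_nonneg) auto
  have E_nonneg: "0 \<le> (\<Sum>i\<in>?I. \<Sum>j\<in>?I. - (g i j * (y i - y j)\<^sup>2))"
    using g_nonpos by (intro sum_nonneg) auto
  assume "\<not> inner_form X x x > 0"
  then have "real_of_int (inner_form X x x) \<le> 0" by simp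
  with eq D_nonneg E_nonneg have D0: "(\<Sum>i\<in>?I. (y i)\<^sup>2 * (\<Sum>j\<in>?I. g j i)) = 0"
    and E0: "(\<Sum>i\<in>?I. \<Sum>j\<in>?I. - (g i j * (y i - y j)\<^sup>2)) = 0" by linarith+
  have "(y base)\<^sup>2 * (\<Sum>j\<in>?I. g j base) = 0"
    using D0 D base(1) by (subst (asm) sum_nonneg_eq_0_iff) auto
  moreover have "0 < R base" "0 < d base" using base d by (simp_all add: R_def)
  ultimately have y0: "y base = 0" unfolding row' by simp
  have "y j = 0" if a: "a \<in> ?I" "j \<in> ?I" "y a = 0" "gram X a j \<noteq> 0" for a j
  proof -
    have "(\<Sum>j\<in>?I. - (g a j * (y a - y j)\<^sup>2)) = 0"
      using E0 g_nonpos a(1) by (subst (asm) sum_nonneg_eq_0_iff) (auto intro: sum_nonneg)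
    then have "- (g a j * (y a - y j)\<^sup>2) = 0"
      using g_nonpos a(1,2) by (subst (asm) sum_nonneg_eq_0_iff) auto
    moreover have "g a j \<noteq> 0" using a d[OF a(1)] d[OF a(2)] by (simp add: g_def)
    ultimately show ?thesis using a(3) by simp
  qed
  then have "y i = 0" using conn[of base "\<lambda>i. y i = 0" i] base(1) y0 x(1) by blast
  then show False using xy[OF x(1)] x(2) by simp
qed

text \<open>The function \<open>f\<close> encodes a spanning tree with root \<open>r\<close>; as the
  Gram matrix is symmetric, \<open>Q\<close> travels along its edges in both directions.\<close>

lemma connected_tree:
  fixes f :: "nat \<Rightarrow> nat"
  assumes tree: "\<And>i. i \<in> {1..rk X} \<Longrightarrow> i \<noteq> r \<Longrightarrow> \<exists>j\<in>{1..rk X}. f j < f i \<and> gram X i j \<noteq> 0"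
    and Q: "i \<in> {1..rk X}" "Q i"
      "\<And>i j. i \<in> {1..rk X} \<Longrightarrow> j \<in> {1..rk X} \<Longrightarrow> Q i \<Longrightarrow> gram X i j \<noteq> 0 \<Longrightarrow> Q j"
    and j: "j \<in> {1..rk X}"
  shows "Q j"
proof -
  have eq: "Q a = Q r" if "a \<in> {1..rk X}" for a
    using that
  proof (induction "f a" arbitrary: a rule: less_induct)
    case less
    show ?case
    proof (cases "a = r")
      case False
      then obtain b where b: "b \<in> {1..rk X}" "f b < f a" "gram X a b \<noteq> 0" using tree less.prems by blast
      then have "Q a = Q b" using Q(3)[OF less.prems b(1)] Q(3)[OF b(1) less.prems] gram_sym[of X a b] by metis
      then show ?thesis using less.hyps[OF b(2,1)] by simp
    qed simp
  qed
  show ?thesis using eq[OF Q(1)] eq[OF j] Q(2) by simp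
qed

text \<open>In all uses \<open>d\<close> lists the coordinates of a dominant vector:
  \<open>\<epsilon>_1\<close> in type B, \<open>2 \<epsilon>_1\<close> in type D, and the highest
  root otherwise. The sums in \<open>row\<close> are its inner products with simple roots, and
  \<open>base\<close> is a node where this is positive.\<close>

lemma root_systemI:
  fixes f :: "nat \<Rightarrow> nat" and d :: "nat \<Rightarrow> int"
  assumes tree: "\<And>i. i \<in> {1..rk X} \<Longrightarrow> i \<noteq> r \<Longrightarrow> \<exists>j\<in>{1..rk X}. f j < f i \<and> gram X i j \<noteq> 0"
    and d: "\<And>i. i \<in> {1..rk X} \<Longrightarrow> d i > 0"
    and row: "\<And>i. i \<in> {1..rk X} \<Longrightarrow> 0 \<le> (\<Sum>j\<in>{1..rk X}. d j * gram X j i)"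
    and base: "base \<in> {1..rk X}" "0 < (\<Sum>j\<in>{1..rk X}. d j * gram X j base)"
  shows "root_system X"
proof
  show "{1..rk X} \<noteq> {}" using base(1) by blast
  show "Q j" if "i \<in> {1..rk X}" "Q i"
    "\<And>i j. i \<in> {1..rk X} \<Longrightarrow> j \<in> {1..rk X} \<Longrightarrow> Q i \<Longrightarrow> gram X i j \<noteq> 0 \<Longrightarrow> Q j" "j \<in> {1..rk X}" for Q i j
    by (rule connected_tree[of X r f i Q j, OF tree that])
  show "inner_form X x x > 0" if "i \<in> {1..rk X}" "x i \<noteq> 0" for i x
  proof (rule posdef_criterion[of X d base i x, OF d row base])
    show "Q b" if "a \<in> {1..rk X}" "Q a"
      "\<And>i j. i \<in> {1..rk X} \<Longrightarrow> j \<in> {1..rk X} \<Longrightarrow> Q i \<Longrightarrow> gram X i j \<noteq> 0 \<Longrightarrow> Q j" "b \<in> {1..rk X}" for Q a b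
      by (rule connected_tree[of X r f a Q b, OF tree that])
  qed (use that in simp_all)
qed

lemma sum_chain:
  assumes zero: "\<And>j. j \<in> {1..n} \<Longrightarrow> j \<noteq> i \<Longrightarrow> Suc j \<noteq> i \<Longrightarrow> j \<noteq> Suc i \<Longrightarrow> g j = (0::int)"
    and i: "i \<in> {1..n}"
  shows "(\<Sum>j\<in>{1..n}. g j) = g i + (if 1 < i then g (i - 1) else 0) + (if i < n then g (Suc i) else 0)"
proof -
  have "(\<Sum>j\<in>{1..n}. g j) = (\<Sum>j\<in>{i - 1, i, Suc i} \<inter> {1..n}. g j)"
  proof (rule sum.mono_neutral_right)
    show "\<forall>j\<in>{1..n} - {i - 1, i, Suc i} \<inter> {1..n}. g j = 0"
    proof
      fix j assume j: "j \<in> {1..n} - {i - 1, i, Suc i} \<inter> {1..n}"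
      then have "Suc j \<noteq> i" by auto
      then show "g j = 0" using zero[of j] j by auto
    qed
  qed auto
  also have "\<dots> = g i + (if 1 < i then g (i - 1) else 0) + (if i < n then g (Suc i) else 0)"
  proof -
    obtain k where k: "i = Suc k" using i by (cases i) auto
    show ?thesis using i unfolding k by (cases k; cases "Suc k < n") (auto simp: Int_insert_left)
  qed
  finally show ?thesis .
qed

lemma root_system_A: "n \<ge> 1 \<Longrightarrow> root_system (TypeA n)"
proof (rule root_systemI[where r = 1 and f = id and d = "\<lambda>_. 1" and base = 1])
  assume n: "n \<ge> 1"
  have row: "(\<Sum>j\<in>{1..n}. 1 * gram (TypeA n) j i) = 2 - (if 1 < i then 1 else 0) - (if i < n then 1 else 0)" if "i \<in> {1..n}" for i
    using that by (subst sum_chain[of n i]) (auto simp: gram_def)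
  show "\<exists>j\<in>{1..rk (TypeA n)}. id j < id i \<and> gram (TypeA n) i j \<noteq> 0" if "i \<in> {1..rk (TypeA n)}" "i \<noteq> 1" for i
    using that by (intro bexI[of _ "i - 1"]) (auto simp: gram_def)
  show "0 \<le> (\<Sum>j\<in>{1..rk (TypeA n)}. 1 * gram (TypeA n) j i)" if "i \<in> {1..rk (TypeA n)}" for i
    using row[of i] that by simp
  show "0 < (\<Sum>j\<in>{1..rk (TypeA n)}. 1 * gram (TypeA n) j 1)" using row[of 1] n by simp
qed simp_all

lemma root_system_B: "n \<ge> 2 \<Longrightarrow> root_system (TypeB n)"
proof (rule root_systemI[where r = 1 and f = id and d = "\<lambda>_. 1" and base = 1])
  assume n: "n \<ge> 2"
  have row: "(\<Sum>j\<in>{1..n}. 1 * gram (TypeB n) j i) =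
      (if i < n then 4 else 2) - (if 1 < i then 2 else 0) - (if i < n then 2 else 0)" if "i \<in> {1..n}" for i
    using that n by (subst sum_chain[of n i]) (auto simp: gram_def)
  show "\<exists>j\<in>{1..rk (TypeB n)}. id j < id i \<and> gram (TypeB n) i j \<noteq> 0" if "i \<in> {1..rk (TypeB n)}" "i \<noteq> 1" for i
    using that by (intro bexI[of _ "i - 1"]) (auto simp: gram_def max_def)
  show "0 \<le> (\<Sum>j\<in>{1..rk (TypeB n)}. 1 * gram (TypeB n) j i)" if "i \<in> {1..rk (TypeB n)}" for i
    using row[of i] that by simp
  show "0 < (\<Sum>j\<in>{1..rk (TypeB n)}. 1 * gram (TypeB n) j 1)" using row[of 1] n by simp
qed simp_all

lemma root_system_C: "n \<ge> 2 \<Longrightarrow> root_system (TypeC n)"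
proof (rule root_systemI[where r = 1 and f = id and d = "\<lambda>i. if i < n then 2 else 1" and base = 1])
  assume n: "n \<ge> 2"
  have row: "(\<Sum>j\<in>{1..n}. (if j < n then 2 else 1) * gram (TypeC n) j i) =
      4 - (if 1 < i then (if i < n then 2 else 4) else 0) - (if i < n then 2 else 0)" if "i \<in> {1..n}" for i
    using that n by (subst sum_chain[of n i]) (auto simp: gram_def)
  show "\<exists>j\<in>{1..rk (TypeC n)}. id j < id i \<and> gram (TypeC n) i j \<noteq> 0" if "i \<in> {1..rk (TypeC n)}" "i \<noteq> 1" for i
    using that by (intro bexI[of _ "i - 1"]) (auto simp: gram_def max_def)
  show "0 \<le> (\<Sum>j\<in>{1..rk (TypeC n)}. (if j < n then 2 else 1) * gram (TypeC n) j i)" if "i \<in> {1..rk (TypeC n)}" for i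
    using row[of i] that by simp
  show "0 < (\<Sum>j\<in>{1..rk (TypeC n)}. (if j < n then 2 else 1) * gram (TypeC n) j 1)" using row[of 1] n by simp
qed simp_all

text \<open>Writing the rank as \<open>m + 4\<close> keeps natural subtraction out of the
  fork.\<close>

lemma gram_D:
  "i \<in> {1..m + 4} \<Longrightarrow> j \<in> {1..m + 4} \<Longrightarrow> gram (TypeD (m + 4)) i j =
    (if i = j then 2 else if (j = Suc i \<and> j < m + 4) \<or> (i = Suc j \<and> i < m + 4) \<or> (i = m + 2 \<and> j = m + 4) \<or> (j = m + 2 \<and> i = m + 4)
     then - 1 else 0)"
  by (auto simp: gram_def)

lemma row_D:
  assumes "i \<in> {1..m + 4}"
  shows "(\<Sum>j\<in>{1..m + 4}. d j * gram (TypeD (m + 4)) j i) =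
    2 * d i - (if i = m + 2 then d (m + 1) + d (m + 3) + d (m + 4)
      else if i = m + 3 \<or> i = m + 4 then d (m + 2) else (if 1 < i then d (i - 1) else 0) + d (Suc i))"
proof -
  let ?S = "if i = m + 2 then {m + 1, m + 2, m + 3, m + 4} else if i = m + 3 \<or> i = m + 4 then {m + 2, i}
    else if 1 < i then {i - 1, i, Suc i} else {i, Suc i}"
  have "(\<Sum>j\<in>{1..m + 4}. d j * gram (TypeD (m + 4)) j i) = (\<Sum>j\<in>?S. d j * gram (TypeD (m + 4)) j i)"
    using assms by (intro sum.mono_neutral_right) (auto simp: gram_D split: if_splits)
  also have "\<dots> = 2 * d i - (if i = m + 2 then d (m + 1) + d (m + 3) + d (m + 4)
      else if i = m + 3 \<or> i = m + 4 then d (m + 2) else (if 1 < i then d (i - 1) else 0) + d (Suc i))"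
  proof -
    obtain k where k: "i = Suc k" using assms by (cases i) auto
    show ?thesis using assms unfolding k by (cases k) (auto simp: gram_D)
  qed
  finally show ?thesis .
qed

lemma root_system_D: "n \<ge> 4 \<Longrightarrow> root_system (TypeD n)"
proof -
  assume "n \<ge> 4"
  then obtain m where n: "n = m + 4" using le_Suc_ex by (metis add.commute)
  define d where "d i = (if i < m + 3 then 2 else 1 :: int)" for i
  have row: "(\<Sum>j\<in>{1..m + 4}. d j * gram (TypeD (m + 4)) j i) = (if i = 1 then 2 else 0)" if "i \<in> {1..m + 4}" for i
    unfolding row_D[OF that] using that by (auto simp: d_def)
  show ?thesis
    unfolding n
  proof (rule root_systemI[where r = 1 and f = id and d = d and base = 1])
    show "\<exists>j\<in>{1..rk (TypeD (m + 4))}. id j < id i \<and> gram (TypeD (m + 4)) i j \<noteq> 0"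
      if i: "i \<in> {1..rk (TypeD (m + 4))}" "i \<noteq> 1" for i
    proof -
      obtain k where "i = Suc k" using i by (cases i) auto
      then show ?thesis
        using i by (intro bexI[of _ "if i = m + 4 then m + 2 else k"]) (auto simp: gram_D)
    qed
    show "0 \<le> (\<Sum>j\<in>{1..rk (TypeD (m + 4))}. d j * gram (TypeD (m + 4)) j i)" if "i \<in> {1..rk (TypeD (m + 4))}" for i
      using row[of i] that by simp
    show "0 < (\<Sum>j\<in>{1..rk (TypeD (m + 4))}. d j * gram (TypeD (m + 4)) j 1)" using row[of 1] by simp
  qed (auto simp: d_def)
qed

lemma interval_simps:
  "{1..2::nat} = {1, 2}" "{1..4::nat} = {1, 2, 3, 4}" "{1..6::nat} = {1, 2, 3, 4, 5, 6}"
  "{1..7::nat} = {1, 2, 3, 4, 5, 6, 7}" "{1..8::nat} = {1, 2, 3, 4, 5, 6, 7, 8}"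
  by auto

text \<open>The list is the highest root with a filler at index 0. The function \<open>f\<close>
  increases along the chain 1, 3, 4, 5, 6 and places node 2 just above its neighbour 4; E7 and E8
  are treated in the same way.\<close>

lemma root_system_E6: "root_system (TypeE 6)"
  by (rule root_systemI[where r = 1 and base = 2 and f = "\<lambda>i. if i = 2 then 9 else 2 * i"
        and d = "\<lambda>i. [0, 1, 2, 2, 3, 2, 1] ! i"])
    (simp_all only: rk.simps interval_simps, auto simp: gram_def nth_Cons')

lemma root_system_E7: "root_system (TypeE 7)"
  by (rule root_systemI[where r = 1 and base = 1 and f = "\<lambda>i. if i = 2 then 9 else 2 * i"
        and d = "\<lambda>i. [0, 2, 2, 3, 4, 3, 2, 1] ! i"])
    (simp_all only: rk.simps interval_simps, auto simp: gram_def nth_Cons')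

lemma root_system_E8: "root_system (TypeE 8)"
  by (rule root_systemI[where r = 1 and base = 8 and f = "\<lambda>i. if i = 2 then 9 else 2 * i"
        and d = "\<lambda>i. [0, 2, 3, 4, 6, 5, 4, 3, 2] ! i"])
    (simp_all only: rk.simps interval_simps, auto simp: gram_def nth_Cons')

lemma root_system_F4: "root_system TypeF4"
  by (rule root_systemI[where r = 1 and base = 1 and f = id and d = "\<lambda>i. [0, 2, 3, 4, 2] ! i"])
    (simp_all only: rk.simps interval_simps, auto simp: gram_def nth_Cons')

lemma root_system_G2: "root_system TypeG2"
  by (rule root_systemI[where r = 1 and base = 2 and f = id and d = "\<lambda>i. [0, 3, 2] ! i"])
    (simp_all only: rk.simps interval_simps, auto simp: gram_def nth_Cons')

theorem root_system_valid:
  assumes "valid_datum k X"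
  shows "root_system X"
  using assms root_system_A root_system_B root_system_C root_system_D root_system_E6 root_system_E7
    root_system_E8 root_system_F4 root_system_G2
  by (cases k; cases X) auto

section \<open>The opposition involution\<close>

context root_system
begin

lemma opp_inj: "i \<in> {1..rk X} \<Longrightarrow> j \<in> {1..rk X} \<Longrightarrow> opp i = opp j \<Longrightarrow> i = j"
  using opp_opp by metis

lemma opp_sq_length: "i \<in> {1..rk X} \<Longrightarrow> sq_length X (opp i) = sq_length X i"
  using opp_gram[of i i] by simp

text \<open>\<open>opp i\<close> is again a neighbour of the fixed node \<open>j\<close>. Were it
  different from \<open>i\<close>, it would be fixed, contradicting injectivity.\<close>

lemma opp_fixed_step:
  assumes i: "i \<in> {1..rk X}" and j: "j \<in> {1..rk X}" "opp j = j" "gram X i j \<noteq> 0"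
    and fixed: "\<And>k. k \<in> {1..rk X} \<Longrightarrow> k \<noteq> i \<Longrightarrow> gram X k j \<noteq> 0 \<Longrightarrow> opp k = k"
  shows "opp i = i"
proof (rule ccontr)
  assume "opp i \<noteq> i"
  moreover have "gram X (opp i) j \<noteq> 0" using opp_gram[OF i j(1)] j by simp
  ultimately have "opp (opp i) = opp i" using fixed opp(1)[OF i] by blast
  then show False using opp_opp[OF i] \<open>opp i \<noteq> i\<close> by simp
qed

text \<open>Fixedness spreads downwards from \<open>b\<close>, because \<open>i\<close> is the only
  neighbour below \<open>Suc i\<close>.\<close>

lemma opp_chain:
  assumes b: "b \<in> {1..rk X}"
    and top: "\<And>k. k \<in> {1..rk X} \<Longrightarrow> b \<le> k \<Longrightarrow> opp k = k"
    and chain: "\<And>k. 1 \<le> k \<Longrightarrow> k < b \<Longrightarrow> gram X k (Suc k) \<noteq> 0"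
    and only: "\<And>k l. 1 \<le> k \<Longrightarrow> k < b \<Longrightarrow> l \<in> {1..rk X} \<Longrightarrow> l < k \<Longrightarrow> gram X l (Suc k) = 0"
    and i: "i \<in> {1..rk X}"
  shows "opp i = i"
  using i
proof (induction "b - i" arbitrary: i rule: less_induct)
  case less
  show ?case
  proof (cases "b \<le> i")
    case False
    have fixed: "opp k = k" if "k \<in> {1..rk X}" "i < k" for k
      using less.hyps[of k] top[OF that(1)] that False by (cases "b \<le> k") auto
    have Si: "Suc i \<in> {1..rk X}" using False b less.prems by auto
    show ?thesis
    proof (rule opp_fixed_step[OF less.prems Si])
      show "opp (Suc i) = Suc i" using fixed Si by simp
      show "gram X i (Suc i) \<noteq> 0" using chain[of i] less.prems False by simp
      show "opp k = k" if "k \<in> {1..rk X}" "k \<noteq> i" "gram X k (Suc i) \<noteq> 0" for k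
        using fixed[OF that(1)] only[of i k] that less.prems False by force
    qed
  qed (use top less.prems in blast)
qed

text \<open>Such an \<open>x\<close> is \<open>m\<close> times a weight, so the reflection in
  \<alpha>_i moves it by a multiple of \<open>m \<alpha>_i\<close>.\<close>

lemma weyl_congruent:
  assumes "\<And>i. i \<in> {1..rk X} \<Longrightarrow> m dvd copairing X x (simple_root i)" "w \<in> weyl_group X"
  shows "\<exists>y. w x = x + scl m y"
proof -
  obtain u where u: "u \<in> weyl_words X" "w = weyl_elt X u" using assms(2) by (auto simp: weyl_group_def)
  from u(1) have "\<exists>y. weyl_elt X u x = x + scl m y"
  proof (induction u)
    case Nil
    then show ?case by (intro exI[of _ 0]) (simp add: fun_eq_iff)
  next
    case (Cons i u)
    then obtain y where y: "weyl_elt X u x = x + scl m y" by blast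
    obtain c where c: "copairing X x (simple_root i) = m * c" using assms(1) Cons(1) by (auto elim: dvdE)
    have "weyl_elt X (i # u) x = x + scl m (y - scl (c + copairing X y (simple_root i)) (simple_root i))"
      using Cons(1) by (simp add: y reflection_eq copairing_simple_linear c fun_eq_iff algebra_simps)
    then show ?case by blast
  qed
  then show ?thesis using u(2) by simp
qed

text \<open>By linearity \<open>w0 x\<close> has the coordinate \<open>- x (opp k)\<close> at
  \<open>k\<close>.\<close>

lemma opp_congruent:
  assumes "\<And>i. i \<in> {1..rk X} \<Longrightarrow> m dvd copairing X x (simple_root i)" "\<And>k. k \<notin> {1..rk X} \<Longrightarrow> x k = 0"
    and k: "k \<in> {1..rk X}"
  shows "m dvd x k + x (opp k)"
proof -
  obtain y where y: "w0 x = x + scl m y" using weyl_congruent[OF assms(1) w0(1)] by blast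
  have "w0 x k = (\<Sum>i\<in>{1..rk X}. x i * w0 (simple_root i) k)" by (rule weyl_expand[OF w0(1) assms(2)])
  also have "\<dots> = (\<Sum>i\<in>{1..rk X}. if i = opp k then - x i else 0)"
  proof (intro sum.cong HOL.refl)
    fix i assume i: "i \<in> {1..rk X}"
    have "opp i = k \<longleftrightarrow> i = opp k" using opp_opp[OF i] opp_opp[OF k] by auto
    then show "x i * w0 (simple_root i) k = (if i = opp k then - x i else 0)"
      using opp(2)[OF i] by (auto simp: simple_root_def)
  qed
  also have "\<dots> = - x (opp k)" using opp(1)[OF k] by simp
  finally have "x k + x (opp k) = m * - y k" using fun_cong[OF y, of k] by simp
  then show ?thesis by simp
qed

lemma opp_degree:
  assumes i: "i \<in> {1..rk X}"
  shows "card {j \<in> {1..rk X}. gram X (opp i) j \<noteq> 0} = card {j \<in> {1..rk X}. gram X i j \<noteq> 0}"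
proof -
  have "{j \<in> {1..rk X}. gram X (opp i) j \<noteq> 0} = opp ` {j \<in> {1..rk X}. gram X i j \<noteq> 0}"
  proof (intro equalityI subsetI)
    fix j assume j: "j \<in> {j \<in> {1..rk X}. gram X (opp i) j \<noteq> 0}"
    then have "gram X i (opp j) \<noteq> 0" using opp_gram[OF i, of "opp j"] opp(1) opp_opp by auto
    then show "j \<in> opp ` {j \<in> {1..rk X}. gram X i j \<noteq> 0}"
      using j opp(1) opp_opp by (intro image_eqI[of _ _ "opp j"]) auto
  next
    fix j assume "j \<in> opp ` {j \<in> {1..rk X}. gram X i j \<noteq> 0}"
    then show "j \<in> {j \<in> {1..rk X}. gram X (opp i) j \<noteq> 0}" using opp_gram[OF i] opp(1) by auto
  qed
  moreover have "inj_on opp {j \<in> {1..rk X}. gram X i j \<noteq> 0}" using opp_inj by (auto intro!: inj_onI)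
  ultimately show ?thesis by (simp add: card_image)
qed

end

text \<open>Node \<open>n\<close> is the only one of its length, and the rest follows along the
  chain.\<close>

lemma opp_B:
  assumes "n \<ge> 2" "i \<in> {1..n}"
  shows "root_system.opp (TypeB n) i = i"
proof -
  interpret root_system "TypeB n" by (rule root_system_B[OF assms(1)])
  have n: "opp n = n"
    using opp(1)[of n] opp_sq_length[of n] assms(1) by (auto split: if_splits)
  show ?thesis
    by (rule opp_chain[of n]) (use n assms in \<open>auto simp: gram_def max_def\<close>)
qed

lemma opp_C:
  assumes "n \<ge> 2" "i \<in> {1..n}"
  shows "root_system.opp (TypeC n) i = i"
proof -
  interpret root_system "TypeC n" by (rule root_system_C[OF assms(1)])
  have n: "opp n = n"
    using opp(1)[of n] opp_sq_length[of n] assms(1) by (auto split: if_splits)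
  show ?thesis
    by (rule opp_chain[of n]) (use n assms in \<open>auto simp: gram_def max_def\<close>)
qed

text \<open>The Weyl group acts trivially on the weight lattice modulo the root lattice. This is applied
  to the multiples \<open>2\<omega>\<^sub>1\<close> and \<open>4\<omega>\<^sub>n\<close> of fundamental weights.\<close>

lemma opp_D:
  assumes "n \<ge> 4" "even n" "i \<in> {1..n}"
  shows "root_system.opp (TypeD n) i = i"
proof -
  interpret root_system "TypeD n" by (rule root_system_D[OF assms(1)])
  obtain m where n: "n = m + 4" using le_Suc_ex[OF assms(1)] by (metis add.commute)
  have cop: "copairing (TypeD n) x (simple_root i) = (\<Sum>j\<in>{1..m + 4}. x j * gram (TypeD (m + 4)) j i)"
    if "i \<in> {1..m + 4}" for x i
    using copairing_simple[of i "TypeD n" x] inner_form_simple_right[of i x] that by (simp add: n)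
  \<comment> \<open>The vector \<open>2 \<omega>_1\<close> has odd coordinates exactly at the two
    ends of the fork, so \<open>opp\<close> preserves this pair.\<close>
  define x where "x i = (if i \<in> {1..m + 4} then if i < m + 3 then 2 else 1 else 0 :: int)" for i
  have x: "even (x k + x (opp k))" if "k \<in> {1..n}" for k
  proof (rule opp_congruent)
    show "even (copairing (TypeD n) x (simple_root i))" if "i \<in> {1..rk (TypeD n)}" for i
      using that unfolding cop[OF that[unfolded n rk.simps]] row_D[OF that[unfolded n rk.simps]] by (auto simp: x_def n)
  qed (use that in \<open>auto simp: x_def n\<close>)
  have ends: "opp k \<in> {m + 3, m + 4}" if "k \<in> {m + 3, m + 4}" for k
    using x[of k] opp(1)[of k] that by (auto simp: x_def n split: if_splits)
  \<comment> \<open>The vector \<open>4 \<omega>_n\<close>. If \<open>opp\<close> exchanged the ends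
    of the fork, 4 would divide \<open>(m + 2) + (m + 4) = 2 n - 2\<close>, which fails for even
    \<open>n\<close>.\<close>
  define y where "y i = (if i \<in> {1..m + 4} then if i < m + 3 then 2 * int i else if i = m + 3 then int m + 2 else int m + 4 else 0)" for i
  have y: "4 dvd y k + y (opp k)" if "k \<in> {1..n}" for k
  proof (rule opp_congruent)
    show "4 dvd copairing (TypeD n) y (simple_root i)" if "i \<in> {1..rk (TypeD n)}" for i
      using that unfolding cop[OF that[unfolded n rk.simps]] row_D[OF that[unfolded n rk.simps]]
      by (auto simp: y_def n of_nat_diff)
  qed (use that in \<open>auto simp: y_def n\<close>)
  have "opp (m + 3) \<noteq> m + 4"
  proof
    assume *: "opp (m + 3) = m + 4"
    have "m + 3 \<in> {1..n}" by (simp add: n)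
    from y[OF this, unfolded *] have "4 dvd (int m + 2) + (int m + 4)" by (simp add: y_def)
    then show False using assms(2) by (simp add: n) presburger
  qed
  then have 3: "opp (m + 3) = m + 3" using ends[of "m + 3"] by simp
  have 4: "opp (m + 4) = m + 4"
    using ends[of "m + 4"] opp_inj[of "m + 3" "m + 4"] 3 by (auto simp: n)
  have 2: "opp (m + 2) = m + 2"
    by (rule opp_fixed_step[of _ "m + 4"]) (use 4 in \<open>auto simp: n gram_D split: if_splits\<close>)
  show ?thesis
  proof (rule opp_chain[of "m + 2"])
    show "opp k = k" if "k \<in> {1..rk (TypeD n)}" "m + 2 \<le> k" for k
    proof -
      have "k = m + 2 \<or> k = m + 3 \<or> k = m + 4" using that by (auto simp: n)
      then show ?thesis using 2 3 4 by blast
    qed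
  qed (use assms(3) in \<open>auto simp: n gram_D\<close>)
qed

lemma gram_E_zero:
  "i \<in> {1..n} \<Longrightarrow> j \<in> {1..n} \<Longrightarrow> gram (TypeE n) i j = 0 \<longleftrightarrow> i \<noteq> j \<and>
    (i, j) \<notin> {(1, 3), (3, 1), (2, 4), (4, 2)} \<and> (3 \<le> i \<longrightarrow> j \<noteq> Suc i) \<and> (3 \<le> j \<longrightarrow> i \<noteq> Suc j)"
  by (auto simp: gram_def)

text \<open>The sets \<open>N i\<close> contain \<open>i\<close> itself, so the branching node 4 is
  recognised by cardinality 4. Node 2 is the only end next to it. The ends 1 and \<open>n\<close>
  are not exchanged, because 1 has a common neighbour with node 4 and \<open>n\<close> has
  none.\<close>

lemma opp_E:
  assumes n: "n = 7 \<or> n = 8" and i: "i \<in> {1..n}"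
  shows "root_system.opp (TypeE n) i = i"
proof -
  interpret root_system "TypeE n" using n root_system_E7 root_system_E8 by blast
  define N where "N i = {j \<in> {1..n}. gram (TypeE n) i j \<noteq> 0}" for i
  have card_N: "card (N (opp i)) = card (N i)" if "i \<in> {1..n}" for i
    using opp_degree[of i] that by (simp add: N_def)
  have adj: "opp j \<in> N (opp i)" if "i \<in> {1..n}" "j \<in> N i" for i j
    using opp_gram[of i j] opp(1)[of j] that by (auto simp: N_def)
  have range: "opp i \<in> {1..n}" if "i \<in> {1..n}" for i using opp(1)[of i] that by simp
  have N: "N 1 = {1, 3}" "N 2 = {2, 4}" "N 3 = {1, 3, 4}" "N 4 = {2, 3, 4, 5}" "N 5 = {4, 5, 6}" "N 6 = {5, 6, 7}"
    "N 7 = (if n = 7 then {6, 7} else {6, 7, 8})" "n = 8 \<Longrightarrow> N 8 = {7, 8}"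
    using n by (auto simp: N_def gram_E_zero)
  have card: "card (N i) = (if i = 4 then 4 else if i = 1 \<or> i = 2 \<or> i = n then 2 else 3)" if "i \<in> {1..n}" for i
  proof -
    have "i \<in> {1, 2, 3, 4, 5, 6, 7, 8}" using that n by auto
    then show ?thesis using N n that by (auto split: if_splits)
  qed
  have 4: "opp 4 = 4" using card_N[of 4] card[of 4] card[OF range[of 4]] n by (auto split: if_splits)
  have 2: "opp 2 = 2"
    using adj[of 4 2] card_N[of 2] card[of 2] card[OF range[of 2]] n N(4) 4 by (auto split: if_splits)
  have 1: "opp 1 = 1"
  proof (rule ccontr)
    assume ne: "opp 1 \<noteq> 1"
    have one: "1 \<in> {1..n}" using n by auto
    have "card (N (opp 1)) = 2" using card_N[OF one] card[OF one] by simp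
    then have "opp 1 = 1 \<or> opp 1 = 2 \<or> opp 1 = n"
      using card[OF range[OF one]] by (simp only: split: if_splits)
    moreover have "opp 1 \<noteq> 2" using opp_inj[of 1 2] 2 n by auto
    ultimately have n': "opp 1 = n" using ne by blast
    have "3 \<in> N 1" "3 \<in> N 4" "4 \<in> {1..n}" using N(1,4) n by auto
    then have "opp 3 \<in> N n \<inter> N 4" using adj[OF one, of 3] adj[of 4 3] unfolding n' 4 by blast
    moreover have "N n \<inter> N 4 = {}" using N(4,7,8) n by auto
    ultimately show False by blast
  qed
  have step: "opp i = i" if "i \<in> {1..n}" "j \<in> {1..n}" "opp j = j" "i \<in> N j"
    "\<And>k. k \<in> N j \<Longrightarrow> k \<noteq> i \<Longrightarrow> opp k = k" for i j
    by (rule opp_fixed_step[of i j]) (use that gram_sym[of "TypeE n"] in \<open>auto simp: N_def\<close>)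
  have 3: "opp 3 = 3" by (rule step[of 3 1]) (use n N 1 in auto)
  have 5: "opp 5 = 5" by (rule step[of 5 4]) (use n N 2 3 4 in auto)
  have 6: "opp 6 = 6" by (rule step[of 6 5]) (use n N 4 5 in auto)
  have 7: "opp 7 = 7" by (rule step[of 7 6]) (use n N 5 6 in auto)
  have 8: "opp 8 = 8" if "n = 8" by (rule step[of 8 7]) (use that N 6 7 in auto)
  have "i \<in> {1, 2, 3, 4, 5, 6, 7, 8}" using i n by auto
  then show ?thesis using 1 2 3 4 5 6 7 8 i n by auto
qed

text \<open>Lengths separate the nodes 1, 2 from 3, 4, and only the edge between 2 and 3 joins these
  sets.\<close>

lemma opp_F4:
  assumes i: "i \<in> {1..4}"
  shows "root_system.opp TypeF4 i = i"
proof -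
  interpret root_system TypeF4 by (rule root_system_F4)
  have range: "opp i \<in> {1, 2, 3, 4}" if "i \<in> {1, 2, 3, 4}" for i using opp(1)[of i] that by (auto simp: interval_simps)
  have len: "opp i \<le> 2 \<longleftrightarrow> i \<le> 2" if "i \<in> {1, 2, 3, 4}" for i
    using opp_sq_length[of i] that by (auto split: if_splits)
  have "gram TypeF4 (opp 2) (opp 3) \<noteq> 0" using opp_gram[of 2 3] by (simp add: gram_def)
  then have 23: "opp 2 = 2" "opp 3 = 3"
    using range[of 2] range[of 3] len[of 2] len[of 3] by (auto simp: gram_def)
  have "opp 1 = 1" by (rule opp_fixed_step[of 1 2]) (use 23 in \<open>auto simp: gram_def interval_simps split: if_splits\<close>)
  moreover have "opp 4 = 4" by (rule opp_fixed_step[of 4 3]) (use 23 in \<open>auto simp: gram_def interval_simps split: if_splits\<close>)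
  moreover have "i = 1 \<or> i = 2 \<or> i = 3 \<or> i = 4" using i by auto
  ultimately show ?thesis using 23 by blast
qed

lemma opp_G2:
  assumes i: "i \<in> {1..2}"
  shows "root_system.opp TypeG2 i = i"
proof -
  interpret root_system TypeG2 by (rule root_system_G2)
  show ?thesis
    using i opp(1)[of i] opp_sq_length[of i] by (auto simp: interval_simps split: if_splits)
qed

theorem opp_not_exceptional:
  assumes "valid_datum k X" "\<not> exceptional k X" "i \<in> {1..rk X}"
  shows "root_system.opp X i = i"
proof (cases X)
  case (TypeA n)
  then have n: "n = 1" using assms(1,2) by (cases k) (auto simp: exceptional_def)
  interpret root_system X by (rule root_system_valid[OF assms(1)])
  show ?thesis using opp(1)[OF assms(3)] assms(3) by (simp add: TypeA n)
next
  case (TypeD n)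
  have "even n"
  proof (rule ccontr)
    assume "odd n"
    then obtain m where "n = 2 * m + 1" by (auto elim: oddE)
    then show False using assms(1,2) TypeD by (cases k) (auto simp: exceptional_def)
  qed
  then show ?thesis using opp_D[of n i] assms TypeD by (cases k) auto
next
  case (TypeE n)
  then have "n = 7 \<or> n = 8" using assms(1,2) by (cases k) (auto simp: exceptional_def)
  then show ?thesis using opp_E[of n i] assms(3) TypeE by simp
qed (use assms opp_B opp_C opp_F4 opp_G2 in \<open>cases k; auto\<close>)+

section \<open>The plane of the dominant roots\<close>

text \<open>A root that is not orthogonal to the plane of the dominant roots \<open>\<theta>\<close>, \<open>\<phi>\<close> is positive iff both of
  its inner products with \<open>\<theta>\<close> and \<open>\<phi>\<close> are nonnegative. Inversions of the elements of the dihedral group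
  generated by the reflections \<open>sM\<close>, \<open>sN\<close> can therefore be read off from these two numbers.\<close>

locale um_plane = root_system +
  fixes r :: int
  assumes r: "r = 2 \<or> r = 3"
    and short: "inner_form X (dominant_short_root X) (dominant_short_root X) = 2"
    and long: "inner_form X (highest_root X) (highest_root X) = 2 * r"
begin

abbreviation "\<theta> \<equiv> dominant_short_root X"
abbreviation "\<phi> \<equiv> highest_root X"
abbreviation "s\<^sub>\<theta> \<equiv> reflection X \<theta>"
abbreviation "s\<^sub>\<phi> \<equiv> reflection X \<phi>"

text \<open>The simple roots of the rank 2 system in the plane: \<open>\<beta>M\<close> is
  orthogonal to \<theta> and \<open>\<beta>N\<close> to \<phi>. The two formulas for
  \<open>\<beta>M\<close> belong to types B2 and G2.\<close>

definition \<beta>M :: lattice_vec where "\<beta>M = (if r = 2 then \<phi> - \<theta> else scl 2 \<phi> - scl 3 \<theta>)"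
definition \<beta>N :: lattice_vec where "\<beta>N = scl 2 \<theta> - \<phi>"

abbreviation "sM \<equiv> reflection X \<beta>M"
abbreviation "sN \<equiv> reflection X \<beta>N"

text \<open>The value is \<open>r\<close> times a positive integer, and a factor of 2 or more would
  give \<open>\<phi> - r \<theta>\<close> a negative norm.\<close>

lemma inner_theta_phi: "inner_form X \<theta> \<phi> = r" "inner_form X \<phi> \<theta> = r"
proof -
  let ?c = "copairing X \<theta> \<phi>"
  have c: "inner_form X \<theta> \<phi> = r * ?c" using roots_copairing[OF highest_root(1), of \<theta>] long by (simp add: mult.commute)
  have "?c > 0"
    using dominant_roots_inner_pos[OF dominant_short_root(1,2) highest_root(1) highest_root_dominant] r
    by (auto simp: c zero_less_mult_iff)
  moreover have "0 \<le> inner_form X (\<phi> - scl r \<theta>) (\<phi> - scl r \<theta>)" by (rule norm_nonneg)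
  then have "0 \<le> 2 * r - 2 * r * (r * ?c) + 2 * r * r"
    using short long by (simp add: inner_form_diff inner_form_scl inner_form_sym[of X \<phi> \<theta>] c algebra_simps)
  then have "?c < 2" using r by auto
  ultimately have "?c = 1" by simp
  then show "inner_form X \<theta> \<phi> = r" "inner_form X \<phi> \<theta> = r" by (simp_all add: c inner_form_sym[of X \<phi> \<theta>])
qed

lemma phi_minus_theta: "\<phi> - \<theta> \<in> roots X"
proof (rule roots_diff[OF highest_root(1) dominant_short_root(1)])
  show "\<phi> \<noteq> \<theta>" using short long r by auto
qed (use inner_theta_phi r in auto)

lemma reflection_phi_theta: "s\<^sub>\<phi> \<theta> = \<theta> - \<phi>" "s\<^sub>\<phi> \<phi> = - \<phi>"
  and reflection_theta_phi: "s\<^sub>\<theta> \<phi> = \<phi> - scl r \<theta>" "s\<^sub>\<theta> \<theta> = - \<theta>"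
  using r short long inner_theta_phi
  by (auto simp: reflection_eq copairing_def fun_eq_iff)

lemma \<beta>_roots: "\<beta>M \<in> roots X" "\<beta>N \<in> roots X"
proof -
  have 1: "\<phi> - scl r \<theta> \<in> roots X"
    using roots_reflection[OF dominant_short_root(1) highest_root(1)] by (simp add: reflection_theta_phi)
  have 2: "s\<^sub>\<phi> (\<phi> - scl r \<theta>) \<in> roots X" by (rule roots_reflection[OF highest_root(1) 1])
  also have "s\<^sub>\<phi> (\<phi> - scl r \<theta>) = - \<phi> - scl r (\<theta> - \<phi>)"
    using weyl_groupD(2,4)[OF reflection_group[OF highest_root(1)]] by (simp add: reflection_phi_theta)
  finally have 3: "- \<phi> - scl r (\<theta> - \<phi>) \<in> roots X" .
  show "\<beta>M \<in> roots X"
  proof (cases "r = 2")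
    case False
    then have "\<beta>M = - \<phi> - scl r (\<theta> - \<phi>)" using r unfolding \<beta>M_def by (simp add: fun_eq_iff)
    then show ?thesis using 3 by simp
  next
    case True
    then show ?thesis using phi_minus_theta unfolding \<beta>M_def by simp
  qed
  show "\<beta>N \<in> roots X"
  proof (cases "r = 2")
    case True
    then have "\<beta>N = - (\<phi> - scl r \<theta>)" by (simp add: \<beta>N_def)
    then show ?thesis using roots_uminus[OF 1] by simp
  next
    case False
    have "\<phi> - \<theta> - \<theta> \<in> roots X"
    proof (rule roots_diff[OF phi_minus_theta dominant_short_root(1)])
      show "\<phi> - \<theta> \<noteq> \<theta>"
      proof
        assume "\<phi> - \<theta> = \<theta>"
        then have "inner_form X (\<phi> - \<theta>) \<theta> = inner_form X \<theta> \<theta>" by simp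
        then show False using False r short by (simp add: inner_form_diff inner_theta_phi)
      qed
    qed (use False r short in \<open>auto simp: inner_form_diff inner_theta_phi\<close>)
    then have "- (\<phi> - \<theta> - \<theta>) \<in> roots X" by (rule roots_uminus)
    moreover have "- (\<phi> - \<theta> - \<theta>) = \<beta>N" by (simp add: \<beta>N_def fun_eq_iff)
    ultimately show ?thesis by simp
  qed
qed

lemma s_group: "sM \<in> weyl_group X" "sN \<in> weyl_group X" "s\<^sub>\<theta> \<in> weyl_group X" "s\<^sub>\<phi> \<in> weyl_group X"
  using reflection_group \<beta>_roots highest_root(1) dominant_short_root(1) by blast+

lemma s_plane: "sM \<theta> = \<theta>" "sM \<phi> = scl r \<theta> - \<phi>" "sN \<phi> = \<phi>" "sN \<theta> = \<phi> - \<theta>"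
  using r short long inner_theta_phi
  unfolding \<beta>M_def \<beta>N_def
  by (auto simp: reflection_eq copairing_def fun_eq_iff inner_form_diff inner_form_scl)

lemma s_invol: "sM (sM x) = x" "sN (sN x) = x" "s\<^sub>\<theta> (s\<^sub>\<theta> x) = x" "s\<^sub>\<phi> (s\<^sub>\<phi> x) = x"
  using reflection_invol \<beta>_roots highest_root(1) dominant_short_root(1) by blast+

lemma s_plane_scl: "sM (x - y) = sM x - sM y" "sM (scl a x) = scl a (sM x)"
  "sN (x - y) = sN x - sN y" "sN (scl a x) = scl a (sN x)"
  using weyl_groupD(2,4)[OF s_group(1)] weyl_groupD(2,4)[OF s_group(2)] by simp_all

lemma s_inner:
  "inner_form X (sM \<gamma>) \<theta> = inner_form X \<gamma> \<theta>"
  "inner_form X (sM \<gamma>) \<phi> = r * inner_form X \<gamma> \<theta> - inner_form X \<gamma> \<phi>"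
  "inner_form X (sN \<gamma>) \<theta> = inner_form X \<gamma> \<phi> - inner_form X \<gamma> \<theta>"
  "inner_form X (sN \<gamma>) \<phi> = inner_form X \<gamma> \<phi>"
proof -
  have M: "inner_form X (sM \<gamma>) x = inner_form X \<gamma> (sM x)" for x
    using weyl_groupD(5)[OF s_group(1), of \<gamma> "sM x"] by (simp add: s_invol)
  have N: "inner_form X (sN \<gamma>) x = inner_form X \<gamma> (sN x)" for x
    using weyl_groupD(5)[OF s_group(2), of \<gamma> "sN x"] by (simp add: s_invol)
  show "inner_form X (sM \<gamma>) \<theta> = inner_form X \<gamma> \<theta>"
  "inner_form X (sM \<gamma>) \<phi> = r * inner_form X \<gamma> \<theta> - inner_form X \<gamma> \<phi>"
  "inner_form X (sN \<gamma>) \<theta> = inner_form X \<gamma> \<phi> - inner_form X \<gamma> \<theta>"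
  "inner_form X (sN \<gamma>) \<phi> = inner_form X \<gamma> \<phi>"
    unfolding M N s_plane by (simp_all add: inner_form_diff inner_form_scl)
qed

lemma s_fixed:
  assumes "inner_form X \<gamma> \<theta> = 0" "inner_form X \<gamma> \<phi> = 0"
  shows "sM \<gamma> = \<gamma>" "sN \<gamma> = \<gamma>"
  using assms unfolding \<beta>M_def \<beta>N_def
  by (auto simp: reflection_eq copairing_def inner_form_diff inner_form_scl fun_eq_iff)

lemma pos_roots_inner:
  assumes "\<gamma> \<in> roots X"
  shows "\<gamma> \<in> pos_roots X \<Longrightarrow> inner_form X \<gamma> \<theta> \<ge> 0 \<and> inner_form X \<gamma> \<phi> \<ge> 0"
    and "\<gamma> \<notin> pos_roots X \<Longrightarrow> inner_form X \<gamma> \<theta> \<le> 0 \<and> inner_form X \<gamma> \<phi> \<le> 0"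
proof -
  have dom: "0 \<le> inner_form X y \<theta> \<and> 0 \<le> inner_form X y \<phi>" if "\<And>k. 0 \<le> y k" for y
    using dominant_inner_nonneg[of X \<theta> y] dominant_inner_nonneg[of X \<phi> y] dominant_short_root(2) highest_root_dominant that
    by (simp add: inner_form_sym)
  show "\<gamma> \<in> pos_roots X \<Longrightarrow> inner_form X \<gamma> \<theta> \<ge> 0 \<and> inner_form X \<gamma> \<phi> \<ge> 0"
    by (rule dom) (rule pos_rootsD(2))
  show "\<gamma> \<notin> pos_roots X \<Longrightarrow> inner_form X \<gamma> \<theta> \<le> 0 \<and> inner_form X \<gamma> \<phi> \<le> 0"
    using dom[of "- \<gamma>"] pos_roots_uminus[OF assms] pos_rootsD(2)[of "- \<gamma>"] by (simp add: inner_form_uminus del: uminus_apply)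
qed

lemma not_pos_roots_inner:
  assumes "\<gamma> \<in> roots X" "inner_form X \<gamma> \<theta> \<noteq> 0 \<or> inner_form X \<gamma> \<phi> \<noteq> 0"
  shows "\<gamma> \<notin> pos_roots X \<longleftrightarrow> inner_form X \<gamma> \<theta> \<le> 0 \<and> inner_form X \<gamma> \<phi> \<le> 0"
  using pos_roots_inner[OF assms(1)] assms(2) by force

fun alt_refl :: "nat \<Rightarrow> bool \<Rightarrow> lattice_vec \<Rightarrow> lattice_vec" where
  "alt_refl 0 b = id"
| "alt_refl (Suc m) b = (if b then sM else sN) \<circ> alt_refl m (\<not> b)"

lemma alt_refl_group: "alt_refl m b \<in> weyl_group X"
  by (induction m arbitrary: b) (auto intro: weyl_group_intros weyl_group_comp s_group)

lemma alt_refl_fixed: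
  "inner_form X \<gamma> \<theta> = 0 \<Longrightarrow> inner_form X \<gamma> \<phi> = 0 \<Longrightarrow> alt_refl m b \<gamma> = \<gamma>"
  by (induction m arbitrary: b) (auto simp: s_fixed)

text \<open>Up to \<open>2 r\<close> alternating factors do not go beyond the longest element of the
  dihedral group, so a root that has become negative stays negative. Roots orthogonal to the plane
  do not move; for the others this is checked on the pair of inner products.\<close>

lemma alt_refl_additive:
  assumes m: "int m < 2 * r" and \<gamma>: "\<gamma> \<in> pos_roots X" "alt_refl m (\<not> b) \<gamma> \<notin> pos_roots X"
  shows "alt_refl (Suc m) b \<gamma> \<notin> pos_roots X"
proof (cases "inner_form X \<gamma> \<theta> = 0 \<and> inner_form X \<gamma> \<phi> = 0")
  case False
  let ?\<delta> = "alt_refl m (\<not> b) \<gamma>"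
  have \<gamma>0: "\<gamma> \<in> roots X" using pos_rootsD(1)[OF \<gamma>(1)] .
  have nz: "inner_form X (alt_refl k c \<gamma>) \<theta> \<noteq> 0 \<or> inner_form X (alt_refl k c \<gamma>) \<phi> \<noteq> 0" for k c
    using False by (induction k arbitrary: c) (auto simp: s_inner)
  have root: "alt_refl k c \<gamma> \<in> roots X" for k c by (rule weyl_groupD(9)[OF alt_refl_group \<gamma>0])
  have "inner_form X \<gamma> \<theta> \<ge> 0 \<and> inner_form X \<gamma> \<phi> \<ge> 0" by (rule pos_roots_inner(1)[OF \<gamma>0 \<gamma>(1)])
  moreover have "inner_form X ?\<delta> \<theta> \<le> 0 \<and> inner_form X ?\<delta> \<phi> \<le> 0"
    using not_pos_roots_inner[OF root nz] \<gamma>(2) by blast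
  moreover have "m = 0 \<or> m = 1 \<or> m = 2 \<or> m = 3 \<or> m = 4 \<or> m = 5" using m r by auto
  ultimately have "inner_form X (alt_refl (Suc m) b \<gamma>) \<theta> \<le> 0 \<and> inner_form X (alt_refl (Suc m) b \<gamma>) \<phi> \<le> 0"
    by (cases b; elim disjE conjE; simp add: s_inner numeral_eq_Suc; insert r m; auto)
  then show ?thesis using not_pos_roots_inner[OF root nz] by blast
qed (use \<gamma> alt_refl_fixed in auto)

end

lemma reflection_uminus:
  assumes "\<gamma> \<in> roots X"
  shows "reflection X (- \<gamma>) = reflection X \<gamma>"
proof -
  have "copairing X x (- \<gamma>) = - copairing X x \<gamma>" for x
  proof -
    have "copairing X x (- \<gamma>) * inner_form X \<gamma> \<gamma> = - copairing X x \<gamma> * inner_form X \<gamma> \<gamma>"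
      using roots_copairing[OF assms, of x] roots_copairing[OF roots_uminus[OF assms], of x]
      by (simp add: inner_form_uminus)
    then show ?thesis using roots_norm_bounds(1)[OF assms] by (simp only: mult_cancel_right) auto
  qed
  then show ?thesis by (simp add: reflection_eq fun_eq_iff)
qed

context artin
begin

lemma Tw_id: "Tw id = \<one>"
  using Tw_reduced[of "[]" id] ninv_id by (simp add: reduced_word_iff)

text \<open>By \<open>stabilizer_word\<close> a reduced word of \<open>w\<close> uses only letters
  orthogonal to \<delta>, and their lifts commute with \<open>x\<close>.\<close>

lemma Tw_commute:
  assumes x: "x \<in> carrier G" "\<And>i. i \<in> {1..rk X} \<Longrightarrow> inner_form X \<delta> (simple_root i) = 0 \<Longrightarrow> \<tau> i \<otimes> x = x \<otimes> \<tau> i"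
    and \<delta>: "dominant X \<delta>" and w: "w \<in> weyl_group X" "w \<delta> = \<delta>"
  shows "Tw w \<otimes> x = x \<otimes> Tw w"
proof -
  obtain u where u: "reduced_word X u w" using ex_reduced_word[OF w(1)] by blast
  then have "u \<in> weyl_words X" by (simp add: reduced_word_iff)
  moreover have "\<forall>i\<in>set u. inner_form X \<delta> (simple_root i) = 0" using stabilizer_word[OF \<delta> u w(2)] by blast
  ultimately have "prodw u \<otimes> x = x \<otimes> prodw u"
  proof (induction u rule: list.induct)
    case (Cons i u)
    then have i: "i \<in> {1..rk X}" and u: "u \<in> weyl_words X" by auto
    have "\<tau> i \<otimes> prodw u \<otimes> x = \<tau> i \<otimes> (x \<otimes> prodw u)" using Cons i u x(1) by (simp add: m_assoc \<tau>)
    also have "\<dots> = x \<otimes> \<tau> i \<otimes> prodw u" using Cons.prems x(2)[OF i] i u x(1) by (simp add: m_assoc[symmetric] \<tau>)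
    finally show ?case using i u x(1) by (simp add: m_assoc \<tau>)
  qed (simp add: x)
  then show ?thesis by (simp add: Tw_reduced[OF u])
qed

text \<open>Every factorisation of \<open>w0\<close> is length-additive, because \<open>w0\<close>
  leaves no positive root positive.\<close>

lemma Tw_w0_comp:
  assumes "a \<in> weyl_group X" "b \<in> weyl_group X" "a \<circ> b = w0"
  shows "Tw w0 = Tw a \<otimes> Tw b"
proof -
  have "a (b \<gamma>) = w0 \<gamma>" for \<gamma> using fun_cong[OF assms(3), of \<gamma>] by simp
  then show ?thesis using Tw_comp[OF assms(1,2)] w0(2) unfolding assms(3) by metis
qed

text \<open>With \<open>u = w0 s_i\<close> and \<open>j = opp i\<close>, the element
  \<open>w0\<close> factors both as \<open>u s_i\<close> and as \<open>s_j u\<close>.\<close>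

lemma Tw_w0_simple:
  assumes i: "i \<in> {1..rk X}"
  shows "Tw w0 \<otimes> \<tau> i = \<tau> (opp i) \<otimes> Tw w0"
proof -
  let ?s = "refl_s X i" and ?t = "refl_s X (opp i)"
  have j: "opp i \<in> {1..rk X}" using opp(1)[OF i] .
  have s: "?s \<in> weyl_group X" "?t \<in> weyl_group X" using i j weyl_group_intros(2) by blast+
  have invol: "?s (?s x) = x" "?t (?t x) = x" for x using simple_reflection_invol i j by blast+
  define u where "u = w0 \<circ> ?s"
  have u: "u \<in> weyl_group X" unfolding u_def by (rule weyl_group_comp[OF w0(1) s(1)])
  have "reflection X (- simple_root (opp i)) = ?t"
    by (rule reflection_uminus[OF simple_root_roots[OF j]])
  then have w0s: "w0 (?s x) = ?t (w0 x)" for x using weyl_groupD(10)[OF w0(1), of "simple_root i"] opp(2)[OF i] by simp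
  have u2: "?t \<circ> u = w0" by (rule HOL.ext) (simp add: u_def w0s invol)
  have u1: "u \<circ> ?s = w0" by (rule HOL.ext) (simp add: u_def invol)
  have "Tw w0 \<otimes> \<tau> i = \<tau> (opp i) \<otimes> Tw u \<otimes> \<tau> i"
    using Tw_w0_comp[OF s(2) u u2] Tw_simple[OF j] by simp
  also have "\<dots> = \<tau> (opp i) \<otimes> Tw w0"
    using Tw_w0_comp[OF u s(1) u1] Tw_simple[OF i] u \<tau> i j by (simp add: m_assoc)
  finally show ?thesis .
qed

end

locale um_artin = um_plane X r + artin X G \<tau> for X and r and G (structure) and \<tau>
begin

abbreviation "M \<equiv> Tw sM"
abbreviation "N \<equiv> Tw sN"

lemma MN_closed: "M \<in> carrier G" "N \<in> carrier G" by (simp_all add: s_group)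

fun altp :: "nat \<Rightarrow> bool \<Rightarrow> 'a" where
  "altp 0 b = \<one>"
| "altp (Suc m) b = (if b then M else N) \<otimes> altp m (\<not> b)"

lemma Tw_alt_refl: "int m \<le> 2 * r \<Longrightarrow> Tw (alt_refl m b) = altp m b"
proof (induction m arbitrary: b)
  case (Suc m)
  have "Tw ((if b then sM else sN) \<circ> alt_refl m (\<not> b)) = Tw (if b then sM else sN) \<otimes> Tw (alt_refl m (\<not> b))"
  proof (rule Tw_comp)
    fix \<gamma> assume "\<gamma> \<in> pos_roots X" "alt_refl m (\<not> b) \<gamma> \<notin> pos_roots X"
    then show "(if b then sM else sN) (alt_refl m (\<not> b) \<gamma>) \<notin> pos_roots X"
      using alt_refl_additive[of m \<gamma> b] Suc.prems by (cases b) simp_all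
  qed (auto simp: s_group alt_refl_group)
  then show ?case using Suc by (cases b) (simp_all del: o_apply)
qed (simp add: Tw_id)

text \<open>\<open>sM\<close> takes \<open>\<beta>N\<close> to \<phi> and \<open>sN\<close> takes
  \<open>\<beta>M\<close> to \<theta>, so both reflections are conjugates. The dihedral relation
  holds because \<open>sN\<close> fixes \<phi> and thus commutes with its reflection.\<close>

lemma reflections_2:
  assumes "r = 2"
  shows "s\<^sub>\<phi> = alt_refl 3 True" "s\<^sub>\<theta> = alt_refl 3 False" "alt_refl 4 True = alt_refl 4 False"
    "s\<^sub>\<phi> \<circ> s\<^sub>\<theta> = alt_refl 2 False"
proof -
  have "sM \<beta>N = scl 2 (sM \<theta>) - sM \<phi>" by (simp add: \<beta>N_def s_plane_scl)
  also have "\<dots> = \<phi>" unfolding s_plane by (simp add: assms)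
  finally have "sM \<beta>N = \<phi>" .
  then have \<phi>: "s\<^sub>\<phi> x = sM (sN (sM x))" for x
    using weyl_groupD(10)[OF s_group(1), of \<beta>N "sM x"] by (simp add: s_invol)
  have "sN \<beta>M = \<theta>" using assms unfolding \<beta>M_def by (simp add: s_plane_scl s_plane)
  then have \<theta>: "s\<^sub>\<theta> x = sN (sM (sN x))" for x
    using weyl_groupD(10)[OF s_group(2), of \<beta>M "sN x"] by (simp add: s_invol)
  show "s\<^sub>\<phi> = alt_refl 3 True" "s\<^sub>\<theta> = alt_refl 3 False" by (auto simp: \<phi> \<theta> numeral_eq_Suc)
  have N\<phi>: "sN (s\<^sub>\<phi> x) = s\<^sub>\<phi> (sN x)" for x
    using weyl_groupD(10)[OF s_group(2), of \<phi> x] by (simp add: s_plane)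
  show "alt_refl 4 True = alt_refl 4 False" using N\<phi> by (auto simp: \<phi> numeral_eq_Suc)
  have "s\<^sub>\<phi> (s\<^sub>\<theta> x) = sN (s\<^sub>\<phi> (sM (sN x)))" for x by (simp only: \<theta> N\<phi>)
  then show "s\<^sub>\<phi> \<circ> s\<^sub>\<theta> = alt_refl 2 False" by (auto simp: \<phi> numeral_eq_Suc s_invol)
qed

text \<open>In G2 the dominant roots are two steps away: \<phi> is \<open>sM (sN \<beta>M)\<close>
  and \<theta> is \<open>sN (sM \<beta>N)\<close>.\<close>

lemma reflections_3:
  assumes "r = 3"
  shows "s\<^sub>\<phi> = alt_refl 5 True" "s\<^sub>\<theta> = alt_refl 5 False" "alt_refl 6 True = alt_refl 6 False"
    "s\<^sub>\<phi> \<circ> s\<^sub>\<theta> = alt_refl 2 False"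
proof -
  have "\<beta>M = scl 2 \<phi> - scl 3 \<theta>" using assms unfolding \<beta>M_def by simp
  then have "sN \<beta>M = sN (scl 2 \<phi> - scl 3 \<theta>)" by (rule arg_cong)
  then have "sM (sN \<beta>M) = scl 2 (sM \<phi>) - scl 3 (sM \<phi> - sM \<theta>)" by (simp add: s_plane_scl s_plane(3,4))
  also have "\<dots> = \<phi>" unfolding s_plane by (simp add: assms fun_eq_iff)
  finally have "sM (sN \<beta>M) = \<phi>" .
  then have \<phi>: "s\<^sub>\<phi> x = sM (sN (sM (sN (sM x))))" for x
    using weyl_groupD(10)[OF s_group(1), of "sN \<beta>M" "sM x"] weyl_groupD(10)[OF s_group(2), of \<beta>M "sN (sM x)"]
    by (simp add: s_invol)
  have "sM \<beta>N = scl 2 \<theta> - (scl r \<theta> - \<phi>)" by (simp add: \<beta>N_def s_plane_scl s_plane(1,2))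
  then have "sN (sM \<beta>N) = scl 2 (sN \<theta>) - sN (scl r \<theta> - \<phi>)" by (simp only: s_plane_scl)
  also have "\<dots> = \<theta>" unfolding s_plane_scl s_plane by (simp add: assms fun_eq_iff)
  finally have "sN (sM \<beta>N) = \<theta>" .
  then have \<theta>: "s\<^sub>\<theta> x = sN (sM (sN (sM (sN x))))" for x
    using weyl_groupD(10)[OF s_group(2), of "sM \<beta>N" "sN x"] weyl_groupD(10)[OF s_group(1), of \<beta>N "sM (sN x)"]
    by (simp add: s_invol)
  show "s\<^sub>\<phi> = alt_refl 5 True" "s\<^sub>\<theta> = alt_refl 5 False" by (auto simp: \<phi> \<theta> numeral_eq_Suc)
  have N\<phi>: "sN (s\<^sub>\<phi> x) = s\<^sub>\<phi> (sN x)" for x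
    using weyl_groupD(10)[OF s_group(2), of \<phi> x] by (simp add: s_plane)
  show "alt_refl 6 True = alt_refl 6 False" using N\<phi> by (auto simp: \<phi> numeral_eq_Suc)
  have "s\<^sub>\<phi> (s\<^sub>\<theta> x) = sN (s\<^sub>\<phi> (sM (sN (sM (sN x)))))" for x by (simp only: \<theta> N\<phi>)
  then show "s\<^sub>\<phi> \<circ> s\<^sub>\<theta> = alt_refl 2 False" by (auto simp: \<phi> numeral_eq_Suc s_invol)
qed

lemma Tw_plane_2:
  assumes "r = 2"
  shows "Tw s\<^sub>\<phi> = M \<otimes> (N \<otimes> M)" "Tw s\<^sub>\<theta> = N \<otimes> (M \<otimes> N)" "Tw (s\<^sub>\<phi> \<circ> s\<^sub>\<theta>) = N \<otimes> M"
    "M \<otimes> (N \<otimes> (M \<otimes> N)) = N \<otimes> (M \<otimes> (N \<otimes> M))"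
proof -
  have T: "Tw (alt_refl m b) = altp m b" if "m \<le> 4" for m b
    by (rule Tw_alt_refl) (use assms that in simp)
  show "Tw s\<^sub>\<phi> = M \<otimes> (N \<otimes> M)" "Tw s\<^sub>\<theta> = N \<otimes> (M \<otimes> N)" "Tw (s\<^sub>\<phi> \<circ> s\<^sub>\<theta>) = N \<otimes> M"
    unfolding reflections_2(4)[OF assms] unfolding reflections_2(1,2)[OF assms]
    by (subst T, simp, simp add: numeral_eq_Suc MN_closed)+
  have "altp 4 True = altp 4 False" using T[of 4 True] T[of 4 False] by (simp add: reflections_2(3)[OF assms])
  then show "M \<otimes> (N \<otimes> (M \<otimes> N)) = N \<otimes> (M \<otimes> (N \<otimes> M))" by (simp add: numeral_eq_Suc MN_closed)
qed

lemma Tw_plane_3: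
  assumes "r = 3"
  shows "Tw s\<^sub>\<phi> = M \<otimes> (N \<otimes> (M \<otimes> (N \<otimes> M)))" "Tw s\<^sub>\<theta> = N \<otimes> (M \<otimes> (N \<otimes> (M \<otimes> N)))"
    "Tw (s\<^sub>\<phi> \<circ> s\<^sub>\<theta>) = N \<otimes> M"
    "M \<otimes> (N \<otimes> (M \<otimes> (N \<otimes> (M \<otimes> N)))) = N \<otimes> (M \<otimes> (N \<otimes> (M \<otimes> (N \<otimes> M))))"
proof -
  have T: "Tw (alt_refl m b) = altp m b" if "m \<le> 6" for m b
    by (rule Tw_alt_refl) (use assms that in simp)
  show "Tw s\<^sub>\<phi> = M \<otimes> (N \<otimes> (M \<otimes> (N \<otimes> M)))" "Tw s\<^sub>\<theta> = N \<otimes> (M \<otimes> (N \<otimes> (M \<otimes> N)))"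
    "Tw (s\<^sub>\<phi> \<circ> s\<^sub>\<theta>) = N \<otimes> M"
    unfolding reflections_3(4)[OF assms] unfolding reflections_3(1,2)[OF assms]
    by (subst T, simp, simp add: numeral_eq_Suc MN_closed)+
  have "altp 6 True = altp 6 False" using T[of 6 True] T[of 6 False] by (simp add: reflections_3(3)[OF assms])
  then show "M \<otimes> (N \<otimes> (M \<otimes> (N \<otimes> (M \<otimes> N)))) = N \<otimes> (M \<otimes> (N \<otimes> (M \<otimes> (N \<otimes> M))))"
    by (simp add: numeral_eq_Suc MN_closed)
qed

text \<open>The alternating product \<open>l\<close> with \<open>2 r\<close> factors is -1 on the
  plane. As \<open>w0\<close> is -1 on all roots here, \<open>v = l^-1 w0\<close> fixes both
  dominant roots.\<close>

lemma Tw_w0_plane: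
  assumes "\<And>i. i \<in> {1..rk X} \<Longrightarrow> opp i = i"
  obtains v where "v \<in> weyl_group X" "v \<theta> = \<theta>" "v \<phi> = \<phi>"
    "r = 2 \<Longrightarrow> Tw w0 = M \<otimes> (N \<otimes> (M \<otimes> N)) \<otimes> Tw v"
    "r = 3 \<Longrightarrow> Tw w0 = M \<otimes> (N \<otimes> (M \<otimes> (N \<otimes> (M \<otimes> N)))) \<otimes> Tw v"
proof -
  define l where "l = alt_refl (nat (2 * r)) True"
  have l: "l \<in> weyl_group X" by (simp add: l_def alt_refl_group)
  \<comment> \<open>The dihedral relation lets the word begin with \<open>sN\<close>, and what
    follows is the word of the reflection in \<phi>.\<close>
  have l_eq: "l x = sN (s\<^sub>\<phi> x)" for x
  proof (cases "r = 2")
    case True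
    then have "l = alt_refl 4 True" by (simp only: l_def) simp
    then have "l = sN \<circ> alt_refl 3 True" by (simp only: reflections_2(3)[OF True]) (simp add: numeral_eq_Suc)
    then show ?thesis by (simp only: reflections_2(1)[OF True, symmetric] o_apply)
  next
    case False
    then have 3: "r = 3" using r by simp
    then have "l = alt_refl 6 True" by (simp only: l_def) simp
    then have "l = sN \<circ> alt_refl 5 True" by (simp only: reflections_3(3)[OF 3]) (simp add: numeral_eq_Suc)
    then show ?thesis by (simp only: reflections_3(1)[OF 3, symmetric] o_apply)
  qed
  have l_plane: "l \<theta> = - \<theta>" "l \<phi> = - \<phi>"
    unfolding l_eq reflection_phi_theta using weyl_groupD(3)[OF s_group(2), of \<phi>]
    by (simp_all add: s_plane_scl s_plane)
  define v where "v = winv l \<circ> w0"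
  have v: "v \<in> weyl_group X" unfolding v_def by (intro weyl_group_comp weyl_group_inv l w0(1))
  have w0_root: "w0 \<gamma> = - \<gamma>" if "\<gamma> \<in> roots X" for \<gamma>
    by (rule w0_minus_one[OF assms]) (use roots_support[OF that] in auto)
  have "winv l (- \<theta>) = \<theta>" "winv l (- \<phi>) = \<phi>"
    using weyl_groupD(7)[OF l] l_plane by metis+
  then have 1: "v \<theta> = \<theta>" "v \<phi> = \<phi>"
    using w0_root[OF dominant_short_root(1)] w0_root[OF highest_root(1)] by (simp_all add: v_def)
  have "l \<circ> v = w0" by (rule HOL.ext) (simp add: v_def weyl_groupD(6)[OF l])
  then have Tw: "Tw w0 = Tw l \<otimes> Tw v" by (rule Tw_w0_comp[OF l v])
  have Tw_l: "Tw l = altp (nat (2 * r)) True" unfolding l_def by (rule Tw_alt_refl) (use r in auto)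
  show thesis
  proof (rule that[OF v 1])
    show "Tw w0 = M \<otimes> (N \<otimes> (M \<otimes> N)) \<otimes> Tw v" if "r = 2"
    proof -
      have "nat (2 * r) = 4" using that by simp
      then show ?thesis unfolding Tw Tw_l by (simp add: numeral_eq_Suc MN_closed)
    qed
    show "Tw w0 = M \<otimes> (N \<otimes> (M \<otimes> (N \<otimes> (M \<otimes> N)))) \<otimes> Tw v" if "r = 3"
    proof -
      have "nat (2 * r) = 6" using that by simp
      then show ?thesis unfolding Tw Tw_l by (simp add: numeral_eq_Suc MN_closed)
    qed
  qed
qed

end

section \<open>Conjugation calculations\<close>

definition cj :: "('a, 'm) monoid_scheme \<Rightarrow> 'a \<Rightarrow> 'a \<Rightarrow> 'a" where
  "cj G g z = g \<otimes>\<^bsub>G\<^esub> z \<otimes>\<^bsub>G\<^esub> inv\<^bsub>G\<^esub> g"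

context group
begin

lemma inv_cancel:
  "u \<in> carrier G \<Longrightarrow> v \<in> carrier G \<Longrightarrow> u \<otimes> (inv u \<otimes> v) = v"
  "u \<in> carrier G \<Longrightarrow> v \<in> carrier G \<Longrightarrow> inv u \<otimes> (u \<otimes> v) = v"
  by (simp_all add: m_assoc[symmetric])

lemmas group_word = m_assoc inv_mult_group inv_cancel

lemma cj_closed [simp]: "g \<in> carrier G \<Longrightarrow> z \<in> carrier G \<Longrightarrow> cj G g z \<in> carrier G"
  by (simp add: cj_def)

lemma cj_mult: "g \<in> carrier G \<Longrightarrow> h \<in> carrier G \<Longrightarrow> z \<in> carrier G \<Longrightarrow> cj G (g \<otimes> h) z = cj G g (cj G h z)"
  by (simp add: cj_def group_word)

lemma cj_fixes: "g \<in> carrier G \<Longrightarrow> z \<in> carrier G \<Longrightarrow> g \<otimes> z = z \<otimes> g \<Longrightarrow> cj G g z = z"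
  by (simp add: cj_def group_word)

lemma inv_commutes:
  assumes "g \<in> carrier G" "h \<in> carrier G" "g \<otimes> h = h \<otimes> g"
  shows "inv g \<otimes> h = h \<otimes> inv g"
proof -
  have "inv g \<otimes> h = inv g \<otimes> (h \<otimes> g) \<otimes> inv g" using assms(1,2) by (simp add: m_assoc)
  also have "\<dots> = h \<otimes> inv g" using assms(1,2) by (simp add: assms(3)[symmetric] group_word)
  finally show ?thesis .
qed

lemma cj_inv_fixes: "g \<in> carrier G \<Longrightarrow> z \<in> carrier G \<Longrightarrow> g \<otimes> z = z \<otimes> g \<Longrightarrow> cj G (inv g) z = z"
  by (simp add: cj_fixes inv_commutes)

text \<open>Moves a conjugation to the other side of a commutation, which turns a relation for the
  image of a generator into one for the generator itself.\<close>

lemma cj_commutes: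
  assumes "w \<in> carrier G" "z \<in> carrier G" "n \<in> carrier G" "cj G w z \<otimes> n = n \<otimes> cj G w z"
  shows "z \<otimes> (inv w \<otimes> n \<otimes> w) = (inv w \<otimes> n \<otimes> w) \<otimes> z"
proof -
  have "z \<otimes> (inv w \<otimes> n \<otimes> w) = inv w \<otimes> (cj G w z \<otimes> n) \<otimes> w" using assms(1-3) by (simp add: cj_def group_word)
  also have "\<dots> = (inv w \<otimes> n \<otimes> w) \<otimes> z" unfolding assms(4) using assms(1-3) by (simp add: cj_def group_word)
  finally show ?thesis .
qed

lemma commutes_left:
  assumes "g \<in> carrier G" "h \<in> carrier G" "g \<otimes> h = h \<otimes> g" "z \<in> carrier G"
  shows "g \<otimes> (h \<otimes> z) = h \<otimes> (g \<otimes> z)"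
  using assms by (simp add: m_assoc[symmetric])

lemma commutes_rules:
  assumes "g \<in> carrier G" "h \<in> carrier G" "g \<otimes> h = h \<otimes> g"
  shows "g \<otimes> h = h \<otimes> g" "z \<in> carrier G \<Longrightarrow> g \<otimes> (h \<otimes> z) = h \<otimes> (g \<otimes> z)"
    "inv g \<otimes> h = h \<otimes> inv g" "z \<in> carrier G \<Longrightarrow> inv g \<otimes> (h \<otimes> z) = h \<otimes> (inv g \<otimes> z)"
    "g \<otimes> inv h = inv h \<otimes> g" "z \<in> carrier G \<Longrightarrow> g \<otimes> (inv h \<otimes> z) = inv h \<otimes> (g \<otimes> z)"
    "inv g \<otimes> inv h = inv h \<otimes> inv g" "z \<in> carrier G \<Longrightarrow> inv g \<otimes> (inv h \<otimes> z) = inv h \<otimes> (inv g \<otimes> z)"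
proof -
  have 1: "inv g \<otimes> h = h \<otimes> inv g" by (rule inv_commutes[OF assms])
  have 2: "g \<otimes> inv h = inv h \<otimes> g" by (rule inv_commutes[OF assms(2,1) assms(3)[symmetric], symmetric])
  have 3: "inv g \<otimes> inv h = inv h \<otimes> inv g" by (rule inv_commutes[OF assms(1) inv_closed[OF assms(2)] 2])
  show "g \<otimes> h = h \<otimes> g" "z \<in> carrier G \<Longrightarrow> g \<otimes> (h \<otimes> z) = h \<otimes> (g \<otimes> z)"
    "inv g \<otimes> h = h \<otimes> inv g" "z \<in> carrier G \<Longrightarrow> inv g \<otimes> (h \<otimes> z) = h \<otimes> (inv g \<otimes> z)"
    "g \<otimes> inv h = inv h \<otimes> g" "z \<in> carrier G \<Longrightarrow> g \<otimes> (inv h \<otimes> z) = inv h \<otimes> (g \<otimes> z)"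
    "inv g \<otimes> inv h = inv h \<otimes> inv g" "z \<in> carrier G \<Longrightarrow> inv g \<otimes> (inv h \<otimes> z) = inv h \<otimes> (inv g \<otimes> z)"
    using assms 1 2 3 commutes_left by simp_all
qed

end

text \<open>Here \<open>x = \<Theta>\<^sub>0\<close>, \<open>y = \<Phi>\<^sub>0\<close>, \<open>\<Phi> = N\<^sup>-\<^sup>1 L\<close> and \<open>\<Theta> = M\<^sup>-\<^sup>1 L\<close>. The central word of the presentation is the
  square of \<open>y L N\<^sup>-\<^sup>1 M\<^sup>-\<^sup>1 x\<close>, because \<open>\<Psi>\<^sup>-\<^sup>1 = N M\<close> and \<open>M\<close>, \<open>N\<close> commute with \<open>x\<close>, \<open>y\<close> respectively.\<close>

locale um_calc = group G for G (structure) +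
  fixes x y M N L :: 'a and a b :: "'a \<Rightarrow> 'a"
  assumes closed [simp]: "x \<in> carrier G" "y \<in> carrier G" "M \<in> carrier G" "N \<in> carrier G" "L \<in> carrier G"
    and Mx: "x \<otimes> M = M \<otimes> x" and Ny: "y \<otimes> N = N \<otimes> y"
    and LM: "M \<otimes> L = L \<otimes> M" and LN: "N \<otimes> L = L \<otimes> N"
    and a: "a \<in> hom G G" "a M = M" "a N = N" "a L = L" "a y = y" "a x = cj G (y \<otimes> inv N \<otimes> L) x"
    and b: "b \<in> hom G G" "b M = M" "b N = N" "b L = L" "b x = x" "b y = cj G (inv M \<otimes> L \<otimes> x) y"
    and central: "\<And>g. g \<in> carrier G \<Longrightarrow>
      (y \<otimes> L \<otimes> inv N \<otimes> inv M \<otimes> x) \<otimes> (y \<otimes> L \<otimes> inv N \<otimes> inv M \<otimes> x) \<otimes> g =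
      g \<otimes> ((y \<otimes> L \<otimes> inv N \<otimes> inv M \<otimes> x) \<otimes> (y \<otimes> L \<otimes> inv N \<otimes> inv M \<otimes> x))"
begin

sublocale a: group_hom G G a by unfold_locales (rule a)
sublocale b: group_hom G G b by unfold_locales (rule b)

lemmas L_left = commutes_rules[OF _ _ LM, simplified] commutes_rules[OF _ _ LN, simplified]
lemmas M_left = commutes_rules[OF _ _ Mx, simplified]
lemmas N_left = commutes_rules[OF _ _ Ny, simplified]
lemmas hom_simps = a(2-6) b(2-6)

definition "h = y \<otimes> L \<otimes> inv N \<otimes> inv M \<otimes> x"

lemma h_closed [simp]: "h \<in> carrier G" by (simp add: h_def)

lemma hh_cj: "g \<in> carrier G \<Longrightarrow> cj G h (cj G h g) = g"
  using central[of g] by (subst cj_mult[symmetric]) (simp_all add: cj_fixes flip: h_def)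

lemma cj_hom_a: "g \<in> carrier G \<Longrightarrow> z \<in> carrier G \<Longrightarrow> a (cj G g z) = cj G (a g) (a z)"
  and cj_hom_b: "g \<in> carrier G \<Longrightarrow> z \<in> carrier G \<Longrightarrow> b (cj G g z) = cj G (b g) (b z)"
  by (simp_all add: cj_def)

text \<open>The conjugator is split so that the relation between \<open>x\<close> and
  \<open>N\<close> enters only through the inner conjugation by
  \<open>inv x \<otimes> inv N\<close>.\<close>

lemma ba_x: "b (a x) = cj G (inv M \<otimes> L \<otimes> x \<otimes> y \<otimes> M) (cj G (inv x \<otimes> inv N) x)"
proof -
  have "b (a x) = cj G (cj G (inv M \<otimes> L \<otimes> x) y \<otimes> inv N \<otimes> L) x"
    by (simp add: hom_simps cj_hom_b)
  also have "cj G (inv M \<otimes> L \<otimes> x) y \<otimes> inv N \<otimes> L = (inv M \<otimes> L \<otimes> x \<otimes> y \<otimes> M) \<otimes> (inv x \<otimes> inv N)"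
    by (simp add: cj_def group_word L_left M_left)
  finally show ?thesis by (simp add: cj_mult)
qed

text \<open>Derives the relation of length 4 between \<open>x\<close> and \<open>N\<close>. Since
  \<open>h h\<close> is central, \<open>h\<close> and its inverse conjugate \<open>N\<close> to the
  same element. The conjugate by \<open>inv h\<close> is \<open>q\<close>, and \<open>q\<close>
  commutes with \<open>y\<close>; stripping \<open>y\<close> from the conjugate by \<open>h\<close>
  leaves a relation in \<open>M\<close>, \<open>N\<close>, \<open>x\<close> alone.\<close>

lemma ba_x_r2:
  assumes L: "L = M \<otimes> (N \<otimes> (M \<otimes> N))"
  shows "b (a x) = cj G (N \<otimes> inv y) x"
proof -
  have h: "h = y \<otimes> (M \<otimes> (N \<otimes> x))"
  proof -
    have "L \<otimes> inv N \<otimes> inv M = M \<otimes> N" unfolding L by (simp add: group_word)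
    moreover have "h = y \<otimes> (L \<otimes> inv N \<otimes> inv M) \<otimes> x" by (simp add: h_def m_assoc)
    ultimately show ?thesis by (simp add: m_assoc)
  qed
  have NL: "L = N \<otimes> (M \<otimes> (N \<otimes> M))"
  proof -
    have "inv M \<otimes> L \<otimes> M = N \<otimes> (M \<otimes> (N \<otimes> M))" unfolding L by (simp add: group_word)
    then show ?thesis by (simp add: L_left group_word)
  qed
  have \<Theta>: "inv N \<otimes> (inv M \<otimes> (N \<otimes> (M \<otimes> N))) = M \<otimes> (N \<otimes> inv M)"
  proof -
    have "inv N \<otimes> (inv M \<otimes> (N \<otimes> (M \<otimes> N))) = inv N \<otimes> inv M \<otimes> L \<otimes> inv M" unfolding NL by (simp add: group_word)
    also have "\<dots> = L \<otimes> inv N \<otimes> inv M \<otimes> inv M" by (simp add: L_left group_word)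
    also have "\<dots> = M \<otimes> (N \<otimes> inv M)" unfolding L by (simp add: group_word)
    finally show ?thesis .
  qed
  \<comment> \<open>If \<open>b\<close> sends \<open>y\<close> to its conjugate by \<open>w\<close>,
    then \<open>q = w^-1 N w\<close>. Applying \<open>b\<close> to \<open>y N = N y\<close>
    therefore shows that \<open>q\<close> commutes with \<open>y\<close>.\<close>
  define q where "q = M \<otimes> (inv x \<otimes> (N \<otimes> (x \<otimes> inv M)))"
  have q [simp]: "q \<in> carrier G" by (simp add: q_def)
  have yq: "y \<otimes> q = q \<otimes> y"
  proof -
    let ?w = "inv M \<otimes> L \<otimes> x"
    have "b (y \<otimes> N) = b (N \<otimes> y)" by (simp only: Ny)
    then have "cj G ?w y \<otimes> N = N \<otimes> cj G ?w y" by (simp add: hom_simps)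
    then have "y \<otimes> (inv ?w \<otimes> N \<otimes> ?w) = (inv ?w \<otimes> N \<otimes> ?w) \<otimes> y" by (intro cj_commutes) simp_all
    moreover have "inv ?w \<otimes> N \<otimes> ?w = q"
      by (simp add: q_def group_word L_left M_left)
    ultimately show ?thesis by (simp only:)
  qed
  have "h \<otimes> N \<otimes> inv h = inv h \<otimes> N \<otimes> h"
  proof -
    have "inv h \<otimes> (h \<otimes> h \<otimes> N) \<otimes> inv h = inv h \<otimes> (N \<otimes> (h \<otimes> h)) \<otimes> inv h"
      using central[of N] by (simp add: h_def)
    then show ?thesis by (simp add: group_word)
  qed
  also have "inv h \<otimes> N \<otimes> h = inv x \<otimes> (inv N \<otimes> (inv M \<otimes> (N \<otimes> (M \<otimes> N)))) \<otimes> x"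
    by (simp add: h group_word N_left)
  also have "\<dots> = q" unfolding \<Theta> by (simp add: q_def group_word M_left)
  finally have "inv y \<otimes> (h \<otimes> N \<otimes> inv h) \<otimes> y = inv y \<otimes> (q \<otimes> y)" by (simp add: m_assoc)
  then have "M \<otimes> (N \<otimes> (x \<otimes> (N \<otimes> (inv x \<otimes> (inv N \<otimes> inv M))))) = q"
    by (simp add: h group_word yq[symmetric])
  then have "inv M \<otimes> (M \<otimes> (N \<otimes> (x \<otimes> (N \<otimes> (inv x \<otimes> (inv N \<otimes> inv M)))))) \<otimes> M = inv M \<otimes> q \<otimes> M" by simp
  \<comment> \<open>Equivalent to \<open>x N x N = N x N x\<close>.\<close>
  then have e: "N \<otimes> (x \<otimes> (N \<otimes> (inv x \<otimes> inv N))) = inv x \<otimes> (N \<otimes> x)"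
    by (simp add: q_def group_word)
  have "inv (inv x \<otimes> (N \<otimes> x)) \<otimes> N \<otimes> x = inv (N \<otimes> (x \<otimes> (N \<otimes> (inv x \<otimes> inv N)))) \<otimes> N \<otimes> x"
    by (simp add: e)
  then have *: "cj G (inv x \<otimes> inv N) x = cj G N x" by (simp add: cj_def group_word)
  have "b (a x) = cj G (inv M \<otimes> L \<otimes> x \<otimes> y \<otimes> M \<otimes> N) x" unfolding ba_x * by (simp add: cj_mult)
  \<comment> \<open>The conjugator contains the central square of \<open>h\<close>, and its last
    factor \<open>inv x\<close> fixes \<open>x\<close>.\<close>
  also have "inv M \<otimes> L \<otimes> x \<otimes> y \<otimes> M \<otimes> N = (N \<otimes> inv y) \<otimes> (h \<otimes> h) \<otimes> inv x"
  proof -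
    have "inv M \<otimes> L = N \<otimes> (M \<otimes> N)" unfolding L by (simp add: group_word)
    then show ?thesis by (simp add: h m_assoc) (simp add: group_word)
  qed
  also have "cj G ((N \<otimes> inv y) \<otimes> (h \<otimes> h) \<otimes> inv x) x = cj G (N \<otimes> inv y) x"
    by (simp add: cj_mult hh_cj cj_inv_fixes)
  finally show ?thesis .
qed

lemma aba_x_r2:
  assumes "L = M \<otimes> (N \<otimes> (M \<otimes> N))"
  shows "a (b (a x)) = cj G L x"
proof -
  have "a (b (a x)) = cj G (N \<otimes> inv y \<otimes> (y \<otimes> inv N \<otimes> L)) x"
    unfolding ba_x_r2[OF assms] by (simp add: cj_hom_a hom_simps cj_mult)
  also have "N \<otimes> inv y \<otimes> (y \<otimes> inv N \<otimes> L) = L" by (simp add: group_word)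
  finally show ?thesis .
qed

text \<open>By the relation of length 3, conjugating \<open>x\<close> by
  \<open>inv x \<otimes> inv N\<close> gives \<open>N\<close>. The images are thus conjugates of
  \<open>N\<close> until a later step turns them back into conjugates of \<open>x\<close>; the
  factor \<open>h h\<close> drops out as in level 2.\<close>

lemma ababa_x_r3:
  assumes L: "L = M \<otimes> (N \<otimes> (M \<otimes> (N \<otimes> (M \<otimes> N))))" and braid: "x \<otimes> (N \<otimes> x) = N \<otimes> (x \<otimes> N)"
  shows "a (b (a (b (a x)))) = cj G (L \<otimes> L) x"
proof -
  have 1: "cj G (inv x \<otimes> inv N) x = N"
  proof -
    have "cj G (inv x \<otimes> inv N) x = inv x \<otimes> inv N \<otimes> (x \<otimes> (N \<otimes> x))" by (simp add: cj_def group_word)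
    also have "\<dots> = N" unfolding braid by (simp add: group_word)
    finally show ?thesis .
  qed
  have 2: "cj G (inv x) N = cj G N x"
  proof -
    have "cj G (inv x) N = inv x \<otimes> (N \<otimes> (x \<otimes> N)) \<otimes> inv N" by (simp add: cj_def group_word)
    also have "\<dots> = cj G N x" unfolding braid[symmetric] by (simp add: cj_def group_word)
    finally show ?thesis .
  qed
  let ?D = "L \<otimes> inv N \<otimes> inv M"
  have xyM: "inv M \<otimes> L \<otimes> x \<otimes> y \<otimes> M = N \<otimes> inv y \<otimes> (h \<otimes> h) \<otimes> (inv x \<otimes> inv ?D \<otimes> M)"
    by (simp add: h_def group_word L_left N_left)
  have "b (a x) = cj G (N \<otimes> inv y \<otimes> inv x \<otimes> inv ?D \<otimes> M) N"
    unfolding ba_x 1 xyM by (simp add: cj_mult hh_cj)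
  also have "\<dots> = cj G (N \<otimes> inv y \<otimes> inv x \<otimes> inv ?D \<otimes> M \<otimes> N) N" by (simp add: cj_mult cj_fixes)
  also have "N \<otimes> inv y \<otimes> inv x \<otimes> inv ?D \<otimes> M \<otimes> N = N \<otimes> inv y \<otimes> inv x \<otimes> inv N \<otimes> inv M"
  proof -
    have "inv ?D \<otimes> M \<otimes> N = inv L \<otimes> (M \<otimes> (N \<otimes> (M \<otimes> N)))" by (simp add: group_word L_left)
    also have "\<dots> = inv N \<otimes> inv M" unfolding L by (simp add: group_word)
    finally show ?thesis by (simp add: m_assoc)
  qed
  finally have ba: "b (a x) = cj G (N \<otimes> inv y \<otimes> inv x \<otimes> inv N \<otimes> inv M) N" .
  have "a (b (a x)) = cj G (N \<otimes> inv y \<otimes> inv (cj G (y \<otimes> inv N \<otimes> L) x) \<otimes> inv N \<otimes> inv M) N"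
    unfolding ba by (simp add: cj_hom_a hom_simps)
  also have "N \<otimes> inv y \<otimes> inv (cj G (y \<otimes> inv N \<otimes> L) x) \<otimes> inv N \<otimes> inv M = L \<otimes> inv x \<otimes> inv L \<otimes> inv y \<otimes> inv M"
    by (simp add: cj_def group_word N_left)
  finally have aba: "a (b (a x)) = cj G (L \<otimes> inv x \<otimes> inv L \<otimes> inv y \<otimes> inv M) N" .
  have "b (a (b (a x))) = cj G (L \<otimes> inv x \<otimes> inv L \<otimes> inv (cj G (inv M \<otimes> L \<otimes> x) y) \<otimes> inv M) N"
    unfolding aba by (simp add: cj_hom_b hom_simps)
  also have "L \<otimes> inv x \<otimes> inv L \<otimes> inv (cj G (inv M \<otimes> L \<otimes> x) y) \<otimes> inv M =
      L \<otimes> (inv x \<otimes> (inv L \<otimes> (inv M \<otimes> (L \<otimes> (x \<otimes> (inv y \<otimes> (inv x \<otimes> inv L)))))))"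
    by (simp add: cj_def group_word)
  also have "\<dots> = (L \<otimes> inv M \<otimes> inv y) \<otimes> inv x \<otimes> inv L"
    by (simp add: group_word L_left M_left)
  also have "cj G ((L \<otimes> inv M \<otimes> inv y) \<otimes> inv x \<otimes> inv L) N = cj G (L \<otimes> inv M \<otimes> inv y) (cj G N x)"
    by (simp add: cj_mult cj_inv_fixes[of L N] LN 2)
  finally have "a (b (a (b (a x)))) = cj G (L \<otimes> inv M \<otimes> inv y \<otimes> N \<otimes> (y \<otimes> inv N \<otimes> L)) x"
    by (simp add: cj_hom_a hom_simps cj_mult)
  also have "L \<otimes> inv M \<otimes> inv y \<otimes> N \<otimes> (y \<otimes> inv N \<otimes> L) = L \<otimes> L \<otimes> inv M" by (simp add: group_word L_left N_left)
  also have "cj G (L \<otimes> L \<otimes> inv M) x = cj G (L \<otimes> L) x" by (simp add: cj_mult cj_inv_fixes Mx)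
  finally show ?thesis .
qed

end

text \<open>Reversing products turns conjugation by \<open>u\<close> into conjugation by its
  inverse, which is the form of the images under the inverse automorphisms.\<close>

definition opposite :: "('a, 'm) monoid_scheme \<Rightarrow> ('a, 'm) monoid_scheme" where
  "opposite G = G\<lparr>mult := \<lambda>u v. v \<otimes>\<^bsub>G\<^esub> u\<rparr>"

lemma opposite_simps [simp]:
  "carrier (opposite G) = carrier G" "u \<otimes>\<^bsub>opposite G\<^esub> v = v \<otimes>\<^bsub>G\<^esub> u" "\<one>\<^bsub>opposite G\<^esub> = \<one>\<^bsub>G\<^esub>"
  by (simp_all add: opposite_def)

context group
begin

lemma group_opposite: "group (opposite G)"
proof (rule groupI)
  show "\<exists>v\<in>carrier (opposite G). v \<otimes>\<^bsub>opposite G\<^esub> u = \<one>\<^bsub>opposite G\<^esub>" if "u \<in> carrier (opposite G)" for u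
    using that by (intro bexI[of _ "inv u"]) simp_all
qed (simp_all add: m_assoc)

lemma inv_opposite [simp]:
  assumes "u \<in> carrier G"
  shows "inv\<^bsub>opposite G\<^esub> u = inv u"
  by (rule group.inv_equality[OF group_opposite]) (use assms in simp_all)

lemma cj_opposite: "u \<in> carrier G \<Longrightarrow> z \<in> carrier G \<Longrightarrow> cj (opposite G) u z = cj G (inv u) z"
  by (simp add: cj_def m_assoc)

lemma hom_opposite: "f \<in> hom G G \<Longrightarrow> f \<in> hom (opposite G) (opposite G)"
  by (auto simp: hom_def)

end

text \<open>Passing to the opposite group and to the inverse automorphisms interchanges the roles of the
  two affine generators.\<close>

locale um_calc_auto = um_calc +
  fixes a' b'
  assumes a': "a' \<in> hom G G" "\<And>g. g \<in> carrier G \<Longrightarrow> a (a' g) = g" "\<And>g. g \<in> carrier G \<Longrightarrow> a' (a g) = g"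
    and b': "b' \<in> hom G G" "\<And>g. g \<in> carrier G \<Longrightarrow> b (b' g) = g" "\<And>g. g \<in> carrier G \<Longrightarrow> b' (b g) = g"
begin

sublocale a': group_hom G G a' by unfold_locales (rule a')
sublocale b': group_hom G G b' by unfold_locales (rule b')

lemma inverse_simps: "a' M = M" "a' N = N" "a' L = L" "a' y = y" "b' M = M" "b' N = N" "b' L = L" "b' x = x"
  using a'(3)[of M] a'(3)[of N] a'(3)[of L] a'(3)[of y] b'(3)[of M] b'(3)[of N] b'(3)[of L] b'(3)[of x]
  by (simp_all add: hom_simps)

lemma inverse_images: "a' x = cj G (inv (y \<otimes> inv N \<otimes> L)) x" "b' y = cj G (inv (inv M \<otimes> L \<otimes> x)) y"
proof -
  let ?u = "y \<otimes> inv N \<otimes> L" and ?w = "inv M \<otimes> L \<otimes> x"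
  have "a' (a (cj G (inv ?u) x)) = a' x"
    by (rule arg_cong[of _ _ a']) (simp add: cj_def hom_simps group_word)
  then show "a' x = cj G (inv ?u) x" using a'(3)[of "cj G (inv ?u) x"] by simp
  have "b' (b (cj G (inv ?w) y)) = b' y"
    by (rule arg_cong[of _ _ b']) (simp add: cj_def hom_simps group_word)
  then show "b' y = cj G (inv ?w) y" using b'(3)[of "cj G (inv ?w) y"] by simp
qed

sublocale dual: um_calc "opposite G" y x N M L b' a'
proof (intro um_calc.intro group_opposite um_calc_axioms.intro)
  show "b' \<in> hom (opposite G) (opposite G)" "a' \<in> hom (opposite G) (opposite G)" using a' b' hom_opposite by blast+
  show "b' y = cj (opposite G) (x \<otimes>\<^bsub>opposite G\<^esub> inv\<^bsub>opposite G\<^esub> M \<otimes>\<^bsub>opposite G\<^esub> L) y"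
    by (simp add: cj_opposite inverse_images group_word L_left)
  show "a' x = cj (opposite G) (inv\<^bsub>opposite G\<^esub> N \<otimes>\<^bsub>opposite G\<^esub> L \<otimes>\<^bsub>opposite G\<^esub> y) x"
    by (simp add: cj_opposite inverse_images group_word L_left)
  fix g assume g: "g \<in> carrier (opposite G)"
  \<comment> \<open>Reversed and with exchanged roles, the word of \<open>h\<close> is
    \<open>h\<close> again, because \<open>L\<close> commutes with \<open>M\<close> and
    \<open>N\<close>.\<close>
  have h: "x \<otimes>\<^bsub>opposite G\<^esub> L \<otimes>\<^bsub>opposite G\<^esub> inv\<^bsub>opposite G\<^esub> M \<otimes>\<^bsub>opposite G\<^esub> inv\<^bsub>opposite G\<^esub> N \<otimes>\<^bsub>opposite G\<^esub> y = h"
    by (simp add: h_def group_word L_left)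
  show "x \<otimes>\<^bsub>opposite G\<^esub> L \<otimes>\<^bsub>opposite G\<^esub> inv\<^bsub>opposite G\<^esub> M \<otimes>\<^bsub>opposite G\<^esub> inv\<^bsub>opposite G\<^esub> N \<otimes>\<^bsub>opposite G\<^esub> y \<otimes>\<^bsub>opposite G\<^esub>
      (x \<otimes>\<^bsub>opposite G\<^esub> L \<otimes>\<^bsub>opposite G\<^esub> inv\<^bsub>opposite G\<^esub> M \<otimes>\<^bsub>opposite G\<^esub> inv\<^bsub>opposite G\<^esub> N \<otimes>\<^bsub>opposite G\<^esub> y) \<otimes>\<^bsub>opposite G\<^esub> g =
      g \<otimes>\<^bsub>opposite G\<^esub> (x \<otimes>\<^bsub>opposite G\<^esub> L \<otimes>\<^bsub>opposite G\<^esub> inv\<^bsub>opposite G\<^esub> M \<otimes>\<^bsub>opposite G\<^esub> inv\<^bsub>opposite G\<^esub> N \<otimes>\<^bsub>opposite G\<^esub> y \<otimes>\<^bsub>opposite G\<^esub>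
      (x \<otimes>\<^bsub>opposite G\<^esub> L \<otimes>\<^bsub>opposite G\<^esub> inv\<^bsub>opposite G\<^esub> M \<otimes>\<^bsub>opposite G\<^esub> inv\<^bsub>opposite G\<^esub> N \<otimes>\<^bsub>opposite G\<^esub> y))"
    unfolding h using central[of g] g by (simp flip: h_def)
qed (simp_all add: inverse_simps Mx Ny LM LN)

lemma abab_r2:
  assumes L: "L = M \<otimes> (N \<otimes> (M \<otimes> N))"
  shows "a (b (a (b x))) = cj G L x" "a (b (a (b y))) = cj G L y"
proof -
  show "a (b (a (b x))) = cj G L x" by (simp only: b(5) aba_x_r2[OF L])
  \<comment> \<open>The dual statement describes the inverse of \<open>a b a b\<close> at
    \<open>y\<close>; applying \<open>a b a b\<close> to both sides gives the image of
    \<open>y\<close> itself.\<close>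
  have "b' (a' (b' (a' y))) = cj G (inv L) y"
    using dual.aba_x_r2 by (simp add: inverse_simps cj_opposite L m_assoc)
  then have "a (b (a (b (b' (a' (b' (a' y))))))) = a (b (a (b (cj G (inv L) y))))" by simp
  then have "y = cj G (inv L) (a (b (a (b y))))" by (simp add: a' b' hom_simps cj_hom_a cj_hom_b)
  then have "cj G L y = cj G (L \<otimes> inv L) (a (b (a (b y))))" by (subst cj_mult) simp_all
  then show "a (b (a (b y))) = cj G L y" by (simp add: cj_fixes)
qed

lemma ababab_r3:
  assumes L: "L = M \<otimes> (N \<otimes> (M \<otimes> (N \<otimes> (M \<otimes> N))))"
    and braid: "x \<otimes> (N \<otimes> x) = N \<otimes> (x \<otimes> N)" "y \<otimes> (M \<otimes> y) = M \<otimes> (y \<otimes> M)"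
  shows "a (b (a (b (a (b x))))) = cj G (L \<otimes> L) x" "a (b (a (b (a (b y))))) = cj G (L \<otimes> L) y"
proof -
  show "a (b (a (b (a (b x))))) = cj G (L \<otimes> L) x" by (simp only: b(5) ababa_x_r3[OF L braid(1)])
  have "b' (a' (b' (a' (b' (a' y))))) = cj G (inv (L \<otimes> L)) y"
    using dual.ababa_x_r3 braid(2) by (simp add: inverse_simps cj_opposite L m_assoc)
  then have "a (b (a (b (a (b (b' (a' (b' (a' (b' (a' y))))))))))) = a (b (a (b (a (b (cj G (inv (L \<otimes> L)) y))))))" by simp
  then have "y = cj G (inv (L \<otimes> L)) (a (b (a (b (a (b y))))))" by (simp add: a' b' hom_simps cj_hom_a cj_hom_b del: inv_mult_group)
  then have "cj G (L \<otimes> L) y = cj G (L \<otimes> L \<otimes> inv (L \<otimes> L)) (a (b (a (b (a (b y))))))" by (subst cj_mult) simp_all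
  then show "a (b (a (b (a (b y))))) = cj G (L \<otimes> L) y" by (simp add: cj_fixes)
qed

end

section \<open>The action on the affine generators\<close>

lemma nodes_simps [simp]:
  "i \<in> {1..rk X} \<Longrightarrow> T i \<in> nodes k X"
  "g \<in> affine_nodes k \<Longrightarrow> g \<in> nodes k X"
  by (auto simp: nodes_def)

lemma affine_nodes_simps:
  "affine_nodes DDD = {Theta01, Theta02, Theta03}" "affine_nodes UM = {Theta0, Phi0}"
  by (simp_all add: affine_nodes_def)

lemma T_not_affine [simp]: "T i \<notin> affine_nodes k"
  by (cases k) (simp_all add: affine_nodes_def)

lemma finite_nodes: "finite (nodes k X)"
  by (cases k) (simp_all add: nodes_def affine_nodes_def)

lemma alternating_gwords: "g \<in> S \<Longrightarrow> h \<in> S \<Longrightarrow> alternating m g h \<in> gwords S"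
  by (induction m arbitrary: g h) simp_all

locale datum =
  fixes k X
  assumes valid: "valid_datum k X"
begin

abbreviation "G \<equiv> B_group k X"
abbreviation "cl \<equiv> B_class k X"
abbreviation "gen g \<equiv> cl (pos g)"
abbreviation "W \<equiv> gwords (nodes k X)"

sublocale root_system X by (rule root_system_valid[OF valid])

sublocale G: group G by (simp add: B_group_def group_pres_group)

lemma cl_closed [simp]: "u \<in> W \<Longrightarrow> cl u \<in> carrier G"
  by (simp add: B_group_def B_class_def pres_carrier)

lemma cl_append: "u \<in> W \<Longrightarrow> v \<in> W \<Longrightarrow> cl (u @ v) = cl u \<otimes>\<^bsub>G\<^esub> cl v"
  by (simp add: B_group_def B_class_def pres_mult)

lemma cl_Nil: "cl [] = \<one>\<^bsub>G\<^esub>"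
  by (simp add: B_group_def B_class_def pres_one)

lemma cl_word_inv: "u \<in> W \<Longrightarrow> cl (word_inv u) = inv\<^bsub>G\<^esub> cl u"
  by (simp add: B_group_def B_class_def pres_inv)

lemma cl_neg: "g \<in> nodes k X \<Longrightarrow> cl (neg g) = inv\<^bsub>G\<^esub> gen g"
  using cl_word_inv[of "pos g"] by (simp add: word_inv_def)

lemma cl_Cons: "g \<in> nodes k X \<Longrightarrow> u \<in> W \<Longrightarrow> cl ((g, True) # u) = gen g \<otimes>\<^bsub>G\<^esub> cl u"
  using cl_append[of "pos g" u] by simp

lemma cl_Cons_Cons: "g \<in> nodes k X \<Longrightarrow> h # u \<in> W \<Longrightarrow> cl ((g, True) # h # u) = gen g \<otimes>\<^bsub>G\<^esub> cl (h # u)"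
  by (rule cl_Cons)

lemma cl_relation: "(u, v) \<in> B_relations k X \<Longrightarrow> u \<in> W \<Longrightarrow> v \<in> W \<Longrightarrow> cl u = cl v"
  by (simp add: B_class_def pres_class_eq_iff pres_eq.rel)

lemma braid_relation:
  assumes "g \<in> nodes k X" "h \<in> nodes k X" "g \<noteq> h" "edges k X g h < 4"
  shows "cl (alternating (braid_length (edges k X g h)) g h) = cl (alternating (braid_length (edges k X g h)) h g)"
proof (rule cl_relation)
  show "(alternating (braid_length (edges k X g h)) g h, alternating (braid_length (edges k X g h)) h g) \<in> B_relations k X"
    unfolding B_relations_def braid_relations_def
    by (rule UnI1, rule UnI1, rule CollectI, rule exI[of _ g], rule exI[of _ h], intro conjI HOL.refl assms)
qed (intro alternating_gwords assms)+

lemma cl_alternating_T: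
  assumes "i \<in> {1..rk X}" "j \<in> {1..rk X}"
  shows "cl (alternating m (T i) (T j)) = foldr (\<lambda>i x. gen (T i) \<otimes>\<^bsub>G\<^esub> x) (alt m i j) \<one>\<^bsub>G\<^esub>"
  using assms
proof (induction m arbitrary: i j)
  case (Suc m)
  then have "T i \<in> nodes k X" "alternating m (T j) (T i) \<in> W" by (simp_all add: alternating_gwords)
  then have "cl ((T i, True) # alternating m (T j) (T i)) = gen (T i) \<otimes>\<^bsub>G\<^esub> cl (alternating m (T j) (T i))"
    by (rule cl_Cons)
  then show ?case using Suc by simp
qed (simp add: cl_Nil)

sublocale artin X G "\<lambda>i. gen (T i)"
proof unfold_locales
  show "gen (T i) \<in> carrier G" if "i \<in> {1..rk X}" for i using that by simp
  show "foldr (\<lambda>i x. gen (T i) \<otimes>\<^bsub>G\<^esub> x) (alt (coxeter_m X i j) i j) \<one>\<^bsub>G\<^esub> =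
      foldr (\<lambda>i x. gen (T i) \<otimes>\<^bsub>G\<^esub> x) (alt (coxeter_m X i j) j i) \<one>\<^bsub>G\<^esub>"
    if ij: "i \<in> {1..rk X}" "j \<in> {1..rk X}" "i \<noteq> j" for i j
  proof -
    have e: "coxeter_m X i j = braid_length (edges k X (T i) (T j))" by (simp add: edges_def coxeter_m_def)
    have "edges k X (T i) (T j) < 4" using cartan_cases[OF ij] by (auto simp: edges_def)
    then show ?thesis
      using braid_relation[of "T i" "T j"] ij by (simp add: e cl_alternating_T)
  qed
qed

lemma T_word_gwords: "w \<in> weyl_group X \<Longrightarrow> T_word X w \<in> W"
  and cl_T_word: "w \<in> weyl_group X \<Longrightarrow> cl (T_word X w) = Tw w"
proof -
  assume w: "w \<in> weyl_group X"
  let ?u = "SOME u. reduced_word X u w"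
  have "reduced_word X ?u w" using ex_reduced_word[OF w] by (rule someI_ex)
  then have u: "?u \<in> weyl_words X" by (simp add: reduced_word_iff)
  have "map (\<lambda>i. (T i, True)) u \<in> W \<and> cl (map (\<lambda>i. (T i, True)) u) = prodw u" if "u \<in> weyl_words X" for u
    using that
  proof (induction u rule: list.induct)
    case (Cons i u)
    then have "cl ((T i, True) # map (\<lambda>i. (T i, True)) u) = gen (T i) \<otimes>\<^bsub>G\<^esub> cl (map (\<lambda>i. (T i, True)) u)"
      by (intro cl_Cons) simp_all
    then show ?case using Cons by simp
  qed (simp add: cl_Nil)
  from this[OF u] show "T_word X w \<in> W" "cl (T_word X w) = Tw w" by (simp_all add: T_word_def Tw_def)
qed

lemma central_relation:
  assumes "central_word k X \<in> W" "g \<in> nodes k X"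
  shows "cl (central_word k X) \<otimes>\<^bsub>G\<^esub> gen g = gen g \<otimes>\<^bsub>G\<^esub> cl (central_word k X)"
proof -
  have "(central_word k X @ [(g, True)], (g, True) # central_word k X) \<in> B_relations k X"
    unfolding B_relations_def central_relations_def
    by (rule UnI1, rule UnI2, rule CollectI, rule exI[of _ g], intro conjI HOL.refl assms)
  then have "cl (central_word k X @ [(g, True)]) = cl ((g, True) # central_word k X)"
    by (rule cl_relation) (use assms in simp_all)
  also have "\<dots> = gen g \<otimes>\<^bsub>G\<^esub> cl (central_word k X)" using assms by (rule cl_Cons[rotated])
  finally show ?thesis using assms by (simp add: cl_append)
qed

text \<open>Orthogonal roots are joined by no edge, and the braid relation for 0 edges is
  commutation.\<close>

lemma orthogonal_commute:
  assumes g: "g \<in> affine_nodes k" and i: "i \<in> {1..rk X}" and "inner_form X (node_root X g) (simple_root i) = 0"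
  shows "gen (T i) \<otimes>\<^bsub>G\<^esub> gen g = gen g \<otimes>\<^bsub>G\<^esub> gen (T i)"
proof -
  have "edges k X (T i) g = 0"
    using assms by (auto simp: edges_def copairing_def inner_form_sym)
  then show ?thesis
    using braid_relation[of "T i" g] assms by (cases "T i = g") (auto simp: braid_length_def numeral_eq_Suc cl_Cons_Cons)
qed

lemma node_root_dominant:
  assumes "g \<in> affine_nodes k"
  shows "dominant X (node_root X g)"
  using assms highest_root_dominant dominant_short_root(2) by (cases k) (auto simp: affine_nodes_simps)

text \<open>Makes the lift of \<open>v\<close> drop out when a product ending in it conjugates an
  affine generator whose root is fixed by \<open>v\<close>.\<close>

lemma Tw_affine_commute:
  assumes "g \<in> affine_nodes k" "w \<in> weyl_group X" "w (node_root X g) = node_root X g"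
  shows "Tw w \<otimes>\<^bsub>G\<^esub> gen g = gen g \<otimes>\<^bsub>G\<^esub> Tw w"
  using assms by (intro Tw_commute[of _ "node_root X g"] node_root_dominant orthogonal_commute) auto

abbreviation "K \<equiv> generate G ((\<lambda>i. gen (T i)) ` {1..rk X})"

lemma K_subgroup: "subgroup K G"
  by (rule G.generate_is_subgroup) auto

lemma Tw_in_K:
  assumes "w \<in> weyl_group X"
  shows "Tw w \<in> K"
proof -
  obtain u where u: "reduced_word X u w" using ex_reduced_word[OF assms] by blast
  then have "u \<in> weyl_words X" by (simp add: reduced_word_iff)
  then have "prodw u \<in> K"
  proof (induction u rule: list.induct)
    case (Cons i u)
    then have "gen (T i) \<in> K" "prodw u \<in> K" by (auto intro: generate.incl)
    then show ?case using generate.eng[of "gen (T i)" G _ "prodw u"] by simp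
  qed (simp add: generate.one)
  then show ?thesis by (simp add: Tw_reduced[OF u])
qed

definition "\<zeta> = Tw w0"

lemma \<zeta>_closed [simp]: "\<zeta> \<in> carrier G" by (simp add: \<zeta>_def w0(1))

lemma \<zeta>_K: "\<zeta> \<in> K" unfolding \<zeta>_def by (rule Tw_in_K[OF w0(1)])

lemma commutes_K:
  assumes z: "z \<in> carrier G" "\<And>i. i \<in> {1..rk X} \<Longrightarrow> z \<otimes>\<^bsub>G\<^esub> gen (T i) = gen (T i) \<otimes>\<^bsub>G\<^esub> z" and g: "g \<in> K"
  shows "z \<otimes>\<^bsub>G\<^esub> g = g \<otimes>\<^bsub>G\<^esub> z"
  using g
proof (induction rule: generate.induct)
  case (eng g h)
  then have "g \<in> carrier G" "h \<in> carrier G" using subgroup.subset[OF K_subgroup] by blast+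
  then show ?case using eng.IH z(1) by (metis G.m_assoc)
next
  case (inv g)
  then show ?case using G.commutes_rules(5)[OF z(1)] z(2) by auto
qed (use z in auto)

lemma \<zeta>_T: "i \<in> {1..rk X} \<Longrightarrow> \<zeta> \<otimes>\<^bsub>G\<^esub> gen (T i) = gen (T (opp i)) \<otimes>\<^bsub>G\<^esub> \<zeta>"
  unfolding \<zeta>_def by (rule Tw_w0_simple)

lemma \<zeta>_central:
  assumes "\<not> exceptional k X" "g \<in> K"
  shows "\<zeta> \<otimes>\<^bsub>G\<^esub> g = g \<otimes>\<^bsub>G\<^esub> \<zeta>"
  by (rule commutes_K[OF _ _ assms(2)]) (use \<zeta>_T opp_not_exceptional[OF valid assms(1)] in auto)

text \<open>\<open>\<zeta>\<close> permutes the generators by \<open>opp\<close>, which is an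
  involution.\<close>

lemma \<zeta>\<zeta>_central:
  assumes "g \<in> K"
  shows "(\<zeta> \<otimes>\<^bsub>G\<^esub> \<zeta>) \<otimes>\<^bsub>G\<^esub> g = g \<otimes>\<^bsub>G\<^esub> (\<zeta> \<otimes>\<^bsub>G\<^esub> \<zeta>)"
proof (rule commutes_K[OF _ _ assms])
  fix i assume i: "i \<in> {1..rk X}"
  have "(\<zeta> \<otimes>\<^bsub>G\<^esub> \<zeta>) \<otimes>\<^bsub>G\<^esub> gen (T i) = \<zeta> \<otimes>\<^bsub>G\<^esub> (gen (T (opp i)) \<otimes>\<^bsub>G\<^esub> \<zeta>)" using i by (simp add: G.m_assoc \<zeta>_T)
  also have "\<dots> = gen (T i) \<otimes>\<^bsub>G\<^esub> (\<zeta> \<otimes>\<^bsub>G\<^esub> \<zeta>)"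
    using \<zeta>_T[OF opp(1)[OF i]] opp(1)[OF i] i by (simp add: G.m_assoc[symmetric] opp_opp)
  finally show "(\<zeta> \<otimes>\<^bsub>G\<^esub> \<zeta>) \<otimes>\<^bsub>G\<^esub> gen (T i) = gen (T i) \<otimes>\<^bsub>G\<^esub> (\<zeta> \<otimes>\<^bsub>G\<^esub> \<zeta>)" .
qed simp

lemma hom_eqI:
  assumes "\<phi> \<in> hom G G" "\<psi> \<in> hom G G" "\<And>g. g \<in> nodes k X \<Longrightarrow> \<phi> (gen g) = \<psi> (gen g)" "g \<in> carrier G"
  shows "\<phi> g = \<psi> g"
  using pres_hom_eqI[of G \<phi> "nodes k X" "B_relations k X" \<psi> g] assms
  by (simp add: G.is_group flip: B_group_def B_class_def)

lemma cj_hom: "z \<in> carrier G \<Longrightarrow> cj G z \<in> hom G G"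
  by (auto simp: hom_def cj_def G.group_word)

lemma central_all:
  assumes "z \<in> carrier G" "\<And>g. g \<in> nodes k X \<Longrightarrow> z \<otimes>\<^bsub>G\<^esub> gen g = gen g \<otimes>\<^bsub>G\<^esub> z" "g \<in> carrier G"
  shows "z \<otimes>\<^bsub>G\<^esub> g = g \<otimes>\<^bsub>G\<^esub> z"
proof -
  have "cj G z g = id g"
    by (rule hom_eqI[OF cj_hom[OF assms(1)] _ _ assms(3)]) (use assms(1,2) in \<open>simp_all add: G.cj_fixes hom_def\<close>)
  then have "cj G z g \<otimes>\<^bsub>G\<^esub> z = g \<otimes>\<^bsub>G\<^esub> z" by simp
  then show ?thesis using assms(1,3) by (simp add: cj_def G.m_assoc)
qed

end

locale action = datum +
  fixes act
  assumes act: "is_Gamma_action k X act"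
begin

abbreviation "r \<equiv> level k X"
abbreviation "E \<equiv> Gamma1_tilde r"
abbreviation "u\<^sub>1 \<equiv> u_gen (Suc 0)"
abbreviation "u\<^sub>2 \<equiv> u_gen 2 [^]\<^bsub>Braid3\<^esub> r"

lemma r: "r = 1 \<or> r = 2 \<or> r = 3"
  by (cases k) (simp_all add: level_def)

sublocale E: group E by (rule group_Gamma1_tilde)

lemma E_mult [simp]: "\<gamma> \<otimes>\<^bsub>E\<^esub> \<delta> = \<gamma> \<otimes>\<^bsub>Braid3\<^esub> \<delta>"
  by (simp add: Gamma1_tilde_def)

lemma E_one [simp]: "\<one>\<^bsub>E\<^esub> = \<one>\<^bsub>Braid3\<^esub>"
  by (simp add: Gamma1_tilde_def)

lemma E_inv [simp]: "\<gamma> \<in> carrier E \<Longrightarrow> inv\<^bsub>E\<^esub> \<gamma> = inv\<^bsub>Braid3\<^esub> \<gamma>"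
  using B3.m_inv_consistent[OF Gamma1_tilde_subgroup] by (simp add: Gamma1_tilde_def)

lemma E_closed [simp]: "\<gamma> \<in> carrier E \<Longrightarrow> \<delta> \<in> carrier E \<Longrightarrow> \<gamma> \<otimes>\<^bsub>Braid3\<^esub> \<delta> \<in> carrier E"
  "\<gamma> \<in> carrier E \<Longrightarrow> inv\<^bsub>Braid3\<^esub> \<gamma> \<in> carrier E" "\<one>\<^bsub>Braid3\<^esub> \<in> carrier E"
  using E.m_closed[of \<gamma> \<delta>] E.inv_closed[of \<gamma>] E.one_closed by simp_all

lemma E_carrier: "\<gamma> \<in> carrier E \<Longrightarrow> \<gamma> \<in> carrier Braid3"
  using subgroup.subset[OF Gamma1_tilde_subgroup] by blast

lemma act_Auto: "act \<in> hom E (AutoGroup G)"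
  using act by (simp add: is_Gamma_action_def)

lemma act_hom: "\<gamma> \<in> carrier E \<Longrightarrow> act \<gamma> \<in> hom G G"
  using hom_in_carrier[OF act_Auto, of \<gamma>] by (simp add: AutoGroup_def auto_def)

lemma act_closed [simp]: "\<gamma> \<in> carrier E \<Longrightarrow> g \<in> carrier G \<Longrightarrow> act \<gamma> g \<in> carrier G"
  using act_hom by (auto simp: hom_def)

lemma act_comp: "\<lbrakk>\<gamma> \<in> carrier E; \<delta> \<in> carrier E; g \<in> carrier G\<rbrakk> \<Longrightarrow> act (\<gamma> \<otimes>\<^bsub>Braid3\<^esub> \<delta>) g = act \<gamma> (act \<delta> g)"
proof -
  assume *: "\<gamma> \<in> carrier E" "\<delta> \<in> carrier E" "g \<in> carrier G"
  then have "act (\<gamma> \<otimes>\<^bsub>Braid3\<^esub> \<delta>) = act \<gamma> \<otimes>\<^bsub>AutoGroup G\<^esub> act \<delta>" using hom_mult[OF act_Auto] by simp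
  moreover have "act \<gamma> \<in> Bij (carrier G)" "act \<delta> \<in> Bij (carrier G)"
    using act_Auto * by (auto simp: hom_def AutoGroup_def auto_def)
  ultimately show ?thesis using * by (simp add: AutoGroup_def BijGroup_def compose_def)
qed

lemma act_one: "g \<in> carrier G \<Longrightarrow> act \<one>\<^bsub>Braid3\<^esub> g = g"
proof -
  assume g: "g \<in> carrier G"
  have "act \<one>\<^bsub>E\<^esub> = \<one>\<^bsub>AutoGroup G\<^esub>"
    by (rule hom_one[OF act_Auto E.is_group G.AutoGroup])
  then show ?thesis using g by (simp add: AutoGroup_def BijGroup_def)
qed

lemma act_inv:
  assumes "\<gamma> \<in> carrier E" "g \<in> carrier G"
  shows "act (inv\<^bsub>Braid3\<^esub> \<gamma>) (act \<gamma> g) = g" "act \<gamma> (act (inv\<^bsub>Braid3\<^esub> \<gamma>) g) = g"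
  using act_comp[of "inv\<^bsub>Braid3\<^esub> \<gamma>" \<gamma> g] act_comp[of \<gamma> "inv\<^bsub>Braid3\<^esub> \<gamma>" g] assms E_carrier
  by (simp_all add: act_one)

lemma gens [simp]: "u\<^sub>1 \<in> carrier E" "u\<^sub>2 \<in> carrier E"
  by (rule Gamma1_tilde_gens)+

lemma act_gens:
  assumes "g \<in> nodes k X"
  shows "act u\<^sub>1 (gen g) = cl (a_image X g)" "act u\<^sub>2 (gen g) = cl (b_image X g)"
  using act assms by (simp_all add: is_Gamma_action_def)

lemma act_T:
  assumes "\<gamma> \<in> carrier E" and i: "i \<in> {1..rk X}"
  shows "act \<gamma> (gen (T i)) = gen (T i)"
proof -
  have gi: "gen (T i) \<in> carrier G" using i by simp
  have gen: "act h (gen (T i)) = gen (T i)" "h \<in> carrier E" if "h \<in> {u_gen 1, u\<^sub>2}" for h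
    using that act_gens[of "T i"] i gens by auto
  have "\<gamma> \<in> generate Braid3 {u_gen 1, u\<^sub>2}" using assms(1) by (simp add: Gamma1_tilde_def)
  then have "\<gamma> \<in> carrier E \<and> act \<gamma> (gen (T i)) = gen (T i)"
  proof (induction rule: generate.induct)
    case (inv h)
    then show ?case using act_inv(1)[OF gen(2)[OF inv] gi] gen[OF inv] by simp
  next
    case (eng h1 h2)
    then show ?case using act_comp[of h1 h2, OF _ _ gi] by simp
  qed (use gen act_one[OF gi] in simp_all)
  then show ?thesis ..
qed

lemma act_K:
  assumes "\<gamma> \<in> carrier E" "g \<in> K"
  shows "act \<gamma> g = g"
proof -
  interpret f: group_hom G G "act \<gamma>" by unfold_locales (rule act_hom[OF assms(1)])
  show ?thesis
    using assms(2)
  proof (induction rule: generate.induct)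
    case (incl h)
    then show ?case using act_T[OF assms(1)] by auto
  next
    case (inv h)
    then show ?case using act_T[OF assms(1)] by auto
  next
    case (eng g h)
    then have "g \<in> carrier G" "h \<in> carrier G" using subgroup.subset[OF K_subgroup] by blast+
    then show ?case using eng.IH by simp
  qed simp
qed

text \<open>The action fixes the finite generators and conjugation by a central element of
  \<open>K\<close> does so too; only the affine generators remain to be compared.\<close>

lemma act_inner:
  assumes "\<gamma> \<in> carrier E" "z \<in> K" "\<And>h. h \<in> K \<Longrightarrow> z \<otimes>\<^bsub>G\<^esub> h = h \<otimes>\<^bsub>G\<^esub> z"
    and "\<And>g. g \<in> affine_nodes k \<Longrightarrow> act \<gamma> (gen g) = cj G z (gen g)" and g: "g \<in> carrier G"
  shows "act \<gamma> g = z \<otimes>\<^bsub>G\<^esub> g \<otimes>\<^bsub>G\<^esub> inv\<^bsub>G\<^esub> z"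
proof -
  have z: "z \<in> carrier G" using assms(2) subgroup.subset[OF K_subgroup] by blast
  have "act \<gamma> g = cj G z g"
  proof (rule hom_eqI[OF act_hom[OF assms(1)] cj_hom[OF z] _ g])
    fix n assume "n \<in> nodes k X"
    then consider i where "n = T i" "i \<in> {1..rk X}" | "n \<in> affine_nodes k" by (auto simp: nodes_def)
    then show "act \<gamma> (gen n) = cj G z (gen n)"
    proof cases
      case 1
      then have "gen n \<in> K" by (auto intro: generate.incl)
      then show ?thesis using 1 act_T[OF assms(1)] assms(3) z by (simp add: G.cj_fixes)
    qed (rule assms(4))
  qed
  then show ?thesis by (simp add: cj_def)
qed

end

text \<open>\<open>a\<close> and \<open>b\<close> are Hurwitz moves on the triple
  \<open>(x, y, z)\<close>, and their full twist conjugates the triple by the inverse of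
  \<open>x y z\<close>. Centrality of \<open>x y z \<Theta>\<close> replaces this inverse by
  \<Theta>.\<close>

lemma (in group) ddd_calc:
  assumes closed [simp]: "x \<in> carrier G" "y \<in> carrier G" "z \<in> carrier G" "\<Theta> \<in> carrier G"
    and a: "a \<in> hom G G" "a x = y" "a y = inv y \<otimes> (x \<otimes> y)" "a z = z"
    and b: "b \<in> hom G G" "b x = x" "b y = z" "b z = inv z \<otimes> (y \<otimes> z)"
    and central: "\<And>g. g \<in> {x, y, z} \<Longrightarrow> (x \<otimes> (y \<otimes> (z \<otimes> \<Theta>))) \<otimes> g = g \<otimes> (x \<otimes> (y \<otimes> (z \<otimes> \<Theta>)))"
    and g: "g \<in> {x, y, z}"
  shows "a (b (a (b (a (b g))))) = cj G \<Theta> g"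
proof -
  interpret a: group_hom G G a by unfold_locales (rule a)
  interpret b: group_hom G G b by unfold_locales (rule b)
  have "a (b (a (b (a (b g))))) = cj G (inv (x \<otimes> (y \<otimes> z))) g"
    using g by (auto simp: a(2-) b(2-) cj_def group_word)
  also have "\<dots> = cj G (\<Theta> \<otimes> inv (x \<otimes> (y \<otimes> (z \<otimes> \<Theta>)))) g"
    by (simp add: group_word)
  also have "\<dots> = cj G \<Theta> (cj G (inv (x \<otimes> (y \<otimes> (z \<otimes> \<Theta>)))) g)"
    using g by (intro cj_mult) auto
  also have "cj G (inv (x \<otimes> (y \<otimes> (z \<otimes> \<Theta>)))) g = g"
    using g by (intro cj_inv_fixes central) auto
  finally show ?thesis .
qed

context action
begin

lemma act_c_ddd:
  assumes k: "k = DDD" and g: "g \<in> affine_nodes k"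
  shows "act bp.c (gen g) = cj G \<zeta> (gen g)"
proof -
  have r1: "r = 1" by (simp add: k level_def)
  have u2: "u\<^sub>2 = u_gen 2" by (simp add: r1)
  have c: "bp.c = u\<^sub>1 \<otimes>\<^bsub>Braid3\<^esub> (u\<^sub>2 \<otimes>\<^bsub>Braid3\<^esub> (u\<^sub>1 \<otimes>\<^bsub>Braid3\<^esub> (u\<^sub>2 \<otimes>\<^bsub>Braid3\<^esub> (u\<^sub>1 \<otimes>\<^bsub>Braid3\<^esub> u\<^sub>2))))"
    unfolding u2 by (simp add: bp.c_def bp.t_def B3.m_assoc)
  let ?\<theta> = "highest_root X"
  let ?s = "reflection X ?\<theta>"
  have s: "?s \<in> weyl_group X" by (rule reflection_group[OF highest_root(1)])
  have sub: "g \<in> {Theta01, Theta02, Theta03}" using g by (simp add: k affine_nodes_simps)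
  have nodes: "Theta01 \<in> nodes k X" "Theta02 \<in> nodes k X" "Theta03 \<in> nodes k X"
    by (auto simp: k affine_nodes_simps nodes_def)
  have word: "central_word k X \<in> W"
    "cl (central_word k X) = gen Theta01 \<otimes>\<^bsub>G\<^esub> (gen Theta02 \<otimes>\<^bsub>G\<^esub> (gen Theta03 \<otimes>\<^bsub>G\<^esub> Tw ?s))"
  proof -
    have e: "central_word k X = pos Theta01 @ pos Theta02 @ pos Theta03 @ T_word X ?s"
      unfolding k central_word_def by simp
    show "central_word k X \<in> W" unfolding e using nodes T_word_gwords[OF s] by simp
    show "cl (central_word k X) = gen Theta01 \<otimes>\<^bsub>G\<^esub> (gen Theta02 \<otimes>\<^bsub>G\<^esub> (gen Theta03 \<otimes>\<^bsub>G\<^esub> Tw ?s))"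
      unfolding e using nodes T_word_gwords[OF s] by (simp add: cl_append cl_T_word[OF s] del: append_Cons append_Nil)
  qed
  have images: "act u\<^sub>1 (gen Theta01) = gen Theta02" "act u\<^sub>1 (gen Theta03) = gen Theta03"
    "act u\<^sub>1 (gen Theta02) = inv\<^bsub>G\<^esub> gen Theta02 \<otimes>\<^bsub>G\<^esub> (gen Theta01 \<otimes>\<^bsub>G\<^esub> gen Theta02)"
    "act u\<^sub>2 (gen Theta01) = gen Theta01" "act u\<^sub>2 (gen Theta02) = gen Theta03"
    "act u\<^sub>2 (gen Theta03) = inv\<^bsub>G\<^esub> gen Theta03 \<otimes>\<^bsub>G\<^esub> (gen Theta02 \<otimes>\<^bsub>G\<^esub> gen Theta03)"
    using nodes by (simp_all add: act_gens cl_append cl_neg del: append_Cons append_Nil)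
  have "act u\<^sub>1 (act u\<^sub>2 (act u\<^sub>1 (act u\<^sub>2 (act u\<^sub>1 (act u\<^sub>2 (gen g)))))) = cj G (Tw ?s) (gen g)"
  proof (rule G.ddd_calc[where x = "gen Theta01" and y = "gen Theta02" and z = "gen Theta03"
        and a = "act u\<^sub>1" and b = "act u\<^sub>2"])
    show "gen Theta01 \<otimes>\<^bsub>G\<^esub> (gen Theta02 \<otimes>\<^bsub>G\<^esub> (gen Theta03 \<otimes>\<^bsub>G\<^esub> Tw ?s)) \<otimes>\<^bsub>G\<^esub> h =
        h \<otimes>\<^bsub>G\<^esub> (gen Theta01 \<otimes>\<^bsub>G\<^esub> (gen Theta02 \<otimes>\<^bsub>G\<^esub> (gen Theta03 \<otimes>\<^bsub>G\<^esub> Tw ?s)))"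
      if "h \<in> {gen Theta01, gen Theta02, gen Theta03}" for h
      using that central_relation[OF word(1)] nodes unfolding word(2) by blast
    show "gen g \<in> {gen Theta01, gen Theta02, gen Theta03}" using sub by blast
    show "act u\<^sub>1 \<in> hom G G" "act u\<^sub>2 \<in> hom G G" by (simp_all add: act_hom)
  qed (use nodes s images in simp_all)
  also have "\<dots> = cj G \<zeta> (gen g)"
  proof -
    have rt: "node_root X g = ?\<theta>" using sub by auto
    \<comment> \<open>Both the reflection in \<theta> and \<open>w0\<close> send \<theta> to its
      negative, so \<open>v\<close> fixes it. This is valid in the exceptional types as
      well.\<close>
    define v where "v = ?s \<circ> w0"
    have v: "v \<in> weyl_group X" unfolding v_def by (rule weyl_group_comp[OF s w0(1)])
    have "v ?\<theta> = - ?s ?\<theta>"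
      using w0_highest_root weyl_groupD(3)[OF s] by (simp add: v_def)
    also have "?s ?\<theta> = - ?\<theta>"
      using roots_norm_bounds(1)[OF highest_root(1)] by (auto simp: reflection_eq copairing_def fun_eq_iff)
    finally have "v ?\<theta> = ?\<theta>" by simp
    then have comm: "Tw v \<otimes>\<^bsub>G\<^esub> gen g = gen g \<otimes>\<^bsub>G\<^esub> Tw v" using Tw_affine_commute[OF g v] rt by simp
    have "?s \<circ> v = w0" by (rule HOL.ext) (simp add: v_def reflection_invol[OF highest_root(1)])
    then have "\<zeta> = Tw ?s \<otimes>\<^bsub>G\<^esub> Tw v" unfolding \<zeta>_def by (rule Tw_w0_comp[OF s v])
    then show ?thesis using g s v comm by (simp add: G.cj_mult G.cj_fixes)
  qed
  finally show ?thesis using g by (simp add: c act_comp)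
qed

end

section \<open>The action in the family with two affine nodes\<close>

lemma (in group) pow_2_3:
  assumes "u \<in> carrier G"
  shows "u [^] (2::nat) = u \<otimes> u" "u [^] (3::nat) = u \<otimes> (u \<otimes> u)"
  using assms by (simp_all add: numeral_eq_Suc m_assoc)

lemma inner_form_G2:
  "inner_form TypeG2 (rank2 1 2 p q) (rank2 1 2 p' q') = 2 * p * p' - 3 * (p * q' + q * p') + 6 * q * q'"
proof -
  have "{1..rk TypeG2} = {1, 2}" by auto
  then show ?thesis
    unfolding inner_form_def by (simp add: rank2_def gram_def algebra_simps)
qed

context root_system
begin

text \<open>Each root is reached from a simple root by two reflections and recognised by dominance
  and extremal norm. As a consequence \<open>\<beta>N\<close> and \<open>\<beta>M\<close> are the
  simple roots.\<close>

lemma G2_dominant_roots: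
  assumes X: "X = TypeG2"
  shows "dominant_short_root X = rank2 1 2 2 1" "highest_root X = rank2 1 2 3 2"
proof -
  have i: "1 \<in> {1..rk X}" "2 \<in> {1..rk X}" by (simp_all add: X)
  have ip: "inner_form X (rank2 1 2 p q) (rank2 1 2 p' q') = 2 * p * p' - 3 * (p * q' + q * p') + 6 * q * q'" for p q p' q'
    unfolding X by (rule inner_form_G2)
  have simple: "simple_root 1 = rank2 1 2 1 0" "simple_root 2 = rank2 1 2 0 1" by (rule rank2_simple)+
  have cop: "copairing X (simple_root 2) (simple_root 1) = - 3" "copairing X (simple_root 1) (simple_root 2) = - 1"
    unfolding simple copairing_def ip by simp_all
  note root = simple_root_roots[OF i(1), unfolded simple] simple_root_roots[OF i(2), unfolded simple]
  note refl = rank2_refl0[OF i, unfolded cop]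
  have short: "rank2 1 2 2 1 \<in> roots X"
    using simple_reflection_roots[OF i(1) simple_reflection_roots[OF i(2) root(1)]] by (simp add: refl del: One_nat_def)
  have long: "rank2 1 2 3 2 \<in> roots X"
    using simple_reflection_roots[OF i(2) simple_reflection_roots[OF i(1) root(2)]] by (simp add: refl del: One_nat_def)
  have dom: "dominant X (rank2 1 2 p q)" if "3 * q \<le> 2 * p" "p \<le> 2 * q" for p q
  proof -
    have "inner_form X (rank2 1 2 p q) (simple_root 1) \<ge> 0" "inner_form X (rank2 1 2 p q) (simple_root 2) \<ge> 0"
      unfolding simple ip using that by simp_all
    moreover have "{1..rk X} = {1, 2}" by (auto simp: X)
    ultimately show ?thesis by (simp add: dominant_def)
  qed
  have norm: "inner_form X (rank2 1 2 2 1) (rank2 1 2 2 1) = 2" "inner_form X (rank2 1 2 3 2) (rank2 1 2 3 2) = 6"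
    unfolding ip by simp_all
  show "dominant_short_root X = rank2 1 2 2 1"
    by (rule dominant_short_root_eqI[OF short dom]) (simp_all add: norm roots_norm_bounds(1) del: One_nat_def)
  show "highest_root X = rank2 1 2 3 2"
    by (rule highest_root_eqI[OF long dom]) (simp_all add: norm roots_norm_bounds(2) del: One_nat_def)
qed

end

locale um_action = action +
  assumes k: "k = UM"
begin

lemma level_um: "r = 2 \<or> r = 3" "r = 3 \<longleftrightarrow> X = TypeG2"
  by (simp_all add: k level_def)

lemma um_norms:
  "inner_form X (dominant_short_root X) (dominant_short_root X) = 2"
  "inner_form X (highest_root X) (highest_root X) = 2 * int r"
proof -
  have short: "\<exists>i\<in>{1..rk X}. sq_length X i = 2" and long: "\<exists>i\<in>{1..rk X}. sq_length X i = 2 * int r"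
    and bound: "sq_length X i \<le> 2 * int r" for i
    using valid unfolding k level_def
    by (cases X; force)+
  obtain i j where i: "i \<in> {1..rk X}" "sq_length X i = 2" and j: "j \<in> {1..rk X}" "sq_length X j = 2 * int r"
    using short long by blast
  show "inner_form X (dominant_short_root X) (dominant_short_root X) = 2"
    using dominant_short_root(3)[OF simple_root_roots[OF i(1)]] roots_norm_bounds(1)[OF dominant_short_root(1)]
    by (simp add: inner_form_simple_roots[OF i(1) i(1)] i(2))
  show "inner_form X (highest_root X) (highest_root X) = 2 * int r"
    using highest_root_long[OF simple_root_roots[OF j(1)]] roots_norm[OF highest_root(1)] bound
    by (auto simp: inner_form_simple_roots[OF j(1) j(1)] j(2) intro: antisym)
qed

sublocale um: um_artin X "int r" G "\<lambda>i. gen (T i)"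
  by unfold_locales (use level_um um_norms in auto)

abbreviation "x \<equiv> gen Theta0"
abbreviation "y \<equiv> gen Phi0"
abbreviation "M \<equiv> um.M"
abbreviation "N \<equiv> um.N"

lemma um_nodes: "Theta0 \<in> nodes k X" "Phi0 \<in> nodes k X" "Theta0 \<in> affine_nodes k" "Phi0 \<in> affine_nodes k"
  by (auto simp: k affine_nodes_simps nodes_def)

text \<open>The lift of -1 on the plane of \<theta> and \<phi>, equal to
  \<open>(M N)^r\<close>.\<close>

definition "L = N \<otimes>\<^bsub>G\<^esub> Tw um.s\<^sub>\<phi>"

lemma um_closed [simp]: "x \<in> carrier G" "y \<in> carrier G" "M \<in> carrier G" "N \<in> carrier G" "L \<in> carrier G"
  using um.MN_closed um.s_group by (simp_all add: um_nodes L_def)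

lemma L_words:
  "r = 2 \<Longrightarrow> L = M \<otimes>\<^bsub>G\<^esub> (N \<otimes>\<^bsub>G\<^esub> (M \<otimes>\<^bsub>G\<^esub> N))" "r = 2 \<Longrightarrow> L = N \<otimes>\<^bsub>G\<^esub> (M \<otimes>\<^bsub>G\<^esub> (N \<otimes>\<^bsub>G\<^esub> M))"
  "r = 3 \<Longrightarrow> L = M \<otimes>\<^bsub>G\<^esub> (N \<otimes>\<^bsub>G\<^esub> (M \<otimes>\<^bsub>G\<^esub> (N \<otimes>\<^bsub>G\<^esub> (M \<otimes>\<^bsub>G\<^esub> N))))"
  "r = 3 \<Longrightarrow> L = N \<otimes>\<^bsub>G\<^esub> (M \<otimes>\<^bsub>G\<^esub> (N \<otimes>\<^bsub>G\<^esub> (M \<otimes>\<^bsub>G\<^esub> (N \<otimes>\<^bsub>G\<^esub> M))))"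
  unfolding L_def using um.Tw_plane_2(1,4) um.Tw_plane_3(1,4) by auto

text \<open>\<open>L\<close> is the alternating word of even length \<open>2 r\<close>, beginning
  with either letter.\<close>

lemma L_commutes: "M \<otimes>\<^bsub>G\<^esub> L = L \<otimes>\<^bsub>G\<^esub> M" "N \<otimes>\<^bsub>G\<^esub> L = L \<otimes>\<^bsub>G\<^esub> N"
proof -
  consider "r = 2" | "r = 3" using level_um by blast
  then have "M \<otimes>\<^bsub>G\<^esub> L = L \<otimes>\<^bsub>G\<^esub> M \<and> N \<otimes>\<^bsub>G\<^esub> L = L \<otimes>\<^bsub>G\<^esub> N"
  proof cases
    case 1
    have "M \<otimes>\<^bsub>G\<^esub> L = L \<otimes>\<^bsub>G\<^esub> M"
      by (subst L_words(2)[OF 1], subst L_words(1)[OF 1]) (simp add: G.m_assoc)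
    moreover have "N \<otimes>\<^bsub>G\<^esub> L = L \<otimes>\<^bsub>G\<^esub> N"
      by (subst L_words(1)[OF 1], subst L_words(2)[OF 1]) (simp add: G.m_assoc)
    ultimately show ?thesis ..
  next
    case 2
    have "M \<otimes>\<^bsub>G\<^esub> L = L \<otimes>\<^bsub>G\<^esub> M"
      by (subst L_words(4)[OF 2], subst L_words(3)[OF 2]) (simp add: G.m_assoc)
    moreover have "N \<otimes>\<^bsub>G\<^esub> L = L \<otimes>\<^bsub>G\<^esub> N"
      by (subst L_words(3)[OF 2], subst L_words(4)[OF 2]) (simp add: G.m_assoc)
    ultimately show ?thesis ..
  qed
  then show "M \<otimes>\<^bsub>G\<^esub> L = L \<otimes>\<^bsub>G\<^esub> M" "N \<otimes>\<^bsub>G\<^esub> L = L \<otimes>\<^bsub>G\<^esub> N" by blast+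
qed

lemma Tw_reflections:
  "Tw um.s\<^sub>\<phi> = inv\<^bsub>G\<^esub> N \<otimes>\<^bsub>G\<^esub> L" "Tw um.s\<^sub>\<theta> = inv\<^bsub>G\<^esub> M \<otimes>\<^bsub>G\<^esub> L" "Tw (um.s\<^sub>\<phi> \<circ> um.s\<^sub>\<theta>) = N \<otimes>\<^bsub>G\<^esub> M"
proof -
  show "Tw um.s\<^sub>\<phi> = inv\<^bsub>G\<^esub> N \<otimes>\<^bsub>G\<^esub> L" by (simp add: L_def um.s_group G.inv_cancel)
  have int: "r = 2 \<Longrightarrow> int r = 2" "r = 3 \<Longrightarrow> int r = 3" by simp_all
  have "r = 2 \<Longrightarrow> L = M \<otimes>\<^bsub>G\<^esub> Tw um.s\<^sub>\<theta>" "r = 3 \<Longrightarrow> L = M \<otimes>\<^bsub>G\<^esub> Tw um.s\<^sub>\<theta>"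
    by (simp_all only: L_words(1,3) um.Tw_plane_2(2)[OF int(1)] um.Tw_plane_3(2)[OF int(2)])
  then have "L = M \<otimes>\<^bsub>G\<^esub> Tw um.s\<^sub>\<theta>" using level_um(1) by blast
  then show "Tw um.s\<^sub>\<theta> = inv\<^bsub>G\<^esub> M \<otimes>\<^bsub>G\<^esub> L" by (simp add: um.s_group G.inv_cancel)
  show "Tw (um.s\<^sub>\<phi> \<circ> um.s\<^sub>\<theta>) = N \<otimes>\<^bsub>G\<^esub> M" 
    using level_um(1) um.Tw_plane_2(3)[OF int(1)] um.Tw_plane_3(3)[OF int(2)] by blast
qed

lemma MN_in_K: "M \<in> K" "N \<in> K" "L \<in> K"
proof -
  show M: "M \<in> K" and N: "N \<in> K" by (intro Tw_in_K um.s_group)+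
  show "L \<in> K" unfolding L_def by (intro subgroup.m_closed[OF K_subgroup] N Tw_in_K um.s_group)
qed

lemma Mx: "x \<otimes>\<^bsub>G\<^esub> M = M \<otimes>\<^bsub>G\<^esub> x" and Ny: "y \<otimes>\<^bsub>G\<^esub> N = N \<otimes>\<^bsub>G\<^esub> y"
  using Tw_affine_commute[OF um_nodes(3) um.s_group(1)] Tw_affine_commute[OF um_nodes(4) um.s_group(2)] um.s_plane
  by simp_all

lemma um_images:
  "act u\<^sub>1 x = cj G (y \<otimes>\<^bsub>G\<^esub> inv\<^bsub>G\<^esub> N \<otimes>\<^bsub>G\<^esub> L) x" "act u\<^sub>1 y = y"
  "act u\<^sub>2 y = cj G (inv\<^bsub>G\<^esub> M \<otimes>\<^bsub>G\<^esub> L \<otimes>\<^bsub>G\<^esub> x) y" "act u\<^sub>2 x = x"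
proof -
  let ?\<Phi> = "T_word X um.s\<^sub>\<phi>" and ?\<Theta> = "T_word X um.s\<^sub>\<theta>"
  have w: "?\<Phi> \<in> W" "?\<Theta> \<in> W" by (simp_all add: T_word_gwords um.s_group)
  have "act u\<^sub>1 x = cl (pos Phi0 @ ?\<Phi> @ pos Theta0 @ word_inv ?\<Phi> @ neg Phi0)"
    using act_gens(1)[OF um_nodes(1)] by (simp add: Let_def)
  also have "\<dots> = y \<otimes>\<^bsub>G\<^esub> (Tw um.s\<^sub>\<phi> \<otimes>\<^bsub>G\<^esub> (x \<otimes>\<^bsub>G\<^esub> (inv\<^bsub>G\<^esub> Tw um.s\<^sub>\<phi> \<otimes>\<^bsub>G\<^esub> inv\<^bsub>G\<^esub> y)))"
    using w um_nodes by (simp add: cl_append cl_neg cl_word_inv cl_T_word um.s_group del: append_Cons append_Nil)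
  finally show "act u\<^sub>1 x = cj G (y \<otimes>\<^bsub>G\<^esub> inv\<^bsub>G\<^esub> N \<otimes>\<^bsub>G\<^esub> L) x"
    by (simp add: Tw_reflections cj_def G.group_word)
  have "act u\<^sub>2 y = cl (?\<Theta> @ pos Theta0 @ pos Phi0 @ neg Theta0 @ word_inv ?\<Theta>)"
    using act_gens(2)[OF um_nodes(2)] by (simp add: Let_def)
  also have "\<dots> = Tw um.s\<^sub>\<theta> \<otimes>\<^bsub>G\<^esub> (x \<otimes>\<^bsub>G\<^esub> (y \<otimes>\<^bsub>G\<^esub> (inv\<^bsub>G\<^esub> x \<otimes>\<^bsub>G\<^esub> inv\<^bsub>G\<^esub> Tw um.s\<^sub>\<theta>)))"
    using w um_nodes by (simp add: cl_append cl_neg cl_word_inv cl_T_word um.s_group del: append_Cons append_Nil)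
  finally show "act u\<^sub>2 y = cj G (inv\<^bsub>G\<^esub> M \<otimes>\<^bsub>G\<^esub> L \<otimes>\<^bsub>G\<^esub> x) y"
    by (simp add: Tw_reflections cj_def G.group_word)
  show "act u\<^sub>1 y = y" "act u\<^sub>2 x = x" using act_gens um_nodes by simp_all
qed

lemma um_central:
  assumes "g \<in> carrier G"
  defines "h \<equiv> y \<otimes>\<^bsub>G\<^esub> L \<otimes>\<^bsub>G\<^esub> inv\<^bsub>G\<^esub> N \<otimes>\<^bsub>G\<^esub> inv\<^bsub>G\<^esub> M \<otimes>\<^bsub>G\<^esub> x"
  shows "h \<otimes>\<^bsub>G\<^esub> h \<otimes>\<^bsub>G\<^esub> g = g \<otimes>\<^bsub>G\<^esub> (h \<otimes>\<^bsub>G\<^esub> h)"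
proof -
  let ?\<Phi> = "T_word X um.s\<^sub>\<phi>" and ?\<Theta> = "T_word X um.s\<^sub>\<theta>" and ?\<Psi> = "T_word X (um.s\<^sub>\<phi> \<circ> um.s\<^sub>\<theta>)"
  have g: "um.s\<^sub>\<phi> \<circ> um.s\<^sub>\<theta> \<in> weyl_group X" by (intro weyl_group_comp um.s_group)
  have w: "?\<Phi> \<in> W" "?\<Theta> \<in> W" "?\<Psi> \<in> W" by (simp_all add: T_word_gwords um.s_group g del: o_apply)
  have e: "central_word k X = pos Phi0 @ ?\<Phi> @ pos Theta0 @ word_inv ?\<Psi> @ pos Phi0 @ ?\<Theta> @ pos Theta0"
    unfolding k central_word_def by (simp add: Let_def)
  have W: "central_word k X \<in> W" unfolding e using w um_nodes by simp
  note rules = G.commutes_rules[OF _ _ Mx, simplified] G.commutes_rules[OF _ _ Ny, simplified]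
    G.commutes_rules[OF _ _ L_commutes(1), simplified] G.commutes_rules[OF _ _ L_commutes(2)[symmetric], simplified]
  have "cl (central_word k X) = y \<otimes>\<^bsub>G\<^esub> (Tw um.s\<^sub>\<phi> \<otimes>\<^bsub>G\<^esub> (x \<otimes>\<^bsub>G\<^esub> (inv\<^bsub>G\<^esub> Tw (um.s\<^sub>\<phi> \<circ> um.s\<^sub>\<theta>) \<otimes>\<^bsub>G\<^esub> (y \<otimes>\<^bsub>G\<^esub> (Tw um.s\<^sub>\<theta> \<otimes>\<^bsub>G\<^esub> x)))))"
    unfolding e using w um_nodes by (simp add: cl_append cl_word_inv cl_T_word um.s_group g del: append_Cons append_Nil o_apply)
  \<comment> \<open>Moving \<open>M\<close> past \<open>x\<close> and \<open>N\<close> past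
    \<open>y\<close> turns the factor of \<open>\<Psi>\<close> into the missing pieces of two copies
    of \<open>h\<close>.\<close>
  also have "\<dots> = h \<otimes>\<^bsub>G\<^esub> h"
    unfolding Tw_reflections h_def by (simp add: G.group_word rules)
  finally have hh: "cl (central_word k X) = h \<otimes>\<^bsub>G\<^esub> h" .
  show ?thesis
  proof (rule central_all[OF _ _ assms(1)])
    show "h \<otimes>\<^bsub>G\<^esub> h \<otimes>\<^bsub>G\<^esub> gen n = gen n \<otimes>\<^bsub>G\<^esub> (h \<otimes>\<^bsub>G\<^esub> h)" if "n \<in> nodes k X" for n
      using central_relation[OF W that] unfolding hh .
  qed (simp add: h_def)
qed

sublocale calc: um_calc_auto G x y M N L "act u\<^sub>1" "act u\<^sub>2" "act (inv\<^bsub>Braid3\<^esub> u\<^sub>1)" "act (inv\<^bsub>Braid3\<^esub> u\<^sub>2)"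
proof unfold_locales
  show "act u\<^sub>1 \<in> hom G G" "act u\<^sub>2 \<in> hom G G" "act (inv\<^bsub>Braid3\<^esub> u\<^sub>1) \<in> hom G G" "act (inv\<^bsub>Braid3\<^esub> u\<^sub>2) \<in> hom G G"
    by (intro act_hom E_closed gens)+
  show "act u\<^sub>1 M = M" "act u\<^sub>1 N = N" "act u\<^sub>1 L = L" "act u\<^sub>2 M = M" "act u\<^sub>2 N = N" "act u\<^sub>2 L = L"
    by (intro act_K gens MN_in_K)+
  show "act u\<^sub>1 (act (inv\<^bsub>Braid3\<^esub> u\<^sub>1) g) = g" "act (inv\<^bsub>Braid3\<^esub> u\<^sub>1) (act u\<^sub>1 g) = g"
    "act u\<^sub>2 (act (inv\<^bsub>Braid3\<^esub> u\<^sub>2) g) = g" "act (inv\<^bsub>Braid3\<^esub> u\<^sub>2) (act u\<^sub>2 g) = g"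
    if "g \<in> carrier G" for g using act_inv[OF _ that] gens by blast+
qed (fact um_closed Mx Ny L_commutes um_images um_central)+

lemma \<zeta>_conj:
  assumes opp: "\<And>i. i \<in> {1..rk X} \<Longrightarrow> opp i = i" and g: "g \<in> affine_nodes k"
  shows "cj G L (gen g) = cj G \<zeta> (gen g)"
proof -
  obtain v where v: "v \<in> weyl_group X" "v (dominant_short_root X) = dominant_short_root X"
    "v (highest_root X) = highest_root X"
    "r = 2 \<Longrightarrow> Tw w0 = M \<otimes>\<^bsub>G\<^esub> (N \<otimes>\<^bsub>G\<^esub> (M \<otimes>\<^bsub>G\<^esub> N)) \<otimes>\<^bsub>G\<^esub> Tw v"
    "r = 3 \<Longrightarrow> Tw w0 = M \<otimes>\<^bsub>G\<^esub> (N \<otimes>\<^bsub>G\<^esub> (M \<otimes>\<^bsub>G\<^esub> (N \<otimes>\<^bsub>G\<^esub> (M \<otimes>\<^bsub>G\<^esub> N)))) \<otimes>\<^bsub>G\<^esub> Tw v"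
    by (rule um.Tw_w0_plane[OF opp]) auto
  have "\<zeta> = L \<otimes>\<^bsub>G\<^esub> Tw v"
    using level_um(1) v(4,5) unfolding \<zeta>_def L_words(1)[symmetric] L_words(3)[symmetric] by (metis L_words(1,3))
  moreover have "Tw v \<otimes>\<^bsub>G\<^esub> gen g = gen g \<otimes>\<^bsub>G\<^esub> Tw v"
    by (rule Tw_affine_commute[OF g v(1)]) (use g v(2,3) in \<open>auto simp: k affine_nodes_simps\<close>)
  ultimately show ?thesis using g v(1) by (simp add: G.cj_mult G.cj_fixes)
qed

lemma um_opp: "i \<in> {1..rk X} \<Longrightarrow> opp i = i"
  by (rule opp_not_exceptional[OF valid]) (simp_all add: exceptional_def k)

lemma act_c_um:
  assumes r: "r = 2" and g: "g \<in> affine_nodes k"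
  shows "act bp.c (gen g) = cj G \<zeta> (gen g)"
proof -
  have gc: "gen g \<in> carrier G" using g by simp
  have "u\<^sub>2 = u_gen 2 \<otimes>\<^bsub>Braid3\<^esub> u_gen 2" using r by (simp add: B3.pow_2_3)
  then have c: "bp.c = u\<^sub>1 \<otimes>\<^bsub>Braid3\<^esub> (u\<^sub>2 \<otimes>\<^bsub>Braid3\<^esub> (u\<^sub>1 \<otimes>\<^bsub>Braid3\<^esub> u\<^sub>2))"
    using bp.c_eq_2 by (simp add: B3.m_assoc)
  have "act bp.c (gen g) = act u\<^sub>1 (act u\<^sub>2 (act u\<^sub>1 (act u\<^sub>2 (gen g))))"
    unfolding c using gc gens by (simp only: act_comp E_closed act_closed)
  also have "\<dots> = cj G L (gen g)" using calc.abab_r2[OF L_words(1)[OF r]] g by (auto simp: k affine_nodes_simps)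
  also have "\<dots> = cj G \<zeta> (gen g)" by (rule \<zeta>_conj[OF um_opp g])
  finally show ?thesis .
qed

text \<open>Here \<open>N\<close> and \<open>M\<close> are the generators of nodes 1 and 2, each
  joined by one edge to the affine node concerned.\<close>

lemma G2_braid:
  assumes r: "r = 3"
  shows "x \<otimes>\<^bsub>G\<^esub> (N \<otimes>\<^bsub>G\<^esub> x) = N \<otimes>\<^bsub>G\<^esub> (x \<otimes>\<^bsub>G\<^esub> N)" "y \<otimes>\<^bsub>G\<^esub> (M \<otimes>\<^bsub>G\<^esub> y) = M \<otimes>\<^bsub>G\<^esub> (y \<otimes>\<^bsub>G\<^esub> M)"
proof -
  have X: "X = TypeG2" using r level_um(2) by simp
  have i: "1 \<in> {1..rk X}" "2 \<in> {1..rk X}" by (simp_all add: X)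
  have ip: "inner_form X (rank2 1 2 p q) (rank2 1 2 p' q') = 2 * p * p' - 3 * (p * q' + q * p') + 6 * q * q'" for p q p' q'
    unfolding X by (rule inner_form_G2)
  note G2 = G2_dominant_roots[OF X]
  have simple: "simple_root 1 = rank2 1 2 1 0" "simple_root 2 = rank2 1 2 0 1" by (rule rank2_simple)+
  have "um.\<beta>N = simple_root 1" "um.\<beta>M = simple_root 2"
    unfolding um.\<beta>N_def um.\<beta>M_def G2 simple using r by (simp_all add: rank2_def fun_eq_iff)
  then have NM: "N = gen (T 1)" "M = gen (T 2)" using Tw_simple[OF i(1)] Tw_simple[OF i(2)] by simp_all
  have e: "edges k X Theta0 (T 1) = 1" "edges k X Phi0 (T 2) = 1"
    unfolding edges_def node_root.simps G2 simple copairing_def ip by simp_all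
  have n: "T 1 \<in> nodes k X" "T 2 \<in> nodes k X" using i by simp_all
  show "x \<otimes>\<^bsub>G\<^esub> (N \<otimes>\<^bsub>G\<^esub> x) = N \<otimes>\<^bsub>G\<^esub> (x \<otimes>\<^bsub>G\<^esub> N)"
    using braid_relation[OF um_nodes(1) n(1)] n um_nodes unfolding e NM
    by (simp add: braid_length_def numeral_eq_Suc cl_Cons_Cons)
  show "y \<otimes>\<^bsub>G\<^esub> (M \<otimes>\<^bsub>G\<^esub> y) = M \<otimes>\<^bsub>G\<^esub> (y \<otimes>\<^bsub>G\<^esub> M)"
    using braid_relation[OF um_nodes(2) n(2)] n um_nodes unfolding e NM
    by (simp add: braid_length_def numeral_eq_Suc cl_Cons_Cons)
qed

lemma act_cc_um:
  assumes r: "r = 3" and g: "g \<in> affine_nodes k"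
  shows "act (bp.c \<otimes>\<^bsub>Braid3\<^esub> bp.c) (gen g) = cj G (\<zeta> \<otimes>\<^bsub>G\<^esub> \<zeta>) (gen g)"
proof -
  have gc: "gen g \<in> carrier G" using g by simp
  have z: "cj G L (gen g) = cj G \<zeta> (gen g)" by (rule \<zeta>_conj[OF um_opp g])
  have "u\<^sub>2 = u_gen 2 \<otimes>\<^bsub>Braid3\<^esub> (u_gen 2 \<otimes>\<^bsub>Braid3\<^esub> u_gen 2)" using r by (simp add: B3.pow_2_3)
  then have c: "bp.c \<otimes>\<^bsub>Braid3\<^esub> bp.c = u\<^sub>1 \<otimes>\<^bsub>Braid3\<^esub> (u\<^sub>2 \<otimes>\<^bsub>Braid3\<^esub> (u\<^sub>1 \<otimes>\<^bsub>Braid3\<^esub> (u\<^sub>2 \<otimes>\<^bsub>Braid3\<^esub> (u\<^sub>1 \<otimes>\<^bsub>Braid3\<^esub> u\<^sub>2))))"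
    using bp.cc_eq_3 by (simp add: B3.m_assoc)
  have "act (bp.c \<otimes>\<^bsub>Braid3\<^esub> bp.c) (gen g) = act u\<^sub>1 (act u\<^sub>2 (act u\<^sub>1 (act u\<^sub>2 (act u\<^sub>1 (act u\<^sub>2 (gen g))))))"
    unfolding c using gc gens by (simp only: act_comp E_closed act_closed)
  also have "\<dots> = cj G (L \<otimes>\<^bsub>G\<^esub> L) (gen g)"
    using calc.ababab_r3[OF L_words(3)[OF r] G2_braid[OF r]] g by (auto simp: k affine_nodes_simps)
  also have "\<dots> = cj G L (cj G \<zeta> (gen g))" using gc by (simp only: G.cj_mult um_closed z)
  \<comment> \<open>\<open>L\<close> and \<open>\<zeta>\<close> commute and agree as conjugations of
    affine generators, hence so do their squares.\<close>
  also have "\<dots> = cj G (\<zeta> \<otimes>\<^bsub>G\<^esub> \<zeta>) (gen g)"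
  proof -
    have "\<zeta> \<otimes>\<^bsub>G\<^esub> L = L \<otimes>\<^bsub>G\<^esub> \<zeta>" by (rule \<zeta>_central[OF _ MN_in_K(3)]) (simp add: exceptional_def k)
    then have "cj G L (cj G \<zeta> (gen g)) = cj G \<zeta> (cj G L (gen g))"
      using gc by (simp flip: G.cj_mult)
    then show ?thesis using gc by (simp only: G.cj_mult \<zeta>_closed z)
  qed
  finally show ?thesis .
qed

end

section \<open>The projective representation of the congruence group\<close>

lemma minus_one_mult: "M2 (- 1) 0 0 (- 1) ** M = - M" for M :: "int^2^2"
proof -
  have "M2 (- 1) 0 0 (- 1) ** M2 a b c d = - M2 a b c d" for a b c d by simp
  then show ?thesis using M2_eta[of M] by metis
qed

lemma plus_minus_coset: "plus_minus_one #>\<^bsub>SL2Z\<^esub> M = {M, - M}"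
  by (subst (1 2 3) M2_eta[of M]) (auto simp: r_coset_def plus_minus_one_def M2_one)

lemma plus_minus_mult: "{M, - M} <#>\<^bsub>SL2Z\<^esub> {M', - M'} = {M ** M', - (M ** M')}"
proof -
  have "- A ** B = - (A ** B)" "A ** - B = - (A ** B)" for A B :: "int^2^2"
    by (subst (1 2) M2_eta[of A], subst (1 2) M2_eta[of B], simp add: algebra_simps)+
  then show ?thesis by (auto simp: set_mult_def)
qed

text \<open>The cosets are \<open>{M, - M}\<close>, and \<open>- M\<close> need not lie in the
  congruence group; the condition is imposed only when it does.\<close>

lemma descendsI:
  assumes H: "group H" and P: "P \<in> hom (Gamma1 r) H"
    and eq: "\<And>M. M \<in> carrier (Gamma1 r) \<Longrightarrow> - M \<in> carrier (Gamma1 r) \<Longrightarrow> P (- M) = P M"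
  shows "descends r H P"
proof -
  let ?c = "\<lambda>M. plus_minus_one #>\<^bsub>SL2Z\<^esub> M"
  define Q where "Q C = P (SOME M. M \<in> carrier (Gamma1 r) \<and> ?c M = C)" for C
  have Q: "Q (?c M) = P M" if M: "M \<in> carrier (Gamma1 r)" for M
  proof -
    define M' where "M' = (SOME M'. M' \<in> carrier (Gamma1 r) \<and> ?c M' = ?c M)"
    have "M' \<in> carrier (Gamma1 r) \<and> ?c M' = ?c M"
      unfolding M'_def by (rule someI[of _ M]) (use M in simp)
    then have "M' \<in> carrier (Gamma1 r)" "M' = M \<or> M' = - M" by (auto simp: plus_minus_coset doubleton_eq_iff)
    then show ?thesis using eq[OF M] by (auto simp: Q_def simp flip: M'_def)
  qed
  have "Q \<in> hom (Gamma1_bar r) H"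
  proof (rule homI)
    fix C assume "C \<in> carrier (Gamma1_bar r)"
    then obtain M where "M \<in> carrier (Gamma1 r)" "C = ?c M" by (auto simp: Gamma1_bar_def)
    then show "Q C \<in> carrier H" using Q hom_in_carrier[OF P] by simp
  next
    fix C D assume "C \<in> carrier (Gamma1_bar r)" "D \<in> carrier (Gamma1_bar r)"
    then obtain M N where M: "M \<in> carrier (Gamma1 r)" "C = ?c M" and N: "N \<in> carrier (Gamma1 r)" "D = ?c N"
      by (auto simp: Gamma1_bar_def)
    have "C \<otimes>\<^bsub>Gamma1_bar r\<^esub> D = ?c (M ** N)"
      by (simp add: M(2) N(2) Gamma1_bar_def FactGroup_def plus_minus_coset plus_minus_mult)
    moreover have mn: "M ** N = M \<otimes>\<^bsub>Gamma1 r\<^esub> N" by (simp add: Gamma1_def)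
    moreover have "M ** N \<in> carrier (Gamma1 r)"
      using subgroup.m_closed[OF Gamma1_subgroup M(1) N(1)] by simp
    ultimately show "Q (C \<otimes>\<^bsub>Gamma1_bar r\<^esub> D) = Q C \<otimes>\<^bsub>H\<^esub> Q D"
      using Q M N hom_mult[OF P M(1) N(1)] by simp
  qed
  then show ?thesis unfolding descends_def using Q by (intro bexI[of _ Q]) simp_all
qed

text \<open>Adding the congruences of the upper left entries gives 0 = 2 mod 3.\<close>

lemma Gamma1_3_minus:
  assumes "M \<in> carrier (Gamma1 3)"
  shows "- M \<notin> carrier (Gamma1 3)"
proof
  assume "- M \<in> carrier (Gamma1 3)"
  then have "[M $ 1 $ 1 = 1] (mod 3)" "[- (M $ 1 $ 1) = 1] (mod 3)"
    using assms by (simp_all add: Gamma1_def)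
  then have "[0 = 2] (mod (3 :: int))" using cong_add[of "M $ 1 $ 1" 1 3 "- (M $ 1 $ 1)" 1] by simp
  then show False by (simp add: cong_def)
qed

lemma group_Gamma1: "group (Gamma1 r)"
proof -
  have "SL2Z\<lparr>carrier := carrier (Gamma1 r)\<rparr> = Gamma1 r" by (simp add: Gamma1_def)
  then show ?thesis using SL2Z.subgroup_imp_group[OF Gamma1_subgroup, of r] by simp
qed

lemma proj_hom_Gamma1:
  assumes "r = 1 \<or> r = 2 \<or> r = 3"
  shows "braid_proj \<in> hom (Gamma1_tilde r) (Gamma1 r)"
proof (rule homI)
  show "braid_proj \<gamma> \<in> carrier (Gamma1 r)" if "\<gamma> \<in> carrier (Gamma1_tilde r)" for \<gamma>
    using braid_proj_image[OF assms] that by blast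
  show "braid_proj (\<gamma> \<otimes>\<^bsub>Gamma1_tilde r\<^esub> \<delta>) = braid_proj \<gamma> \<otimes>\<^bsub>Gamma1 r\<^esub> braid_proj \<delta>"
    if "\<gamma> \<in> carrier (Gamma1_tilde r)" "\<delta> \<in> carrier (Gamma1_tilde r)" for \<gamma> \<delta>
  proof -
    have "\<gamma> \<in> carrier Braid3" "\<delta> \<in> carrier Braid3" using that subgroup.subset[OF Gamma1_tilde_subgroup] by blast+
    then show ?thesis using hom_mult[OF braid_proj_hom] by (simp add: Gamma1_tilde_def Gamma1_def)
  qed
qed

context action
begin

lemma act_c:
  assumes "r \<noteq> 3" "g \<in> affine_nodes k"
  shows "act bp.c (gen g) = cj G \<zeta> (gen g)"
proof (cases k)
  case DDD
  then show ?thesis using act_c_ddd assms(2) by simp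
next
  case UM
  then interpret um_action k X act by unfold_locales
  show ?thesis using act_c_um assms level_um(1) by blast
qed

lemma c_closed: "r \<noteq> 3 \<Longrightarrow> bp.c \<in> carrier E" and cc_closed: "bp.c \<otimes>\<^bsub>Braid3\<^esub> bp.c \<in> carrier E"
  using r c_in_Gamma1_tilde[of r] cc_in_Gamma1_tilde[of r] by blast+

text \<open>For \<open>r \<noteq> 3\<close> the action of \<open>c\<close> is applied twice, with
  \<open>\<zeta>\<close> fixed as an element of \<open>K\<close>. In level 3 the square is treated
  directly.\<close>

lemma act_cc:
  assumes "g \<in> affine_nodes k"
  shows "act (bp.c \<otimes>\<^bsub>Braid3\<^esub> bp.c) (gen g) = cj G (\<zeta> \<otimes>\<^bsub>G\<^esub> \<zeta>) (gen g)"
proof (cases "r = 3")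
  case True
  then have "k = UM" by (cases k) (simp_all add: level_def)
  then interpret um_action k X act by unfold_locales
  show ?thesis using act_cc_um True assms by blast
next
  case False
  have gc: "gen g \<in> carrier G" using assms by simp
  interpret f: group_hom G G "act bp.c" by unfold_locales (rule act_hom[OF c_closed[OF False]])
  have "act (bp.c \<otimes>\<^bsub>Braid3\<^esub> bp.c) (gen g) = act bp.c (\<zeta> \<otimes>\<^bsub>G\<^esub> gen g \<otimes>\<^bsub>G\<^esub> inv\<^bsub>G\<^esub> \<zeta>)"
    using gc c_closed[OF False] act_c[OF False assms] by (simp add: act_comp cj_def)
  also have "\<dots> = cj G \<zeta> (act bp.c (gen g))"
    using gc act_K[OF c_closed[OF False] \<zeta>_K] by (simp add: cj_def)
  also have "\<dots> = cj G (\<zeta> \<otimes>\<^bsub>G\<^esub> \<zeta>) (gen g)"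
    using gc by (simp add: act_c[OF False assms] G.cj_mult)
  finally show ?thesis .
qed

text \<open>The property that \<open>twisted_rep\<close> asks of the kernel. It is closed under
  products and inverses, so it has to be checked only for the generator \<open>c^2\<close>.\<close>

definition central_inner :: "nat gword set \<Rightarrow> bool" where
  "central_inner \<gamma> \<longleftrightarrow> \<gamma> \<in> carrier E \<and> (\<exists>z\<in>K. (\<forall>h\<in>K. z \<otimes>\<^bsub>G\<^esub> h = h \<otimes>\<^bsub>G\<^esub> z) \<and> (\<forall>g\<in>carrier G. act \<gamma> g = cj G z g))"

lemma K_closed: "z \<in> K \<Longrightarrow> z \<in> carrier G"
  using subgroup.subset[OF K_subgroup] by blast

lemma inner_mult:
  assumes "central_inner \<gamma>" "central_inner \<delta>"
  shows "central_inner (\<gamma> \<otimes>\<^bsub>Braid3\<^esub> \<delta>)"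
proof -
  obtain z where z: "z \<in> K" "\<And>h. h \<in> K \<Longrightarrow> z \<otimes>\<^bsub>G\<^esub> h = h \<otimes>\<^bsub>G\<^esub> z" "\<And>g. g \<in> carrier G \<Longrightarrow> act \<gamma> g = cj G z g"
    using assms(1) by (auto simp: central_inner_def)
  obtain z' where z': "z' \<in> K" "\<And>h. h \<in> K \<Longrightarrow> z' \<otimes>\<^bsub>G\<^esub> h = h \<otimes>\<^bsub>G\<^esub> z'" "\<And>g. g \<in> carrier G \<Longrightarrow> act \<delta> g = cj G z' g"
    using assms(2) by (auto simp: central_inner_def)
  have E: "\<gamma> \<in> carrier E" "\<delta> \<in> carrier E" using assms by (simp_all add: central_inner_def)
  note c = K_closed[OF z(1)] K_closed[OF z'(1)]
  show ?thesis
    unfolding central_inner_def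
  proof (intro conjI bexI[of _ "z \<otimes>\<^bsub>G\<^esub> z'"] ballI)
    show "\<gamma> \<otimes>\<^bsub>Braid3\<^esub> \<delta> \<in> carrier E" using E by simp
    show "z \<otimes>\<^bsub>G\<^esub> z' \<in> K" by (intro subgroup.m_closed[OF K_subgroup] z(1) z'(1))
    fix h assume h: "h \<in> K"
    have "z \<otimes>\<^bsub>G\<^esub> z' \<otimes>\<^bsub>G\<^esub> h = z \<otimes>\<^bsub>G\<^esub> (h \<otimes>\<^bsub>G\<^esub> z')" using c K_closed[OF h] by (simp only: G.m_assoc z'(2)[OF h])
    also have "\<dots> = z \<otimes>\<^bsub>G\<^esub> h \<otimes>\<^bsub>G\<^esub> z'" using c K_closed[OF h] by (simp only: G.m_assoc)
    also have "\<dots> = h \<otimes>\<^bsub>G\<^esub> (z \<otimes>\<^bsub>G\<^esub> z')" using c K_closed[OF h] by (simp only: z(2)[OF h] G.m_assoc)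
    finally show "z \<otimes>\<^bsub>G\<^esub> z' \<otimes>\<^bsub>G\<^esub> h = h \<otimes>\<^bsub>G\<^esub> (z \<otimes>\<^bsub>G\<^esub> z')" .
  next
    fix g assume "g \<in> carrier G"
    then show "act (\<gamma> \<otimes>\<^bsub>Braid3\<^esub> \<delta>) g = cj G (z \<otimes>\<^bsub>G\<^esub> z') g"
      using c E by (simp add: act_comp G.cj_mult z(3) z'(3))
  qed
qed

lemma inner_inv:
  assumes "central_inner \<gamma>"
  shows "central_inner (inv\<^bsub>Braid3\<^esub> \<gamma>)"
proof -
  obtain z where z: "z \<in> K" "\<And>h. h \<in> K \<Longrightarrow> z \<otimes>\<^bsub>G\<^esub> h = h \<otimes>\<^bsub>G\<^esub> z" "\<And>g. g \<in> carrier G \<Longrightarrow> act \<gamma> g = cj G z g"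
    using assms by (auto simp: central_inner_def)
  have E: "\<gamma> \<in> carrier E" using assms by (simp add: central_inner_def)
  have "inv\<^bsub>G\<^esub> z \<otimes>\<^bsub>G\<^esub> h = h \<otimes>\<^bsub>G\<^esub> inv\<^bsub>G\<^esub> z" if "h \<in> K" for h
    using G.inv_commutes[OF _ _ z(2)[OF that]] K_closed z(1) that by blast
  moreover have "act (inv\<^bsub>Braid3\<^esub> \<gamma>) g = cj G (inv\<^bsub>G\<^esub> z) g" if g: "g \<in> carrier G" for g
  proof -
    have "act \<gamma> (cj G (inv\<^bsub>G\<^esub> z) g) = g"
      using K_closed[OF z(1)] g by (simp add: z(3) cj_def G.group_word)
    then show ?thesis using act_inv(1)[OF E, of "cj G (inv\<^bsub>G\<^esub> z) g"] K_closed[OF z(1)] g by simp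
  qed
  moreover have "inv\<^bsub>Braid3\<^esub> \<gamma> \<in> carrier E" using E by simp
  ultimately show ?thesis
    unfolding central_inner_def using subgroup.m_inv_closed[OF K_subgroup z(1)] by blast
qed

lemma inner_cc: "central_inner (bp.c \<otimes>\<^bsub>Braid3\<^esub> bp.c)"
  unfolding central_inner_def
proof (intro conjI cc_closed bexI[of _ "\<zeta> \<otimes>\<^bsub>G\<^esub> \<zeta>"] ballI)
  show "\<zeta> \<otimes>\<^bsub>G\<^esub> \<zeta> \<in> K" by (intro subgroup.m_closed[OF K_subgroup] \<zeta>_K)
  then show "act (bp.c \<otimes>\<^bsub>Braid3\<^esub> bp.c) g = cj G (\<zeta> \<otimes>\<^bsub>G\<^esub> \<zeta>) g" if "g \<in> carrier G" for g
    unfolding cj_def by (rule act_inner[OF cc_closed _ \<zeta>\<zeta>_central act_cc that])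
qed (rule \<zeta>\<zeta>_central)

lemma kernel_inner:
  assumes "\<gamma> \<in> carrier E" "braid_proj \<gamma> = \<one>\<^bsub>SL2Z\<^esub>"
  shows "central_inner \<gamma>"
proof -
  obtain j :: int where j: "\<gamma> = (bp.c \<otimes>\<^bsub>Braid3\<^esub> bp.c) [^]\<^bsub>Braid3\<^esub> j"
    using braid_proj_kernel[OF E_carrier[OF assms(1)] assms(2)] by blast
  have one: "central_inner \<one>\<^bsub>Braid3\<^esub>"
    unfolding central_inner_def using subgroup.one_closed[OF K_subgroup] K_closed
    by (intro conjI bexI[of _ "\<one>\<^bsub>G\<^esub>"]) (simp_all add: act_one cj_def)
  have nat: "central_inner ((bp.c \<otimes>\<^bsub>Braid3\<^esub> bp.c) [^]\<^bsub>Braid3\<^esub> n)" for n :: nat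
  proof (induction n)
    case 0
    then show ?case using one by (simp only: B3.nat_pow_0)
  next
    case (Suc n)
    show ?case unfolding B3.nat_pow_Suc by (rule inner_mult[OF Suc inner_cc])
  qed
  show ?thesis unfolding j int_pow_def2 using nat inner_inv[OF nat] by (cases "j < 0") (simp_all only: if_True if_False)
qed

end

theorem theorem5:
  fixes k :: family and X :: cartan_type
    and act :: "nat gword set \<Rightarrow> node gword set \<Rightarrow> node gword set"
    and s :: "complex \<Rightarrow> 'v::ab_group_add \<Rightarrow> 'v" and V :: "'v set"
    and \<rho> :: "node gword set \<Rightarrow> 'v \<Rightarrow> 'v"
    and t :: "complex \<Rightarrow> 'w::ab_group_add \<Rightarrow> 'w" and W :: "'w set"
    and \<pi> :: "node gword set \<Rightarrow> 'w \<Rightarrow> 'w"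
  assumes "valid_datum k X"
    and "is_Gamma_action k X act"
    and "simple_rep (B_group k X) s V \<rho>"
    and "Gamma_stable k X act s V \<rho>"
    and "simple_rep (B_fin k X) t W \<pi>"
  shows "\<exists>P. induced_projective_rep k X act s V \<rho> (isotypic (B_fin k X) s V \<rho> t W \<pi>) P \<and>
    (admissible (B_fin k X) s V \<rho> \<longrightarrow> fin_dim s (isotypic (B_fin k X) s V \<rho> t W \<pi>)) \<and>
    (\<not> exceptional k X \<longrightarrow>
      descends (level k X) (PGL s (isotypic (B_fin k X) s V \<rho> t W \<pi>)) P)"
proof -
  interpret A: action k X act using assms(1,2) by unfold_locales
  let ?r = "level k X" and ?G = "B_group k X" and ?E = "Gamma1_tilde (level k X)"
  have simple: "simple ?G s V \<rho>" by (rule iffD1[OF simple_iff[OF A.G.is_group] assms(3)])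
  interpret R: twisted_rep ?G s V \<rho> ?E A.K act t W \<pi> "Gamma1 ?r" braid_proj
  proof (intro twisted_rep.intro twisted_rep_axioms.intro simple A.E.is_group)
    show "countable (carrier ?G)"
      unfolding B_group_def by (rule countable_pres_group[OF countable_finite[OF finite_nodes]])
    show "subgroup A.K ?G" by (rule A.K_subgroup)
    show "act \<in> hom ?E (AutoGroup ?G)" by (rule A.act_Auto)
    show "act \<gamma> g = g" if "\<gamma> \<in> carrier ?E" "g \<in> A.K" for \<gamma> g using A.act_K that .
    show "\<exists>f. twist_iso ?G (act \<gamma>) s V \<rho> f" if "\<gamma> \<in> carrier ?E" for \<gamma>
      using assms(4) that by (simp add: Gamma_stable_def)
    show "simple_rep (?G\<lparr>carrier := A.K\<rparr>) t W \<pi>" using assms(5) by (simp add: B_fin_def)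
    show "group (Gamma1 ?r)" by (rule group_Gamma1)
    show "braid_proj \<in> hom ?E (Gamma1 ?r)" by (rule proj_hom_Gamma1[OF A.r])
    show "braid_proj ` carrier ?E = carrier (Gamma1 ?r)" by (rule braid_proj_image[OF A.r])
    show "\<exists>\<zeta>\<in>A.K. (\<forall>g\<in>A.K. \<zeta> \<otimes>\<^bsub>?G\<^esub> g = g \<otimes>\<^bsub>?G\<^esub> \<zeta>) \<and> (\<forall>g\<in>carrier ?G. act \<gamma> g = \<zeta> \<otimes>\<^bsub>?G\<^esub> g \<otimes>\<^bsub>?G\<^esub> inv\<^bsub>?G\<^esub> \<zeta>)"
      if "\<gamma> \<in> carrier ?E" "braid_proj \<gamma> = \<one>\<^bsub>Gamma1 ?r\<^esub>" for \<gamma>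
    proof -
      have "braid_proj \<gamma> = \<one>\<^bsub>SL2Z\<^esub>" using that(2) by (simp add: Gamma1_def)
      then show ?thesis using A.kernel_inner[OF that(1)] by (simp add: A.central_inner_def cj_def)
    qed
  qed
  have H: "B_fin k X = R.H" by (simp add: B_fin_def)
  have U: "isotypic (B_fin k X) s V \<rho> t W \<pi> = R.U" by (simp only: H R.U_def)
  obtain P where P: "P \<in> hom (Gamma1 ?r) (PGL s R.U)"
    "\<And>\<gamma> f. \<gamma> \<in> carrier ?E \<Longrightarrow> R.twist \<gamma> f \<Longrightarrow> P (braid_proj \<gamma>) = R.cls f"
    using R.projective_representation by blast
  have 1: "induced_projective_rep k X act s V \<rho> R.U P"
    unfolding induced_projective_rep_def
  proof (intro conjI ballI allI impI P(1))
    fix \<gamma> f assume *: "\<gamma> \<in> carrier ?E" "R.twist \<gamma> f"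
    show "restrict f R.U \<in> carrier (GL s R.U)" by (rule R.twist_U(2)[OF *(2,1)])
    show "P (braid_proj \<gamma>) = scalar_maps s R.U #>\<^bsub>GL s R.U\<^esub> restrict f R.U"
      using P(2)[OF *] unfolding R.cls_def .
  qed
  have 2: "fin_dim s R.U" if "admissible (B_fin k X) s V \<rho>"
    unfolding R.U_def
    by (rule admissible_fin_dim_isotypic[OF A.G.subgroup_imp_group[OF A.K_subgroup] R.Vh.rep_axioms R.W_simple])
      (use that in \<open>simp only: H\<close>)
  have 3: "descends ?r (PGL s R.U) P" if ne: "\<not> exceptional k X"
  proof (rule descendsI[OF R.PGL_U.is_group P(1)])
    fix M assume M: "M \<in> carrier (Gamma1 ?r)" "- M \<in> carrier (Gamma1 ?r)"
    \<comment> \<open>Both signs occur only in levels 1 and 2. There -1 is the image of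
      \<open>c\<close>, which acts as conjugation by the central \<open>\<zeta>\<close>, so its
      class is trivial.\<close>
    then have r: "?r \<noteq> 3" using Gamma1_3_minus by auto
    have c: "bp.c \<in> carrier ?E" by (rule A.c_closed[OF r])
    obtain f where f: "R.twist bp.c f" using R.stable[OF c] by blast
    have "R.cls f = \<one>\<^bsub>PGL s R.U\<^esub>"
      by (rule R.cls_inner[OF c A.\<zeta>_K A.\<zeta>_central[OF ne] A.act_inner[OF c A.\<zeta>_K A.\<zeta>_central[OF ne] A.act_c[OF r]] f])
    then have one: "P (M2 (- 1) 0 0 (- 1)) = \<one>\<^bsub>PGL s R.U\<^esub>"
      using P(2)[OF c f] by (simp add: braid_proj_cst)
    have "M2 (- 1) 0 0 (- 1) \<in> carrier (Gamma1 ?r)"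
      using hom_in_carrier[OF proj_hom_Gamma1[OF A.r] c] by (simp add: braid_proj_cst)
    then have "P (M2 (- 1) 0 0 (- 1) \<otimes>\<^bsub>Gamma1 ?r\<^esub> M) = \<one>\<^bsub>PGL s R.U\<^esub> \<otimes>\<^bsub>PGL s R.U\<^esub> P M"
      unfolding one[symmetric] by (rule hom_mult[OF P(1) _ M(1)])
    also have "\<dots> = P M" by (rule R.PGL_U.l_one[OF hom_in_carrier[OF P(1) M(1)]])
    also have "M2 (- 1) 0 0 (- 1) \<otimes>\<^bsub>Gamma1 ?r\<^esub> M = - M" by (simp add: Gamma1_def minus_one_mult)
    finally show "P (- M) = P M" .
  qed
  show ?thesis unfolding U using 1 2 3 by blast
qed

end
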